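(* The seven Petersen family graphs are the only MMNA graphs on 16 or fewer edges. That is, a graph $G$ with at most $16$ edges is minor minimal not apex if and only if $G$ is (isomorphic to) one of the seven graphs of the Petersen family.
   Context: All graphs are finite and simple. A graph $H$ is a minor of $G$ if $H$ is obtained by contracting (zero or more) edges in a subgraph of $G$. A graph is apex ($1$-apex) if the deletion of at most one vertex results in a planar graph. A graph is NA if it is not apex, and MMNA (minor minimal not apex) if it is NA but no proper minor of it is NA. A $\nabla\mathrm{Y}$ move on a graph consists of deleting the three edges of a $3$-cycle $abc$ and adding a new degree three vertex adjacent to $a$, $b$ and $c$. The reverse operation, deleting a degree three vertex and making its three neighbors pairwise adjacent, is a $\mathrm{Y}\nabla$ move. The Petersen family is the set of (seven, up to isomorphism) graphs obtained from the Petersen graph by a sequence of zero or more $\nabla\mathrm{Y}$ or $\mathrm{Y}\nabla$ moves; it includes $K_6$, $K_{3,3,1}$ and $K_{4,4}$ minus an edge, and each member has $15$ edges. *)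

theory Defs
  imports "HOL-Analysis.Analysis"
begin

record 'a ugraph =
  verts :: "'a set"
  edges :: "'a set set"

definition simple_graph :: "'a ugraph \<Rightarrow> bool" where
  "simple_graph G \<longleftrightarrow>
     finite (verts G) \<and> (\<forall>e\<in>edges G. e \<subseteq> verts G \<and> card e = 2)"

definition graph_iso :: "'a ugraph \<Rightarrow> 'b ugraph \<Rightarrow> bool" where
  "graph_iso G H \<longleftrightarrow>
     (\<exists>f. bij_betw f (verts G) (verts H) \<and> (\<lambda>e. f ` e) ` edges G = edges H)"

definition subgraph :: "'a ugraph \<Rightarrow> 'a ugraph \<Rightarrow> bool" where
  "subgraph H G \<longleftrightarrow>
     simple_graph H \<and> verts H \<subseteq> verts G \<and> edges H \<subseteq> edges G"

definition del_vertex :: "'a ugraph \<Rightarrow> 'a \<Rightarrow> 'a ugraph" where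
  "del_vertex G v = \<lparr>verts = verts G - {v}, edges = {e \<in> edges G. v \<notin> e}\<rparr>"

text \<open>Contraction of the edge \<open>{u, v}\<close>: the merged vertex keeps the name \<open>u\<close>. The contracted
  edge disappears, and parallel edges are identified because the edges form a set.\<close>

definition contract_edge :: "'a ugraph \<Rightarrow> 'a \<Rightarrow> 'a \<Rightarrow> 'a ugraph" where
  "contract_edge G u v =
     (let f = (\<lambda>x. if x = v then u else x)
      in \<lparr>verts = f ` verts G, edges = (\<lambda>e. f ` e) ` (edges G - {{u, v}})\<rparr>)"

inductive contracts_to :: "'a ugraph \<Rightarrow> 'a ugraph \<Rightarrow> bool" for G where
  contracts_refl: "contracts_to G G"
| contracts_step: "contracts_to G H \<Longrightarrow> {u, v} \<in> edges H \<Longrightarrow> u \<noteq> v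
                     \<Longrightarrow> contracts_to G (contract_edge H u v)"

definition is_minor :: "'a ugraph \<Rightarrow> 'a ugraph \<Rightarrow> bool" where
  "is_minor H G \<longleftrightarrow> (\<exists>K. subgraph K G \<and> contracts_to K H)"

text \<open>Minors are taken as labelled graphs on vertices of \<open>G\<close>. Every proper deletion or
  contraction strictly decreases the number of vertices or edges, so a minor is proper exactly
  when it differs from \<open>G\<close>.\<close>

definition proper_minor :: "'a ugraph \<Rightarrow> 'a ugraph \<Rightarrow> bool" where
  "proper_minor H G \<longleftrightarrow> is_minor H G \<and> H \<noteq> G"

text \<open>A plane drawing: vertices are distinct points, edges are arcs joining the points of their
  end vertices and passing through no other vertex, and two different edges meet only in common
  end vertices.\<close>

definition plane_embedding ::
    "'a ugraph \<Rightarrow> ('a \<Rightarrow> real ^ 2) \<Rightarrow> ('a set \<Rightarrow> real \<Rightarrow> real ^ 2) \<Rightarrow> bool" where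
  "plane_embedding G p \<gamma> \<longleftrightarrow>
     inj_on p (verts G) \<and>
     (\<forall>e\<in>edges G. arc (\<gamma> e) \<and>
        {pathstart (\<gamma> e), pathfinish (\<gamma> e)} = p ` e \<and>
        path_image (\<gamma> e) \<inter> p ` verts G = p ` e) \<and>
     (\<forall>e\<in>edges G. \<forall>e'\<in>edges G. e \<noteq> e' \<longrightarrow>
        path_image (\<gamma> e) \<inter> path_image (\<gamma> e') = p ` (e \<inter> e'))"

definition planar :: "'a ugraph \<Rightarrow> bool" where
  "planar G \<longleftrightarrow> (\<exists>p \<gamma>. plane_embedding G p \<gamma>)"

definition apex :: "'a ugraph \<Rightarrow> bool" where
  "apex G \<longleftrightarrow> planar G \<or> (\<exists>v\<in>verts G. planar (del_vertex G v))"

definition MMNA :: "'a ugraph \<Rightarrow> bool" where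
  "MMNA G \<longleftrightarrow> \<not> apex G \<and> (\<forall>H. proper_minor H G \<longrightarrow> apex H)"

definition nabla_Y :: "'a ugraph \<Rightarrow> 'a ugraph \<Rightarrow> bool" where
  "nabla_Y G H \<longleftrightarrow>
     (\<exists>a b c v. distinct [a, b, c] \<and>
        {a, b} \<in> edges G \<and> {b, c} \<in> edges G \<and> {a, c} \<in> edges G \<and> v \<notin> verts G \<and>
        H = \<lparr>verts = insert v (verts G),
             edges = (edges G - {{a, b}, {b, c}, {a, c}}) \<union> {{v, a}, {v, b}, {v, c}}\<rparr>)"

definition Y_nabla :: "'a ugraph \<Rightarrow> 'a ugraph \<Rightarrow> bool" where
  "Y_nabla G H \<longleftrightarrow>
     (\<exists>v a b c. v \<in> verts G \<and> distinct [a, b, c] \<and> {u. {v, u} \<in> edges G} = {a, b, c} \<and>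
        H = \<lparr>verts = verts G - {v},
             edges = {e \<in> edges G. v \<notin> e} \<union> {{a, b}, {b, c}, {a, c}}\<rparr>)"

text \<open>Outer 5-cycle on \<open>0, \<dots>, 4\<close>, spokes \<open>i, i + 5\<close>, inner pentagram on \<open>5, \<dots>, 9\<close>.\<close>

definition petersen_graph :: "nat ugraph" where
  "petersen_graph =
     \<lparr>verts = {0..<10},
      edges = (\<Union>i\<in>{0..<5}. {{i, (i + 1) mod 5}, {i, i + 5}, {i + 5, (i + 2) mod 5 + 5}})\<rparr>"

text \<open>The family as labelled graphs on natural numbers (so that a fresh vertex is always
  available); its members are meant up to \<open>graph_iso\<close>.\<close>

inductive_set petersen_family :: "nat ugraph set" where
  petersen: "petersen_graph \<in> petersen_family"
| nabla_Y: "G \<in> petersen_family \<Longrightarrow> nabla_Y G H \<Longrightarrow> H \<in> petersen_family"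
| Y_nabla: "G \<in> petersen_family \<Longrightarrow> Y_nabla G H \<Longrightarrow> H \<in> petersen_family"

end

theory Submission
  imports Defs
begin

text \<open>A graph that is not apex has no straight-line drawing, even after deletion of any one vertex.
  Straight-line drawability survives the addition of vertices of degree at most two, so a smallest
  graph with at most 16 edges that is not apex and has no Petersen family minor has minimum degree
  three and at most ten vertices. Deleting a vertex \<open>v\<close> of maximum degree leaves a nonplanar graph
  with at most 12 edges, which contains a subdivision of \<open>K33\<close> or \<open>K5\<close>. From there on the remaining
  edges are found by branching: if the edges known so far become planar after deletion of some vertex
  \<open>w\<close>, then some edge of the graph avoids \<open>w\<close> and lies outside any fixed straight-line drawn
  triangulation of the other vertices. The resulting case analysis, up to isomorphism, is recorded in
  certificates; it ends in graphs with a Petersen family minor or with too large a degree sum.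

  Conversely, deleting a vertex from a member of the Petersen family leaves a subdivision of \<open>K33\<close> or
  \<open>K5\<close>, which is nonplanar since no face of a theta graph touches the interior of all three of its
  arcs. Its proper minors have at most 14 edges, hence are apex by the first part.\<close>

section \<open>Theta graphs in the plane\<close>

text \<open>Straight-line drawings carry the search because finitely many sign tests on integer
  points certify them. So nonplanarity is assumed in a weak form, as the absence of a straight-line
  drawing, on the way to a Petersen minor; it is proved in the strong form, for arbitrary arcs, for
  the subdivisions of \<open>K33\<close> and \<open>K5\<close>. The step from "no straight-line
  drawing" to such a subdivision is made by a search of the same kind, on graphs with at most 12
  edges. Both searches rest on monotonicity: what holds for all graphs that contain a pattern holds
  for all graphs that contain a larger one. A pattern is settled once each of its candidate one-edge
  extensions contains a settled pattern or breaks the degree bound. The number 12 is 16 - 4 when the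
  deleted vertex has degree at least 4. Otherwise the graph is cubic; then 3 divides twice the
  number of edges, so there are at most 15 edges, of which 12 remain. With minimum degree 3, twice
  12 and twice 16 edges allow 8 and 10 vertices. For the converse no minor is inspected: a graph
  with at most 14 edges cannot have a minor with 15, so the first part applies to it.\<close>

definition arc_set :: "complex set \<Rightarrow> complex \<Rightarrow> complex \<Rightarrow> bool" where
  "arc_set S a b \<longleftrightarrow> (\<exists>g. arc g \<and> pathstart g = a \<and> pathfinish g = b \<and> path_image g = S)"

lemma arc_set_sym: "arc_set S a b \<Longrightarrow> arc_set S b a"
  unfolding arc_set_def
  by (metis arc_reversepath path_image_reversepath pathfinish_reversepath pathstart_reversepath)

lemma arc_set_join:
  assumes "arc_set S a b" "arc_set T b c" "S \<inter> T = {b}"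
  shows "arc_set (S \<union> T) a c"
proof -
  from assms obtain g h where g: "arc g" "pathstart g = a" "pathfinish g = b" "path_image g = S"
    and h: "arc h" "pathstart h = b" "pathfinish h = c" "path_image h = T"
    unfolding arc_set_def by blast
  have "arc (g +++ h)"
    using g h assms(3) by (intro arc_join) auto
  then show ?thesis
    unfolding arc_set_def using g h by (metis path_image_join pathfinish_join pathstart_join)
qed

lemma arc_set_ends: "arc_set S a b \<Longrightarrow> a \<in> S \<and> b \<in> S \<and> a \<noteq> b"
  unfolding arc_set_def
  by (metis arc_distinct_ends pathfinish_in_path_image pathstart_in_path_image)

lemma arc_set_compact: "arc_set S a b \<Longrightarrow> compact S"
  unfolding arc_set_def using compact_arc_image by blast

lemma arc_set_connected: "arc_set S a b \<Longrightarrow> connected S"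
  unfolding arc_set_def using connected_arc_image by blast

lemma arc_set_connected_minus_end:
  assumes "arc_set S a b" shows "connected (S - {a})"
proof -
  obtain g where g: "arc g" "pathstart g = a" "pathfinish g = b" "path_image g = S"
    using assms unfolding arc_set_def by blast
  have inj: "inj_on g {0..1}" and cont: "continuous_on {0..1} g"
    using g(1) by (auto simp: arc_def path_def)
  have "S - {a} = g ` {0<..1}"
  proof -
    have "S = g ` {0..1}" "a = g 0" using g by (auto simp: path_image_def pathstart_def)
    moreover have "{0..1::real} - {0} = {0<..1}" by auto
    ultimately show ?thesis using inj_on_image_set_diff[OF inj, of "{0..1}" "{0}"] by auto
  qed
  moreover have "connected (g ` {0<..1})"
    by (rule connected_continuous_image[OF continuous_on_subset[OF cont]]) auto
  ultimately show ?thesis by simp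
qed

lemma arc_set_connected_interior:
  assumes "arc_set S a b" shows "connected (S - {a, b})" "S - {a, b} \<noteq> {}"
proof -
  obtain g where g: "arc g" "pathstart g = a" "pathfinish g = b" "path_image g = S"
    using assms unfolding arc_set_def by blast
  have inj: "inj_on g {0..1}" and cont: "continuous_on {0..1} g"
    using g(1) by (auto simp: arc_def path_def)
  have eq: "S - {a,b} = g ` {0<..<1}"
  proof -
    have "S = g ` {0..1}" "a = g 0" "b = g 1"
      using g by (auto simp: path_image_def pathstart_def pathfinish_def)
    moreover have "{0..1::real} - {0,1} = {0<..<1}" by auto
    ultimately show ?thesis using inj_on_image_set_diff[OF inj, of "{0..1}" "{0,1}"] by auto
  qed
  have "connected (g ` {0<..<1})"
    by (rule connected_continuous_image[OF continuous_on_subset[OF cont]]) auto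
  then show "connected (S - {a, b})" using eq by simp
  show "S - {a, b} \<noteq> {}" using eq by (simp add: dense)
qed

text \<open>\<open>D\<close> is the side of the closed curve \<open>A \<union> B\<close> that does not contain \<open>C\<close>; hence it is also a face
  of the theta graph.\<close>

lemma theta_far_side:
  assumes A: "arc_set A p q" and B: "arc_set B p q" and C: "arc_set C p q"
    and AB: "A \<inter> B = {p, q}" and AC: "A \<inter> C = {p, q}" and BC: "B \<inter> C = {p, q}"
  obtains D where "open D" "connected D" "D \<noteq> {}" "frontier D = A \<union> B" "D \<inter> (A \<union> B \<union> C) = {}"
    "\<And>x y. x \<in> D \<Longrightarrow> connected_component (- (A \<union> B)) x y \<Longrightarrow> y \<in> D"
proof -
  note thesisI = that
  obtain g h where g: "arc g" "pathstart g = p" "pathfinish g = q" "path_image g = A"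
    and h: "arc h" "pathstart h = q" "pathfinish h = p" "path_image h = B"
    using A arc_set_sym[OF B] unfolding arc_set_def by blast
  have "simple_path (g +++ h)"
    by (rule simple_path_join_loop) (use g h AB in auto)
  moreover have "pathfinish (g +++ h) = pathstart (g +++ h)" using g h by simp
  moreover have img: "path_image (g +++ h) = A \<union> B" using g h by (simp add: path_image_join)
  ultimately obtain I J where IJ: "I \<noteq> {}" "open I" "connected I" "J \<noteq> {}" "open J" "connected J"
    "I \<inter> J = {}" "I \<union> J = - (A \<union> B)" "frontier I = A \<union> B" "frontier J = A \<union> B"
    using Jordan_curve by metis
  have Cint: "connected (C - {p, q})" "C - {p, q} \<subseteq> I \<union> J"
    using arc_set_connected_interior[OF C] AC BC IJ by auto
  \<comment> \<open>\<open>K\<close> is the side that contains the interior of \<open>C\<close>,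
    \<open>L\<close> the other one. It is applied to both assignments of \<open>I\<close> and
    \<open>J\<close>.\<close>
  have main: thesis if K: "C - {p, q} \<subseteq> K" "K \<inter> L = {}" "K \<union> L = - (A \<union> B)"
      "open K" "connected K" "open L" "connected L" "L \<noteq> {}" "frontier L = A \<union> B" for K L
  proof (rule thesisI[of L])
    show "open L" "connected L" "L \<noteq> {}" "frontier L = A \<union> B" using K by auto
    have "p \<in> A" "q \<in> A" using arc_set_ends[OF A] by auto
    then show "L \<inter> (A \<union> B \<union> C) = {}" using K(1-3) by auto
    show "y \<in> L" if x: "x \<in> L" and xy: "connected_component (- (A \<union> B)) x y" for x y
    proof (rule ccontr)
      assume "y \<notin> L"
      obtain T where T: "connected T" "T \<subseteq> K \<union> L" "x \<in> T" "y \<in> T"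
        using xy K(3) unfolding connected_component_def by auto
      have "y \<in> K" using T \<open>y \<notin> L\<close> by auto
      then show False
        using connectedD[OF T(1) K(4,6)] T K(2) \<open>x \<in> L\<close> by blast
    qed
  qed
  have "C - {p,q} \<subseteq> I \<or> C - {p,q} \<subseteq> J"
    using connectedD[OF Cint(1) IJ(2,5)] Cint(2) IJ(7) by blast
  then show thesis
    using main[of I J] main[of J I] IJ by (auto simp: Int_commute Un_commute)
qed

text \<open>If all three connections existed, a point \<open>z\<close> on the side of
  \<open>A \<union> B\<close> away from \<open>C\<close> could be joined to \<open>x\<close> off
  \<open>A \<union> C\<close> and also off \<open>B \<union> C\<close>, because that side reaches
  every point of its frontier, in particular \<open>b\<close> and \<open>a\<close>. The two sets
  meet in the connected set \<open>C\<close>, so Janiszewski's theorem joins \<open>z\<close> to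
  \<open>x\<close> off the whole theta graph. The third connection then puts \<open>c\<close> on the
  side of \<open>z\<close>, which avoids \<open>C\<close>.\<close>

lemma theta_faces:
  assumes A: "arc_set A p q" and B: "arc_set B p q" and C: "arc_set C p q"
    and AB: "A \<inter> B = {p, q}" and AC: "A \<inter> C = {p, q}" and BC: "B \<inter> C = {p, q}"
    and x: "x \<notin> A \<union> B \<union> C"
    and a: "a \<in> A - {p, q}" and b: "b \<in> B - {p, q}" and c: "c \<in> C - {p, q}"
  shows "\<not> connected_component (- (A \<union> B)) c x \<or> \<not> connected_component (- (A \<union> C)) b x \<or>
    \<not> connected_component (- (B \<union> C)) a x"
proof (rule ccontr)
  assume "\<not> ?thesis"
  then have conn: "connected_component (- (A \<union> B)) c x" "connected_component (- (A \<union> C)) b x"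
    "connected_component (- (B \<union> C)) a x" by auto
  obtain D where D: "open D" "connected D" "D \<noteq> {}" "frontier D = A \<union> B" "D \<inter> (A \<union> B \<union> C) = {}"
    "\<And>x y. x \<in> D \<Longrightarrow> connected_component (- (A \<union> B)) x y \<Longrightarrow> y \<in> D"
    using theta_far_side[OF A B C AB AC BC] by metis
  obtain z where z: "z \<in> D" using D by auto
  \<comment> \<open>A frontier point \<open>w\<close> of \<open>D\<close> has a ball that misses
    \<open>S\<close> and meets \<open>D\<close>, so \<open>D\<close> together with the ball is
    connected.\<close>
  have reach: "connected_component (- S) z w"
    if w: "w \<in> A \<union> B" "w \<notin> S" and S: "closed S" "S \<subseteq> A \<union> B \<union> C" for w S
  proof -
    have "w \<in> closure D" using w D(4) by (auto simp: frontier_def)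
    moreover obtain e where e: "e > 0" "ball w e \<subseteq> - S"
      using w S(1) by (metis ComplI open_Compl open_contains_ball)
    ultimately obtain z' where z': "z' \<in> D" "dist z' w < e"
      by (meson closure_approachable)
    have "connected (D \<union> ball w e)"
      by (rule connected_Un[OF D(2) connected_ball]) (use z' in \<open>auto simp: dist_commute\<close>)
    moreover have "D \<union> ball w e \<subseteq> - S" using D(5) S(2) e by auto
    ultimately show ?thesis
      unfolding connected_component_def using z e by (intro exI[of _ "D \<union> ball w e"]) auto
  qed
  have cl: "closed (A \<union> C)" "closed (B \<union> C)" "compact (A \<union> C)"
    using arc_set_compact[OF A] arc_set_compact[OF B] arc_set_compact[OF C]
    by (auto intro: compact_imp_closed)
  have "connected_component (- (A \<union> C)) z b"
    by (rule reach) (use b AB BC cl in auto)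
  then have 1: "connected_component (- (A \<union> C)) z x"
    using conn(2) connected_component_trans by blast
  have "connected_component (- (B \<union> C)) z a"
    by (rule reach) (use a AB AC cl in auto)
  then have 2: "connected_component (- (B \<union> C)) z x"
    using conn(3) connected_component_trans by blast
  have "(A \<union> C) \<inter> (B \<union> C) = C" using AB arc_set_ends[OF C] by auto
  then have "connected ((A \<union> C) \<inter> (B \<union> C))" using arc_set_connected[OF C] by simp
  then have "connected_component (- ((A \<union> C) \<union> (B \<union> C))) z x"
    using Janiszewski cl 1 2 by blast
  then have "connected_component (- (A \<union> B)) z x"
    by (rule connected_component_of_subset) auto
  then have "x \<in> D" using D(6) z by blast
  moreover have "connected_component (- (A \<union> B)) x c" using conn(1) connected_component_sym by blast
  ultimately have "c \<in> D" using D(6) by blast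
  then show False using D(5) c by auto
qed

section \<open>Drawings with arcs; nonplanarity of the Kuratowski graphs\<close>

lemma Jordan_two_sides:
  assumes A: "arc_set A p q" and B: "arc_set B p q" and AB: "A \<inter> B = {p, q}"
    and "x \<notin> A \<union> B" "y \<notin> A \<union> B" "z \<notin> A \<union> B"
  shows "connected_component (- (A \<union> B)) x y \<or> connected_component (- (A \<union> B)) x z \<or>
    connected_component (- (A \<union> B)) y z"
proof -
  obtain g h where g: "arc g" "pathstart g = p" "pathfinish g = q" "path_image g = A"
    and h: "arc h" "pathstart h = q" "pathfinish h = p" "path_image h = B"
    using A arc_set_sym[OF B] unfolding arc_set_def by blast
  have "simple_path (g +++ h)"
    by (rule simple_path_join_loop) (use g h AB in auto)
  moreover have "pathfinish (g +++ h) = pathstart (g +++ h)" using g h by simp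
  moreover have img: "path_image (g +++ h) = A \<union> B" using g h by (simp add: path_image_join)
  ultimately obtain I J where IJ: "connected I" "connected J" "I \<union> J = - (A \<union> B)"
    using Jordan_curve by metis
  have "connected_component (- (A \<union> B)) u v" if "u \<in> I \<and> v \<in> I \<or> u \<in> J \<and> v \<in> J" for u v
    unfolding connected_component_def using that IJ by blast
  moreover have "x \<in> I \<union> J" "y \<in> I \<union> J" "z \<in> I \<union> J" using assms IJ by auto
  ultimately show ?thesis by blast
qed

text \<open>Only the point set of an edge is kept, so arcs have no direction. Loops are excluded by
  the arc condition, since the ends of an arc differ.\<close>

definition curve_drawing :: "'a ugraph \<Rightarrow> ('a \<Rightarrow> complex) \<Rightarrow> ('a set \<Rightarrow> complex set) \<Rightarrow> bool" where
  "curve_drawing G p \<Gamma> \<longleftrightarrow> inj_on p (verts G) \<and> (\<forall>e\<in>edges G. e \<subseteq> verts G) \<and>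
     (\<forall>u v. {u, v} \<in> edges G \<longrightarrow> arc_set (\<Gamma> {u, v}) (p u) (p v)) \<and>
     (\<forall>e\<in>edges G. \<Gamma> e \<inter> p ` verts G = p ` e) \<and>
     (\<forall>e\<in>edges G. \<forall>e'\<in>edges G. e \<noteq> e' \<longrightarrow> \<Gamma> e \<inter> \<Gamma> e' = p ` (e \<inter> e'))"

lemma curve_drawing_edge:
  assumes "curve_drawing G p \<Gamma>" "{u, v} \<in> edges G"
  shows "arc_set (\<Gamma> {u, v}) (p u) (p v)" "u \<in> verts G" "v \<in> verts G" "u \<noteq> v"
  using assms arc_set_ends[of "\<Gamma> {u, v}" "p u" "p v"] unfolding curve_drawing_def by auto

lemma curve_drawing_subset: "curve_drawing G p \<Gamma> \<Longrightarrow> e \<in> edges G \<Longrightarrow> e \<subseteq> verts G"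
  by (simp add: curve_drawing_def)

lemma curve_drawing_meet:
  assumes "curve_drawing G p \<Gamma>" "e \<in> edges G" "e' \<in> edges G" "e \<noteq> e'"
  shows "\<Gamma> e \<inter> \<Gamma> e' = p ` (e \<inter> e')"
  using assms unfolding curve_drawing_def by blast

lemma curve_drawing_vertex:
  assumes "curve_drawing G p \<Gamma>" "e \<in> edges G" "v \<in> verts G"
  shows "p v \<in> \<Gamma> e \<longleftrightarrow> v \<in> e"
proof -
  have "inj_on p (verts G)" "e \<subseteq> verts G" "\<Gamma> e \<inter> p ` verts G = p ` e"
    using assms unfolding curve_drawing_def by auto
  then show ?thesis using assms(3) by (metis Int_iff image_eqI inj_on_image_mem_iff)
qed

lemma curve_drawing_path2:
  assumes D: "curve_drawing G p \<Gamma>" and "{a, x} \<in> edges G" "{x, b} \<in> edges G" "a \<noteq> b"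
  shows "arc_set (\<Gamma> {a, x} \<union> \<Gamma> {x, b}) (p a) (p b)"
proof (rule arc_set_join)
  show "arc_set (\<Gamma> {a, x}) (p a) (p x)" "arc_set (\<Gamma> {x, b}) (p x) (p b)"
    using curve_drawing_edge[OF D] assms by auto
  have "a \<noteq> x" "b \<noteq> x" using curve_drawing_edge[OF D] assms by blast+
  then show "\<Gamma> {a, x} \<inter> \<Gamma> {x, b} = {p x}"
    using curve_drawing_meet[OF D assms(2,3)] assms(4) by (auto simp: doubleton_eq_iff)
qed

lemma connected_component_via:
  assumes "arc_set S x y" "S \<inter> T = {}"
  shows "connected_component (- T) x y"
  unfolding connected_component_def
  using arc_set_connected[OF assms(1)] arc_set_ends[OF assms(1)] assms(2)
  by (intro exI[of _ S]) auto

text \<open>The theta graph has poles \<open>b1\<close>, \<open>b2\<close> and one arc through each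
  of \<open>a1\<close>, \<open>a2\<close>, \<open>a3\<close>. The edge from \<open>b3\<close> to one
  of them misses the other two arcs, so \<open>b3\<close> violates
  \<open>theta_faces\<close>.\<close>

lemma no_curve_drawing_K33:
  assumes D: "curve_drawing G p \<Gamma>"
    and dist: "distinct [a1, a2, a3, b1, b2, b3]"
    and E: "\<And>a b. a \<in> {a1, a2, a3} \<Longrightarrow> b \<in> {b1, b2, b3} \<Longrightarrow> {a, b} \<in> edges G"
  shows False
proof -
  have E': "{b, a} \<in> edges G" if "a \<in> {a1, a2, a3}" "b \<in> {b1, b2, b3}" for a b
    using E[OF that] by (simp add: insert_commute)
  define A where "A a = \<Gamma> {b1, a} \<union> \<Gamma> {a, b2}" for a
  have arc: "arc_set (A a) (p b1) (p b2)" if "a \<in> {a1, a2, a3}" for a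
    unfolding A_def by (rule curve_drawing_path2[OF D]) (use that E E' dist in auto)
  have meet: "A a \<inter> A a' = {p b1, p b2}" if "a \<in> {a1, a2, a3}" "a' \<in> {a1, a2, a3}" "a \<noteq> a'" for a a'
  proof -
    have ne: "a \<noteq> b1" "a \<noteq> b2" "a' \<noteq> b1" "a' \<noteq> b2" "b1 \<noteq> b2" using that dist by auto
    have "\<Gamma> {b1, a} \<inter> \<Gamma> {b1, a'} = {p b1}" "\<Gamma> {a, b2} \<inter> \<Gamma> {a', b2} = {p b2}"
      "\<Gamma> {b1, a} \<inter> \<Gamma> {a', b2} = {}" "\<Gamma> {a, b2} \<inter> \<Gamma> {b1, a'} = {}"
      using that E E' ne
      by (subst curve_drawing_meet[OF D]; auto simp: doubleton_eq_iff)+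
    then show ?thesis unfolding A_def by auto
  qed
  have vert: "v \<in> verts G" if "v \<in> {a1, a2, a3, b1, b2, b3}" for v
    using that curve_drawing_edge(2,3)[OF D] E by blast
  have mem: "p a \<in> A a - {p b1, p b2}" if "a \<in> {a1, a2, a3}" for a
  proof -
    have "p a \<in> \<Gamma> {b1, a}"
      by (subst curve_drawing_vertex[OF D]) (use that E' vert in auto)
    then have "p a \<in> A a" by (simp add: A_def)
    moreover have "p a \<noteq> p b1" "p a \<noteq> p b2"
      using D vert that dist unfolding curve_drawing_def by (auto dest: inj_onD)
    ultimately show ?thesis by auto
  qed
  have nin: "p b3 \<notin> A a" if "a \<in> {a1, a2, a3}" for a
    using that E E' vert dist unfolding A_def by (auto simp: curve_drawing_vertex[OF D])
  have conn: "connected_component (- (A a \<union> A a')) (p a'') (p b3)"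
    if "a \<in> {a1, a2, a3}" "a' \<in> {a1, a2, a3}" "a'' \<in> {a1, a2, a3}" "a'' \<noteq> a" "a'' \<noteq> a'" for a a' a''
  proof (rule connected_component_via)
    show "arc_set (\<Gamma> {a'', b3}) (p a'') (p b3)" using curve_drawing_edge(1)[OF D E[OF that(3)]] by simp
    have "\<Gamma> {a'', b3} \<inter> A c = {}" if c: "c \<in> {a1, a2, a3}" "c \<noteq> a''" for c
    proof -
      have ne: "c \<noteq> b1" "c \<noteq> b2" "c \<noteq> b3" "a'' \<noteq> b1" "a'' \<noteq> b2" "a'' \<noteq> b3" "b3 \<noteq> b1" "b3 \<noteq> b2"
        using c \<open>a'' \<in> {a1, a2, a3}\<close> dist by auto
      have "\<Gamma> {a'', b3} \<inter> \<Gamma> {b1, c} = {}" "\<Gamma> {a'', b3} \<inter> \<Gamma> {c, b2} = {}"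
        using c \<open>a'' \<in> {a1, a2, a3}\<close> E E' ne
        by (subst curve_drawing_meet[OF D]; auto simp: doubleton_eq_iff)+
      then show ?thesis unfolding A_def by auto
    qed
    from this[of a] this[of a'] show "\<Gamma> {a'', b3} \<inter> (A a \<union> A a') = {}" using that by auto
  qed
  have K: "a1 \<in> {a1, a2, a3}" "a2 \<in> {a1, a2, a3}" "a3 \<in> {a1, a2, a3}"
    and ne: "a1 \<noteq> a2" "a1 \<noteq> a3" "a2 \<noteq> a3" using dist by auto
  show False
    using theta_faces[OF arc[OF K(1)] arc[OF K(2)] arc[OF K(3)] meet[OF K(1,2) ne(1)]
        meet[OF K(1,3) ne(2)] meet[OF K(2,3) ne(3)] _ mem[OF K(1)] mem[OF K(2)] mem[OF K(3)], of "p b3"]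
      conn[OF K(1,2,3)] conn[OF K(1,3,2)] conn[OF K(2,3,1)] nin[OF K(1)] nin[OF K(2)] nin[OF K(3)] ne
    by auto
qed

text \<open>Besides the arcs through \<open>a1\<close>, \<open>a2\<close>, \<open>a3\<close> there
  is the direct edge from \<open>u\<close> to \<open>v\<close>, with an inner point
  \<open>x\<close>. An inner point \<open>y\<close> of the edge between two of the three vertices
  lies, by two theta graphs, on the side of the cycle \<open>A a \<union> A b\<close> that contains
  neither \<open>x\<close> nor the third vertex, so these two share a side. Holding for all three
  pairs, this contradicts \<open>theta_faces\<close> at \<open>x\<close>.\<close>

lemma no_curve_drawing_K5:
  assumes D: "curve_drawing G p \<Gamma>" and dist: "distinct [u, v, a1, a2, a3]"
    and E: "\<And>a b. a \<in> {u, v, a1, a2, a3} \<Longrightarrow> b \<in> {u, v, a1, a2, a3} \<Longrightarrow> a \<noteq> b \<Longrightarrow> {a, b} \<in> edges G"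
  shows False
proof -
  define A where "A a = \<Gamma> {u, a} \<union> \<Gamma> {a, v}" for a
  define K where "K = {a1, a2, a3}"
  have K: "u \<notin> K" "v \<notin> K" "u \<noteq> v" "a1 \<in> K" "a2 \<in> K" "a3 \<in> K" "a1 \<noteq> a2" "a1 \<noteq> a3" "a2 \<noteq> a3"
    using dist by (auto simp: K_def)
  have Eu: "{u, a} \<in> edges G" "{a, u} \<in> edges G" "{v, a} \<in> edges G" "{a, v} \<in> edges G" if "a \<in> K" for a
    using E that K unfolding K_def by blast+
  have Euv: "{u, v} \<in> edges G" using E K by simp
  have EK: "{a, b} \<in> edges G" if "a \<in> K" "b \<in> K" "a \<noteq> b" for a b
    using E that by (auto simp: K_def)
  have vert: "w \<in> verts G" if "w \<in> insert u (insert v K)" for w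
    using that curve_drawing_edge(2,3)[OF D] Eu K(4) by blast
  have arc: "arc_set (A a) (p u) (p v)" if "a \<in> K" for a
    unfolding A_def by (rule curve_drawing_path2[OF D]) (use that Eu K in auto)
  have arc0: "arc_set (\<Gamma> {u, v}) (p u) (p v)" using curve_drawing_edge[OF D Euv] by simp
  have meet: "A a \<inter> A a' = {p u, p v}" if "a \<in> K" "a' \<in> K" "a \<noteq> a'" for a a'
  proof -
    have ne: "a \<noteq> u" "a \<noteq> v" "a' \<noteq> u" "a' \<noteq> v" "u \<noteq> v" using that K by auto
    have "\<Gamma> {u, a} \<inter> \<Gamma> {u, a'} = {p u}" "\<Gamma> {a, v} \<inter> \<Gamma> {a', v} = {p v}"
      "\<Gamma> {u, a} \<inter> \<Gamma> {a', v} = {}" "\<Gamma> {a, v} \<inter> \<Gamma> {u, a'} = {}"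
      using that Eu ne
      by (subst curve_drawing_meet[OF D]; auto simp: doubleton_eq_iff)+
    then show ?thesis unfolding A_def by auto
  qed
  have meet0: "A a \<inter> \<Gamma> {u, v} = {p u, p v}" if "a \<in> K" for a
  proof -
    have ne: "a \<noteq> u" "a \<noteq> v" "u \<noteq> v" using that K by auto
    have "\<Gamma> {u, a} \<inter> \<Gamma> {u, v} = {p u}" "\<Gamma> {a, v} \<inter> \<Gamma> {u, v} = {p v}"
      using that Eu Euv ne
      by (subst curve_drawing_meet[OF D]; auto simp: doubleton_eq_iff)+
    then show ?thesis unfolding A_def by auto
  qed
  have mem: "p a \<in> A a - {p u, p v}" if "a \<in> K" for a
  proof -
    have "p a \<in> A a" using that Eu vert unfolding A_def by (simp add: curve_drawing_vertex[OF D])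
    moreover have "p a \<noteq> p u" "p a \<noteq> p v"
      using D vert that K unfolding curve_drawing_def by (auto dest: inj_onD)
    ultimately show ?thesis by auto
  qed
  obtain x where x: "x \<in> \<Gamma> {u, v} - {p u, p v}"
    using arc_set_connected_interior(2)[OF arc0] by blast
  have xA: "x \<notin> A a" if "a \<in> K" for a using meet0[OF that] x by auto
  have nin: "p b \<notin> A a" if "a \<in> K" "b \<in> K" "a \<noteq> b" for a b
  proof -
    have "b \<noteq> u" "b \<noteq> v" using that K by auto
    then show ?thesis using that Eu vert unfolding A_def by (auto simp: curve_drawing_vertex[OF D])
  qed
  \<comment> \<open>\<open>y\<close> is an inner point of the edge \<open>{a, b}\<close>. Following
    that edge to \<open>a\<close> and to \<open>b\<close> yields two of the three connections in a
    theta graph whose third arc is \<open>\<Gamma> {u, v}\<close> or \<open>A c\<close>, so the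
    remaining connection must fail.\<close>
  have chord: "\<exists>y. y \<in> \<Gamma> {a, b} - {p a, p b} \<and> y \<notin> \<Gamma> {u, v} \<and> (\<forall>c\<in>K. y \<notin> A c) \<and>
      \<not> connected_component (- (A a \<union> A b)) x y \<and>
      (\<forall>c\<in>K. c \<noteq> a \<longrightarrow> c \<noteq> b \<longrightarrow> \<not> connected_component (- (A a \<union> A b)) (p c) y)"
    if ab: "a \<in> K" "b \<in> K" "a \<noteq> b" for a b
  proof -
    have ne: "a \<noteq> u" "a \<noteq> v" "b \<noteq> u" "b \<noteq> v" "u \<noteq> v" using that K by auto
    have Earc: "arc_set (\<Gamma> {a, b}) (p a) (p b)" using curve_drawing_edge[OF D EK[OF ab]] by simp
    obtain y where y: "y \<in> \<Gamma> {a, b} - {p a, p b}" using arc_set_connected_interior(2)[OF Earc] by blast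
    have e0: "\<Gamma> {a, b} \<inter> \<Gamma> {u, v} = {}"
      using EK[OF ab] Euv ne by (subst curve_drawing_meet[OF D]) (auto simp: doubleton_eq_iff)
    have eA: "\<Gamma> {a, b} \<inter> A c = {p c} \<inter> {p a, p b}" if c: "c \<in> K" for c
    proof -
      have nec: "c \<noteq> u" "c \<noteq> v" using c K by auto
      have "\<Gamma> {a, b} \<inter> \<Gamma> {u, c} = p ` ({a, b} \<inter> {u, c})" "\<Gamma> {a, b} \<inter> \<Gamma> {c, v} = p ` ({a, b} \<inter> {c, v})"
        using EK[OF ab] Eu[OF c] ne nec
        by (subst curve_drawing_meet[OF D]; auto simp: doubleton_eq_iff)+
      moreover have "p ` ({a, b} \<inter> {u, c}) = {p c} \<inter> {p a, p b}" "p ` ({a, b} \<inter> {c, v}) = {p c} \<inter> {p a, p b}"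
        using D vert ne nec ab c unfolding curve_drawing_def by (auto dest: inj_onD)
      ultimately show ?thesis unfolding A_def by auto
    qed
    have yA: "y \<notin> A c" if "c \<in> K" for c using eA[OF that] y by auto
    \<comment> \<open>The edge is cut at its end \<open>d'\<close>, the only point where it may meet
      \<open>S\<close>; the rest is connected and contains \<open>p d\<close> and
      \<open>y\<close>.\<close>
    have conn1: "connected_component (- S) (p d) y"
      if "{d, d'} = {a, b}" "S \<inter> \<Gamma> {a, b} \<subseteq> {p d'}" for d d' S
    proof -
      have arcd: "arc_set (\<Gamma> {a, b}) (p d') (p d)"
        using that(1) Earc arc_set_sym[OF Earc] by (auto simp: doubleton_eq_iff)
      have "p d \<in> \<Gamma> {a, b} - {p d'}" "y \<in> \<Gamma> {a, b} - {p d'}"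
        using arc_set_ends[OF arcd] y that(1) by (auto simp: doubleton_eq_iff)
      then show ?thesis
        unfolding connected_component_def using arc_set_connected_minus_end[OF arcd] that(2)
        by (intro exI[of _ "\<Gamma> {a, b} - {p d'}"]) auto
    qed
    have pab: "p a \<noteq> p b" using arc_set_ends[OF Earc] by simp
    have c1: "connected_component (- (A a \<union> S)) (p b) y" "connected_component (- (A b \<union> S)) (p a) y"
      if "S \<inter> \<Gamma> {a, b} = {}" for S
      using conn1[of b a "A a \<union> S"] conn1[of a b "A b \<union> S"] eA[OF ab(1)] eA[OF ab(2)] that pab
      by (auto simp: insert_commute)
    have "\<not> connected_component (- (A a \<union> A b)) x y"
      using theta_faces[OF arc[OF ab(1)] arc[OF ab(2)] arc0 meet[OF ab] meet0[OF ab(1)] meet0[OF ab(2)]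
          _ mem[OF ab(1)] mem[OF ab(2)] x, of y] c1[of "\<Gamma> {u, v}"] e0 yA ab y by blast
    moreover have "\<not> connected_component (- (A a \<union> A b)) (p c) y" if c: "c \<in> K" "c \<noteq> a" "c \<noteq> b" for c
    proof -
      have "p c \<noteq> p a" "p c \<noteq> p b"
        using D vert ab c unfolding curve_drawing_def by (auto dest: inj_onD)
      then have "A c \<inter> \<Gamma> {a, b} = {}" using eA[OF c(1)] by auto
      then show ?thesis
        using theta_faces[OF arc[OF ab(1)] arc[OF ab(2)] arc[OF c(1)] meet[OF ab] meet meet
          _ mem[OF ab(1)] mem[OF ab(2)] mem[OF c(1)], of y] c1[of "A c"] yA ab c by blast
    qed
    ultimately show ?thesis using y e0 yA by blast
  qed
  \<comment> \<open>Three points on two sides: \<open>y\<close> is separated from both others, so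
    these lie together.\<close>
  have side: "connected_component (- (A a \<union> A b)) (p c) x"
    if abc: "a \<in> K" "b \<in> K" "c \<in> K" "a \<noteq> b" "c \<noteq> a" "c \<noteq> b" for a b c
  proof -
    obtain y where y: "\<forall>c\<in>K. y \<notin> A c" "\<not> connected_component (- (A a \<union> A b)) x y"
      "\<not> connected_component (- (A a \<union> A b)) (p c) y"
      using chord[OF abc(1,2,4)] abc by blast
    have "p c \<notin> A a \<union> A b" "x \<notin> A a \<union> A b" "y \<notin> A a \<union> A b"
      using nin xA y(1) abc by auto
    from Jordan_two_sides[OF arc[OF abc(1)] arc[OF abc(2)] meet[OF abc(1,2,4)] this]
    show ?thesis using y by blast
  qed
  show False
    using theta_faces[OF arc[OF K(4)] arc[OF K(5)] arc[OF K(6)] meet[OF K(4,5,7)] meet[OF K(4,6,8)]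
        meet[OF K(5,6,9)] _ mem[OF K(4)] mem[OF K(5)] mem[OF K(6)], of x]
      side[of a1 a2 a3] side[of a1 a3 a2] side[of a2 a3 a1] xA[OF K(4)] xA[OF K(5)] xA[OF K(6)] K
    by auto
qed

section \<open>Patterns and subdivisions\<close>

text \<open>Lists of pairs make the certificates executable. A pair stands for an undirected edge.
  Only ends of edges count as vertices, so a pattern cannot express isolated vertices.\<close>

type_synonym pattern = "(nat \<times> nat) list"

definition pat_verts :: "pattern \<Rightarrow> nat set" where
  "pat_verts P = (\<Union>(i, j)\<in>set P. {i, j})"

definition pat_edges :: "pattern \<Rightarrow> nat set set" where
  "pat_edges P = (\<lambda>(i, j). {i, j}) ` set P"

definition pat_graph :: "pattern \<Rightarrow> nat ugraph" where
  "pat_graph P = \<lparr>verts = pat_verts P, edges = pat_edges P\<rparr>"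

definition pat_in :: "pattern \<Rightarrow> (nat \<Rightarrow> 'a) \<Rightarrow> 'a ugraph \<Rightarrow> bool" where
  "pat_in P f G \<longleftrightarrow> inj_on f (pat_verts P) \<and> (\<forall>(i, j)\<in>set P. {f i, f j} \<in> edges G)"

lemma pat_verts_Union: "pat_verts P = \<Union> (pat_edges P)"
  by (auto simp: pat_verts_def pat_edges_def)

lemma pat_in_image: "pat_in P f G \<longleftrightarrow> inj_on f (pat_verts P) \<and> (\<forall>e\<in>pat_edges P. f ` e \<in> edges G)"
  by (auto simp: pat_in_def pat_edges_def split_beta)

lemma pat_edgesI: "(i, j) \<in> set P \<or> (j, i) \<in> set P \<Longrightarrow> {i, j} \<in> pat_edges P"
  by (force simp: pat_edges_def insert_commute)

lemma pat_edges_simple: "\<forall>(i, j)\<in>set P. i \<noteq> j \<Longrightarrow> e \<in> pat_edges P \<Longrightarrow> card e = 2"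
  by (auto simp: pat_edges_def)

text \<open>A linear isomorphism carries the drawing from \<open>real ^ 2\<close> to
  \<open>complex\<close>, where the theorems on closed curves used above are formulated.\<close>

lemma planar_imp_curve_drawing:
  assumes "planar G" "simple_graph G"
  obtains p \<Gamma> where "curve_drawing G p \<Gamma>"
proof -
  obtain p \<gamma> where E: "plane_embedding G p \<gamma>" using assms unfolding planar_def by blast
  define h :: "real ^ 2 \<Rightarrow> complex" where "h x = Complex (x $ 1) (x $ 2)" for x
  have lin: "linear h"
    by (rule linearI) (auto simp: h_def complex_eq_iff)
  have inj: "inj h"
    by (rule injI) (auto simp: h_def vec_eq_iff forall_2)
  have injU: "\<And>A. inj_on h A" using inj by (simp add: inj_def inj_on_def)
  have "curve_drawing G (h \<circ> p) (\<lambda>e. h ` path_image (\<gamma> e))"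
    unfolding curve_drawing_def
  proof (intro conjI ballI allI impI)
    show "inj_on (h \<circ> p) (verts G)"
      using E inj unfolding plane_embedding_def by (meson comp_inj_on injU)
    show "e \<subseteq> verts G" if "e \<in> edges G" for e using assms that unfolding simple_graph_def by blast
    show "arc_set (h ` path_image (\<gamma> {u, v})) ((h \<circ> p) u) ((h \<circ> p) v)" if "{u, v} \<in> edges G" for u v
    proof -
      have "arc (\<gamma> {u, v})" "{pathstart (\<gamma> {u, v}), pathfinish (\<gamma> {u, v})} = p ` {u, v}"
        using E that unfolding plane_embedding_def by blast+
      then have "arc (h \<circ> \<gamma> {u, v})"
        and ends: "pathstart (\<gamma> {u, v}) = p u \<and> pathfinish (\<gamma> {u, v}) = p v \<or>
          pathstart (\<gamma> {u, v}) = p v \<and> pathfinish (\<gamma> {u, v}) = p u"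
        using arc_linear_image_eq[OF lin inj] by (auto simp: doubleton_eq_iff)
      then have "arc_set (h ` path_image (\<gamma> {u, v})) (h (pathstart (\<gamma> {u, v}))) (h (pathfinish (\<gamma> {u, v})))"
        unfolding arc_set_def
        by (intro exI[of _ "h \<circ> \<gamma> {u, v}"]) (auto simp: path_image_compose pathstart_compose pathfinish_compose)
      then show ?thesis using ends arc_set_sym by auto
    qed
    show "h ` path_image (\<gamma> e) \<inter> (h \<circ> p) ` verts G = (h \<circ> p) ` e" if "e \<in> edges G" for e
    proof -
      have "path_image (\<gamma> e) \<inter> p ` verts G = p ` e" using E that unfolding plane_embedding_def by blast
      then show ?thesis by (metis image_Int[OF inj] image_comp)
    qed
    show "h ` path_image (\<gamma> e) \<inter> h ` path_image (\<gamma> e') = (h \<circ> p) ` (e \<inter> e')"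
      if "e \<in> edges G" "e' \<in> edges G" "e \<noteq> e'" for e e'
    proof -
      have "path_image (\<gamma> e) \<inter> path_image (\<gamma> e') = p ` (e \<inter> e')"
        using E that unfolding plane_embedding_def by blast
      then show ?thesis by (metis image_Int[OF inj] image_comp)
    qed
  qed
  then show ?thesis using that by blast
qed

lemma curve_drawing_pat:
  assumes D: "curve_drawing G p \<Gamma>" and P: "pat_in P f G"
  shows "curve_drawing (pat_graph P) (p \<circ> f) (\<lambda>e. \<Gamma> (f ` e))"
proof -
  have inj: "inj_on f (pat_verts P)" and E: "\<And>e. e \<in> pat_edges P \<Longrightarrow> f ` e \<in> edges G"
    using P unfolding pat_in_image by auto
  have V: "e \<subseteq> pat_verts P" if "e \<in> pat_edges P" for e using that by (auto simp: pat_verts_Union)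
  have GV: "f ` pat_verts P \<subseteq> verts G"
  proof -
    have "f ` e \<subseteq> verts G" if "e \<in> pat_edges P" for e
      using curve_drawing_subset[OF D E[OF that]] .
    then show ?thesis unfolding pat_verts_Union by auto
  qed
  have pinj: "inj_on p (verts G)" using D unfolding curve_drawing_def by blast
  show ?thesis
    unfolding curve_drawing_def pat_graph_def ugraph.simps
  proof (intro conjI ballI allI impI)
    show "inj_on (p \<circ> f) (pat_verts P)" using inj pinj GV by (meson comp_inj_on inj_on_subset)
    show "e \<subseteq> pat_verts P" if "e \<in> pat_edges P" for e using V that .
    show "arc_set (\<Gamma> (f ` {u, v})) ((p \<circ> f) u) ((p \<circ> f) v)" if "{u, v} \<in> pat_edges P" for u v
      using E[OF that] curve_drawing_edge(1)[OF D] by simp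
    show "\<Gamma> (f ` e) \<inter> (p \<circ> f) ` pat_verts P = (p \<circ> f) ` e" if e: "e \<in> pat_edges P" for e
    proof -
      have "p (f v) \<in> \<Gamma> (f ` e) \<longleftrightarrow> v \<in> e" if "v \<in> pat_verts P" for v
        using curve_drawing_vertex[OF D E[OF e], of "f v"] that GV inj V[OF e]
        by (auto simp: inj_on_image_mem_iff)
      then show ?thesis using V[OF e] by auto
    qed
    show "\<Gamma> (f ` e) \<inter> \<Gamma> (f ` e') = (p \<circ> f) ` (e \<inter> e')"
      if e: "e \<in> pat_edges P" and e': "e' \<in> pat_edges P" and ne: "e \<noteq> e'" for e e'
    proof -
      have "f ` e \<noteq> f ` e'" using ne inj_on_image_eq_iff[OF inj V[OF e] V[OF e']] by simp
      then have "\<Gamma> (f ` e) \<inter> \<Gamma> (f ` e') = p ` (f ` e \<inter> f ` e')"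
        using curve_drawing_meet[OF D E[OF e] E[OF e']] by simp
      then show ?thesis
        using inj_on_image_Int[OF inj V[OF e] V[OF e']] by (metis image_comp)
    qed
  qed
qed

section \<open>Subdivision preserves nonplanarity\<close>

text \<open>The edge \<open>{a, b}\<close> is drawn along the path from \<open>a\<close> over
  \<open>x\<close> to \<open>b\<close>. The other edges of \<open>H\<close> avoid \<open>x\<close>,
  so they meet this path at most in its ends.\<close>

lemma curve_drawing_suppress:
  assumes D: "curve_drawing G p \<Gamma>" and ax: "{a, x} \<in> edges G" and xb: "{x, b} \<in> edges G" and ab: "a \<noteq> b"
    and V: "verts H \<subseteq> verts G - {x}" and E: "edges H \<subseteq> insert {a, b} {e \<in> edges G. x \<notin> e}"
    and EV: "\<forall>e\<in>edges H. e \<subseteq> verts H"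
  shows "\<exists>\<Gamma>'. curve_drawing H p \<Gamma>'"
proof -
  define \<Gamma>' where "\<Gamma>' = \<Gamma>({a, b} := \<Gamma> {a, x} \<union> \<Gamma> {x, b})"
  have arcab: "arc_set (\<Gamma> {a, x} \<union> \<Gamma> {x, b}) (p a) (p b)" by (rule curve_drawing_path2[OF D ax xb ab])
  have xa: "a \<noteq> x" "b \<noteq> x" "a \<in> verts G" "b \<in> verts G" "x \<in> verts G"
    using curve_drawing_edge[OF D] ax xb by blast+
  have pinj: "inj_on p (verts G)" using D unfolding curve_drawing_def by blast
  have meet_ab: "(\<Gamma> {a, x} \<union> \<Gamma> {x, b}) \<inter> \<Gamma> e = p ` ({a, b} \<inter> e)" if e: "e \<in> edges G" "x \<notin> e" for e
    using curve_drawing_meet[OF D ax e(1)] curve_drawing_meet[OF D xb e(1)] e(2) by auto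
  have "curve_drawing H p \<Gamma>'"
    unfolding curve_drawing_def
  proof (intro conjI ballI allI impI)
    show "inj_on p (verts H)" using pinj V by (meson Diff_subset inj_on_subset)
    show "e \<subseteq> verts H" if "e \<in> edges H" for e using EV that by blast
    show "arc_set (\<Gamma>' {u, v}) (p u) (p v)" if uv: "{u, v} \<in> edges H" for u v
    proof (cases "{u, v} = {a, b}")
      case True
      then show ?thesis using arcab arc_set_sym[OF arcab] by (auto simp: \<Gamma>'_def doubleton_eq_iff)
    next
      case False
      then show ?thesis using uv E curve_drawing_edge(1)[OF D, of u v] by (auto simp: \<Gamma>'_def)
    qed
    show "\<Gamma>' e \<inter> p ` verts H = p ` e" if e: "e \<in> edges H" for e
    proof (cases "e = {a, b}")
      case True
      have "p v \<in> \<Gamma>' e \<longleftrightarrow> v \<in> e" if "v \<in> verts H" for v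
      proof -
        have "v \<in> verts G" "v \<noteq> x" using that V by auto
        then show ?thesis
          using True curve_drawing_vertex[OF D ax] curve_drawing_vertex[OF D xb] by (auto simp: \<Gamma>'_def)
      qed
      then show ?thesis using EV e by blast
    next
      case False
      then have eG: "e \<in> edges G" using E e by auto
      have "p v \<in> \<Gamma>' e \<longleftrightarrow> v \<in> e" if "v \<in> verts H" for v
        using that V False curve_drawing_vertex[OF D eG, of v] by (auto simp: \<Gamma>'_def)
      then show ?thesis using EV e by blast
    qed
    show "\<Gamma>' e \<inter> \<Gamma>' e' = p ` (e \<inter> e')" if e: "e \<in> edges H" "e' \<in> edges H" "e \<noteq> e'" for e e'
    proof -
      consider "e = {a, b}" "e' \<in> edges G" "x \<notin> e'" | "e' = {a, b}" "e \<in> edges G" "x \<notin> e"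
        | "e \<noteq> {a, b}" "e' \<noteq> {a, b}" "e \<in> edges G" "e' \<in> edges G" using E e by blast
      then show ?thesis
      proof cases
        case 1
        then show ?thesis using meet_ab e(3) by (simp add: \<Gamma>'_def)
      next
        case 2
        then show ?thesis using meet_ab e(3) by (simp add: \<Gamma>'_def Int_commute)
      next
        case 3
        then show ?thesis using curve_drawing_meet[OF D _ _ e(3)] by (simp add: \<Gamma>'_def)
      qed
    qed
  qed
  then show ?thesis by blast
qed

definition pat_nonplanar :: "pattern \<Rightarrow> bool" where
  "pat_nonplanar P \<longleftrightarrow> (\<nexists>p \<Gamma>. curve_drawing (pat_graph P) p \<Gamma>)"

lemma pat_nonplanar_not_planar:
  "pat_nonplanar P \<Longrightarrow> pat_in P f G \<Longrightarrow> simple_graph G \<Longrightarrow> \<not> planar G"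
  using planar_imp_curve_drawing curve_drawing_pat unfolding pat_nonplanar_def by metis

text \<open>Edges are addressed by their position. One half of the edge stays at position
  \<open>k\<close> and the other goes to the end, so the other positions, to which the certificates
  refer, do not shift.\<close>

definition subdivide :: "pattern \<Rightarrow> nat \<Rightarrow> nat \<Rightarrow> pattern" where
  "subdivide P k x = P[k := (fst (P ! k), x)] @ [(snd (P ! k), x)]"

lemma set_subdivide_subset:
  "k < length P \<Longrightarrow> set (subdivide P k x) \<subseteq> {(fst (P ! k), x), (snd (P ! k), x)} \<union> set P"
  using set_update_subset_insert[of P k "(fst (P ! k), x)"] by (auto simp: subdivide_def)

lemma set_subdivide_superset:
  assumes "k < length P"
  shows "{(fst (P ! k), x), (snd (P ! k), x)} \<union> (set P - {P ! k}) \<subseteq> set (subdivide P k x)"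
proof -
  have "z \<in> set (P[k := y])" if "z \<in> set P" "z \<noteq> P ! k" for y z
    using that by (metis in_set_conv_nth length_list_update nth_list_update_neq)
  then show ?thesis using assms by (auto simp: subdivide_def set_update_memI)
qed

text \<open>A drawing of the subdivision gives a drawing of \<open>P\<close> by suppressing
  \<open>x\<close>.\<close>

lemma pat_nonplanar_subdivide:
  assumes nP: "pat_nonplanar P" and k: "k < length P" and ne: "fst (P ! k) \<noteq> snd (P ! k)" and x: "x \<notin> pat_verts P"
  shows "pat_nonplanar (subdivide P k x)"
proof (rule ccontr)
  define a b where "a = fst (P ! k)" and "b = snd (P ! k)"
  have ab: "(a, b) \<in> set P" "P ! k = (a, b)" using k by (auto simp: a_def b_def)
  let ?Q = "subdivide P k x"
  assume "\<not> pat_nonplanar ?Q"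
  then obtain p \<Gamma> where D: "curve_drawing (pat_graph ?Q) p \<Gamma>" unfolding pat_nonplanar_def by blast
  note sup = set_subdivide_superset[OF k, of x]
  have QE: "{a, x} \<in> pat_edges ?Q" "{x, b} \<in> pat_edges ?Q"
    using sup by (force simp: pat_edges_def a_def b_def insert_commute)+
  have sub: "e \<in> pat_edges ?Q" if "e \<in> pat_edges P" "e \<noteq> {a, b}" for e
    using that sup ab(2) by (auto simp: pat_edges_def)
  have "\<exists>\<Gamma>'. curve_drawing (pat_graph P) p \<Gamma>'"
  proof (rule curve_drawing_suppress[OF D])
    show "{a, x} \<in> edges (pat_graph ?Q)" "{x, b} \<in> edges (pat_graph ?Q)" "a \<noteq> b"
      using QE ne by (auto simp: pat_graph_def a_def b_def)
    have nx: "x \<notin> e" if "e \<in> pat_edges P" for e using x that by (auto simp: pat_verts_Union)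
    show "edges (pat_graph P) \<subseteq> insert {a, b} {e \<in> edges (pat_graph ?Q). x \<notin> e}"
      using sub nx by (auto simp: pat_graph_def)
    have "{a, b} \<subseteq> pat_verts ?Q" using QE by (auto simp: pat_verts_Union)
    then have "pat_verts P \<subseteq> pat_verts ?Q" using sub unfolding pat_verts_Union by blast
    then show "verts (pat_graph P) \<subseteq> verts (pat_graph ?Q) - {x}"
      using x by (auto simp: pat_graph_def)
    show "\<forall>e\<in>edges (pat_graph P). e \<subseteq> verts (pat_graph P)" by (auto simp: pat_graph_def pat_verts_Union)
  qed
  then show False using nP unfolding pat_nonplanar_def by blast
qed

definition K33 :: pattern where
  "K33 = [(0,3),(0,4),(0,5),(1,3),(1,4),(1,5),(2,3),(2,4),(2,5)]"

definition K5 :: pattern where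
  "K5 = [(0,1),(0,2),(0,3),(0,4),(1,2),(1,3),(1,4),(2,3),(2,4),(3,4)]"

lemma pat_nonplanar_K33: "pat_nonplanar K33"
  unfolding pat_nonplanar_def
proof (intro notI, elim exE)
  fix p \<Gamma> assume "curve_drawing (pat_graph K33) p \<Gamma>"
  moreover have "{a, b} \<in> edges (pat_graph K33)" if "a \<in> {0, 1, 2}" "b \<in> {3, 4, 5}" for a b
  proof -
    have "(a, b) \<in> set K33" using that by (auto simp: K33_def)
    then show ?thesis by (simp add: pat_graph_def pat_edgesI)
  qed
  ultimately show False
    using no_curve_drawing_K33[of "pat_graph K33" p \<Gamma> 0 1 2 3 4 5] by simp
qed

lemma pat_nonplanar_K5: "pat_nonplanar K5"
  unfolding pat_nonplanar_def
proof (intro notI, elim exE)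
  fix p \<Gamma> assume "curve_drawing (pat_graph K5) p \<Gamma>"
  moreover have "{a, b} \<in> edges (pat_graph K5)" if "a \<in> {0, 1, 2, 3, 4}" "b \<in> {0, 1, 2, 3, 4}" "a \<noteq> b" for a b
  proof -
    have "(a, b) \<in> set K5 \<or> (b, a) \<in> set K5" using that
      by (elim insertE emptyE; simp add: K5_def)
    then show ?thesis by (simp add: pat_graph_def pat_edgesI)
  qed
  ultimately show False
    using no_curve_drawing_K5[of "pat_graph K5" p \<Gamma> 0 1 2 3 4] by simp
qed

definition pat_iso :: "pattern \<Rightarrow> (nat \<Rightarrow> 'a) \<Rightarrow> 'a ugraph \<Rightarrow> bool" where
  "pat_iso P f G \<longleftrightarrow> inj_on f (pat_verts P) \<and> verts G = f ` pat_verts P \<and> edges G = (`) f ` pat_edges P"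

text \<open>A nonplanar pattern that avoids the label \<open>i\<close> survives the deletion of
  \<open>f i\<close>. For nonplanarity of \<open>G\<close> itself any one of these patterns serves,
  so \<open>R\<close> must have a vertex.\<close>

lemma pat_iso_not_apex:
  assumes iso: "pat_iso R f G" and ne: "R \<noteq> []" and simple: "\<forall>(i, j)\<in>set R. i \<noteq> j"
    and del: "\<And>i. i \<in> pat_verts R \<Longrightarrow> \<exists>B h. pat_nonplanar B \<and> inj_on h (pat_verts B) \<and>
      (\<forall>(a, b)\<in>set B. {h a, h b} \<in> pat_edges R) \<and> i \<notin> h ` pat_verts B"
  shows "\<not> apex G"
proof -
  have inj: "inj_on f (pat_verts R)" and VG: "verts G = f ` pat_verts R" and EG: "edges G = (`) f ` pat_edges R"
    using iso unfolding pat_iso_def by auto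
  have finR: "finite (pat_verts R)" by (auto simp: pat_verts_def)
  have sR: "e \<subseteq> pat_verts R \<and> card e = 2" if "e \<in> pat_edges R" for e
    using that pat_edges_simple[OF simple] by (auto simp: pat_verts_Union)
  have sG: "simple_graph G"
    unfolding simple_graph_def VG EG
    using finR sR inj by (auto simp: card_image inj_on_subset)
  have key: "\<exists>B g. pat_nonplanar B \<and> pat_in B g (del_vertex G v)" if v: "v \<in> verts G" for v
  proof -
    obtain i where i: "i \<in> pat_verts R" "v = f i" using v VG by blast
    obtain B h where B: "pat_nonplanar B" "inj_on h (pat_verts B)"
      "\<forall>(a, b)\<in>set B. {h a, h b} \<in> pat_edges R" "i \<notin> h ` pat_verts B" using del[OF i(1)] by blast
    have hB: "h ` pat_verts B \<subseteq> pat_verts R"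
    proof
      fix y assume "y \<in> h ` pat_verts B"
      then obtain a b where "(a, b) \<in> set B" "y \<in> {h a, h b}" by (auto simp: pat_verts_def)
      then show "y \<in> pat_verts R" using B(3) unfolding pat_verts_Union[of R] by blast
    qed
    have "pat_in B (f \<circ> h) (del_vertex G v)"
      unfolding pat_in_def
    proof (intro conjI ballI, clarify?)
      show "inj_on (f \<circ> h) (pat_verts B)" using B(2) inj hB by (meson comp_inj_on inj_on_subset)
    next
      fix e assume e: "e \<in> set B"
      obtain a b where ab: "e = (a, b)" by fastforce
      have "{h a, h b} \<in> pat_edges R" using B(3) e ab by auto
      then have "f ` {h a, h b} \<in> edges G" using EG by blast
      moreover have "a \<in> pat_verts B" "b \<in> pat_verts B" using e ab by (force simp: pat_verts_def)+
      then have "h a \<noteq> i" "h b \<noteq> i" "h a \<in> pat_verts R" "h b \<in> pat_verts R" using B(4) hB by auto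
      then have "f (h a) \<noteq> v" "f (h b) \<noteq> v" using i inj by (auto dest: inj_onD)
      ultimately show "case e of (i, j) \<Rightarrow> {(f \<circ> h) i, (f \<circ> h) j} \<in> edges (del_vertex G v)"
        by (auto simp: ab del_vertex_def)
    qed
    then show ?thesis using B(1) by blast
  qed
  have sD: "simple_graph (del_vertex G v)" for v
    using sG unfolding simple_graph_def del_vertex_def by auto
  have np: "\<not> planar (del_vertex G v)" if v: "v \<in> verts G" for v
    using key[OF v] pat_nonplanar_not_planar sD by blast
  obtain i where "i \<in> pat_verts R" using ne by (cases R) (auto simp: pat_verts_def)
  then have v: "f i \<in> verts G" using VG by blast
  obtain B g where B: "pat_nonplanar B" "pat_in B g (del_vertex G (f i))" using key[OF v] by blast
  then have "pat_in B g G" by (auto simp: pat_in_def del_vertex_def)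
  then have "\<not> planar G" using pat_nonplanar_not_planar B(1) sG by blast
  then show ?thesis using np unfolding apex_def by blast
qed

section \<open>Straight-line drawings\<close>

text \<open>Convex hulls of images treat an edge as a set, without choosing an order of its ends.
  Stating the last clause as an inclusion is enough, since common ends lie in both hulls.\<close>

definition line_drawing :: "'a ugraph \<Rightarrow> ('a \<Rightarrow> real ^ 2) \<Rightarrow> bool" where
  "line_drawing G p \<longleftrightarrow> inj_on p (verts G) \<and>
     (\<forall>e\<in>edges G. \<forall>c\<in>verts G - e. p c \<notin> convex hull (p ` e)) \<and>
     (\<forall>e\<in>edges G. \<forall>e'\<in>edges G. e \<noteq> e' \<longrightarrow> convex hull (p ` e) \<inter> convex hull (p ` e') \<subseteq> p ` (e \<inter> e'))"

definition line_planar :: "'a ugraph \<Rightarrow> bool" where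
  "line_planar G \<longleftrightarrow> (\<exists>p. line_drawing G p)"

lemma line_drawing_inj: "line_drawing G p \<Longrightarrow> inj_on p (verts G)"
  and line_drawing_vertex: "line_drawing G p \<Longrightarrow> e \<in> edges G \<Longrightarrow> c \<in> verts G \<Longrightarrow> c \<notin> e \<Longrightarrow> p c \<notin> convex hull (p ` e)"
  and line_drawing_meet: "line_drawing G p \<Longrightarrow> e \<in> edges G \<Longrightarrow> e' \<in> edges G \<Longrightarrow> e \<noteq> e' \<Longrightarrow>
    convex hull (p ` e) \<inter> convex hull (p ` e') \<subseteq> p ` (e \<inter> e')"
  by (auto simp: line_drawing_def)

lemma line_planar_mono:
  "line_planar G \<Longrightarrow> verts H \<subseteq> verts G \<Longrightarrow> edges H \<subseteq> edges G \<Longrightarrow> line_planar H"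
  unfolding line_planar_def line_drawing_def by (meson Diff_mono inj_on_subset order_refl subsetD)

lemma simple_graph_edgeE:
  assumes "simple_graph G" "e \<in> edges G"
  obtains a b where "e = {a, b}" "a \<noteq> b" "a \<in> verts G" "b \<in> verts G"
  using assms unfolding simple_graph_def card_2_iff by (metis insert_subset)

lemma line_planar_imp_planar:
  assumes "line_planar G" "simple_graph G"
  shows "planar G"
proof -
  obtain p where p: "line_drawing G p" using assms unfolding line_planar_def by blast
  have "\<exists>g. arc g \<and> {pathstart g, pathfinish g} = p ` e \<and> path_image g = convex hull (p ` e)"
    if e: "e \<in> edges G" for e
  proof -
    obtain a b where ab: "e = {a, b}" "a \<noteq> b" "a \<in> verts G" "b \<in> verts G"
      using simple_graph_edgeE[OF assms(2) e] by metis
    then have "p a \<noteq> p b" using line_drawing_inj[OF p] by (auto dest: inj_onD)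
    then show ?thesis
      by (intro exI[of _ "linepath (p a) (p b)"]) (auto simp: ab segment_convex_hull)
  qed
  then obtain \<gamma> where \<gamma>: "\<And>e. e \<in> edges G \<Longrightarrow> arc (\<gamma> e) \<and> {pathstart (\<gamma> e), pathfinish (\<gamma> e)} = p ` e \<and>
      path_image (\<gamma> e) = convex hull (p ` e)" by metis
  have sub: "p ` e \<subseteq> convex hull (p ` e)" for e by (rule hull_subset)
  have "plane_embedding G p \<gamma>"
    unfolding plane_embedding_def
  proof (intro conjI ballI impI)
    show "inj_on p (verts G)" using line_drawing_inj[OF p] .
    fix e assume e: "e \<in> edges G"
    show "arc (\<gamma> e)" "{pathstart (\<gamma> e), pathfinish (\<gamma> e)} = p ` e" using \<gamma>[OF e] by auto
    have "e \<subseteq> verts G" using assms(2) e unfolding simple_graph_def by blast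
    then show "path_image (\<gamma> e) \<inter> p ` verts G = p ` e"
      using \<gamma>[OF e] sub[of e] line_drawing_vertex[OF p e] by blast
    fix e' assume e': "e' \<in> edges G" "e \<noteq> e'"
    show "path_image (\<gamma> e) \<inter> path_image (\<gamma> e') = p ` (e \<inter> e')"
      using \<gamma>[OF e] \<gamma>[OF e'(1)] line_drawing_meet[OF p e e'] sub[of e] sub[of e'] by auto
  qed
  then show ?thesis unfolding planar_def by blast
qed

section \<open>Segments with a perturbed end\<close>

definition det2 :: "real ^ 2 \<Rightarrow> real ^ 2 \<Rightarrow> real" where
  "det2 u v = u $ 1 * v $ 2 - u $ 2 * v $ 1"

lemma det2_scaleR: "det2 (s *\<^sub>R u) v = s * det2 u v"
  by (simp add: det2_def algebra_simps)

text \<open>For a common point \<open>y\<close>, the vector \<open>y - a\<close> is a multiple both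
  of \<open>x - a\<close> and of \<open>d - a\<close>; taking the determinant with
  \<open>d - a\<close> shows that the first factor is zero.\<close>

lemma segments_meet_at_start:
  assumes "det2 (x - a) (d - a) \<noteq> 0"
  shows "closed_segment a x \<inter> closed_segment a d = {a}"
proof -
  have "y = a" if y: "y \<in> closed_segment a x" "y \<in> closed_segment a d" for y
  proof -
    obtain s where s: "y - a = s *\<^sub>R (x - a)"
      using y(1) by (auto simp: in_segment algebra_simps)
    obtain t where t: "y - a = t *\<^sub>R (d - a)"
      using y(2) by (auto simp: in_segment algebra_simps)
    have "s * det2 (x - a) (d - a) = det2 (s *\<^sub>R (x - a)) (d - a)" by (simp add: det2_def algebra_simps)
    also have "\<dots> = det2 (t *\<^sub>R (d - a)) (d - a)" using s t by simp
    also have "\<dots> = 0" by (simp add: det2_def algebra_simps)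
    finally have "s = 0" using assms by simp
    then show ?thesis using s by simp
  qed
  then show ?thesis by auto
qed

text \<open>A new vertex will be placed at m + \<delta> n. That its edge is not collinear with an
  old edge at the same neighbour is the nonvanishing of a determinant affine in \<delta>; such a
  function has at most one zero unless it vanishes identically.\<close>

lemma eventually_affine_nonzero:
  fixes \<alpha> \<beta> :: real
  assumes "\<alpha> \<noteq> 0 \<or> \<beta> \<noteq> 0"
  shows "eventually (\<lambda>\<delta>. \<alpha> + \<delta> * \<beta> \<noteq> 0) (at_right 0)"
proof (cases "\<alpha> = 0")
  case True
  then show ?thesis using assms eventually_at_right_less[of "0::real"] by (auto elim: eventually_mono)
next
  case False
  have "((\<lambda>\<delta>. \<alpha> + \<delta> * \<beta>) \<longlongrightarrow> \<alpha> + 0 * \<beta>) (at_right 0)" by (intro tendsto_intros)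
  then show ?thesis using False by (auto intro: tendsto_imp_eventually_ne)
qed

text \<open>Shifting one end by \<delta> n moves every point of the segment by at most \<delta>
  times the norm of n, while a compact set disjoint from the closed segment has positive distance
  from it.\<close>

lemma eventually_segment_disjoint:
  fixes a m n :: "'b::euclidean_space"
  assumes "compact K" "K \<inter> closed_segment a m = {}"
  shows "eventually (\<lambda>\<delta>. K \<inter> closed_segment a (m + \<delta> *\<^sub>R n) = {}) (at_right 0)"
proof -
  obtain d where d: "d > 0" "\<And>x y. x \<in> K \<Longrightarrow> y \<in> closed_segment a m \<Longrightarrow> d \<le> dist x y"
    using separate_compact_closed[OF assms(1) closed_segment assms(2)] by blast
  \<comment> \<open>The added 1 keeps the denominator positive when \<open>n = 0\<close>.\<close>
  have "K \<inter> closed_segment a (m + \<delta> *\<^sub>R n) = {}" if \<delta>: "\<delta> > 0" "\<delta> < d / (norm n + 1)" for \<delta>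
  proof (rule ccontr)
    assume "K \<inter> closed_segment a (m + \<delta> *\<^sub>R n) \<noteq> {}"
    then obtain u where u: "0 \<le> u" "u \<le> 1" "(1 - u) *\<^sub>R a + u *\<^sub>R (m + \<delta> *\<^sub>R n) \<in> K" (is "?y \<in> K")
      by (auto simp: in_segment)
    let ?z = "(1 - u) *\<^sub>R a + u *\<^sub>R m"
    have "?z \<in> closed_segment a m" using u by (auto simp: in_segment)
    then have "d \<le> dist ?y ?z" using d(2) u(3) by blast
    also have "dist ?y ?z = norm ((u * \<delta>) *\<^sub>R n)" by (simp add: dist_norm algebra_simps)
    also have "\<dots> = u * \<delta> * norm n" using u \<delta> by simp
    also have "\<dots> \<le> \<delta> * norm n" using u \<delta> by (simp add: mult_left_le_one_le mult_right_mono)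
    also have "\<dots> < \<delta> * (norm n + 1)" using \<delta> by simp
    also have "\<dots> < d" using \<delta> by (simp add: pos_less_divide_eq add_nonneg_pos)
    finally show False .
  qed
  moreover have "d / (norm n + 1) > 0" using d by (simp add: add_nonneg_pos)
  ultimately show ?thesis unfolding eventually_at_right_field by blast
qed

text \<open>The limiting segment from \<open>p a\<close> to \<open>m\<close> must already be clear
  of everything away from \<open>a\<close>; compactness then keeps it clear for small \<delta>. Only
  edges at \<open>a\<close> need the direction \<open>n\<close>, through the affine determinants. A
  pendant vertex uses \<open>m = p a\<close>, a vertex of degree two the midpoint of an
  edge.\<close>

lemma eventually_spoke:
  assumes G: "simple_graph G" and fin: "finite (edges G)" and p: "line_drawing G p" and a: "a \<in> verts G"
    and h0: "m \<noteq> p a \<or> n \<noteq> 0"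
    and h1: "\<And>d. {a, d} \<in> edges G \<Longrightarrow> det2 (m - p a) (p d - p a) \<noteq> 0 \<or> det2 n (p d - p a) \<noteq> 0"
    and h2: "\<And>e. e \<in> edges G \<Longrightarrow> a \<notin> e \<Longrightarrow> convex hull (p ` e) \<inter> closed_segment (p a) m = {}"
    and h3: "\<And>c. c \<in> verts G \<Longrightarrow> c \<noteq> a \<Longrightarrow> p c \<notin> closed_segment (p a) m"
  shows "eventually (\<lambda>\<delta>. m + \<delta> *\<^sub>R n \<noteq> p a \<and>
    (\<forall>e\<in>edges G. convex hull (p ` e) \<inter> closed_segment (p a) (m + \<delta> *\<^sub>R n) \<subseteq> (if a \<in> e then {p a} else {})) \<and>
    (\<forall>c\<in>verts G - {a}. p c \<notin> closed_segment (p a) (m + \<delta> *\<^sub>R n))) (at_right 0)"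
proof (intro eventually_conj)
  have finV: "finite (verts G)" using G by (simp add: simple_graph_def)
  show "eventually (\<lambda>\<delta>. m + \<delta> *\<^sub>R n \<noteq> p a) (at_right 0)"
  proof -
    obtain k where k: "(m - p a) $ k \<noteq> 0 \<or> n $ k \<noteq> 0" using h0 by (auto simp: vec_eq_iff)
    show ?thesis
      by (rule eventually_mono[OF eventually_affine_nonzero[OF k]])
        (auto simp: algebra_simps dest!: arg_cong[where f = "\<lambda>v. v $ k"])
  qed
  show "eventually (\<lambda>\<delta>. \<forall>e\<in>edges G. convex hull (p ` e) \<inter> closed_segment (p a) (m + \<delta> *\<^sub>R n) \<subseteq>
      (if a \<in> e then {p a} else {})) (at_right 0)"
  proof (rule eventually_ball_finite[OF fin], rule ballI)
    fix e assume e: "e \<in> edges G"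
    obtain c d where cd: "e = {c, d}" "c \<in> verts G" "d \<in> verts G" using simple_graph_edgeE[OF G e] by metis
    show "eventually (\<lambda>\<delta>. convex hull (p ` e) \<inter> closed_segment (p a) (m + \<delta> *\<^sub>R n) \<subseteq>
      (if a \<in> e then {p a} else {})) (at_right 0)"
    proof (cases "a \<in> e")
      case True
      then obtain b where b: "e = {a, b}" using cd by auto
      have "det2 (m - p a) (p b - p a) \<noteq> 0 \<or> det2 n (p b - p a) \<noteq> 0" using h1 e b by blast
      then show ?thesis
      proof (rule eventually_mono[OF eventually_affine_nonzero])
        fix \<delta> assume "det2 (m - p a) (p b - p a) + \<delta> * det2 n (p b - p a) \<noteq> 0"
        then have "det2 (m + \<delta> *\<^sub>R n - p a) (p b - p a) \<noteq> 0" by (simp add: det2_def algebra_simps)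
        from segments_meet_at_start[OF this]
        show "convex hull (p ` e) \<inter> closed_segment (p a) (m + \<delta> *\<^sub>R n) \<subseteq> (if a \<in> e then {p a} else {})"
          by (auto simp: b segment_convex_hull)
      qed
    next
      case False
      have "compact (convex hull (p ` e))" using cd by (simp add: compact_convex_hull finite_imp_compact)
      from eventually_segment_disjoint[OF this h2[OF e False]] False show ?thesis by simp
    qed
  qed
  have "eventually (\<lambda>\<delta>. p c \<notin> closed_segment (p a) (m + \<delta> *\<^sub>R n)) (at_right 0)"
    if "c \<in> verts G - {a}" for c
    using eventually_segment_disjoint[of "{p c}" "p a" m n] h3[of c] that by simp
  then show "eventually (\<lambda>\<delta>. \<forall>c\<in>verts G - {a}. p c \<notin> closed_segment (p a) (m + \<delta> *\<^sub>R n)) (at_right 0)"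
    using finV by (intro eventually_ball_finite) auto
qed

section \<open>Adding a vertex of degree one or two to a straight-line drawing\<close>

lemma line_drawing_add_vertex:
  assumes G: "simple_graph G" and p: "line_drawing G p" and x: "x \<notin> verts G" and S: "S \<subseteq> verts G"
    and q: "\<forall>c\<in>verts G. q \<noteq> p c" "\<forall>e\<in>edges G. q \<notin> convex hull (p ` e)"
    and h1: "\<And>a e. a \<in> S \<Longrightarrow> e \<in> edges G \<Longrightarrow>
      convex hull (p ` e) \<inter> closed_segment (p a) q \<subseteq> (if a \<in> e then {p a} else {})"
    and h2: "\<And>a c. a \<in> S \<Longrightarrow> c \<in> verts G \<Longrightarrow> c \<noteq> a \<Longrightarrow> p c \<notin> closed_segment (p a) q"
    and h3: "\<And>a b. a \<in> S \<Longrightarrow> b \<in> S \<Longrightarrow> a \<noteq> b \<Longrightarrow> closed_segment (p a) q \<inter> closed_segment (p b) q \<subseteq> {q}"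
    and V': "verts G' = insert x (verts G)" and E': "edges G' = edges G \<union> (\<lambda>a. {x, a}) ` S"
  shows "line_drawing G' (p(x := q))"
proof -
  let ?p = "p(x := q)"
  have eV: "e \<subseteq> verts G" if "e \<in> edges G" for e using G that unfolding simple_graph_def by blast
  have old: "?p ` e = p ` e" if "x \<notin> e" for e using that by auto
  have oldE: "?p ` e = p ` e" "x \<notin> e" if "e \<in> edges G" for e using eV[OF that] x by auto
  have new: "convex hull (?p ` {x, a}) = closed_segment (p a) q" if "a \<in> S" for a
  proof -
    have "a \<noteq> x" using that S x by auto
    then show ?thesis by (simp add: segment_convex_hull insert_commute)
  qed
  show ?thesis
    unfolding line_drawing_def V' E'
  proof (intro conjI ballI impI)
    show "inj_on ?p (insert x (verts G))"
      using line_drawing_inj[OF p] q(1) x by (auto simp: inj_on_def)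
  next
    fix e c assume e: "e \<in> edges G \<union> (\<lambda>a. {x, a}) ` S" and c: "c \<in> insert x (verts G) - e"
    show "?p c \<notin> convex hull (?p ` e)"
    proof (cases "e \<in> edges G")
      case True
      show ?thesis
      proof (cases "c = x")
        case True
        then show ?thesis using q(2) \<open>e \<in> edges G\<close> oldE by auto
      next
        case False
        then show ?thesis using line_drawing_vertex[OF p True, of c] c oldE[OF True] by auto
      qed
    next
      case False
      then obtain a where a: "a \<in> S" "e = {x, a}" using e by auto
      then have "c \<in> verts G" "c \<noteq> a" "c \<noteq> x" using c by auto
      then show ?thesis using h2[OF a(1)] new[OF a(1)] a(2) by simp
    qed
  next
    fix e e' assume e: "e \<in> edges G \<union> (\<lambda>a. {x, a}) ` S" "e' \<in> edges G \<union> (\<lambda>a. {x, a}) ` S" "e \<noteq> e'"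
    have on: "convex hull (?p ` e) \<inter> convex hull (?p ` {x, a}) \<subseteq> ?p ` (e \<inter> {x, a})"
      if e: "e \<in> edges G" and a: "a \<in> S" for e a
    proof -
      have "a \<noteq> x" using a S x by auto
      then show ?thesis using h1[OF a e] new[OF a] oldE[OF e] by (auto split: if_splits)
    qed
    consider "e \<in> edges G" "e' \<in> edges G" | a where "e \<in> edges G" "a \<in> S" "e' = {x, a}"
      | a where "e' \<in> edges G" "a \<in> S" "e = {x, a}" | a b where "a \<in> S" "b \<in> S" "e = {x, a}" "e' = {x, b}"
      using e by auto
    then show "convex hull (?p ` e) \<inter> convex hull (?p ` e') \<subseteq> ?p ` (e \<inter> e')"
    proof cases
      case 1
      have "?p ` (e \<inter> e') = p ` (e \<inter> e')" using oldE[OF 1(1)] by (intro old) auto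
      then show ?thesis using line_drawing_meet[OF p 1 e(3)] oldE 1 by simp
    next
      case 2
      then show ?thesis using on by blast
    next
      case 3
      then show ?thesis using on[OF 3(1,2)] by (simp add: Int_commute)
    next
      case 4
      then have "a \<noteq> b" using e(3) by auto
      have "convex hull (?p ` e) \<inter> convex hull (?p ` e') \<subseteq> {q}"
        using h3[OF 4(1,2) \<open>a \<noteq> b\<close>] new 4 by simp
      moreover have "q \<in> ?p ` (e \<inter> e')" using 4 by auto
      ultimately show ?thesis by blast
    qed
  qed
qed

lemma finite_edges: "simple_graph G \<Longrightarrow> finite (edges G)"
  unfolding simple_graph_def by (meson PowI finite_Pow_iff finite_subset subsetI)

text \<open>The new vertex is placed close to \<open>p a\<close>, in a direction not parallel to
  that of any other vertex seen from \<open>p a\<close>.\<close>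

lemma line_planar_add_pendant:
  assumes G: "simple_graph G" and lp: "line_planar G" and x: "x \<notin> verts G" and a: "a \<in> verts G"
    and V': "verts G' = insert x (verts G)" and E': "edges G' = insert {x, a} (edges G)"
  shows "line_planar G'"
proof -
  obtain p where p: "line_drawing G p" using lp unfolding line_planar_def by blast
  have finV: "finite (verts G)" using G by (simp add: simple_graph_def)
  define w where "w d = p d - p a" for d
  have w0: "w d \<noteq> 0" if "d \<in> verts G - {a}" for d
    using line_drawing_inj[OF p] that a by (auto simp: w_def dest: inj_onD)
  \<comment> \<open>The direction of slope \<open>k\<close>. Each other vertex rules out at most one
    slope, and one straight above or below \<open>p a\<close> rules out none.\<close>
  define u where "u k = (vector [1, k] :: real ^ 2)" for k :: real
  have det_u: "det2 (u k) v = v $ 2 - k * v $ 1" for k v by (simp add: det2_def u_def)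
  have "finite {k::real. \<exists>d\<in>verts G - {a}. det2 (u k) (w d) = 0}"
  proof (rule finite_subset)
    show "finite ((\<lambda>d. w d $ 2 / w d $ 1) ` (verts G - {a}))" using finV by simp
    show "{k::real. \<exists>d\<in>verts G - {a}. det2 (u k) (w d) = 0} \<subseteq> (\<lambda>d. w d $ 2 / w d $ 1) ` (verts G - {a})"
    proof
      fix k assume "k \<in> {k. \<exists>d\<in>verts G - {a}. det2 (u k) (w d) = 0}"
      then obtain d where d: "d \<in> verts G" "d \<noteq> a" "det2 (u k) (w d) = 0" by blast
      then have eq: "w d $ 2 = k * w d $ 1" by (simp add: det_u)
      moreover have "w d \<noteq> 0" using w0 d by simp
      ultimately have "w d $ 1 \<noteq> 0" by (auto simp: vec_eq_iff forall_2)
      then have "k = w d $ 2 / w d $ 1" using eq by simp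
      then show "k \<in> (\<lambda>d. w d $ 2 / w d $ 1) ` (verts G - {a})" using d by blast
    qed
  qed
  then obtain k :: real where k: "\<And>d. d \<in> verts G - {a} \<Longrightarrow> det2 (u k) (w d) \<noteq> 0"
    using ex_new_if_finite[OF infinite_UNIV_char_0] by (metis (mono_tags, lifting) mem_Collect_eq)
  have edge: "d \<in> verts G - {a}" if "{a, d} \<in> edges G" for d
    using G that unfolding simple_graph_def by (auto simp: card_insert_if split: if_splits)
  have "eventually (\<lambda>\<delta>. p a + \<delta> *\<^sub>R u k \<noteq> p a \<and>
    (\<forall>e\<in>edges G. convex hull (p ` e) \<inter> closed_segment (p a) (p a + \<delta> *\<^sub>R u k) \<subseteq> (if a \<in> e then {p a} else {})) \<and>
    (\<forall>c\<in>verts G - {a}. p c \<notin> closed_segment (p a) (p a + \<delta> *\<^sub>R u k))) (at_right 0)"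
  \<comment> \<open>With \<open>m = p a\<close> the limiting segment is a single point.\<close>
  proof (rule eventually_spoke[OF G finite_edges[OF G] p a])
    have "u k $ 1 \<noteq> 0" by (simp add: u_def)
    then show "p a \<noteq> p a \<or> u k \<noteq> 0" by auto
    show "det2 (p a - p a) (p d - p a) \<noteq> 0 \<or> det2 (u k) (p d - p a) \<noteq> 0" if "{a, d} \<in> edges G" for d
      using k[OF edge[OF that]] by (simp add: w_def)
    show "convex hull (p ` e) \<inter> closed_segment (p a) (p a) = {}" if "e \<in> edges G" "a \<notin> e" for e
      using line_drawing_vertex[OF p that(1) a that(2)] by simp
    show "p c \<notin> closed_segment (p a) (p a)" if "c \<in> verts G" "c \<noteq> a" for c
      using line_drawing_inj[OF p] a that by (auto dest: inj_onD)
  qed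
  from eventually_happens'[OF trivial_limit_at_right_real this] obtain \<delta> where \<delta>: "p a + \<delta> *\<^sub>R u k \<noteq> p a"
    "\<forall>e\<in>edges G. convex hull (p ` e) \<inter> closed_segment (p a) (p a + \<delta> *\<^sub>R u k) \<subseteq> (if a \<in> e then {p a} else {})"
    "\<forall>c\<in>verts G - {a}. p c \<notin> closed_segment (p a) (p a + \<delta> *\<^sub>R u k)"
    by blast
  define q where "q = p a + \<delta> *\<^sub>R u k"
  have qs: "q \<in> closed_segment (p a) q" by simp
  have "line_drawing G' (p(x := q))"
  proof (rule line_drawing_add_vertex[OF G p x, of "{a}"])
    show "\<forall>c\<in>verts G. q \<noteq> p c" using \<delta> qs unfolding q_def[symmetric] by (metis DiffI singletonD)
    show "\<forall>e\<in>edges G. q \<notin> convex hull (p ` e)"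
      using \<delta>(1,2) qs unfolding q_def[symmetric] by (auto split: if_splits)
    show "convex hull (p ` e) \<inter> closed_segment (p c) q \<subseteq> (if c \<in> e then {p c} else {})"
      if "c \<in> {a}" "e \<in> edges G" for c e
      using bspec[OF \<delta>(2) that(2)] that(1) unfolding q_def by (simp only: singleton_iff)
    show "p v \<notin> closed_segment (p c) q" if "c \<in> {a}" "v \<in> verts G" "v \<noteq> c" for c v
      using \<delta>(3) that by (simp add: q_def)
  qed (use a V' E' in auto)
  then show ?thesis unfolding line_planar_def by blast
qed

text \<open>The new vertex is the tip of a flat triangle over the edge \<open>{a, b}\<close>, so
  close to the midpoint that its two edges run beside the old one and meet nothing else.\<close>

lemma line_planar_add_parallel:
  assumes G: "simple_graph G" and lp: "line_planar G" and x: "x \<notin> verts G" and ab: "{a, b} \<in> edges G"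
    and V': "verts G' = insert x (verts G)" and E': "edges G' = edges G \<union> {{x, a}, {x, b}}"
  shows "line_planar G'"
proof -
  obtain p where p: "line_drawing G p" using lp unfolding line_planar_def by blast
  have abV: "a \<in> verts G" "b \<in> verts G" "a \<noteq> b"
    using G ab unfolding simple_graph_def by (auto simp: card_insert_if split: if_splits)
  have pab: "p a \<noteq> p b" using line_drawing_inj[OF p] abV by (auto dest: inj_onD)
  define m where "m = midpoint (p a) (p b)"
  \<comment> \<open>The vector from \<open>p a\<close> to \<open>p b\<close>, turned by a right
    angle.\<close>
  define n :: "real ^ 2" where "n = vector [- (p b - p a) $ 2, (p b - p a) $ 1]"
  have n: "n $ 1 = - (p b - p a) $ 2" "n $ 2 = (p b - p a) $ 1" by (simp_all add: n_def)
  have sq: "((p b - p a) $ 1)\<^sup>2 + ((p b - p a) $ 2)\<^sup>2 \<noteq> 0"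
    using pab by (auto simp: vec_eq_iff forall_2 sum_power2_eq_zero_iff)
  have spoke: "eventually (\<lambda>\<delta>. m + \<delta> *\<^sub>R n \<noteq> p c \<and>
    (\<forall>e\<in>edges G. convex hull (p ` e) \<inter> closed_segment (p c) (m + \<delta> *\<^sub>R n) \<subseteq> (if c \<in> e then {p c} else {})) \<and>
    (\<forall>v\<in>verts G - {c}. p v \<notin> closed_segment (p c) (m + \<delta> *\<^sub>R n))) (at_right 0)"
    if cc': "c = a \<and> c' = b \<or> c = b \<and> c' = a" for c c'
  proof (rule eventually_spoke[OF G finite_edges[OF G] p])
    have cE: "{c, c'} \<in> edges G" "c \<noteq> c'" "c \<in> verts G" "c' \<in> verts G" "p c \<noteq> p c'"
      using cc' ab abV pab by (auto simp: insert_commute)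
    show "c \<in> verts G" by fact
    have mc: "m = midpoint (p c) (p c')" using cc' by (auto simp: m_def midpoint_sym)
    show "m \<noteq> p c \<or> n \<noteq> 0" using cE mc by (simp add: midpoint_eq_iff)
    have seg: "closed_segment (p c) m \<subseteq> closed_segment (p c) (p c')" "p c' \<notin> closed_segment (p c) m"
      "closed_segment (p c) (p c') = convex hull (p ` {c, c'})"
    proof -
      show "closed_segment (p c) m \<subseteq> closed_segment (p c) (p c')"
        by (simp add: mc subset_closed_segment)
      show "p c' \<notin> closed_segment (p c) m"
      proof
        assume "p c' \<in> closed_segment (p c) m"
        then have "dist (p c) (p c') \<le> dist (p c) m" using dist_in_closed_segment by (metis dist_commute)
        then show False using cE(5) by (simp add: mc dist_midpoint)
      qed
      show "closed_segment (p c) (p c') = convex hull (p ` {c, c'})" by (simp add: segment_convex_hull)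
    qed
    show "convex hull (p ` e) \<inter> closed_segment (p c) m = {}" if e: "e \<in> edges G" "c \<notin> e" for e
    proof -
      have "e \<noteq> {c, c'}" using e by auto
      from line_drawing_meet[OF p e(1) cE(1) this] seg e(2) show ?thesis by auto
    qed
    show "p v \<notin> closed_segment (p c) m" if "v \<in> verts G" "v \<noteq> c" for v
      using seg line_drawing_vertex[OF p cE(1) that(1)] that(2) by (cases "v = c'") auto
    \<comment> \<open>\<open>m - p c\<close> is parallel to the edge \<open>{a, b}\<close> and
      \<open>n\<close> is perpendicular to it, so a vector for which both determinants vanish is
      zero.\<close>
    show "det2 (m - p c) (p d - p c) \<noteq> 0 \<or> det2 n (p d - p c) \<noteq> 0" if d: "{c, d} \<in> edges G" for d
    proof (rule ccontr)
      assume "\<not> ?thesis"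
      then have z: "det2 (m - p c) (p d - p c) = 0" "det2 n (p d - p c) = 0" by auto
      have "d \<in> verts G" "d \<noteq> c"
        using G d unfolding simple_graph_def by (auto simp: card_insert_if split: if_splits)
      then have pd: "p d - p c \<noteq> 0" using line_drawing_inj[OF p] cE by (auto dest: inj_onD)
      define U where "U = p b - p a"
      define W where "W = p d - p c"
      have "m - p c = (1/2) *\<^sub>R U \<or> m - p c = (- 1/2) *\<^sub>R U"
        using cc' by (auto simp: m_def U_def midpoint_def vec_eq_iff field_simps)
      then obtain s where "m - p c = s *\<^sub>R U" "s \<noteq> 0" by (metis divide_eq_0_iff neg_equal_0_iff_equal zero_neq_numeral one_neq_zero)
      then have "det2 U W = 0" using z(1) by (simp add: W_def[symmetric] det2_scaleR)
      moreover have "U $ 2 * W $ 2 + U $ 1 * W $ 1 = 0" using z(2) n by (simp add: det2_def W_def U_def algebra_simps)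
      ultimately have "U $ 1 * W $ 2 - U $ 2 * W $ 1 = 0" "U $ 2 * W $ 2 + U $ 1 * W $ 1 = 0"
        by (auto simp: det2_def)
      then have "((U $ 1)\<^sup>2 + (U $ 2)\<^sup>2) * W $ 1 = 0" "((U $ 1)\<^sup>2 + (U $ 2)\<^sup>2) * W $ 2 = 0" by algebra+
      then have "W = 0" using sq by (auto simp: U_def vec_eq_iff forall_2)
      then show False using pd by (simp add: W_def)
    qed
  qed
  \<comment> \<open>The determinant is twice the area of the triangle with tip m + \<delta> n,
    namely \<delta> times the squared length of the edge. Being nonzero, it makes the two new edges
    meet only in the tip.\<close>
  have apex_det: "eventually (\<lambda>\<delta>. det2 (p a - (m + \<delta> *\<^sub>R n)) (p b - (m + \<delta> *\<^sub>R n)) \<noteq> 0) (at_right 0)"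
  proof (rule eventually_mono[OF eventually_at_right_less[of "0::real"]])
    fix \<delta> :: real assume \<delta>: "0 < \<delta>"
    have "det2 (p a - (m + \<delta> *\<^sub>R n)) (p b - (m + \<delta> *\<^sub>R n)) =
        \<delta> * (((p b - p a) $ 1)\<^sup>2 + ((p b - p a) $ 2)\<^sup>2)"
      by (simp add: det2_def m_def midpoint_def n power2_eq_square field_simps)
    then show "det2 (p a - (m + \<delta> *\<^sub>R n)) (p b - (m + \<delta> *\<^sub>R n)) \<noteq> 0" using \<delta> sq by simp
  qed
  from eventually_happens'[OF trivial_limit_at_right_real
      eventually_conj[OF spoke[of a b] eventually_conj[OF spoke[of b a] apex_det]]]
  obtain \<delta> where \<delta>0: "m + \<delta> *\<^sub>R n \<noteq> p a" "m + \<delta> *\<^sub>R n \<noteq> p b"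
    "\<forall>c\<in>{a, b}. \<forall>e\<in>edges G. convex hull (p ` e) \<inter> closed_segment (p c) (m + \<delta> *\<^sub>R n) \<subseteq> (if c \<in> e then {p c} else {})"
    "\<forall>c\<in>{a, b}. \<forall>v\<in>verts G - {c}. p v \<notin> closed_segment (p c) (m + \<delta> *\<^sub>R n)"
    "det2 (p a - (m + \<delta> *\<^sub>R n)) (p b - (m + \<delta> *\<^sub>R n)) \<noteq> 0" by auto
  note \<delta> = \<delta>0(1,2) bspec[OF bspec[OF \<delta>0(3)]] bspec[OF bspec[OF \<delta>0(4)]] \<delta>0(5)
  define q where "q = m + \<delta> *\<^sub>R n"
  have qs: "q \<in> closed_segment (p a) q" by simp
  have "line_drawing G' (p(x := q))"
  proof (rule line_drawing_add_vertex[OF G p x, of "{a, b}"])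
    show "\<forall>c\<in>verts G. q \<noteq> p c" using \<delta>(1) \<delta>(4)[of a] qs unfolding q_def[symmetric] by (metis DiffI insertI1 singletonD)
    show "\<forall>e\<in>edges G. q \<notin> convex hull (p ` e)"
      using \<delta>(1) \<delta>(3)[of a] qs unfolding q_def[symmetric] by (fastforce split: if_splits)
    have "closed_segment q (p a) \<inter> closed_segment q (p b) = {q}"
      by (rule segments_meet_at_start) (use \<delta>(5) in \<open>simp add: q_def\<close>)
    then show "closed_segment (p c) q \<inter> closed_segment (p d) q \<subseteq> {q}" if "c \<in> {a, b}" "d \<in> {a, b}" "c \<noteq> d" for c d
      using that by (auto simp: closed_segment_commute)
    show "convex hull (p ` e) \<inter> closed_segment (p c) q \<subseteq> (if c \<in> e then {p c} else {})"
      if "c \<in> {a, b}" "e \<in> edges G" for c e using \<delta>(3)[OF that] by (simp add: q_def)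
    show "p v \<notin> closed_segment (p c) q" if "c \<in> {a, b}" "v \<in> verts G" "v \<noteq> c" for c v
      using \<delta>(4)[OF that(1), of v] that by (simp add: q_def)
  qed (use abV V' E' in auto)
  then show ?thesis unfolding line_planar_def by blast
qed

section \<open>Vertices of small degree, minors, and degree sums\<close>

definition nbrs :: "'a ugraph \<Rightarrow> 'a \<Rightarrow> 'a set" where
  "nbrs G x = {y. {x, y} \<in> edges G}"

text \<open>For a vertex with exactly the neighbours \<open>a\<close> and \<open>b\<close>, this is
  the contraction of one of its two edges. If \<open>a\<close> and \<open>b\<close> are adjacent
  already, the new edge coincides with the old one.\<close>

definition suppress :: "'a ugraph \<Rightarrow> 'a \<Rightarrow> 'a \<Rightarrow> 'a \<Rightarrow> 'a ugraph" where
  "suppress G x a b = \<lparr>verts = verts G - {x}, edges = insert {a, b} {e \<in> edges G. x \<notin> e}\<rparr>"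

lemma nbrs_subset:
  assumes "simple_graph G" shows "nbrs G x \<subseteq> verts G - {x}"
proof
  fix y assume "y \<in> nbrs G x"
  then have "{x, y} \<subseteq> verts G" "card {x, y} = 2" using assms unfolding nbrs_def simple_graph_def by auto
  then show "y \<in> verts G - {x}" by (auto simp: card_insert_if split: if_splits)
qed

lemma simple_del_vertex: "simple_graph G \<Longrightarrow> simple_graph (del_vertex G v)"
  unfolding simple_graph_def del_vertex_def by auto

lemma simple_suppress:
  assumes "simple_graph G" "nbrs G x = {a, b}" "a \<noteq> b"
  shows "simple_graph (suppress G x a b)"
  using assms nbrs_subset[OF assms(1), of x] unfolding simple_graph_def suppress_def by auto

lemma edge_at_cases:
  assumes "simple_graph G" "e \<in> edges G"
  obtains "x \<notin> e" | y where "y \<in> nbrs G x" "e = {x, y}"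
proof (cases "x \<in> e")
  case True
  obtain a b where "e = {a, b}" using simple_graph_edgeE[OF assms] by metis
  then have "e = {x, if x = a then b else a}" using True by auto
  then show ?thesis using assms(2) that(2)[of "if x = a then b else a"] by (simp add: nbrs_def)
qed (use that in blast)

text \<open>An isolated vertex is treated as pendant at some other vertex and the extra edge is
  dropped again; the graph with one vertex is separate because it offers no such neighbour.\<close>

lemma line_planar_del_low_degree:
  assumes G: "simple_graph G" and x: "x \<in> verts G" and le: "nbrs G x \<subseteq> {a}"
    and lp: "line_planar (del_vertex G x)"
  shows "line_planar G"
proof (cases "verts G = {x}")
  case True
  then have "edges G = {}" by (metis G ex_in_conv simple_graph_edgeE singletonD)
  then have "line_drawing G (\<lambda>_. 0)" using True by (simp add: line_drawing_def)
  then show ?thesis unfolding line_planar_def by blast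
next
  case False
  then obtain c where c: "c \<in> verts G - {x}" "nbrs G x \<subseteq> {c}"
    using le nbrs_subset[OF G, of x] x by (cases "nbrs G x = {}") blast+
  let ?G' = "\<lparr>verts = verts G, edges = insert {x, c} (edges (del_vertex G x))\<rparr>"
  have "line_planar ?G'"
    by (rule line_planar_add_pendant[OF simple_del_vertex[OF G] lp, of x c])
      (use c x in \<open>auto simp: del_vertex_def\<close>)
  moreover have "edges G \<subseteq> edges ?G'"
  proof
    fix e assume e: "e \<in> edges G"
    then show "e \<in> edges ?G'"
      by (cases rule: edge_at_cases[OF G e, of x]) (use e c(2) in \<open>auto simp: del_vertex_def\<close>)
  qed
  ultimately show ?thesis using line_planar_mono[of ?G' G] by simp
qed

lemma line_planar_suppress:
  assumes G: "simple_graph G" and x: "x \<in> verts G" and ab: "nbrs G x = {a, b}" "a \<noteq> b"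
    and lp: "line_planar (suppress G x a b)"
  shows "line_planar G"
proof -
  let ?G' = "\<lparr>verts = verts G, edges = edges (suppress G x a b) \<union> {{x, a}, {x, b}}\<rparr>"
  have "line_planar ?G'"
    by (rule line_planar_add_parallel[OF simple_suppress[OF G ab] lp, of x a b])
      (use x in \<open>auto simp: suppress_def\<close>)
  moreover have "edges G \<subseteq> edges ?G'"
  proof
    fix e assume e: "e \<in> edges G"
    then show "e \<in> edges ?G'"
      by (cases rule: edge_at_cases[OF G e, of x]) (use e ab in \<open>auto simp: suppress_def\<close>)
  qed
  ultimately show ?thesis using line_planar_mono[of ?G' G] by simp
qed

section \<open>Straight-line apex graphs and vertices of small degree\<close>

definition line_apex :: "'a ugraph \<Rightarrow> bool" where
  "line_apex G \<longleftrightarrow> line_planar G \<or> (\<exists>v\<in>verts G. line_planar (del_vertex G v))"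

lemma line_apex_imp_apex:
  assumes G: "simple_graph G" and "line_apex G"
  shows "apex G"
  using assms(2) line_planar_imp_planar[OF _ G] line_planar_imp_planar[OF _ simple_del_vertex[OF G]]
  unfolding line_apex_def apex_def by metis

lemma del_vertex_commute: "del_vertex (del_vertex G v) w = del_vertex (del_vertex G w) v"
  by (auto simp: del_vertex_def)

lemma nbrs_del_vertex: "nbrs (del_vertex G w) x = (if x = w then {} else nbrs G x - {w})"
  by (auto simp: nbrs_def del_vertex_def)

lemma line_apex_del_low_degree:
  assumes G: "simple_graph G" and x: "x \<in> verts G" and le: "nbrs G x \<subseteq> {a}"
    and la: "line_apex (del_vertex G x)"
  shows "line_apex G"
  using la unfolding line_apex_def
proof (elim disjE bexE)
  assume "line_planar (del_vertex G x)"
  then show "line_planar G \<or> (\<exists>v\<in>verts G. line_planar (del_vertex G v))"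
    using line_planar_del_low_degree[OF G x le] by blast
next
  fix v assume v: "v \<in> verts (del_vertex G x)" "line_planar (del_vertex (del_vertex G x) v)"
  have "line_planar (del_vertex G v)"
    by (rule line_planar_del_low_degree[OF simple_del_vertex[OF G], of x _ a])
      (use v x le in \<open>auto simp: del_vertex_commute nbrs_del_vertex, auto simp: del_vertex_def\<close>)
  then show "line_planar G \<or> (\<exists>v\<in>verts G. line_planar (del_vertex G v))"
    using v by (auto simp: del_vertex_def)
qed

text \<open>Deleting \<open>v\<close> commutes with suppressing \<open>x\<close>, except when
  \<open>v\<close> is a neighbour of \<open>x\<close>. In that case \<open>x\<close> has degree one
  after the deletion, and the new edge has disappeared together with \<open>v\<close>.\<close>

lemma line_apex_suppress:
  assumes G: "simple_graph G" and x: "x \<in> verts G" and ab: "nbrs G x = {a, b}" "a \<noteq> b"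
    and la: "line_apex (suppress G x a b)"
  shows "line_apex G"
  using la unfolding line_apex_def
proof (elim disjE bexE)
  assume "line_planar (suppress G x a b)"
  then show "line_planar G \<or> (\<exists>v\<in>verts G. line_planar (del_vertex G v))"
    using line_planar_suppress[OF G x ab] by blast
next
  fix v assume v: "v \<in> verts (suppress G x a b)" and lp: "line_planar (del_vertex (suppress G x a b) v)"
  have vG: "v \<in> verts G" "v \<noteq> x" using v by (auto simp: suppress_def)
  then have xv: "x \<in> verts (del_vertex G v)" using x by (simp add: del_vertex_def)
  have "line_planar (del_vertex G v)"
  proof (cases "v \<in> {a, b}")
    case True
    have "del_vertex (suppress G x a b) v = del_vertex (del_vertex G v) x"
      using True by (auto simp: suppress_def del_vertex_def)
    moreover have "nbrs (del_vertex G v) x \<subseteq> {if v = a then b else a}"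
      using True ab vG by (auto simp: nbrs_del_vertex)
    ultimately show ?thesis using line_planar_del_low_degree[OF simple_del_vertex[OF G] xv] lp by simp
  next
    case False
    have "del_vertex (suppress G x a b) v = suppress (del_vertex G v) x a b"
      using False by (auto simp: suppress_def del_vertex_def)
    moreover have "nbrs (del_vertex G v) x = {a, b}"
      using False ab vG by (auto simp: nbrs_del_vertex)
    ultimately show ?thesis using line_planar_suppress[OF simple_del_vertex[OF G] xv _ ab(2)] lp by simp
  qed
  then show "line_planar G \<or> (\<exists>v\<in>verts G. line_planar (del_vertex G v))" using vG by blast
qed

section \<open>Minors after deletion or suppression of a vertex\<close>

lemma contracts_to_trans: "contracts_to K H \<Longrightarrow> contracts_to H J \<Longrightarrow> contracts_to K J"
  by (rotate_tac, induction rule: contracts_to.induct) (auto intro: contracts_to.intros)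

lemma is_minor_del_vertex: "is_minor H (del_vertex G x) \<Longrightarrow> is_minor H G"
  unfolding is_minor_def subgraph_def by (auto simp: del_vertex_def)

text \<open>A subgraph \<open>K\<close> that uses the edge \<open>{a, b}\<close> is realized in
  \<open>G\<close> with the path over \<open>x\<close> in place of this edge; contracting the edge
  from \<open>a\<close> to \<open>x\<close> gives \<open>K\<close> back. Otherwise \<open>K\<close>
  is a subgraph of \<open>G\<close> itself.\<close>

lemma is_minor_suppress:
  assumes G: "simple_graph G" and x: "x \<in> verts G" and ab: "nbrs G x = {a, b}" "a \<noteq> b"
    and min: "is_minor H (suppress G x a b)"
  shows "is_minor H G"
proof -
  obtain K where K: "subgraph K (suppress G x a b)" "contracts_to K H" using min unfolding is_minor_def by blast
  then have KV: "verts K \<subseteq> verts G - {x}" and KE: "edges K \<subseteq> insert {a, b} {e \<in> edges G. x \<notin> e}"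
    and sK: "simple_graph K" unfolding subgraph_def suppress_def by auto
  have xa: "x \<noteq> a" "x \<noteq> b" "a \<in> verts G" "b \<in> verts G" "{x, a} \<in> edges G" "{x, b} \<in> edges G"
    using nbrs_subset[OF G, of x] ab by (auto simp: nbrs_def)
  show ?thesis
  proof (cases "{a, b} \<in> edges K")
    case False
    then have "subgraph K G" using K KV KE unfolding subgraph_def by auto
    then show ?thesis using K(2) unfolding is_minor_def by blast
  next
    case True
    then have abK: "a \<in> verts K" "b \<in> verts K" using sK unfolding simple_graph_def by auto
    define L where "L = \<lparr>verts = insert x (verts K), edges = (edges K - {{a, b}}) \<union> {{x, a}, {x, b}}\<rparr>"
    have sL: "simple_graph L" using sK abK xa unfolding simple_graph_def L_def by auto
    have "subgraph L G" unfolding subgraph_def using sL KV KE xa x by (auto simp: L_def)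
    moreover have "contract_edge L a x = K"
    proof -
      define f where "f = (\<lambda>y. if y = x then a else y)"
      have fK: "f ` e = e" if "e \<in> edges K" for e
      proof -
        have "x \<notin> e" using that sK KV unfolding simple_graph_def by blast
        then show ?thesis by (auto simp: f_def image_iff)
      qed
      have "edges L - {{a, x}} = insert {x, b} (edges K - {{a, b}})"
      proof -
        have "{a, x} \<notin> edges K"
        proof
          assume "{a, x} \<in> edges K"
          then have "{a, x} \<subseteq> verts K" using sK unfolding simple_graph_def by blast
          then show False using KV by auto
        qed
        then show ?thesis using xa ab(2) by (auto simp: L_def doubleton_eq_iff)
      qed
      moreover have "f ` {x, b} = {a, b}" using xa by (auto simp: f_def)
      moreover have "(`) f ` (edges K - {{a, b}}) = edges K - {{a, b}}" using fK by (auto simp: image_iff)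
      ultimately have "(`) f ` (edges L - {{a, x}}) = edges K" using True by auto
      moreover have "f ` verts L = verts K" using abK KV by (auto simp: f_def L_def)
      ultimately show ?thesis unfolding contract_edge_def Let_def f_def by simp
    qed
    moreover have "{a, x} \<in> edges L" by (auto simp: L_def insert_commute)
    ultimately have "contracts_to L K"
      using contracts_step[OF contracts_refl, of a x L] xa(1) by simp
    then have "contracts_to L H" using contracts_to_trans K(2) by blast
    then show ?thesis using \<open>subgraph L G\<close> unfolding is_minor_def by blast
  qed
qed

section \<open>Degree counts\<close>

lemma card_nbrs:
  assumes "simple_graph G" shows "card (nbrs G x) = card {e \<in> edges G. x \<in> e}"
proof -
  have "e \<in> (\<lambda>y. {x, y}) ` nbrs G x" if e: "e \<in> edges G" "x \<in> e" for e
    by (cases rule: edge_at_cases[OF assms e(1), of x]) (use e in auto)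
  then have "(\<lambda>y. {x, y}) ` nbrs G x = {e \<in> edges G. x \<in> e}" by (auto simp: nbrs_def)
  moreover have "inj_on (\<lambda>y. {x, y}) (nbrs G x)" by (auto simp: inj_on_def doubleton_eq_iff)
  ultimately show ?thesis by (metis card_image)
qed

lemma sum_card_nbrs:
  assumes G: "simple_graph G"
  shows "(\<Sum>x\<in>verts G. card (nbrs G x)) = 2 * card (edges G)"
proof -
  have "{x \<in> verts G. x \<in> e} = e" "card e = 2" if "e \<in> edges G" for e
    using G that unfolding simple_graph_def by auto
  then have "(\<Sum>x\<in>verts G. card {e \<in> edges G. x \<in> e}) = (\<Sum>e\<in>edges G. 2)"
    using G finite_edges[OF G] by (intro sum_multicount_gen) (auto simp: simple_graph_def)
  then show ?thesis by (simp add: card_nbrs[OF G])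
qed

lemma card_edges_del_vertex:
  assumes G: "simple_graph G"
  shows "card (edges (del_vertex G x)) + card (nbrs G x) = card (edges G)"
proof -
  have "card (edges G) = card ({e \<in> edges G. x \<notin> e} \<union> {e \<in> edges G. x \<in> e})" by (rule arg_cong[of _ _ card]) auto
  also have "\<dots> = card {e \<in> edges G. x \<notin> e} + card {e \<in> edges G. x \<in> e}"
    using finite_edges[OF G] by (intro card_Un_disjoint) auto
  finally show ?thesis by (simp add: card_nbrs[OF G] del_vertex_def)
qed

lemma card_edges_suppress:
  assumes G: "simple_graph G" and ab: "nbrs G x = {a, b}" "a \<noteq> b"
  shows "card (edges (suppress G x a b)) < card (edges G)"
proof -
  have "card (edges (suppress G x a b)) \<le> Suc (card (edges (del_vertex G x)))"
    using card_insert_le_m1 finite_edges[OF simple_del_vertex[OF G], of x]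
    by (simp add: suppress_def del_vertex_def card_insert_if)
  then show ?thesis using card_edges_del_vertex[OF G, of x] ab by simp
qed

section \<open>Verified search certificates\<close>

datatype branch = At nat | Cover nat "nat list"

text \<open>An index out of range makes the test fail instead of leaving it unspecified, so success
  always yields a list entry that passes.\<close>

fun nth_ok :: "'a list \<Rightarrow> nat \<Rightarrow> ('a \<Rightarrow> bool) \<Rightarrow> bool" where
  "nth_ok [] k f \<longleftrightarrow> False"
| "nth_ok (x # xs) 0 f \<longleftrightarrow> f x"
| "nth_ok (x # xs) (Suc k) f \<longleftrightarrow> nth_ok xs k f"

type_synonym matrix = "bool list list"

definition add_arc :: "nat \<Rightarrow> nat \<Rightarrow> matrix \<Rightarrow> matrix" where
  "add_arc i j M = M[i := (M ! i)[j := True]]"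

definition add_edge :: "nat \<Rightarrow> nat \<Rightarrow> matrix \<Rightarrow> matrix" where
  "add_edge i j M = add_arc i j (add_arc j i M)"

fun adj_mat :: "nat \<Rightarrow> pattern \<Rightarrow> matrix" where
  "adj_mat n [] = replicate n (replicate n False)"
| "adj_mat n ((i, j) # P) = add_edge i j (adj_mat n P)"

fun count_true :: "bool list \<Rightarrow> nat" where
  "count_true [] = 0"
| "count_true (True # r) = Suc (count_true r)"
| "count_true (False # r) = count_true r"

text \<open>A lower bound for the degree sum, given that vertex 0 has maximum degree and that all degrees are
  at least three.\<close>

definition degree_bound :: "matrix \<Rightarrow> nat" where
  "degree_bound M = foldr (\<lambda>r s. max 3 (count_true r) + s) (tl M) (foldr (\<lambda>r s. max (count_true r) s) M 3)"

definition is_perm :: "nat \<Rightarrow> nat list \<Rightarrow> bool" where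
  "is_perm n xs \<longleftrightarrow> length xs = n \<and> distinct xs \<and> list_all (\<lambda>x. x < n) xs"

text \<open>Label 0 stands for a vertex of maximum degree, and \<open>degree_bound\<close> relies on
  this. Relabellings must therefore fix it.\<close>

definition contains_by :: "nat \<Rightarrow> matrix \<Rightarrow> nat list \<Rightarrow> pattern \<Rightarrow> bool" where
  "contains_by n M \<pi> Q \<longleftrightarrow> is_perm n \<pi> \<and> \<pi> ! 0 = 0 \<and> list_all (\<lambda>(i, j). M ! (\<pi> ! i) ! (\<pi> ! j)) Q"

text \<open>Permutations are given without the final segment on which they are the identity.\<close>

definition contains :: "nat \<Rightarrow> matrix \<Rightarrow> nat list \<Rightarrow> pattern \<Rightarrow> bool" where
  "contains n M \<pi> Q \<longleftrightarrow> contains_by n M (\<pi> @ [length \<pi>..<n]) Q"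

text \<open>A pair whose addition breaks the bound \<open>em\<close> on the degree sum consumes no
  entry of \<open>subs\<close>; every other pair consumes exactly one. Passing the outcome of the
  comparison to a second function keeps the two lists in step.\<close>

fun closes :: "nat \<Rightarrow> nat \<Rightarrow> pattern list \<Rightarrow> matrix \<Rightarrow> pattern \<Rightarrow> (nat \<times> nat list) list \<Rightarrow> bool"
  and closes_child :: "bool \<Rightarrow> nat \<Rightarrow> nat \<Rightarrow> pattern list \<Rightarrow> matrix \<Rightarrow> matrix \<Rightarrow> pattern \<Rightarrow> (nat \<times> nat list) list \<Rightarrow> bool"
  where
  "closes n em Qs M [] subs \<longleftrightarrow> True"
| "closes n em Qs M ((i, j) # ps) subs \<longleftrightarrow>
     closes_child (em < degree_bound (add_edge i j M)) n em Qs M (add_edge i j M) ps subs"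
| "closes_child True n em Qs M M' ps subs \<longleftrightarrow> closes n em Qs M ps subs"
| "closes_child False n em Qs M M' ps [] \<longleftrightarrow> False"
| "closes_child False n em Qs M M' ps ((k, \<pi>) # subs) \<longleftrightarrow>
     nth_ok Qs k (contains n M' \<pi>) \<and> closes n em Qs M ps subs"

fun row_pairs :: "nat \<Rightarrow> nat \<Rightarrow> bool list \<Rightarrow> pattern" where
  "row_pairs x j [] = []"
| "row_pairs x j (True # r) = row_pairs x (Suc j) r"
| "row_pairs x j (False # r) = (if x = j then row_pairs x (Suc j) r else (x, j) # row_pairs x (Suc j) r)"

definition in_range :: "nat \<Rightarrow> pattern \<Rightarrow> bool" where
  "in_range n P \<longleftrightarrow> list_all (\<lambda>(i, j). i < n \<and> j < n) P"

text \<open>A node \<open>(P, br, subs)\<close> treats the graphs that contain the pattern \<open>P\<close>. The branching \<open>br\<close> yields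
  pairs one of which is a further edge: for \<open>At x\<close> because \<open>x\<close> has degree at least three, for
  \<open>Cover c \<tau>\<close> because the \<open>c\<close>-th cover, relabelled by \<open>\<tau>\<close>, lists the nonedges of a planar graph (or of
  an apex graph, respectively). Adding such a pair to \<open>P\<close> either makes the degree sum too large or
  yields a pattern that contains an earlier one: the next entry \<open>(k, \<pi>)\<close> of \<open>subs\<close> stands for the
  pattern \<open>k\<close> steps back, relabelled by \<open>\<pi>\<close>.\<close>

type_synonym proof_node = "pattern \<times> branch \<times> (nat \<times> nat list) list"

fun node_ok :: "nat \<Rightarrow> nat \<Rightarrow> pattern list \<Rightarrow> pattern list \<Rightarrow> proof_node \<Rightarrow> bool" where
  "node_ok n em covs Qs (P, At x, subs) \<longleftrightarrow> in_range n P \<and> x < n \<and> count_true (adj_mat n P ! x) < 3 \<and>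
     closes n em Qs (adj_mat n P) (row_pairs x 0 (adj_mat n P ! x)) subs"
| "node_ok n em covs Qs (P, Cover c \<tau>, subs) \<longleftrightarrow> in_range n P \<and> is_perm n \<tau> \<and>
     nth_ok covs c (\<lambda>C. closes n em Qs (adj_mat n P) (map (\<lambda>(p, q). (\<tau> ! p, \<tau> ! q)) C) subs)"

text \<open>A root is a starting pattern \<open>B\<close> with a reference to a settled pattern. For
  a root beyond the degree bound every reference passes.\<close>

definition root_ok :: "nat \<Rightarrow> nat \<Rightarrow> pattern list \<Rightarrow> pattern \<times> nat \<times> nat list \<Rightarrow> bool" where
  "root_ok n em Qs = (\<lambda>(B, k, \<pi>). em < degree_bound (adj_mat n B) \<or> nth_ok Qs k (contains n (adj_mat n B) \<pi>))"

text \<open>\<open>Qs\<close> holds the settled patterns, latest first, starting with the terminal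
  ones. Index 0 is therefore the node just before, and an index that counts back past the first node
  reaches a terminal pattern.\<close>

fun run :: "nat \<Rightarrow> nat \<Rightarrow> pattern list \<Rightarrow> pattern list \<Rightarrow> proof_node list \<Rightarrow> (pattern \<times> nat \<times> nat list) list \<Rightarrow> bool" where
  "run n em covs Qs [] roots \<longleftrightarrow> list_all (root_ok n em Qs) roots"
| "run n em covs Qs (nd # nds) roots \<longleftrightarrow> node_ok n em covs Qs nd \<and> run n em covs (fst nd # Qs) nds roots"

section \<open>Soundness of the search\<close>

lemma nth_okD: "nth_ok xs k f \<Longrightarrow> \<exists>x\<in>set xs. f x"
  by (induction xs k f rule: nth_ok.induct) auto

lemma count_true_card: "count_true r = card {j. j < length r \<and> r ! j}"
proof (induction r)
  case (Cons b r)
  have "{j. j < length (b # r) \<and> (b # r) ! j} = (if b then {0} else {}) \<union> Suc ` {j. j < length r \<and> r ! j}"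
    by (auto simp: image_iff less_Suc_eq_0_disj split: if_splits)
  then show ?case using Cons by (cases b) (auto simp: card_insert_if card_image)
qed auto

lemma row_pairs_complete:
  "j < length r \<Longrightarrow> \<not> r ! j \<Longrightarrow> x \<noteq> k + j \<Longrightarrow> (x, k + j) \<in> set (row_pairs x k r)"
proof (induction x k r arbitrary: j rule: row_pairs.induct)
  case (2 x k r)
  then obtain i where "j = Suc i" by (cases j) auto
  then show ?case using 2(1)[of i] 2(2-) by simp
next
  case (3 x k r)
  then show ?case by (cases j) (force+)
qed auto

definition square :: "nat \<Rightarrow> matrix \<Rightarrow> bool" where
  "square n M \<longleftrightarrow> length M = n \<and> (\<forall>i<n. length (M ! i) = n)"

lemma square_add_arc: "square n M \<Longrightarrow> square n (add_arc i j M)"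
  by (cases "i < length M") (auto simp: square_def add_arc_def nth_list_update list_update_beyond)

lemma square_add_edge: "square n M \<Longrightarrow> square n (add_edge i j M)"
  by (simp add: add_edge_def square_add_arc)

lemma square_mat: "square n (adj_mat n P)"
  by (induction n P rule: adj_mat.induct) (auto simp: square_add_edge, simp add: square_def)

lemma foldr_max_le: "(\<forall>r\<in>set rs. g r \<le> D) \<Longrightarrow> z \<le> D \<Longrightarrow> foldr (\<lambda>r s. max (g r) s) rs z \<le> (D::nat)"
  by (induction rs) auto

lemma foldr_sum_le:
  "(\<And>i. i < length rs \<Longrightarrow> g (rs ! i) \<le> D i) \<Longrightarrow> foldr (\<lambda>r s. g r + s) rs z \<le> (\<Sum>i<length rs. D i) + (z::nat)"
proof (induction rs arbitrary: D)
  case (Cons r rs)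
  have "foldr (\<lambda>r s. g r + s) rs z \<le> (\<Sum>i<length rs. D (Suc i)) + z" using Cons.prems by (intro Cons.IH) force
  moreover have "g r \<le> D 0" using Cons.prems[of 0] by simp
  ultimately show ?case by (simp add: sum.lessThan_Suc_shift del: sum.lessThan_Suc)
qed auto

text \<open>The common setting of both searches. \<open>em\<close> bounds the degree sum, that is,
  twice the number of edges. The drawings enter only through \<open>covers\<close>: every list has
  an edge of \<open>G\<close> among its pairs, under every bijective labelling and not just those
  with label 0 at \<open>v\<close>. This is why the permutation of a \<open>Cover\<close> node may
  move label 0, unlike that of a relabelled pattern.\<close>

locale sparse_graph =
  fixes G :: "'a ugraph" and n em :: nat and v :: 'a and covs :: "pattern list"
  assumes simple: "simple_graph G" and card_verts: "card (verts G) = n"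
    and top: "v \<in> verts G" "\<And>x. x \<in> verts G \<Longrightarrow> card (nbrs G x) \<le> card (nbrs G v)"
    and min_degree: "\<And>x. x \<in> verts G \<Longrightarrow> 3 \<le> card (nbrs G x)"
    and few_edges: "2 * card (edges G) \<le> em"
    and covers: "\<And>C f. C \<in> set covs \<Longrightarrow> bij_betw f {..<n} (verts G) \<Longrightarrow> \<exists>(p, q)\<in>set C. p < n \<and> q < n \<and> {f p, f q} \<in> edges G"
begin

definition labelling :: "(nat \<Rightarrow> 'a) \<Rightarrow> bool" where
  "labelling f \<longleftrightarrow> bij_betw f {..<n} (verts G) \<and> f 0 = v"

definition fits :: "(nat \<Rightarrow> 'a) \<Rightarrow> matrix \<Rightarrow> bool" where
  "fits f M \<longleftrightarrow> (\<forall>i<n. \<forall>j<n. M ! i ! j \<longrightarrow> {f i, f j} \<in> edges G)"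

definition holds :: "(nat \<Rightarrow> 'a) \<Rightarrow> pattern \<Rightarrow> bool" where
  "holds f P \<longleftrightarrow> (\<forall>(i, j)\<in>set P. {f i, f j} \<in> edges G)"

text \<open>The goal does not mention the labelling, so it may be derived from any relabelled
  occurrence of the pattern.\<close>

definition implies :: "pattern \<Rightarrow> bool \<Rightarrow> bool" where
  "implies P goal \<longleftrightarrow> (\<forall>f. labelling f \<longrightarrow> holds f P \<longrightarrow> goal)"

lemma fits_add_arc:
  assumes "square n M" "fits f M" "{f i, f j} \<in> edges G"
  shows "fits f (add_arc i j M)"
proof (cases "i < n \<and> j < n")
  case True
  then show ?thesis using assms by (auto simp: fits_def add_arc_def square_def nth_list_update)
next
  case False
  then have "add_arc i j M = M"
    using assms(1) by (cases "i < n") (auto simp: add_arc_def square_def list_update_beyond)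
  then show ?thesis using assms(2) by simp
qed

lemma fits_add_edge:
  assumes "square n M" "fits f M" "{f i, f j} \<in> edges G"
  shows "fits f (add_edge i j M)"
proof -
  have "fits f (add_arc j i M)" using fits_add_arc[OF assms(1,2), of j i] assms(3) by (simp add: insert_commute)
  moreover have "square n (add_arc j i M)" using assms(1) by (rule square_add_arc)
  ultimately show ?thesis unfolding add_edge_def using fits_add_arc assms(3) by blast
qed

lemma fits_mat: "holds f P \<Longrightarrow> fits f (adj_mat n P)"
proof (induction P)
  case Nil
  then show ?case by (simp add: fits_def)
next
  case (Cons e P)
  then show ?case by (cases e) (auto simp: holds_def intro!: fits_add_edge square_mat)
qed

lemma card_nbrs_labelling:
  assumes "labelling f" "i < n"
  shows "card (nbrs G (f i)) = card {j. j < n \<and> {f i, f j} \<in> edges G}"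
proof -
  have inj: "inj_on f {..<n}" and im: "f ` {..<n} = verts G" using assms unfolding labelling_def bij_betw_def by auto
  have "nbrs G (f i) = f ` {j. j < n \<and> {f i, f j} \<in> edges G}"
  proof -
    have "y \<in> f ` {j. j < n \<and> {f i, f j} \<in> edges G}" if "y \<in> nbrs G (f i)" for y
    proof -
      have "y \<in> f ` {..<n}" using that nbrs_subset[OF simple] im by blast
      then show ?thesis using that by (auto simp: nbrs_def)
    qed
    then show ?thesis by (auto simp: nbrs_def)
  qed
  moreover have "inj_on f {j. j < n \<and> {f i, f j} \<in> edges G}" using inj by (rule inj_on_subset) auto
  ultimately show ?thesis by (simp add: card_image)
qed

lemma count_true_le:
  assumes "labelling f" "square n M" "fits f M" "i < n"
  shows "count_true (M ! i) \<le> card (nbrs G (f i))"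
proof -
  have "{j. j < n \<and> M ! i ! j} \<subseteq> {j. j < n \<and> {f i, f j} \<in> edges G}" using assms unfolding fits_def by auto
  then show ?thesis
    using card_nbrs_labelling[OF assms(1,4)] assms(2,4) by (simp add: count_true_card square_def card_mono)
qed

lemma n_pos: "n > 0"
  using card_verts top(1) simple unfolding simple_graph_def by (metis card_gt_0_iff empty_iff)

text \<open>Each row of the matrix bounds the degree of its vertex from below. Since
  \<open>f 0 = v\<close> has maximum degree, the largest row count bounds its degree; the other
  vertices contribute their own row count or 3. Summing gives at most twice the number of
  edges.\<close>

lemma degree_bound_le:
  assumes f: "labelling f" and M: "square n M" "fits f M"
  shows "degree_bound M \<le> em"
proof -
  define D where "D i = card (nbrs G (f i))" for i
  have bij: "bij_betw f {..<n} (verts G)" and f0: "f 0 = v" using f unfolding labelling_def by auto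
  have fV: "f i \<in> verts G" if "i < n" for i using bij that by (auto simp: bij_betw_def)
  obtain r rs where M': "M = r # rs" using M(1) n_pos by (cases M) (auto simp: square_def)
  have len: "n = Suc (length rs)" using M(1) M' by (simp add: square_def)
  have cnt: "count_true (M ! i) \<le> D i" if "i < n" for i using count_true_le[OF f M that] by (simp add: D_def)
  have D0: "D i \<le> D 0" if "i < n" for i using top(2)[OF fV[OF that]] f0 by (simp add: D_def)
  define z where "z = foldr (\<lambda>r s. max (count_true r) s) M 3"
  have "z \<le> D 0"
    unfolding z_def
  proof (rule foldr_max_le)
    show "\<forall>r\<in>set M. count_true r \<le> D 0"
      using cnt D0 M(1) by (metis in_set_conv_nth order_trans square_def)
    show "3 \<le> D 0" using min_degree[OF top(1)] f0 by (simp add: D_def)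
  qed
  moreover have "foldr (\<lambda>r s. max 3 (count_true r) + s) rs z \<le> (\<Sum>i<length rs. D (Suc i)) + z"
  proof (rule foldr_sum_le)
    fix i assume "i < length rs"
    then show "max 3 (count_true (rs ! i)) \<le> D (Suc i)"
      using cnt[of "Suc i"] min_degree[OF fV[of "Suc i"]] len M' by (simp add: D_def)
  qed
  ultimately have "degree_bound M \<le> (\<Sum>i<length rs. D (Suc i)) + D 0"
    unfolding degree_bound_def z_def[symmetric] using M' by simp
  also have "\<dots> = (\<Sum>i<n. D i)" by (simp add: len sum.lessThan_Suc_shift del: sum.lessThan_Suc)
  also have "\<dots> = (\<Sum>x\<in>verts G. card (nbrs G x))" unfolding D_def by (rule sum.reindex_bij_betw[OF bij])
  also have "\<dots> = 2 * card (edges G)" by (rule sum_card_nbrs[OF simple])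
  finally show ?thesis using few_edges by simp
qed

lemma bij_betw_perm: "is_perm n \<pi> \<Longrightarrow> bij_betw ((!) \<pi>) {..<n} {..<n}"
proof (rule bij_betw_nth)
  assume p: "is_perm n \<pi>"
  show "distinct \<pi>" "{..<n} = {..<length \<pi>}" using p by (auto simp: is_perm_def)
  have "set \<pi> \<subseteq> {..<n}" "card (set \<pi>) = n" using p by (auto simp: is_perm_def list_all_iff distinct_card)
  then show "{..<n} = set \<pi>" by (metis card_lessThan card_subset_eq finite_lessThan)
qed

lemma bij_betw_relabel:
  "is_perm n \<pi> \<Longrightarrow> bij_betw f {..<n} (verts G) \<Longrightarrow> bij_betw (\<lambda>i. f (\<pi> ! i)) {..<n} (verts G)"
  using bij_betw_trans[OF bij_betw_perm, of \<pi> f "verts G"] by (simp add: comp_def)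

text \<open>Composing \<open>f\<close> with the permutation gives a labelling that satisfies
  \<open>Q\<close>; it still sends 0 to \<open>v\<close>.\<close>

lemma contains_by_implies:
  assumes "contains_by n M \<pi> Q" "in_range n Q" "implies Q goal" "labelling f" "fits f M"
  shows goal
proof -
  have \<pi>: "is_perm n \<pi>" "\<pi> ! 0 = 0" and Q: "\<And>i j. (i, j) \<in> set Q \<Longrightarrow> M ! (\<pi> ! i) ! (\<pi> ! j)"
    using assms(1) by (auto simp: contains_by_def list_all_iff)
  have "\<pi> ! i < n" if "i < n" for i using bij_betw_perm[OF \<pi>(1)] that by (auto simp: bij_betw_def)
  then have "holds (\<lambda>i. f (\<pi> ! i)) Q"
    using Q assms(2,5) by (fastforce simp: holds_def in_range_def list_all_iff fits_def)
  moreover have "labelling (\<lambda>i. f (\<pi> ! i))"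
    using assms(4) bij_betw_relabel[OF \<pi>(1)] \<pi>(2) by (auto simp: labelling_def)
  ultimately show ?thesis using assms(3) unfolding implies_def by blast
qed

lemma contains_implies:
  "contains n M \<pi> Q \<Longrightarrow> in_range n Q \<Longrightarrow> implies Q goal \<Longrightarrow> labelling f \<Longrightarrow> fits f M \<Longrightarrow> goal"
  unfolding contains_def by (rule contains_by_implies)

text \<open>Some pair in \<open>ps\<close> is an edge. It cannot be one of the pruned pairs, since
  the enlarged matrix still fits the graph and obeys the degree bound; for any other pair the
  enlarged matrix contains a settled pattern.\<close>

lemma closes_sound:
  assumes f: "labelling f" and Qs: "\<And>Q. Q \<in> set Qs \<Longrightarrow> in_range n Q \<and> implies Q goal"
    and M: "square n M" "fits f M"
  shows "closes n em Qs M ps subs \<Longrightarrow> (i, j) \<in> set ps \<Longrightarrow> {f i, f j} \<in> edges G \<Longrightarrow> goal"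
proof (induction ps arbitrary: subs)
  case (Cons e ps)
  obtain a b where e: "e = (a, b)" by fastforce
  show ?case
  proof (cases "em < degree_bound (add_edge a b M)")
    case True
    have "\<not> {f a, f b} \<in> edges G"
      using degree_bound_le[OF f square_add_edge[OF M(1)] fits_add_edge[OF M]] True by fastforce
    then show ?thesis using Cons True e by auto
  next
    case False
    then obtain k \<pi> subs' where s: "nth_ok Qs k (contains n (add_edge a b M) \<pi>)" "closes n em Qs M ps subs'"
      using Cons.prems(1) e by (cases subs) auto
    show ?thesis
    proof (cases "(i, j) = (a, b)")
      case True
      then have "fits f (add_edge a b M)" using fits_add_edge[OF M] Cons.prems(3) by simp
      then show ?thesis using nth_okD[OF s(1)] contains_implies Qs f by blast
    next
      case False
      then show ?thesis using Cons.IH[OF s(2)] Cons.prems e by auto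
    qed
  qed
qed auto

text \<open>For \<open>At x\<close> the pattern shows fewer than three neighbours of
  \<open>x\<close>, so a neighbour is missing from its row; for \<open>Cover\<close> the assumption
  on covers supplies the further edge.\<close>

lemma node_ok_sound:
  assumes "node_ok n em covs Qs nd" and Qs: "\<And>Q. Q \<in> set Qs \<Longrightarrow> in_range n Q \<and> implies Q goal"
  shows "in_range n (fst nd) \<and> implies (fst nd) goal"
proof -
  obtain P br subs where nd: "nd = (P, br, subs)" by (cases nd) auto
  have rng: "in_range n P" using assms(1) nd by (cases br) auto
  have goal if f: "labelling f" and P: "holds f P" for f
  proof -
    let ?M = "adj_mat n P"
    have M: "square n ?M" "fits f ?M" using square_mat fits_mat[OF P] by auto
    have cl: goal if "closes n em Qs ?M ps subs" "(i, j) \<in> set ps" "{f i, f j} \<in> edges G" for ps subs i j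
      by (rule closes_sound[OF f _ M that]) (rule Qs)
    show goal
    proof (cases br)
      case (At x)
      then have x: "x < n" "count_true (?M ! x) < 3" "closes n em Qs ?M (row_pairs x 0 (?M ! x)) subs"
        using assms(1) nd by auto
      have bij: "bij_betw f {..<n} (verts G)" using f unfolding labelling_def by auto
      have "f x \<in> verts G" using bij x by (auto simp: bij_betw_def)
      have len: "length (?M ! x) = n" using M(1) x by (simp add: square_def)
      have "card {j. j < n \<and> ?M ! x ! j} < card {j. j < n \<and> {f x, f j} \<in> edges G}"
        using x(2) len min_degree[OF \<open>f x \<in> verts G\<close>] card_nbrs_labelling[OF f x(1)] by (simp add: count_true_card)
      then have "\<not> {j. j < n \<and> {f x, f j} \<in> edges G} \<subseteq> {j. j < n \<and> ?M ! x ! j}"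
        using card_mono[of "{j. j < n \<and> ?M ! x ! j}" "{j. j < n \<and> {f x, f j} \<in> edges G}"] by fastforce
      then obtain y where y: "y < n" "{f x, f y} \<in> edges G" "\<not> ?M ! x ! y" by blast
      have "x \<noteq> y" using y(2) nbrs_subset[OF simple, of "f x"] by (auto simp: nbrs_def)
      then have "(x, y) \<in> set (row_pairs x 0 (?M ! x))" using y len row_pairs_complete[of y "?M ! x" x 0] by simp
      from cl[OF x(3) this y(2)] show goal .
    next
      case (Cover c \<tau>)
      then have \<tau>: "is_perm n \<tau>" and "\<exists>C\<in>set covs. closes n em Qs ?M (map (\<lambda>(p, q). (\<tau> ! p, \<tau> ! q)) C) subs"
        using assms(1) nd nth_okD by auto
      then obtain C where C: "C \<in> set covs" "closes n em Qs ?M (map (\<lambda>(p, q). (\<tau> ! p, \<tau> ! q)) C) subs" by blast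
      have "bij_betw (\<lambda>i. f (\<tau> ! i)) {..<n} (verts G)" using f bij_betw_relabel[OF \<tau>] unfolding labelling_def by blast
      from covers[OF C(1) this] obtain p q where pq: "(p, q) \<in> set C" "{f (\<tau> ! p), f (\<tau> ! q)} \<in> edges G" by auto
      have "(\<tau> ! p, \<tau> ! q) \<in> set (map (\<lambda>(p, q). (\<tau> ! p, \<tau> ! q)) C)" using pq(1) by force
      from cl[OF C(2) this pq(2)] show goal .
    qed
  qed
  then show ?thesis using rng nd unfolding implies_def by auto
qed

text \<open>The invariant is that every pattern in \<open>Qs\<close> implies the goal. When the
  nodes are used up, the root refers to one of these patterns.\<close>

theorem run_sound:
  assumes "run n em covs Qs nds roots" and "\<And>Q. Q \<in> set Qs \<Longrightarrow> in_range n Q \<and> implies Q goal"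
    and root: "(B, r) \<in> set roots" and f: "labelling f" "holds f B"
  shows goal
  using assms(1,2)
proof (induction nds arbitrary: Qs)
  case Nil
  obtain k \<pi> where "r = (k, \<pi>)" by fastforce
  then have "em < degree_bound (adj_mat n B) \<or> nth_ok Qs k (contains n (adj_mat n B) \<pi>)"
    using Nil(1) root by (auto simp: list_all_iff root_ok_def)
  moreover have "degree_bound (adj_mat n B) \<le> em" by (rule degree_bound_le[OF f(1) square_mat fits_mat[OF f(2)]])
  ultimately have "nth_ok Qs k (contains n (adj_mat n B) \<pi>)" by simp
  then obtain Q where Q: "Q \<in> set Qs" "contains n (adj_mat n B) \<pi> Q" using nth_okD by blast
  then show ?case using contains_implies[OF Q(2) _ _ f(1) fits_mat[OF f(2)]] Nil(2) by blast
next
  case (Cons nd nds)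
  have "node_ok n em covs Qs nd" "run n em covs (fst nd # Qs) nds roots" using Cons.prems(1) by auto
  then show ?case using Cons.IH[of "fst nd # Qs"] node_ok_sound[of Qs nd] Cons.prems(2) by auto
qed

end

section \<open>Drawings with integer coordinates\<close>

type_synonym point = "int \<times> int"

text \<open>Twice the signed area of the triangle; it vanishes exactly for collinear points.\<close>

definition orient :: "point \<Rightarrow> point \<Rightarrow> point \<Rightarrow> int" where
  "orient = (\<lambda>(x1, y1) (x2, y2) (x3, y3). (x2 - x1) * (y3 - y1) - (y2 - y1) * (x3 - x1))"

definition same_side :: "point \<Rightarrow> point \<Rightarrow> point \<Rightarrow> point \<Rightarrow> bool" where
  "same_side a b c d \<longleftrightarrow> 0 < orient a b c * orient a b d"

text \<open>Two edges with a common end must not be collinear. Two edges without one are separated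
  by the line through one of them, which has both ends of the other strictly on one side.\<close>

definition seg_ok :: "point list \<Rightarrow> nat \<times> nat \<Rightarrow> nat \<times> nat \<Rightarrow> bool" where
  "seg_ok pts = (\<lambda>(a, b) (c, d).
     if a = c then orient (pts ! a) (pts ! b) (pts ! d) \<noteq> 0
     else if a = d then orient (pts ! a) (pts ! b) (pts ! c) \<noteq> 0
     else if b = c then orient (pts ! b) (pts ! a) (pts ! d) \<noteq> 0
     else if b = d then orient (pts ! b) (pts ! a) (pts ! c) \<noteq> 0
     else same_side (pts ! a) (pts ! b) (pts ! c) (pts ! d) \<or> same_side (pts ! c) (pts ! d) (pts ! a) (pts ! b))"

text \<open>The complement of \<open>C\<close> in the complete graph on \<open>m\<close> vertices.
  In the certificates it always has 3m - 6 edges and is thus a triangulation, which keeps the list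
  \<open>C\<close> to branch on as short as possible.\<close>

definition tri_edges :: "nat \<Rightarrow> pattern \<Rightarrow> pattern" where
  "tri_edges m C = filter (\<lambda>e. \<not> List.member C e) (concat (map (\<lambda>i. map (Pair i) [Suc i..<m]) [0..<m]))"

text \<open>Comparing edges pairwise also keeps vertices off foreign edges, provided every vertex is
  an end of some edge; this is the purpose of the last conjunct.\<close>

definition drawing_ok :: "nat \<Rightarrow> point list \<times> pattern \<Rightarrow> bool" where
  "drawing_ok m = (\<lambda>(pts, C). length pts = m \<and> distinct pts \<and> in_range m C \<and>
     sorted_wrt (seg_ok pts) (tri_edges m C) \<and>
     list_all (\<lambda>i. list_ex (\<lambda>(a, b). a = i \<or> b = i) (tri_edges m C)) [0..<m])"

definition to_plane :: "point \<Rightarrow> real ^ 2" where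
  "to_plane = (\<lambda>(x, y). vector [of_int x, of_int y])"

lemma det2_to_plane: "det2 (to_plane b - to_plane a) (to_plane c - to_plane a) = of_int (orient a b c)"
  by (auto simp: det2_def to_plane_def orient_def split: prod.splits)

text \<open>The affine function that vanishes on the line through \<open>a\<close> and
  \<open>b\<close> has one strict sign at \<open>c\<close> and \<open>d\<close>, hence on the whole
  segment between them.\<close>

lemma same_side_disjoint:
  assumes "same_side a b c d"
  shows "closed_segment (to_plane a) (to_plane b) \<inter> closed_segment (to_plane c) (to_plane d) = {}"
proof (rule ccontr)
  assume "\<not> ?thesis"
  then obtain s t where s: "0 \<le> s" "s \<le> 1" and t: "0 \<le> t" "t \<le> 1"
    and eq: "(1 - s) *\<^sub>R to_plane a + s *\<^sub>R to_plane b = (1 - t) *\<^sub>R to_plane c + t *\<^sub>R to_plane d"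
    by (auto simp: in_segment)
  define g where "g y = det2 (to_plane b - to_plane a) (y - to_plane a)" for y
  define oc od where "oc = real_of_int (orient a b c)" and "od = real_of_int (orient a b d)"
  have "g ((1 - s) *\<^sub>R to_plane a + s *\<^sub>R to_plane b) = 0"
    by (simp add: g_def det2_def algebra_simps)
  moreover have "g ((1 - t) *\<^sub>R to_plane c + t *\<^sub>R to_plane d) = (1 - t) * g (to_plane c) + t * g (to_plane d)"
    by (simp add: g_def det2_def algebra_simps)
  ultimately have z: "(1 - t) * oc + t * od = 0"
    using eq by (simp add: g_def det2_to_plane oc_def od_def)
  have pos: "0 < oc * od" using assms by (simp add: same_side_def oc_def od_def flip: of_int_mult)
  then consider "oc > 0" "od > 0" | "oc < 0" "od < 0" by (auto simp: zero_less_mult_iff)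
  then show False
  proof cases
    case 1
    then have "(1 - t) * oc \<ge> 0" "t * od \<ge> 0" using t by auto
    then have "(1 - t) * oc = 0" "t * od = 0" using z by linarith+
    then show False using 1 by auto
  next
    case 2
    then have "(1 - t) * oc \<le> 0" "t * od \<le> 0" using t by (auto intro: mult_nonneg_nonpos)
    then have "(1 - t) * oc = 0" "t * od = 0" using z by linarith+
    then show False using 2 by auto
  qed
qed

lemma seg_ok_meet:
  assumes "seg_ok pts (a, b) (c, d)" "(a, b) \<noteq> (c, d)" "a < b" "c < d"
  defines "p \<equiv> \<lambda>i. to_plane (pts ! i)"
  shows "convex hull (p ` {a, b}) \<inter> convex hull (p ` {c, d}) \<subseteq> p ` ({a, b} \<inter> {c, d})"
proof -
  have hull: "convex hull (p ` {i, j}) = closed_segment (p i) (p j)" for i j by (simp add: segment_convex_hull)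
  have share: "closed_segment (p i) (p j) \<inter> closed_segment (p i) (p k) = {p i}"
    if "orient (pts ! i) (pts ! j) (pts ! k) \<noteq> 0" for i j k
    by (rule segments_meet_at_start) (use that in \<open>simp add: p_def det2_to_plane\<close>)
  consider "a = c" | "a = d" | "b = c" | "b = d" | "a \<noteq> c" "a \<noteq> d" "b \<noteq> c" "b \<noteq> d" by blast
  then show ?thesis
  proof cases
    case 1
    then show ?thesis using assms(1) share[of a b d] unfolding hull by (auto simp: seg_ok_def)
  next
    case 2
    then have "closed_segment (p a) (p b) \<inter> closed_segment (p d) (p c) = {p a}"
      using assms share[of a b c] by (auto simp: seg_ok_def)
    then show ?thesis unfolding hull closed_segment_commute[of "p c" "p d"] using 2 by auto
  next
    case 3
    then have "closed_segment (p b) (p a) \<inter> closed_segment (p c) (p d) = {p b}"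
      using assms share[of b a d] by (auto simp: seg_ok_def)
    then show ?thesis unfolding hull closed_segment_commute[of "p a" "p b"] using 3 by auto
  next
    case 4
    then have "closed_segment (p b) (p a) \<inter> closed_segment (p d) (p c) = {p b}"
      using assms share[of b a c] by (auto simp: seg_ok_def)
    then show ?thesis
      unfolding hull closed_segment_commute[of "p a" "p b"] closed_segment_commute[of "p c" "p d"] using 4 by auto
  next
    case 5
    then have "same_side (pts ! a) (pts ! b) (pts ! c) (pts ! d) \<or> same_side (pts ! c) (pts ! d) (pts ! a) (pts ! b)"
      using assms(1) by (simp add: seg_ok_def)
    then have "closed_segment (p a) (p b) \<inter> closed_segment (p c) (p d) = {}"
      using same_side_disjoint[of "pts ! a" "pts ! b" "pts ! c" "pts ! d"]
        same_side_disjoint[of "pts ! c" "pts ! d" "pts ! a" "pts ! b"] unfolding p_def by auto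
    then show ?thesis unfolding hull by simp
  qed
qed

lemma mem_tri_edges: "(i, j) \<in> set (tri_edges m C) \<longleftrightarrow> i < j \<and> j < m \<and> (i, j) \<notin> set C"
  by (force simp: tri_edges_def)

lemma sorted_wrt_either:
  "sorted_wrt R xs \<Longrightarrow> x \<in> set xs \<Longrightarrow> y \<in> set xs \<Longrightarrow> x \<noteq> y \<Longrightarrow> R x y \<or> R y x"
  by (induction xs) auto

lemma drawing_ok_line_drawing:
  assumes ok: "drawing_ok m (pts, C)"
  shows "line_drawing \<lparr>verts = {..<m}, edges = pat_edges (tri_edges m C)\<rparr> (\<lambda>i. to_plane (pts ! i))"
proof -
  let ?p = "\<lambda>i. to_plane (pts ! i)"
  have srt: "sorted_wrt (seg_ok pts) (tri_edges m C)" and len: "length pts = m" and dist: "distinct pts"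
    using ok by (auto simp: drawing_ok_def)
  have inj: "inj_on ?p {..<m}"
  proof (rule inj_onI)
    fix i j assume ij: "i \<in> {..<m}" "j \<in> {..<m}" "?p i = ?p j"
    have "inj to_plane"
      by (rule injI) (auto simp: to_plane_def vec_eq_iff forall_2)
    then have "pts ! i = pts ! j" using ij by (auto dest: injD)
    then show "i = j" using dist len ij nth_eq_iff_index_eq by fastforce
  qed
  have meet: "convex hull (?p ` e) \<inter> convex hull (?p ` e') \<subseteq> ?p ` (e \<inter> e')"
    if e: "e \<in> pat_edges (tri_edges m C)" "e' \<in> pat_edges (tri_edges m C)" "e \<noteq> e'" for e e'
  proof -
    obtain a b c d where abcd: "e = {a, b}" "(a, b) \<in> set (tri_edges m C)" "e' = {c, d}" "(c, d) \<in> set (tri_edges m C)"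
      using e by (auto simp: pat_edges_def)
    then have lt: "a < b" "c < d" and ne: "(a, b) \<noteq> (c, d)" using e(3) by (auto simp: mem_tri_edges)
    have "seg_ok pts (a, b) (c, d) \<or> seg_ok pts (c, d) (a, b)"
      using sorted_wrt_either[OF srt abcd(2,4) ne] .
    then show ?thesis
      using seg_ok_meet[of pts a b c d] seg_ok_meet[of pts c d a b] lt ne unfolding abcd(1,3)
      by (auto simp: Int_commute)
  qed
  have on: "?p c \<notin> convex hull (?p ` e)" if e: "e \<in> pat_edges (tri_edges m C)" and c: "c < m" "c \<notin> e" for e c
  proof
    assume pc: "?p c \<in> convex hull (?p ` e)"
    \<comment> \<open>A vertex \<open>c\<close> on the edge \<open>e\<close> is a common point of
      \<open>e\<close> and of an edge that ends at \<open>c\<close>, so it must be a common end of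
      the two.\<close>
    have "list_ex (\<lambda>(a, b). a = c \<or> b = c) (tri_edges m C)" using ok c(1) by (auto simp: drawing_ok_def list_all_iff)
    then obtain a b where ab: "(a, b) \<in> set (tri_edges m C)" "c \<in> {a, b}" by (auto simp: list_ex_iff)
    have f: "{a, b} \<in> pat_edges (tri_edges m C)" using ab by (intro pat_edgesI) auto
    have "?p c \<in> convex hull (?p ` {a, b})" using ab(2) by (intro hull_inc) auto
    then have "?p c \<in> ?p ` (e \<inter> {a, b})" using meet[OF e f] pc c ab by blast
    then obtain z where z: "z \<in> e" "z \<in> {a, b}" "?p c = ?p z" by auto
    have "z < m" using z(2) ab(1) by (auto simp: mem_tri_edges)
    then have "c = z" using inj_onD[OF inj z(3)] c by simp
    then show False using z c by simp
  qed
  show ?thesis unfolding line_drawing_def using inj meet on by auto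
qed

lemma line_drawing_pullback:
  assumes T: "line_drawing T p" and g: "inj_on g (verts H)" "g ` verts H \<subseteq> verts T"
    and E: "\<And>e. e \<in> edges H \<Longrightarrow> e \<subseteq> verts H \<and> g ` e \<in> edges T"
  shows "line_drawing H (p \<circ> g)"
  unfolding line_drawing_def
proof (intro conjI ballI impI)
  show "inj_on (p \<circ> g) (verts H)" using g line_drawing_inj[OF T] by (meson comp_inj_on inj_on_subset)
next
  fix e c assume e: "e \<in> edges H" and c: "c \<in> verts H - e"
  have "g c \<notin> g ` e" using inj_on_image_mem_iff[OF g(1), of c e] E[OF e] c by auto
  then show "(p \<circ> g) c \<notin> convex hull ((p \<circ> g) ` e)"
    using line_drawing_vertex[OF T, of "g ` e" "g c"] E[OF e] c g(2) by (auto simp: image_comp)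
next
  fix e e' assume e: "e \<in> edges H" "e' \<in> edges H" "e \<noteq> e'"
  have "g ` e \<noteq> g ` e'" using inj_on_image_eq_iff[OF g(1)] E e by metis
  moreover have "g ` (e \<inter> e') = g ` e \<inter> g ` e'" using inj_on_image_Int[OF g(1)] E e by metis
  ultimately show "convex hull ((p \<circ> g) ` e) \<inter> convex hull ((p \<circ> g) ` e') \<subseteq> (p \<circ> g) ` (e \<inter> e')"
    using line_drawing_meet[OF T, of "g ` e" "g ` e'"] E e unfolding image_comp[symmetric] by simp
qed

text \<open>If no listed pair were an edge, all edges of \<open>H\<close> would lie in the drawn
  graph, and its drawing would restrict to \<open>H\<close>.\<close>

lemma drawing_ok_cover:
  assumes ok: "drawing_ok m (pts, C)" and H: "simple_graph H" and f: "bij_betw f {..<m} (verts H)"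
    and np: "\<not> line_planar H"
  shows "\<exists>(i, j)\<in>set C. i < m \<and> j < m \<and> {f i, f j} \<in> edges H"
proof (rule ccontr)
  assume "\<not> ?thesis"
  moreover have rng: "(i, j) \<in> set C \<Longrightarrow> i < m \<and> j < m" for i j using ok by (auto simp: drawing_ok_def in_range_def list_all_iff)
  ultimately have no: "(i, j) \<in> set C \<Longrightarrow> {f i, f j} \<notin> edges H" for i j by auto
  define g where "g = inv_into {..<m} f"
  have g: "bij_betw g (verts H) {..<m}" unfolding g_def by (rule bij_betw_inv_into[OF f])
  have fg: "f (g y) = y" if "y \<in> verts H" for y
    using that f unfolding g_def by (simp add: bij_betw_inv_into_right)
  have "line_drawing H ((\<lambda>i. to_plane (pts ! i)) \<circ> g)"
  proof (rule line_drawing_pullback[OF drawing_ok_line_drawing[OF ok]])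
    show "inj_on g (verts H)" "g ` verts H \<subseteq> verts \<lparr>verts = {..<m}, edges = pat_edges (tri_edges m C)\<rparr>"
      using g by (auto simp: bij_betw_def)
    fix e assume e: "e \<in> edges H"
    obtain a b where ab: "e = {a, b}" "a \<noteq> b" "a \<in> verts H" "b \<in> verts H" using simple_graph_edgeE[OF H e] by metis
    have gm: "g a < m" "g b < m" "g a \<noteq> g b" using g ab by (auto simp: bij_betw_def dest: inj_onD)
    have "(g a, g b) \<notin> set C" "(g b, g a) \<notin> set C"
      using no[of "g a" "g b"] no[of "g b" "g a"] fg ab e by (auto simp: insert_commute)
    then have "(g a, g b) \<in> set (tri_edges m C) \<or> (g b, g a) \<in> set (tri_edges m C)"
      using gm by (auto simp: mem_tri_edges)
    then have "{g a, g b} \<in> pat_edges (tri_edges m C)" by (rule pat_edgesI)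
    then show "e \<subseteq> verts H \<and> g ` e \<in> edges \<lparr>verts = {..<m}, edges = pat_edges (tri_edges m C)\<rparr>"
      using ab by auto
  qed
  then show False using np unfolding line_planar_def by blast
qed

section \<open>Triangle-star exchanges on patterns\<close>

definition map_pat :: "nat list \<Rightarrow> pattern \<Rightarrow> pattern" where
  "map_pat h P = map (\<lambda>(i, j). (h ! i, h ! j)) P"

definition inj_list :: "nat \<Rightarrow> nat \<Rightarrow> nat list \<Rightarrow> bool" where
  "inj_list m k h \<longleftrightarrow> length h = m \<and> distinct h \<and> list_all (\<lambda>x. x < k) h"

lemma inj_listD:
  assumes "inj_list m k h"
  shows "inj_on ((!) h) {..<m}" "\<And>i. i < m \<Longrightarrow> h ! i < k"
  using assms by (auto simp: inj_list_def list_all_iff inj_on_def nth_eq_iff_index_eq)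

lemma add_arc_iff:
  assumes "square n M" "i < n" "j < n" "a < n" "b < n"
  shows "add_arc a b M ! i ! j \<longleftrightarrow> M ! i ! j \<or> (i, j) = (a, b)"
  using assms by (auto simp: add_arc_def square_def nth_list_update)

lemma adj_mat_iff:
  assumes "in_range n P" "i < n" "j < n"
  shows "adj_mat n P ! i ! j \<longleftrightarrow> {i, j} \<in> pat_edges P"
  using assms(1)
proof (induction P)
  case Nil
  then show ?case using assms by (simp add: pat_edges_def)
next
  case (Cons e P)
  obtain a b where e: "e = (a, b)" by fastforce
  have ab: "a < n" "b < n" "in_range n P" using Cons.prems e by (auto simp: in_range_def)
  have "adj_mat n (e # P) ! i ! j \<longleftrightarrow> adj_mat n P ! i ! j \<or> (i, j) = (b, a) \<or> (i, j) = (a, b)"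
    using ab assms(2,3) add_arc_iff[OF square_add_arc[OF square_mat], of i n j a b b a P]
      add_arc_iff[OF square_mat, of i n j b a P] by (auto simp: e add_edge_def)
  moreover have "{i, j} \<in> pat_edges (e # P) \<longleftrightarrow> {i, j} = {a, b} \<or> {i, j} \<in> pat_edges P"
    by (auto simp: pat_edges_def e)
  ultimately show ?case using Cons.IH[OF ab(3)] by (auto simp: doubleton_eq_iff)
qed

lemma in_range_edge:
  assumes "in_range n P" "e \<in> pat_edges P"
  obtains i j where "e = {i, j}" "i < n" "j < n"
  using assms by (auto simp: in_range_def pat_edges_def list_all_iff)

text \<open>Comparing adjacency matrices makes the isomorphism tests independent of the order and
  the orientation of the pairs.\<close>

lemma pat_edges_eqI:
  assumes "in_range n P" "in_range n Q" "adj_mat n P = adj_mat n Q"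
  shows "pat_edges P = pat_edges Q"
proof -
  have "e \<in> pat_edges Q" if "in_range n P" "in_range n Q" "adj_mat n P = adj_mat n Q" "e \<in> pat_edges P" for P Q e
    using in_range_edge[OF that(1,4)] adj_mat_iff[OF that(1)] adj_mat_iff[OF that(2)] that(3,4) by metis
  then show ?thesis using assms by (metis subsetI subset_antisym)
qed

lemma pat_edges_map_pat: "pat_edges (map_pat h P) = (`) ((!) h) ` pat_edges P"
  unfolding pat_edges_def map_pat_def by (simp add: image_image split_beta)

lemma in_range_map_pat: "in_range m P \<Longrightarrow> inj_list m k h \<Longrightarrow> in_range k (map_pat h P)"
  using inj_listD(2)[of m k h] by (auto simp: in_range_def map_pat_def list_all_iff)

lemma in_range_verts: "in_range n P \<Longrightarrow> pat_verts P \<subseteq> {..<n}"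
  by (auto simp: in_range_def pat_verts_def list_all_iff)

lemma pat_iso_relabel:
  assumes G: "pat_iso Q f G" and P: "in_range m P" and h: "inj_list m n h" and Q: "in_range n Q"
    and eq: "adj_mat n (map_pat h P) = adj_mat n Q"
  shows "pat_iso P (\<lambda>i. f (h ! i)) G"
proof -
  have E: "pat_edges Q = (`) ((!) h) ` pat_edges P"
    using pat_edges_eqI[OF in_range_map_pat[OF P h] Q eq] pat_edges_map_pat by simp
  then have V: "pat_verts Q = (!) h ` pat_verts P" by (auto simp: pat_verts_Union)
  have "inj_on ((!) h) (pat_verts P)" using inj_listD(1)[OF h] in_range_verts[OF P] by (rule inj_on_subset)
  moreover have "inj_on f ((!) h ` pat_verts P)" using G V by (simp add: pat_iso_def)
  ultimately have "inj_on (\<lambda>i. f (h ! i)) (pat_verts P)" using comp_inj_on by (force simp: comp_def)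
  moreover have "verts G = (\<lambda>i. f (h ! i)) ` pat_verts P" using G V by (simp add: pat_iso_def image_image)
  moreover have "edges G = (`) (\<lambda>i. f (h ! i)) ` pat_edges P" using G E by (simp add: pat_iso_def image_image)
  ultimately show ?thesis unfolding pat_iso_def by blast
qed

definition spans :: "nat \<Rightarrow> pattern \<Rightarrow> bool" where
  "spans n P \<longleftrightarrow> in_range n P \<and> list_all (\<lambda>i. list_ex (\<lambda>(a, b). a = i \<or> b = i) P) [0..<n]"

lemma spans_verts:
  assumes "spans n P" shows "in_range n P" "pat_verts P = {..<n}"
proof -
  show "in_range n P" using assms by (simp add: spans_def)
  have "i \<in> pat_verts P" if "i < n" for i
    using assms that unfolding spans_def list_all_iff list_ex_iff pat_verts_def by fastforce
  then show "pat_verts P = {..<n}" using in_range_verts[OF \<open>in_range n P\<close>] by auto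
qed

text \<open>\<open>k\<close> is the number of labels of \<open>R\<close> and serves as the fresh
  vertex.\<close>

definition nabla_pat :: "nat \<Rightarrow> pattern \<Rightarrow> nat \<Rightarrow> nat \<Rightarrow> nat \<Rightarrow> pattern" where
  "nabla_pat k R a b c = filter (\<lambda>(i, j). \<not> (List.member [a, b, c] i \<and> List.member [a, b, c] j)) R @ [(k, a), (k, b), (k, c)]"

text \<open>The label \<open>v\<close> stays vacant; the gap is closed only by the isomorphism with
  a representative.\<close>

definition y_pat :: "pattern \<Rightarrow> nat \<Rightarrow> nat \<Rightarrow> nat \<Rightarrow> nat \<Rightarrow> pattern" where
  "y_pat R v a b c = filter (\<lambda>(i, j). i \<noteq> v \<and> j \<noteq> v) R @ [(a, b), (b, c), (a, c)]"

lemma pat_iso_edge: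
  assumes "pat_iso R f G" "i \<in> pat_verts R" "j \<in> pat_verts R"
  shows "{f i, f j} \<in> edges G \<longleftrightarrow> {i, j} \<in> pat_edges R"
proof -
  have "{f i, f j} = f ` {i, j}" by simp
  moreover have "f ` {i, j} \<in> (`) f ` pat_edges R \<longleftrightarrow> {i, j} \<in> pat_edges R"
  proof
    assume "f ` {i, j} \<in> (`) f ` pat_edges R"
    then obtain e where e: "e \<in> pat_edges R" "f ` {i, j} = f ` e" by blast
    have "e \<subseteq> pat_verts R" "{i, j} \<subseteq> pat_verts R" using e assms by (auto simp: pat_verts_Union)
    then have "{i, j} = e" using inj_on_image_eq_iff[of f "pat_verts R" "{i, j}" e] e(2) assms(1) by (simp add: pat_iso_def)
    then show "{i, j} \<in> pat_edges R" using e by simp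
  qed (rule imageI)
  ultimately show ?thesis using assms(1) by (simp add: pat_iso_def)
qed

text \<open>Allows the exchanges to be checked for increasing triples alone, as enumerated in the
  certificates.\<close>

lemma triple_sorted:
  fixes a b c :: nat
  assumes "distinct [a, b, c]"
  obtains i j l where "i < j" "j < l" "{i, j, l} = {a, b, c}"
proof -
  consider "a < b \<and> b < c" | "a < c \<and> c < b" | "b < a \<and> a < c" | "b < c \<and> c < a" | "c < a \<and> a < b" | "c < b \<and> b < a"
    using assms by (auto simp: neq_iff)
  then show ?thesis by cases (use that in \<open>blast+\<close>)
qed

text \<open>Both edge sets of an exchange depend on the triple as a set: one consists of its
  two-element subsets, the other of the pairs of \<open>v\<close> with its elements.\<close>

lemma nabla_Y_triple:
  assumes "{i, j, l} = {a, b, c}" "distinct [a, b, c]"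
  shows "{{a, b}, {b, c}, {a, c}} = {{i, j}, {j, l}, {i, l}}" "{{v, a}, {v, b}, {v, c}} = {{v, i}, {v, j}, {v, l}}"
    "distinct [i, j, l]"
proof -
  have c3: "card {i, j, l} = 3" using assms by simp
  then show d: "distinct [i, j, l]" by (auto simp: card_insert_if split: if_splits)
  have *: "{{x, y}, {y, z}, {x, z}} = {e. e \<subseteq> {x, y, z} \<and> card e = 2}" if "distinct [x, y, z]" for x y z :: 'a
  proof
    show "{e. e \<subseteq> {x, y, z} \<and> card e = 2} \<subseteq> {{x, y}, {y, z}, {x, z}}"
      by (auto simp: card_2_iff)
  qed (use that in auto)
  show "{{a, b}, {b, c}, {a, c}} = {{i, j}, {j, l}, {i, l}}"
    unfolding *[OF assms(2)] *[OF d] assms(1) ..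
  have "(\<lambda>y. {v, y}) ` {a, b, c} = (\<lambda>y. {v, y}) ` {i, j, l}" using assms(1) by simp
  then show "{{v, a}, {v, b}, {v, c}} = {{v, i}, {v, j}, {v, l}}" by simp
qed

lemma pat_edges_append: "pat_edges (P @ Q) = pat_edges P \<union> pat_edges Q"
  by (simp add: pat_edges_def image_Un)

lemma pat_edges_filter: "pat_edges (filter (\<lambda>(a, b). {a, b} \<notin> T) R) = pat_edges R - T"
  by (auto simp: pat_edges_def)

lemma image_diff_separated: "(\<And>e t. e \<in> A \<Longrightarrow> t \<in> T \<Longrightarrow> g e = g t \<Longrightarrow> e = t) \<Longrightarrow> g ` (A - T) = g ` A - g ` T"
  by fastforce

lemma pat_iso_nabla:
  assumes G: "pat_iso R f G" and R: "spans k R" and v: "v \<notin> verts G"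
    and ijl: "i < j" "j < l" "l < k" and sp: "spans (Suc k) (nabla_pat k R i j l)"
    and simple: "\<forall>(a, b)\<in>set R. a \<noteq> b"
    and V: "verts H = insert v (verts G)"
    and E: "edges H = (edges G - {{f i, f j}, {f j, f l}, {f i, f l}}) \<union> {{v, f i}, {v, f j}, {v, f l}}"
  shows "pat_iso (nabla_pat k R i j l) (f(k := v)) H"
proof -
  let ?N = "nabla_pat k R i j l" and ?g = "f(k := v)"
  have RV: "pat_verts R = {..<k}" using spans_verts[OF R] by simp
  have NV: "pat_verts ?N = {..<Suc k}" using spans_verts[OF sp] by simp
  have inj: "inj_on f {..<k}" and GV: "verts G = f ` {..<k}" and GE: "edges G = (`) f ` pat_edges R"
    using G RV by (auto simp: pat_iso_def)
  have "inj_on ?g (pat_verts ?N)"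
    unfolding NV using inj v GV by (auto simp: inj_on_def less_Suc_eq)
  moreover have "verts H = ?g ` pat_verts ?N" unfolding NV V GV by (auto simp: less_Suc_eq image_iff)
  moreover have "edges H = (`) ?g ` pat_edges ?N"
  proof -
    let ?T = "{{i, j}, {j, l}, {i, l}}"
    have e_sub: "e \<subseteq> {..<k}" if "e \<in> pat_edges R" for e using that RV by (auto simp: pat_verts_Union)
    have NE: "pat_edges ?N = (pat_edges R - ?T) \<union> {{k, i}, {k, j}, {k, l}}"
    proof -
      have keep: "\<not> (List.member [i, j, l] a \<and> List.member [i, j, l] b) \<longleftrightarrow> {a, b} \<notin> ?T" if "(a, b) \<in> set R" for a b
        using simple that ijl by (auto simp: doubleton_eq_iff)
      have "filter (\<lambda>(a, b). \<not> (List.member [i, j, l] a \<and> List.member [i, j, l] b)) R = filter (\<lambda>(a, b). {a, b} \<notin> ?T) R"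
        using keep by (intro filter_cong) auto
      then show ?thesis unfolding nabla_pat_def by (simp only: pat_edges_append pat_edges_filter) (simp add: pat_edges_def)
    qed
    have ge: "?g ` e = f ` e" if "e \<in> pat_edges R" for e using e_sub[OF that] by (intro image_cong) auto
    have inj_e: "f ` e = f ` t \<longleftrightarrow> e = t" if "e \<in> pat_edges R" "t \<in> ?T" for e t
      using inj_on_image_eq_iff[OF inj e_sub[OF that(1)], of t] that(2) ijl by auto
    have "(`) ?g ` (pat_edges R - ?T) = edges G - {{f i, f j}, {f j, f l}, {f i, f l}}"
    proof -
      have "(`) ?g ` (pat_edges R - ?T) = (`) f ` (pat_edges R - ?T)" by (rule image_cong[OF refl]) (rule ge, blast)
      also have "\<dots> = (`) f ` pat_edges R - (`) f ` ?T"
        by (rule image_diff_separated) (simp only: inj_e)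
      finally show ?thesis by (simp add: GE)
    qed
    moreover have "(`) ?g ` {{k, i}, {k, j}, {k, l}} = {{v, f i}, {v, f j}, {v, f l}}" using ijl by auto
    ultimately show ?thesis unfolding NE image_Un E by simp
  qed
  ultimately show ?thesis unfolding pat_iso_def by blast
qed

lemma pat_iso_Y:
  assumes G: "pat_iso R f G" and R: "spans k R" and ijl: "i < j" "j < l" "l < k" "x < k" "x \<notin> {i, j, l}"
    and sp: "pat_verts (y_pat R x i j l) = {..<k} - {x}"
    and V: "verts H = verts G - {f x}"
    and E: "edges H = {e \<in> edges G. f x \<notin> e} \<union> {{f i, f j}, {f j, f l}, {f i, f l}}"
  shows "pat_iso (y_pat R x i j l) f H"
proof -
  let ?N = "y_pat R x i j l"
  have RV: "pat_verts R = {..<k}" using spans_verts[OF R] by simp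
  have inj: "inj_on f {..<k}" and GV: "verts G = f ` {..<k}" and GE: "edges G = (`) f ` pat_edges R"
    using G RV by (auto simp: pat_iso_def)
  have e_sub: "e \<subseteq> {..<k}" if "e \<in> pat_edges R" for e using that RV by (auto simp: pat_verts_Union)
  have fx: "f x \<in> f ` e \<longleftrightarrow> x \<in> e" if "e \<in> pat_edges R" for e
    using inj_on_image_mem_iff[OF inj _ e_sub[OF that], of x] ijl by simp
  have "inj_on f (pat_verts ?N)" unfolding sp using inj by (rule inj_on_subset) auto
  moreover have "verts H = f ` pat_verts ?N"
    unfolding sp V GV using inj_on_image_set_diff[OF inj, of "{..<k}" "{x}"] ijl by auto
  moreover have "edges H = (`) f ` pat_edges ?N"
  proof -
    have "pat_edges ?N = {e \<in> pat_edges R. x \<notin> e} \<union> {{i, j}, {j, l}, {i, l}}"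
      unfolding y_pat_def pat_edges_def by (auto simp: image_Un split_beta)
    moreover have "{e \<in> edges G. f x \<notin> e} = (`) f ` {e \<in> pat_edges R. x \<notin> e}" using fx by (auto simp: GE)
    ultimately show ?thesis unfolding E by (simp add: image_Un)
  qed
  ultimately show ?thesis unfolding pat_iso_def by blast
qed

text \<open>Pulling a move back along the labelling turns it into a move on the pattern at an
  increasing triangle. The isomorphism is conditional on \<open>spans\<close>, which evaluation
  supplies for each triangle.\<close>

lemma nabla_Y_pat:
  assumes G: "pat_iso R f G" and R: "spans k R" and simple: "\<forall>(a, b)\<in>set R. a \<noteq> b" and H: "nabla_Y G H"
  obtains i j l v where "i < j" "j < l" "l < k" "{i, j} \<in> pat_edges R" "{j, l} \<in> pat_edges R" "{i, l} \<in> pat_edges R"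
    "spans (Suc k) (nabla_pat k R i j l) \<Longrightarrow> pat_iso (nabla_pat k R i j l) (f(k := v)) H"
proof -
  obtain a b c v where abc: "distinct [a, b, c]" "{a, b} \<in> edges G" "{b, c} \<in> edges G" "{a, c} \<in> edges G" "v \<notin> verts G"
    and HV: "verts H = insert v (verts G)"
    and HE: "edges H = (edges G - {{a, b}, {b, c}, {a, c}}) \<union> {{v, a}, {v, b}, {v, c}}"
    using H unfolding nabla_Y_def by auto
  have RV: "pat_verts R = {..<k}" using spans_verts[OF R] by simp
  have inj: "inj_on f {..<k}" and GV: "verts G = f ` {..<k}" and GE: "edges G = (`) f ` pat_edges R"
    using G RV by (auto simp: pat_iso_def)
  have "e \<subseteq> f ` {..<k}" if "e \<in> edges G" for e using that GE RV by (auto simp: pat_verts_Union)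
  then have "a \<in> f ` {..<k}" "b \<in> f ` {..<k}" "c \<in> f ` {..<k}" using abc by blast+
  then obtain a' b' c' where a': "a' < k" "b' < k" "c' < k" "a = f a'" "b = f b'" "c = f c'" by auto
  have d': "distinct [a', b', c']" using abc(1) a' by auto
  obtain i j l where ijl: "i < j" "j < l" "{i, j, l} = {a', b', c'}" using triple_sorted[OF d'] by metis
  have lk: "l < k" using ijl(3) a' by auto
  have fs: "{f i, f j, f l} = {a, b, c}" using arg_cong[OF ijl(3), of "(`) f"] a' by simp
  note tr = nabla_Y_triple[OF fs abc(1)]
  have "{f i, f j} \<in> edges G" "{f j, f l} \<in> edges G" "{f i, f l} \<in> edges G"
    using abc(2-4) tr(1) by (metis insertI1 insertI2 insertE singletonD)+
  then have "{i, j} \<in> pat_edges R" "{j, l} \<in> pat_edges R" "{i, l} \<in> pat_edges R"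
    using pat_iso_edge[OF G] RV ijl lk by auto
  then show ?thesis
    using that[OF ijl(1,2) lk] pat_iso_nabla[OF G R abc(5) ijl(1,2) lk _ simple HV HE[unfolded tr(1,2)]] by blast
qed

text \<open>The pullback for the reverse move: the vertex becomes a label of degree three with an
  increasing list of neighbours. The condition on the vertices says that no neighbour loses its
  label.\<close>

lemma Y_nabla_pat:
  assumes G: "pat_iso R f G" and R: "spans k R" and simple: "\<forall>(a, b)\<in>set R. a \<noteq> b" and H: "Y_nabla G H"
  obtains x i j l where "x < k" "i < j" "j < l" "l < k" "{y. {x, y} \<in> pat_edges R} = {i, j, l}"
    "pat_verts (y_pat R x i j l) = {..<k} - {x} \<Longrightarrow> pat_iso (y_pat R x i j l) f H"
proof -
  obtain v a b c where abc: "v \<in> verts G" "distinct [a, b, c]" "{u. {v, u} \<in> edges G} = {a, b, c}"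
    and HV: "verts H = verts G - {v}"
    and HE: "edges H = {e \<in> edges G. v \<notin> e} \<union> {{a, b}, {b, c}, {a, c}}"
    using H unfolding Y_nabla_def by auto
  have RV: "pat_verts R = {..<k}" using spans_verts[OF R] by simp
  have inj: "inj_on f {..<k}" and GV: "verts G = f ` {..<k}" and GE: "edges G = (`) f ` pat_edges R"
    using G RV by (auto simp: pat_iso_def)
  obtain x where x: "x < k" "v = f x" using abc(1) GV by auto
  have "e \<subseteq> f ` {..<k}" if "e \<in> edges G" for e using that GE RV by (auto simp: pat_verts_Union)
  moreover have "{v, a} \<in> edges G" "{v, b} \<in> edges G" "{v, c} \<in> edges G" using abc(3) by auto
  ultimately have "a \<in> f ` {..<k}" "b \<in> f ` {..<k}" "c \<in> f ` {..<k}" by blast+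
  then obtain a' b' c' where a': "a' < k" "b' < k" "c' < k" "a = f a'" "b = f b'" "c = f c'" by auto
  have d': "distinct [a', b', c']" using abc(2) a' by auto
  obtain i j l where ijl: "i < j" "j < l" "{i, j, l} = {a', b', c'}" using triple_sorted[OF d'] by metis
  have lk: "l < k" using ijl(3) a' by auto
  have fs: "{f i, f j, f l} = {a, b, c}" using arg_cong[OF ijl(3), of "(`) f"] a' by simp
  note tr = nabla_Y_triple[OF fs abc(2)]
  have yk: "y < k" if "{x, y} \<in> pat_edges R" for y using that RV by (auto simp: pat_verts_Union)
  have nb: "{y. {x, y} \<in> pat_edges R} = {i, j, l}"
  proof -
    have key: "{x, y} \<in> pat_edges R \<longleftrightarrow> y \<in> {i, j, l}" if "y < k" for y
    proof -
      have "{x, y} \<in> pat_edges R \<longleftrightarrow> {v, f y} \<in> edges G" using pat_iso_edge[OF G, of x y] RV x that by auto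
      also have "\<dots> \<longleftrightarrow> f y \<in> f ` {i, j, l}" using abc(3) fs by auto
      also have "\<dots> \<longleftrightarrow> y \<in> {i, j, l}" using inj_on_image_mem_iff[OF inj, of y "{i, j, l}"] that ijl(1,2) lk by simp
      finally show ?thesis .
    qed
    have "i < k" "j < k" using ijl lk by auto
    then have "y < k" if "y \<in> {i, j, l}" for y using that lk by auto
    then show ?thesis using yk key by blast
  qed
  have "x \<notin> {i, j, l}"
  proof
    assume "x \<in> {i, j, l}"
    then have "{x, x} \<in> pat_edges R" using nb by blast
    then show False using pat_edges_simple[OF simple, of "{x, x}"] by simp
  qed
  then show ?thesis
    using that[OF x(1) ijl(1,2) lk nb] pat_iso_Y[OF G R ijl(1,2) lk x(1) _ _ HV[unfolded x(2)] HE[unfolded tr(1) x(2)]] by blast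
qed

section \<open>Kuratowski subdivisions and the Petersen family\<close>

text \<open>An entry consists of the number of labels and the pattern. A step \<open>(p, e)\<close>
  subdivides edge \<open>e\<close> of entry \<open>p\<close>, with the number of labels as the new
  vertex.\<close>

fun build_bases :: "(nat \<times> pattern) list \<Rightarrow> (nat \<times> nat) list \<Rightarrow> (nat \<times> pattern) list" where
  "build_bases acc [] = acc"
| "build_bases acc ((p, e) # ps) = build_bases (acc @ [(Suc (fst (acc ! p)), subdivide (snd (acc ! p)) e (fst (acc ! p)))]) ps"

fun steps_ok :: "(nat \<times> pattern) list \<Rightarrow> (nat \<times> nat) list \<Rightarrow> bool" where
  "steps_ok acc [] \<longleftrightarrow> True"
| "steps_ok acc ((p, e) # ps) \<longleftrightarrow> p < length acc \<and> e < length (snd (acc ! p)) \<and>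
     steps_ok (acc @ [(Suc (fst (acc ! p)), subdivide (snd (acc ! p)) e (fst (acc ! p)))]) ps"

text \<open>Entry 0 is \<open>K33\<close> and entry 1 is \<open>K5\<close>. From \<open>K33\<close>,
  which has 9 edges, come 1, 3 and 7 patterns with one, two and three new vertices; from
  \<open>K5\<close>, with 10 edges, come 1 and 3. This makes 17 patterns in all.\<close>

definition base_steps :: "(nat \<times> nat) list" where
  "base_steps = [(0,0),(2,0),(3,0),(3,1),(3,4),(2,1),(7,2),(7,3),(7,5),(2,4),(11,8),(1,0),(13,0),(13,1),(13,7)]"

text \<open>All subdivisions of \<open>K33\<close> and \<open>K5\<close> with at most 12 edges, up to isomorphism.\<close>

definition bases :: "(nat \<times> pattern) list" where
  "bases = build_bases [(6, K33), (5, K5)] base_steps"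

definition base_pat :: "nat \<times> pattern \<Rightarrow> bool" where
  "base_pat = (\<lambda>(m, B). pat_nonplanar B \<and> in_range m B \<and> (\<forall>(i, j)\<in>set B. i \<noteq> j))"

lemma base_pat_subdivide:
  assumes "base_pat (m, B)" "e < length B"
  shows "base_pat (Suc m, subdivide B e m)"
proof -
  have B: "pat_nonplanar B" "in_range m B" "\<forall>(i, j)\<in>set B. i \<noteq> j" using assms(1) by (auto simp: base_pat_def)
  obtain a b where ab: "B ! e = (a, b)" by fastforce
  have mem: "(a, b) \<in> set B" using assms(2) ab nth_mem by metis
  then have a: "a < m" "b < m" "a \<noteq> b" using B by (auto simp: in_range_def list_all_iff)
  have fresh: "m \<notin> pat_verts B" using in_range_verts[OF B(2)] by auto
  have "pat_nonplanar (subdivide B e m)"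
    by (rule pat_nonplanar_subdivide[OF B(1) assms(2) _ fresh]) (use ab a in simp)
  moreover have sub: "set (subdivide B e m) \<subseteq> {(a, m), (b, m)} \<union> set B"
    using set_subdivide_subset[OF assms(2), of m] ab by simp
  then have "in_range (Suc m) (subdivide B e m)" using B(2) a by (fastforce simp: in_range_def list_all_iff)
  moreover have "\<forall>(i, j)\<in>set (subdivide B e m). i \<noteq> j" using sub B(3) a by fastforce
  ultimately show ?thesis by (simp add: base_pat_def)
qed

lemma build_bases_base_pat:
  "steps_ok acc ps \<Longrightarrow> \<forall>b\<in>set acc. base_pat b \<Longrightarrow> \<forall>b\<in>set (build_bases acc ps). base_pat b"
proof (induction acc ps rule: build_bases.induct)
  case (2 acc p e ps)
  have p: "p < length acc" "e < length (snd (acc ! p))" using 2(2) by auto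
  then have "base_pat (fst (acc ! p), snd (acc ! p))" using 2(3) by (metis nth_mem prod.collapse)
  then have "base_pat (Suc (fst (acc ! p)), subdivide (snd (acc ! p)) e (fst (acc ! p)))"
    using base_pat_subdivide p(2) by blast
  then show ?case using 2 by auto
qed auto

lemma base_pat_bases: "\<forall>b\<in>set bases. base_pat b"
  unfolding bases_def
proof (rule build_bases_base_pat)
  show "steps_ok [(6, K33), (5, K5)] base_steps" by code_simp
  have "in_range 6 K33" "in_range 5 K5" by code_simp+
  moreover have "\<forall>(i, j)\<in>set K33. i \<noteq> j" "\<forall>(i, j)\<in>set K5. i \<noteq> j" by (auto simp: K33_def K5_def)
  ultimately show "\<forall>b\<in>set [(6, K33), (5, K5)]. base_pat b"
    using pat_nonplanar_K33 pat_nonplanar_K5 by (auto simp: base_pat_def)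
qed

definition embeds :: "nat \<Rightarrow> pattern \<Rightarrow> nat list \<Rightarrow> nat \<times> pattern \<Rightarrow> bool" where
  "embeds k Q h = (\<lambda>(m, B). inj_list m k h \<and> in_range m B \<and> list_all (\<lambda>(i, j). adj_mat k Q ! (h ! i) ! (h ! j)) B)"

lemma embedsD:
  assumes "embeds k Q h (m, B)" "in_range k Q"
  shows "inj_on ((!) h) (pat_verts B)" "(!) h ` pat_verts B \<subseteq> set h" "set h \<subseteq> {..<k}"
    "\<And>i j. (i, j) \<in> set B \<Longrightarrow> {h ! i, h ! j} \<in> pat_edges Q"
proof -
  have h: "inj_list m k h" and B: "in_range m B" and E: "\<And>i j. (i, j) \<in> set B \<Longrightarrow> adj_mat k Q ! (h ! i) ! (h ! j)"
    using assms(1) by (auto simp: embeds_def list_all_iff)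
  show "inj_on ((!) h) (pat_verts B)" using inj_listD(1)[OF h] in_range_verts[OF B] by (rule inj_on_subset)
  show "(!) h ` pat_verts B \<subseteq> set h" using in_range_verts[OF B] h by (auto simp: inj_list_def)
  show "set h \<subseteq> {..<k}" using h by (auto simp: inj_list_def list_all_iff)
  show "{h ! i, h ! j} \<in> pat_edges Q" if "(i, j) \<in> set B" for i j
  proof -
    have "i < m" "j < m" using that B by (auto simp: in_range_def list_all_iff)
    then show ?thesis using adj_mat_iff[OF assms(2)] inj_listD(2)[OF h] E[OF that] by blast
  qed
qed

text \<open>Entry \<open>(b, h)\<close> at place \<open>e\<close> of a row embeds base
  \<open>b\<close>, by the label map \<open>h\<close>, into the subdivision of that row's base at
  edge \<open>e\<close>. The empty rows belong to the bases with 12 edges.\<close>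

definition subdivision_certs :: "(nat \<times> nat list) list list" where
  "subdivision_certs = [[(2,[0,1,2,3,4,5,6]), (2,[0,1,2,4,3,5,6]), (2,[0,1,2,5,3,4,6]), (2,[1,0,2,3,4,5,6]), (2,[1,0,2,4,3,5,6]), (2,[1,0,2,5,3,4,6]), (2,[2,0,1,3,4,5,6]), (2,[2,0,1,4,3,5,6]), (2,[2,0,1,5,3,4,6])],
   [(13,[0,1,2,3,4,5]), (13,[0,2,1,3,4,5]), (13,[0,3,1,2,4,5]), (13,[0,4,1,2,3,5]), (13,[1,2,0,3,4,5]), (13,[1,3,0,2,4,5]), (13,[1,4,0,2,3,5]), (13,[2,3,0,1,4,5]), (13,[2,4,0,1,3,5]), (13,[3,4,0,1,2,5])],
   [(3,[0,1,2,3,4,5,6,7]), (7,[0,1,2,3,4,5,6,7]), (7,[0,1,2,3,5,4,6,7]), (7,[3,4,5,0,1,2,6,7]), (11,[0,1,2,3,4,5,6,7]), (11,[0,1,2,3,5,4,6,7]), (7,[3,4,5,0,2,1,6,7]), (11,[0,2,1,3,4,5,6,7]), (11,[0,2,1,3,5,4,6,7]), (3,[0,1,2,3,4,5,7,6])],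
   [(4,[0,1,2,3,4,5,6,7,8]), (5,[0,1,2,3,4,5,6,7,8]), (5,[0,1,2,3,5,4,6,7,8]), (5,[3,4,5,0,1,2,7,6,8]), (6,[0,1,2,3,4,5,6,7,8]), (6,[0,1,2,3,5,4,6,7,8]), (5,[3,4,5,0,2,1,7,6,8]), (6,[0,2,1,3,4,5,6,7,8]), (6,[0,2,1,3,5,4,6,7,8]), (4,[0,1,2,3,4,5,8,6,7]), (4,[0,1,2,3,4,5,6,8,7])],
   [],
   [],
   [],
   [(5,[0,1,2,3,4,5,6,8,7]), (5,[0,1,2,4,3,5,7,8,6]), (8,[0,1,2,3,4,5,6,7,8]), (9,[0,1,2,3,4,5,6,7,8]), (9,[0,1,2,4,3,5,7,6,8]), (10,[0,1,2,3,4,5,6,7,8]), (9,[0,2,1,3,4,5,6,7,8]), (9,[0,2,1,4,3,5,7,6,8]), (10,[0,2,1,3,4,5,6,7,8]), (5,[0,1,2,3,4,5,8,6,7]), (5,[0,1,2,4,3,5,8,7,6])],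
   [],
   [],
   [],
   [(6,[0,1,2,3,4,5,6,8,7]), (9,[0,1,2,4,3,5,8,6,7]), (10,[0,1,2,3,5,4,6,8,7]), (9,[1,0,2,3,4,5,8,7,6]), (6,[1,0,2,4,3,5,7,8,6]), (10,[1,0,2,4,5,3,7,8,6]), (10,[3,4,5,0,2,1,6,8,7]), (10,[4,3,5,1,2,0,7,8,6]), (12,[0,1,2,3,4,5,6,7,8]), (6,[0,1,2,3,4,5,8,6,7]), (6,[1,0,2,4,3,5,8,7,6])],
   [],
   [(14,[0,1,2,3,4,5,6]), (15,[0,1,2,3,4,5,6]), (15,[0,1,3,2,4,5,6]), (15,[0,1,4,2,3,5,6]), (15,[1,0,2,3,4,5,6]), (15,[1,0,3,2,4,5,6]), (15,[1,0,4,2,3,5,6]), (16,[0,1,2,3,4,5,6]), (16,[0,1,2,4,3,5,6]), (16,[0,1,3,4,2,5,6]), (14,[0,1,2,3,4,6,5])],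
   [],
   [],
   []]"

definition subdivision_ok :: "nat \<times> pattern \<Rightarrow> (nat \<times> nat list) list \<Rightarrow> bool" where
  "subdivision_ok = (\<lambda>(m, B) cs. 12 \<le> length B \<or>
     list_all2 (\<lambda>e (b, h). nth_ok bases b (embeds (Suc m) (subdivide B e m) h)) [0..<length B] cs)"

lemma bases_subdivision_ok: "list_all2 subdivision_ok bases subdivision_certs"
  by code_simp

text \<open>This is what carries a base back through the suppression of a vertex of degree
  two.\<close>

lemma bases_closed_under_subdivision:
  assumes "(m, B) \<in> set bases" "length B < 12" "e < length B"
  shows "\<exists>(m', B')\<in>set bases. \<exists>h. embeds (Suc m) (subdivide B e m) h (m', B')"
proof -
  obtain cs where "subdivision_ok (m, B) cs"
    using bases_subdivision_ok assms(1) by (metis in_set_conv_nth list_all2_conv_all_nth)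
  then have l: "list_all2 (\<lambda>e (b, h). nth_ok bases b (embeds (Suc m) (subdivide B e m) h)) [0..<length B] cs"
    using assms(2) by (simp add: subdivision_ok_def)
  obtain b h where "nth_ok bases b (embeds (Suc m) (subdivide B e m) h)"
    using list_all2_nthD[OF l, of e] assms(3) by (auto split: prod.splits)
  then show ?thesis using nth_okD by fastforce
qed

text \<open>In this order: the Petersen graph, \<open>P9\<close>, \<open>P8\<close>, \<open>K331\<close>, \<open>P7\<close>, \<open>K6\<close>, and \<open>K44\<close> minus an edge.\<close>

definition reps :: "(nat \<times> pattern) list" where
  "reps = [(10, [(0,1),(1,2),(2,3),(3,4),(0,4),(0,5),(1,6),(2,7),(3,8),(4,9),(5,7),(6,8),(7,9),(5,8),(6,9)]),
   (9, [(0,1),(1,2),(2,3),(0,5),(1,6),(2,7),(3,8),(4,6),(5,7),(6,8),(4,7),(5,8),(0,3),(3,4),(0,4)]),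
   (8, [(1,2),(0,4),(1,6),(2,7),(3,5),(4,6),(5,7),(3,6),(4,7),(0,2),(2,3),(0,3),(0,1),(1,5),(0,5)]),
   (7, [(1,2),(1,5),(2,6),(3,4),(4,6),(3,5),(0,2),(2,3),(0,3),(0,1),(1,4),(0,4),(0,5),(5,6),(0,6)]),
   (7, [(1,2),(0,4),(2,6),(3,5),(5,6),(4,6),(0,2),(2,3),(0,3),(0,1),(1,5),(0,5),(1,3),(3,4),(1,4)]),
   (6, [(1,2),(0,4),(3,5),(0,2),(2,3),(0,3),(0,1),(1,5),(0,5),(1,3),(3,4),(1,4),(2,4),(4,5),(2,5)]),
   (8, [(1,2),(0,4),(2,6),(3,5),(5,6),(4,6),(0,2),(2,3),(1,5),(0,5),(3,4),(1,4),(0,7),(1,7),(3,7)])]"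

definition rep_ok :: "nat \<times> pattern \<Rightarrow> bool" where
  "rep_ok = (\<lambda>(k, R). spans k R \<and> list_all (\<lambda>(i, j). i \<noteq> j) R \<and> length R = 15)"

lemma reps_ok: "list_all rep_ok reps"
  by code_simp

lemma repsD:
  assumes "(k, R) \<in> set reps"
  shows "spans k R" "\<forall>(i, j)\<in>set R. i \<noteq> j" "length R = 15"
  using reps_ok assms by (auto simp: list_all_iff rep_ok_def)

text \<open>Entry \<open>(b, h)\<close> at place \<open>i\<close> of a row gives base
  \<open>b\<close> in the representative, by a label map \<open>h\<close> that avoids the vertex
  \<open>i\<close>.\<close>

definition deletion_certs :: "(nat \<times> nat list) list list" where
  "deletion_certs = [[(12,[2,9,8,6,3,7,1,4,5]), (12,[3,5,9,7,4,8,2,0,6]), (12,[0,8,9,6,4,5,1,3,7]), (12,[0,7,6,9,1,5,4,2,8]), (12,[1,8,7,5,2,6,0,3,9]), (12,[1,9,3,4,2,6,0,7,8]), (12,[0,7,3,2,4,5,1,9,8]), (12,[0,3,6,8,1,4,5,2,9]), (12,[0,9,2,7,1,4,5,6,3]), (12,[0,8,2,3,1,5,4,6,7])],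
   [(11,[2,8,4,6,7,3,1,5]), (11,[3,4,5,7,8,0,2,6]), (11,[0,4,8,6,5,3,1,7]), (11,[1,5,4,7,6,0,2,8]), (11,[1,5,3,8,2,0,6,7]), (11,[2,6,0,4,3,1,7,8]), (11,[0,3,7,2,5,4,1,8]), (11,[0,3,6,8,1,4,5,2]), (11,[0,4,2,7,1,3,5,6])],
   [(2,[6,2,5,7,1,3,4]), (2,[3,0,7,4,2,5,6]), (2,[4,1,3,5,0,6,7]), (2,[1,0,7,4,2,5,6]), (16,[1,3,2,5,0,6,7]), (2,[2,0,6,4,1,3,7]), (2,[0,2,5,7,1,3,4]), (2,[0,1,3,6,2,5,4])],
   [(0,[1,3,6,2,4,5]), (0,[0,3,6,2,4,5]), (0,[0,4,5,1,3,6]), (0,[0,1,6,2,4,5]), (0,[0,2,5,1,3,6]), (0,[0,2,4,1,3,6]), (0,[0,1,3,2,4,5])],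
   [(0,[1,3,6,2,4,5]), (0,[0,3,6,2,4,5]), (13,[4,5,0,1,3,6]), (0,[0,1,6,2,4,5]), (13,[2,5,0,1,3,6]), (13,[2,4,0,1,3,6]), (0,[0,1,3,2,4,5])],
   [(1,[1,2,3,4,5]), (1,[0,2,3,4,5]), (1,[0,1,3,4,5]), (1,[0,1,2,4,5]), (1,[0,1,2,3,5]), (1,[0,1,2,3,4])],
   [(0,[1,3,6,2,4,5]), (0,[0,3,6,2,4,5]), (0,[0,1,3,4,5,7]), (0,[0,1,6,2,4,5]), (0,[0,1,3,2,5,7]), (0,[0,1,3,2,4,7]), (0,[0,1,3,2,4,5]), (0,[0,1,3,2,4,5])]]"

definition deletion_ok :: "nat \<times> pattern \<Rightarrow> (nat \<times> nat list) list \<Rightarrow> bool" where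
  "deletion_ok = (\<lambda>(k, R) cs. list_all2 (\<lambda>i (b, h). \<not> List.member h i \<and> nth_ok bases b (embeds k R h)) [0..<k] cs)"

lemma reps_deletion_ok: "list_all2 deletion_ok reps deletion_certs"
  by code_simp

lemma reps_not_apex:
  assumes R: "(k, R) \<in> set reps" and iso: "pat_iso R f G"
  shows "\<not> apex G"
proof (rule pat_iso_not_apex[OF iso])
  note r = repsD[OF R]
  show "R \<noteq> []" using r(3) by auto
  show "\<forall>(i, j)\<in>set R. i \<noteq> j" by (rule r(2))
  fix i assume "i \<in> pat_verts R"
  then have i: "i < k" using spans_verts[OF r(1)] by simp
  obtain cs where "deletion_ok (k, R) cs"
    using reps_deletion_ok R by (metis in_set_conv_nth list_all2_conv_all_nth)
  then have l: "list_all2 (\<lambda>i (b, h). \<not> List.member h i \<and> nth_ok bases b (embeds k R h)) [0..<k] cs"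
    by (simp add: deletion_ok_def)
  obtain b h where h: "i \<notin> set h" "nth_ok bases b (embeds k R h)"
    using list_all2_nthD[OF l, of i] i by (auto split: prod.splits)
  obtain m B where B: "(m, B) \<in> set bases" "embeds k R h (m, B)" using nth_okD[OF h(2)] by fastforce
  have "base_pat (m, B)" using base_pat_bases B(1) by blast
  then show "\<exists>B h. pat_nonplanar B \<and> inj_on h (pat_verts B) \<and>
      (\<forall>(a, b)\<in>set B. {h a, h b} \<in> pat_edges R) \<and> i \<notin> h ` pat_verts B"
    using embedsD[OF B(2) spans_verts(1)[OF r(1)]] h(1)
    by (intro exI[of _ B] exI[of _ "(!) h"]) (auto simp: base_pat_def)
qed

section \<open>Closure of the seven graphs under the exchanges\<close>

definition isomorphic :: "nat \<Rightarrow> pattern \<Rightarrow> nat list \<Rightarrow> nat \<times> pattern \<Rightarrow> bool" where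
  "isomorphic n Q h = (\<lambda>(m, P). inj_list m n h \<and> in_range n Q \<and> adj_mat n (map_pat h P) = adj_mat n Q)"

definition triangles :: "nat \<Rightarrow> pattern \<Rightarrow> (nat \<times> nat \<times> nat) list" where
  "triangles k R = (let M = adj_mat k R in
     concat (map (\<lambda>i. concat (map (\<lambda>j. map (\<lambda>l. (i, j, l)) (filter (\<lambda>l. M ! i ! l \<and> M ! j ! l) [Suc j..<k]))
       (filter (\<lambda>j. M ! i ! j) [Suc i..<k]))) [0..<k]))"

text \<open>One entry per triangle, in the order of \<open>triangles\<close>, naming the
  representative obtained and an isomorphism. Two rows are empty: the Petersen graph has girth five,
  and \<open>K44\<close> minus an edge is bipartite.\<close>

definition nabla_certs :: "(nat \<times> nat list) list list" where
  "nabla_certs = [[],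
   [(0,[0,1,2,3,9,5,6,7,8,4])],
   [(1,[0,4,6,3,5,8,7,1,2]), (1,[0,4,7,2,3,8,6,5,1]), (1,[0,4,6,1,5,8,7,3,2]), (1,[0,4,6,1,2,8,7,3,5])],
   [(2,[0,3,4,6,7,5,2,1]), (2,[0,2,3,5,7,6,1,4]), (2,[0,2,3,4,7,6,1,5]), (2,[0,1,4,6,7,5,2,3]), (2,[0,1,4,3,7,5,2,6]), (2,[0,1,2,6,7,5,4,3]), (2,[0,1,2,6,7,4,5,3]), (2,[0,1,2,3,7,5,4,6]), (2,[0,1,2,3,7,4,5,6])],
   [(2,[3,0,4,1,2,5,7,6]), (6,[0,1,2,3,4,5,6,7]), (2,[3,0,2,1,4,5,7,6]), (2,[3,0,2,1,5,4,7,6]), (2,[1,0,4,3,2,5,7,6]), (2,[1,0,2,3,4,5,7,6]), (2,[1,0,2,3,5,4,7,6]), (2,[0,1,4,3,2,5,7,6]), (2,[0,1,2,3,4,5,7,6]), (2,[0,1,2,3,5,4,7,6])],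
   [(4,[3,4,0,5,1,2,6]), (4,[2,4,0,5,1,3,6]), (4,[2,3,0,5,1,4,6]), (4,[2,3,0,4,1,5,6]), (4,[1,4,0,5,2,3,6]), (4,[1,3,0,5,2,4,6]), (4,[1,3,0,4,2,5,6]), (4,[1,2,0,5,3,4,6]), (4,[1,2,0,4,3,5,6]), (4,[1,2,0,3,4,5,6]), (4,[0,4,1,5,2,3,6]), (4,[0,3,1,5,2,4,6]), (4,[0,3,1,4,2,5,6]), (4,[0,2,1,5,3,4,6]), (4,[0,2,1,4,3,5,6]), (4,[0,2,1,3,4,5,6]), (4,[0,1,2,5,3,4,6]), (4,[0,1,2,4,3,5,6]), (4,[0,1,2,3,4,5,6]), (4,[0,1,3,2,4,5,6])],
   []]"

definition nabla_ok :: "nat \<times> pattern \<Rightarrow> (nat \<times> nat list) list \<Rightarrow> bool" where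
  "nabla_ok = (\<lambda>(k, R) cs. list_all2 (\<lambda>(i, j, l) (r, h). spans (Suc k) (nabla_pat k R i j l) \<and>
     nth_ok reps r (isomorphic (Suc k) (nabla_pat k R i j l) h)) (triangles k R) cs)"

lemma reps_nabla_ok: "list_all2 nabla_ok reps nabla_certs"
  by code_simp

definition cubic_vertices :: "nat \<Rightarrow> pattern \<Rightarrow> (nat \<times> nat list) list" where
  "cubic_vertices k R = (let M = adj_mat k R in
     filter (\<lambda>(x, ys). length ys = 3) (map (\<lambda>x. (x, filter (\<lambda>y. M ! x ! y) [0..<k])) [0..<k]))"

definition spans_except :: "nat \<Rightarrow> nat \<Rightarrow> pattern \<Rightarrow> bool" where
  "spans_except k x P \<longleftrightarrow> in_range k P \<and> list_all (\<lambda>i. (i = x) = (\<not> list_ex (\<lambda>(a, b). a = i \<or> b = i) P)) [0..<k]"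

text \<open>One entry per vertex of degree three, in the order of \<open>cubic_vertices\<close>. The
  rows of \<open>K331\<close> and \<open>K6\<close> are empty because their minimum degrees are four
  and five.\<close>

definition Y_certs :: "(nat \<times> nat list) list list" where
  "Y_certs = [[(1,[1,2,3,4,5,6,7,8,9]), (1,[0,4,3,2,6,5,9,8,7]), (1,[1,0,4,3,7,6,5,9,8]), (1,[2,1,0,4,8,7,6,5,9]), (1,[0,1,2,3,9,5,6,7,8]), (1,[0,1,2,7,8,4,6,3,9]), (1,[1,0,5,8,9,2,4,7,3]), (1,[2,1,0,5,9,3,6,4,8]), (1,[3,2,7,5,6,4,1,9,0]), (1,[4,0,1,6,7,3,5,2,8])],
   [(2,[0,2,3,4,5,6,7,8]), (2,[3,0,1,7,8,4,5,6]), (2,[0,3,4,7,1,8,2,6]), (2,[4,0,1,8,7,3,5,2]), (2,[4,0,3,2,6,5,1,8]), (2,[3,0,4,6,2,5,1,7])],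
   [(3,[0,1,2,3,5,6,7]), (4,[0,1,2,3,4,5,7]), (4,[0,2,1,5,3,4,6])],
   [],
   [(5,[0,1,2,3,4,5])],
   [],
   [(4,[2,4,0,5,1,3,7]), (4,[0,1,2,3,4,5,6])]]"

definition Y_ok :: "nat \<times> pattern \<Rightarrow> (nat \<times> nat list) list \<Rightarrow> bool" where
  "Y_ok = (\<lambda>(k, R) cs. list_all2 (\<lambda>(x, ys) (r, h). let N = y_pat R x (ys ! 0) (ys ! 1) (ys ! 2) in spans_except k x N \<and>
     nth_ok reps r (isomorphic k N h)) (cubic_vertices k R) cs)"

lemma reps_Y_ok: "list_all2 Y_ok reps Y_certs"
  by code_simp

lemma spans_except_verts: "spans_except k x P \<Longrightarrow> pat_verts P = {..<k} - {x}"
proof -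
  assume s: "spans_except k x P"
  have "pat_verts P \<subseteq> {..<k}" using s in_range_verts by (simp add: spans_except_def)
  moreover have "i \<in> pat_verts P \<longleftrightarrow> i \<noteq> x" if "i < k" for i
  proof -
    have "i \<in> pat_verts P \<longleftrightarrow> list_ex (\<lambda>(a, b). a = i \<or> b = i) P" by (auto simp: pat_verts_def list_ex_iff)
    then show ?thesis using s that by (auto simp: spans_except_def list_all_iff)
  qed
  ultimately show ?thesis by auto
qed

text \<open>Membership in the Petersen family up to isomorphism, reduced to a finite list and
  available for graphs on any type of vertices.\<close>

definition is_rep :: "'a ugraph \<Rightarrow> bool" where
  "is_rep G \<longleftrightarrow> (\<exists>k R f. (k, R) \<in> set reps \<and> pat_iso R f G)"

lemma pat_iso_isomorphic:
  assumes "pat_iso N f H" "(m, P) \<in> set reps" "isomorphic n N h (m, P)"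
  shows "is_rep H"
proof -
  have "pat_iso P (\<lambda>i. f (h ! i)) H"
    by (rule pat_iso_relabel[OF assms(1)]) (use assms(3) spans_verts(1)[OF repsD(1)[OF assms(2)]] in \<open>auto simp: isomorphic_def\<close>)
  then show ?thesis using assms(2) unfolding is_rep_def by blast
qed

lemma in_set_concat_map: "x \<in> set xs \<Longrightarrow> y \<in> set (F x) \<Longrightarrow> y \<in> set (concat (map F xs))"
  by auto

lemma is_rep_nabla_Y:
  assumes "is_rep G" "nabla_Y G H"
  shows "is_rep H"
proof -
  obtain k R f where R: "(k, R) \<in> set reps" and iso: "pat_iso R f G" using assms(1) unfolding is_rep_def by blast
  note r = repsD[OF R]
  obtain i j l v where ijl: "i < j" "j < l" "l < k" "{i, j} \<in> pat_edges R" "{j, l} \<in> pat_edges R" "{i, l} \<in> pat_edges R"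
    and H: "spans (Suc k) (nabla_pat k R i j l) \<Longrightarrow> pat_iso (nabla_pat k R i j l) (f(k := v)) H"
    using nabla_Y_pat[OF iso r(1,2) assms(2)] by metis
  have "(i, j, l) \<in> set (triangles k R)"
  proof -
    have M: "adj_mat k R ! i ! j" "adj_mat k R ! j ! l" "adj_mat k R ! i ! l"
      using ijl adj_mat_iff[OF spans_verts(1)[OF r(1)]] by auto
    show ?thesis
      unfolding triangles_def Let_def
      by (rule in_set_concat_map[of i], use ijl in simp, rule in_set_concat_map[of j]) (use ijl M in auto)
  qed
  then obtain n where n: "n < length (triangles k R)" "triangles k R ! n = (i, j, l)" by (metis in_set_conv_nth)
  obtain cs where "nabla_ok (k, R) cs"
    using reps_nabla_ok R by (metis in_set_conv_nth list_all2_conv_all_nth)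
  then have l2: "list_all2 (\<lambda>(i, j, l) (r, h). spans (Suc k) (nabla_pat k R i j l) \<and>
     nth_ok reps r (isomorphic (Suc k) (nabla_pat k R i j l) h)) (triangles k R) cs" by (simp add: nabla_ok_def)
  obtain q h where "spans (Suc k) (nabla_pat k R i j l)" "nth_ok reps q (isomorphic (Suc k) (nabla_pat k R i j l) h)"
    using list_all2_nthD[OF l2 n(1)] n(2) by (auto split: prod.splits)
  then show ?thesis using H pat_iso_isomorphic nth_okD by (metis (no_types, lifting) prod.collapse)
qed

lemma cubic_vertices_mem:
  assumes R: "in_range k R" and x: "x < k" and ijl: "i < j" "j < l" "l < k"
    and nb: "{y. {x, y} \<in> pat_edges R} = {i, j, l}"
  shows "(x, [i, j, l]) \<in> set (cubic_vertices k R)"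
proof -
  have "filter (\<lambda>y. adj_mat k R ! x ! y) [0..<k] = [i, j, l]"
  proof (rule sorted_distinct_set_unique)
    have "{y. y < k \<and> adj_mat k R ! x ! y} = {y. {x, y} \<in> pat_edges R}"
      using adj_mat_iff[OF R x] in_range_verts[OF R] unfolding pat_verts_Union by auto
    then show "set (filter (\<lambda>y. adj_mat k R ! x ! y) [0..<k]) = set [i, j, l]" using nb by auto
  qed (use ijl in \<open>auto simp: sorted_wrt_filter\<close>)
  then show ?thesis using x unfolding cubic_vertices_def Let_def by (auto intro!: image_eqI[of _ _ x])
qed

lemma is_rep_Y_nabla:
  assumes "is_rep G" "Y_nabla G H"
  shows "is_rep H"
proof -
  obtain k R f where R: "(k, R) \<in> set reps" and iso: "pat_iso R f G" using assms(1) unfolding is_rep_def by blast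
  note r = repsD[OF R]
  obtain x i j l where x: "x < k" "i < j" "j < l" "l < k" "{y. {x, y} \<in> pat_edges R} = {i, j, l}"
    and H: "pat_verts (y_pat R x i j l) = {..<k} - {x} \<Longrightarrow> pat_iso (y_pat R x i j l) f H"
    using Y_nabla_pat[OF iso r(1,2) assms(2)] by metis
  obtain n where n: "n < length (cubic_vertices k R)" "cubic_vertices k R ! n = (x, [i, j, l])"
    using cubic_vertices_mem[OF spans_verts(1)[OF r(1)] x] by (metis in_set_conv_nth)
  obtain cs where "Y_ok (k, R) cs"
    using reps_Y_ok R by (metis in_set_conv_nth list_all2_conv_all_nth)
  then have l2: "list_all2 (\<lambda>(x, ys) (r, h). let N = y_pat R x (ys ! 0) (ys ! 1) (ys ! 2) in spans_except k x N \<and>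
     nth_ok reps r (isomorphic k N h)) (cubic_vertices k R) cs" by (simp add: Y_ok_def)
  obtain q h where "spans_except k x (y_pat R x i j l)" "nth_ok reps q (isomorphic k (y_pat R x i j l) h)"
    using list_all2_nthD[OF l2 n(1)] n(2) by (auto simp: Let_def split: prod.splits)
  then show ?thesis
    using H[OF spans_except_verts] pat_iso_isomorphic nth_okD by (metis (no_types, lifting) prod.collapse)
qed

lemma pat_iso_petersen_graph: "pat_iso (snd (reps ! 0)) id petersen_graph"
proof -
  have "verts petersen_graph = pat_verts (snd (reps ! 0))"
    using spans_verts(2)[OF repsD(1), of 10 "snd (reps ! 0)"] by (simp add: petersen_graph_def reps_def atLeast0LessThan)
  moreover have "edges petersen_graph = pat_edges (snd (reps ! 0))"
  proof -
    have "{0..<5::nat} = {0, 1, 2, 3, 4}" by auto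
    then show ?thesis by (simp add: petersen_graph_def reps_def pat_edges_def insert_commute numeral_2_eq_2)
  qed
  ultimately show ?thesis by (simp add: pat_iso_def)
qed

lemma petersen_family_is_rep: "P \<in> petersen_family \<Longrightarrow> is_rep P"
proof (induction rule: petersen_family.induct)
  case petersen
  have "(10, snd (reps ! 0)) \<in> set reps" by (simp add: reps_def)
  then show ?case using pat_iso_petersen_graph unfolding is_rep_def by blast
qed (use is_rep_nabla_Y is_rep_Y_nabla in blast)+

section \<open>All seven graphs occur in the family\<close>

definition realized :: "nat \<Rightarrow> bool" where
  "realized r \<longleftrightarrow> (\<exists>P\<in>petersen_family. \<exists>f. pat_iso (snd (reps ! r)) f P)"

definition Y_step :: "nat \<Rightarrow> nat \<Rightarrow> nat \<Rightarrow> nat \<Rightarrow> nat \<Rightarrow> nat \<Rightarrow> nat list \<Rightarrow> bool" where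
  "Y_step r s x i j l h \<longleftrightarrow> r < length reps \<and> s < length reps \<and> (let (k, R) = reps ! r; N = y_pat R x i j l in
     x < k \<and> i < j \<and> j < l \<and> l < k \<and> filter (\<lambda>y. adj_mat k R ! x ! y) [0..<k] = [i, j, l] \<and>
     spans_except k x N \<and> isomorphic k N h (reps ! s))"

lemma realized_Y_step:
  assumes "realized r" "Y_step r s x i j l h"
  shows "realized s"
proof -
  obtain k R where kR: "reps ! r = (k, R)" by fastforce
  obtain m Q where mQ: "reps ! s = (m, Q)" by fastforce
  let ?N = "y_pat R x i j l"
  have st: "r < length reps" "s < length reps" "x < k" "i < j" "j < l" "l < k" "spans_except k x ?N" "isomorphic k ?N h (m, Q)"
    and fl: "filter (\<lambda>y. adj_mat k R ! x ! y) [0..<k] = [i, j, l]"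
    using assms(2) kR mQ by (auto simp: Y_step_def Let_def)
  have R: "(k, R) \<in> set reps" "(m, Q) \<in> set reps" using st(1,2) kR mQ nth_mem by metis+
  note r = repsD[OF R(1)]
  have RV: "pat_verts R = {..<k}" "in_range k R" using spans_verts[OF r(1)] by auto
  obtain P f where P: "P \<in> petersen_family" and iso: "pat_iso R f P" using assms(1) kR by (auto simp: realized_def)
  have nb: "{x, y} \<in> pat_edges R \<longleftrightarrow> y \<in> {i, j, l}" if "y < k" for y
    using arg_cong[OF fl, of set] adj_mat_iff[OF RV(2) st(3) that] that by auto
  have xn: "x \<notin> {i, j, l}"
    using nb[OF st(3)] pat_edges_simple[OF r(2), of "{x, x}"] by auto
  define H where "H = \<lparr>verts = verts P - {f x}, edges = {e \<in> edges P. f x \<notin> e} \<union> {{f i, f j}, {f j, f l}, {f i, f l}}\<rparr>"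
  have isoN: "pat_iso ?N f H"
    by (rule pat_iso_Y[OF iso r(1) st(4-6,3) xn spans_except_verts[OF st(7)]]) (auto simp: H_def)
  have inj: "inj_on f {..<k}" and PV: "verts P = f ` {..<k}" and PE: "edges P = (`) f ` pat_edges R"
    using iso RV by (auto simp: pat_iso_def)
  have "Y_nabla P H"
    unfolding Y_nabla_def
  proof (intro exI conjI)
    show "f x \<in> verts P" using PV st(3) by auto
    show "distinct [f i, f j, f l]" using inj st(4-6) by (auto dest: inj_onD)
    have "{f x, u} \<in> edges P \<longleftrightarrow> u \<in> {f i, f j, f l}" for u
    proof (cases "u \<in> f ` {..<k}")
      case True
      then obtain y where y: "u = f y" "y < k" by auto
      have "{f x, u} \<in> edges P \<longleftrightarrow> y \<in> {i, j, l}"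
        using pat_iso_edge[OF iso, of x y] RV y st(3) nb[OF y(2)] by auto
      also have "\<dots> \<longleftrightarrow> f y \<in> f ` {i, j, l}"
        using inj_on_image_mem_iff[OF inj, of y "{i, j, l}"] y st(4-6) by simp
      finally show ?thesis using y by simp
    next
      case False
      have "e \<subseteq> f ` {..<k}" if "e \<in> edges P" for e using that PE RV by (auto simp: pat_verts_Union)
      then have "{f x, u} \<notin> edges P" using False by blast
      moreover have "u \<notin> {f i, f j, f l}" using False st(4-6) by auto
      ultimately show ?thesis by simp
    qed
    then show "{u. {f x, u} \<in> edges P} = {f i, f j, f l}" by blast
    show "H = \<lparr>verts = verts P - {f x}, edges = {e \<in> edges P. f x \<notin> e} \<union> {{f i, f j}, {f j, f l}, {f i, f l}}\<rparr>"
      by (rule H_def)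
  qed
  then have "H \<in> petersen_family" using P by (rule petersen_family.Y_nabla[rotated])
  moreover have "pat_iso Q (\<lambda>i. f (h ! i)) H"
    by (rule pat_iso_relabel[OF isoN]) (use st(8) spans_verts(1)[OF repsD(1)[OF R(2)]] in \<open>auto simp: isomorphic_def\<close>)
  ultimately show ?thesis using mQ by (auto simp: realized_def)
qed

definition nabla_step :: "nat \<Rightarrow> nat \<Rightarrow> nat \<Rightarrow> nat \<Rightarrow> nat \<Rightarrow> nat list \<Rightarrow> bool" where
  "nabla_step r s i j l h \<longleftrightarrow> r < length reps \<and> s < length reps \<and> (let (k, R) = reps ! r; N = nabla_pat k R i j l; M = adj_mat k R in
     i < j \<and> j < l \<and> l < k \<and> M ! i ! j \<and> M ! j ! l \<and> M ! i ! l \<and> spans (Suc k) N \<and> isomorphic (Suc k) N h (reps ! s))"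

lemma realized_nabla_step:
  assumes "realized r" "nabla_step r s i j l h"
  shows "realized s"
proof -
  obtain k R where kR: "reps ! r = (k, R)" by fastforce
  obtain m Q where mQ: "reps ! s = (m, Q)" by fastforce
  let ?N = "nabla_pat k R i j l"
  have st: "r < length reps" "s < length reps" "i < j" "j < l" "l < k" "spans (Suc k) ?N" "isomorphic (Suc k) ?N h (m, Q)"
    and M: "adj_mat k R ! i ! j" "adj_mat k R ! j ! l" "adj_mat k R ! i ! l"
    using assms(2) kR mQ by (auto simp: nabla_step_def Let_def)
  have R: "(k, R) \<in> set reps" "(m, Q) \<in> set reps" using st(1,2) kR mQ nth_mem by metis+
  note r = repsD[OF R(1)]
  have RV: "pat_verts R = {..<k}" "in_range k R" using spans_verts[OF r(1)] by auto
  obtain P f where P: "P \<in> petersen_family" and iso: "pat_iso R f P" using assms(1) kR by (auto simp: realized_def)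
  have inj: "inj_on f {..<k}" and PV: "verts P = f ` {..<k}"
    using iso RV by (auto simp: pat_iso_def)
  have "finite (verts P)" using PV by simp
  \<comment> \<open>The family lives on the natural numbers, so a fresh vertex exists.\<close>
  then obtain v where v: "v \<notin> verts P" using ex_new_if_finite infinite_UNIV_nat by blast
  define H where "H = \<lparr>verts = insert v (verts P), edges = (edges P - {{f i, f j}, {f j, f l}, {f i, f l}}) \<union> {{v, f i}, {v, f j}, {v, f l}}\<rparr>"
  have isoN: "pat_iso ?N (f(k := v)) H"
    by (rule pat_iso_nabla[OF iso r(1) v st(3-6) r(2)]) (auto simp: H_def)
  have "nabla_Y P H"
    unfolding nabla_Y_def
  proof (intro exI conjI)
    show "distinct [f i, f j, f l]" using inj st(3-5) by (auto dest: inj_onD)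
    show "{f i, f j} \<in> edges P" "{f j, f l} \<in> edges P" "{f i, f l} \<in> edges P"
      using pat_iso_edge[OF iso] RV st(3-5) M adj_mat_iff[OF RV(2)] by auto
  qed (use v in \<open>auto simp: H_def\<close>)
  then have "H \<in> petersen_family" using P by (rule petersen_family.nabla_Y[rotated])
  moreover have "pat_iso Q (\<lambda>i. (f(k := v)) (h ! i)) H"
    by (rule pat_iso_relabel[OF isoN]) (use st(7) spans_verts(1)[OF repsD(1)[OF R(2)]] in \<open>auto simp: isomorphic_def\<close>)
  ultimately show ?thesis using mQ by (auto simp: realized_def)
qed

text \<open>Y-nabla moves lead from the Petersen graph over \<open>P9\<close> to \<open>P8\<close>,
  from there to \<open>K331\<close> and to \<open>P7\<close>, and from \<open>P7\<close> to
  \<open>K6\<close>. One nabla-Y move takes \<open>P7\<close> to \<open>K44\<close> minus an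
  edge.\<close>

lemma all_realized: "r < length reps \<Longrightarrow> realized r"
proof -
  assume r: "r < length reps"
  have 0: "realized 0" using pat_iso_petersen_graph petersen_family.petersen by (auto simp: realized_def)
  have 1: "realized 1" by (rule realized_Y_step[OF 0, of 1 0 1 4 5 "[1,2,3,4,5,6,7,8,9]"]) code_simp
  have 2: "realized 2" by (rule realized_Y_step[OF 1, of 2 1 0 2 6 "[0,2,3,4,5,6,7,8]"]) code_simp
  have 3: "realized 3" by (rule realized_Y_step[OF 2, of 3 4 0 6 7 "[0,1,2,3,5,6,7]"]) code_simp
  have 4: "realized 4" by (rule realized_Y_step[OF 2, of 4 6 1 3 4 "[0,1,2,3,4,5,7]"]) code_simp
  have 5: "realized 5" by (rule realized_Y_step[OF 4, of 5 6 2 4 5 "[0,1,2,3,4,5]"]) code_simp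
  have 6: "realized 6" by (rule realized_nabla_step[OF 4, of 6 0 1 3 "[0,1,2,3,4,5,6,7]"]) code_simp
  have "r = 0 \<or> r = 1 \<or> r = 2 \<or> r = 3 \<or> r = 4 \<or> r = 5 \<or> r = 6" using r by (auto simp: reps_def)
  then show "realized r" using 0 1 2 3 4 5 6 by blast
qed

lemma is_rep_iff_petersen_family:
  assumes G: "simple_graph G"
  shows "is_rep G \<longleftrightarrow> (\<exists>P\<in>petersen_family. graph_iso G P)"
proof
  assume "is_rep G"
  then obtain k R f where R: "(k, R) \<in> set reps" and f: "pat_iso R f G" unfolding is_rep_def by blast
  obtain r where "r < length reps" "reps ! r = (k, R)" using R by (metis in_set_conv_nth)
  then obtain P g where P: "P \<in> petersen_family" and g: "pat_iso R g P" using all_realized[of r] by (fastforce simp: realized_def)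
  let ?h = "g \<circ> inv_into (pat_verts R) f"
  have ff: "inv_into (pat_verts R) f (f i) = i" if "i \<in> pat_verts R" for i using f that by (auto simp: pat_iso_def)
  have "bij_betw ?h (verts G) (verts P)"
    using f g by (intro bij_betw_trans[of _ _ "pat_verts R"] bij_betw_inv_into) (auto simp: pat_iso_def bij_betw_def)
  moreover have "(\<lambda>e. ?h ` e) ` edges G = edges P"
  proof -
    have "?h ` f ` e = g ` e" if "e \<in> pat_edges R" for e
    proof -
      have "inv_into (pat_verts R) f ` f ` e = id ` e"
        unfolding image_image by (rule image_cong) (use ff that in \<open>auto simp: pat_verts_Union\<close>)
      then show ?thesis unfolding image_comp[symmetric] by simp
    qed
    then show ?thesis using f g by (simp add: pat_iso_def image_image)
  qed
  ultimately show "\<exists>P\<in>petersen_family. graph_iso G P" using P unfolding graph_iso_def by blast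
next
  assume "\<exists>P\<in>petersen_family. graph_iso G P"
  then obtain P h where P: "P \<in> petersen_family" and h: "bij_betw h (verts G) (verts P)" "(\<lambda>e. h ` e) ` edges G = edges P"
    unfolding graph_iso_def by blast
  obtain k R f where R: "(k, R) \<in> set reps" and f: "pat_iso R f P" using petersen_family_is_rep[OF P] unfolding is_rep_def by blast
  define e where "e = inv_into (verts G) h"
  have eh: "e (h x) = x" if "x \<in> verts G" for x using h(1) that by (auto simp: e_def bij_betw_def)
  have e: "bij_betw e (verts P) (verts G)" unfolding e_def by (rule bij_betw_inv_into[OF h(1)])
  have "pat_iso R (e \<circ> f) G"
    unfolding pat_iso_def
  proof (intro conjI)
    show "inj_on (e \<circ> f) (pat_verts R)" using e f by (auto simp: pat_iso_def bij_betw_def intro: comp_inj_on)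
    show "verts G = (e \<circ> f) ` pat_verts R" using e f by (auto simp: pat_iso_def bij_betw_def image_comp)
    have "e ` h ` d = d" if "d \<in> edges G" for d
    proof -
      have "d \<subseteq> verts G" using G that by (auto simp: simple_graph_def)
      then have "e ` h ` d = id ` d" unfolding image_image by (intro image_cong) (use eh in auto)
      then show ?thesis by simp
    qed
    then have "edges G = (`) e ` edges P" by (simp add: h(2)[symmetric] image_image)
    then show "edges G = (`) (e \<circ> f) ` pat_edges R" using f by (simp add: pat_iso_def image_image)
  qed
  then show "is_rep G" using R unfolding is_rep_def by blast
qed

section \<open>Soundness of the certificates\<close>

text \<open>The 5 is the order of \<open>K5\<close>; it gives at least six vertices to a graph that
  still contains a base after the deletion of a vertex.\<close>

lemma bases_span: "list_all (\<lambda>(m, B). spans m B \<and> 5 \<le> m) bases"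
  by code_simp

text \<open>No edge is repeated, not even reversed, so the length counts the edges and an edge
  determines its position.\<close>

definition edge_distinct :: "pattern \<Rightarrow> bool" where
  "edge_distinct P \<longleftrightarrow> distinct (map (\<lambda>(i, j). (min i j, max i j)) P)"

lemma edge_distinct_nth:
  assumes "edge_distinct P" "k < length P" "k' < length P" "P ! k = (i, j)" "P ! k' = (p, q)" "{p, q} = {i, j}"
  shows "k' = k"
proof -
  have "map (\<lambda>(i, j). (min i j, max i j)) P ! k' = map (\<lambda>(i, j). (min i j, max i j)) P ! k"
  proof -
    have "p = i \<and> q = j \<or> p = j \<and> q = i" using assms(6) by (auto simp: doubleton_eq_iff)
    then have "(min p q, max p q) = (min i j, max i j)" by (auto simp: min.commute max.commute)
    then show ?thesis using assms(2-5) by simp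
  qed
  then show ?thesis
    using nth_eq_iff_index_eq[OF assms(1)[unfolded edge_distinct_def], of k' k] assms(2,3) by simp
qed

lemma card_pat_edges:
  assumes "edge_distinct P"
  shows "card (pat_edges P) = length P"
proof -
  have "inj_on (\<lambda>k. {fst (P ! k), snd (P ! k)}) {..<length P}"
    using edge_distinct_nth[OF assms] by (intro inj_onI) (metis lessThan_iff prod.collapse)
  moreover have "pat_edges P = (\<lambda>k. {fst (P ! k), snd (P ! k)}) ` {..<length P}"
    unfolding pat_edges_def split_beta by (force simp: in_set_conv_nth)
  ultimately show ?thesis by (simp add: card_image)
qed

lemma bases_edge_distinct: "list_all (\<lambda>(m, B). edge_distinct B) bases"
  by code_simp

lemma embeds_pat_in:
  assumes em: "embeds n Q h (m, B)" and Q: "in_range n Q" and g: "inj_on g {..<n}"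
    and E: "\<And>i j. (i, j) \<in> set Q \<Longrightarrow> {g i, g j} \<in> edges G"
  shows "pat_in B (\<lambda>i. g (h ! i)) G"
  unfolding pat_in_def
proof (intro conjI ballI)
  note em = embedsD[OF em Q]
  have "inj_on g ((!) h ` pat_verts B)" using g em(2,3) by (meson inj_on_subset order_trans)
  then show "inj_on (\<lambda>i. g (h ! i)) (pat_verts B)" using comp_inj_on[OF em(1)] by (simp add: comp_def)
  fix d assume d: "d \<in> set B"
  obtain p q where pq: "d = (p, q)" by fastforce
  then have "{h ! p, h ! q} \<in> pat_edges Q" using em(4) d by blast
  then obtain s t where st: "(s, t) \<in> set Q" "{h ! p, h ! q} = {s, t}" by (auto simp: pat_edges_def)
  have "{g (h ! p), g (h ! q)} = g ` {s, t}" using st(2) by (metis image_empty image_insert)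
  then show "case d of (i, j) \<Rightarrow> {g (h ! i), g (h ! j)} \<in> edges G" using E[OF st(1)] pq by simp
qed

lemma exists_max_degree:
  assumes "simple_graph G" "verts G \<noteq> {}"
  obtains v where "v \<in> verts G" "\<And>x. x \<in> verts G \<Longrightarrow> card (nbrs G x) \<le> card (nbrs G v)"
proof -
  have fin: "finite (verts G)" using assms by (simp add: simple_graph_def)
  have "Max ((\<lambda>x. card (nbrs G x)) ` verts G) \<in> (\<lambda>x. card (nbrs G x)) ` verts G"
    by (rule Max_in) (use fin assms(2) in auto)
  then obtain v where v: "v \<in> verts G" "Max ((\<lambda>x. card (nbrs G x)) ` verts G) = card (nbrs G v)" by blast
  show ?thesis
  proof (rule that[OF v(1)])
    show "card (nbrs G x) \<le> card (nbrs G v)" if "x \<in> verts G" for x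
      unfolding v(2)[symmetric] using fin that by (intro Max_ge) auto
  qed
qed

lemma extend_bij_betw:
  assumes "finite A" "finite B" "card A = card B" "S \<subseteq> A" "inj_on f S" "f ` S \<subseteq> B"
  obtains g where "bij_betw g A B" "\<And>x. x \<in> S \<Longrightarrow> g x = f x"
proof -
  have "card (A - S) = card (B - f ` S)"
    using assms by (simp add: card_Diff_subset card_image finite_subset)
  then obtain h where h: "bij_betw h (A - S) (B - f ` S)"
    using finite_same_card_bij assms(1,2) by (metis finite_Diff)
  define g where "g x = (if x \<in> S then f x else h x)" for x
  have "bij_betw g S (f ` S)" using assms(5) by (auto simp: g_def bij_betw_def inj_on_def)
  moreover have "bij_betw g (A - S) (B - f ` S)"
    using h bij_betw_cong[of "A - S" g h] by (simp add: g_def)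
  ultimately have "bij_betw g (S \<union> (A - S)) (f ` S \<union> (B - f ` S))" by (rule bij_betw_combine) auto
  moreover have "S \<union> (A - S) = A" "f ` S \<union> (B - f ` S) = B" using assms by auto
  ultimately show ?thesis using that[of g] by (simp add: g_def)
qed

lemma min_degree_card_verts:
  assumes G: "simple_graph G" and min: "\<And>x. x \<in> verts G \<Longrightarrow> 3 \<le> card (nbrs G x)"
  shows "3 * card (verts G) \<le> 2 * card (edges G)" "x \<in> verts G \<Longrightarrow> 4 \<le> card (verts G)"
proof -
  have "(\<Sum>x\<in>verts G. 3) \<le> (\<Sum>x\<in>verts G. card (nbrs G x))" by (rule sum_mono) (rule min)
  then show "3 * card (verts G) \<le> 2 * card (edges G)" using sum_card_nbrs[OF G] by simp
  assume x: "x \<in> verts G"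
  have fin: "finite (verts G)" using G by (simp add: simple_graph_def)
  have "card (nbrs G x) \<le> card (verts G - {x})" using nbrs_subset[OF G] fin by (intro card_mono) auto
  then show "4 \<le> card (verts G)" using min[OF x] x fin by simp
qed

definition contains_base :: "'a ugraph \<Rightarrow> bool" where
  "contains_base H \<longleftrightarrow> (\<exists>(m, B)\<in>set bases. \<exists>f. pat_in B f H)"

definition base_terminal :: "nat \<Rightarrow> pattern \<times> nat \<times> nat list \<Rightarrow> bool" where
  "base_terminal n = (\<lambda>(Q, b, h). in_range n Q \<and> nth_ok bases b (embeds n Q h))"

text \<open>24 is twice 12. The only root is the empty pattern, and its reference to index 0 means
  the last node.\<close>

definition kuratowski_certificate ::
    "nat \<Rightarrow> (point list \<times> pattern) list \<Rightarrow> (pattern \<times> nat \<times> nat list) list \<Rightarrow> proof_node list \<Rightarrow> bool" where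
  "kuratowski_certificate n draws terms nodes \<longleftrightarrow> list_all (drawing_ok n) draws \<and> list_all (base_terminal n) terms \<and>
     run n 24 (map snd draws) (map fst terms) nodes [([], 0, [])]"

lemma contains_base_if_certificate:
  assumes H: "simple_graph H" and np: "\<not> line_planar H" and e: "card (edges H) \<le> 12"
    and min: "\<And>x. x \<in> verts H \<Longrightarrow> 3 \<le> card (nbrs H x)" and ne: "verts H \<noteq> {}"
    and cert: "kuratowski_certificate (card (verts H)) draws terms nodes"
  shows "contains_base H"
proof -
  define n where "n = card (verts H)"
  have ok: "list_all (drawing_ok n) draws" "list_all (base_terminal n) terms"
    "run n 24 (map snd draws) (map fst terms) nodes [([], 0, [])]"
    using cert unfolding kuratowski_certificate_def n_def by auto
  obtain v where v: "v \<in> verts H" "\<And>x. x \<in> verts H \<Longrightarrow> card (nbrs H x) \<le> card (nbrs H v)"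
    using exists_max_degree[OF H ne] by metis
  interpret sparse_graph H n 24 v "map snd draws"
  proof
    fix C f assume "C \<in> set (map snd draws)" and f: "bij_betw f {..<n} (verts H)"
    then obtain pts where "(pts, C) \<in> set draws" by auto
    then have "drawing_ok n (pts, C)" using ok(1) by (auto simp: list_all_iff)
    from drawing_ok_cover[OF this H f np]
    show "\<exists>(p, q)\<in>set C. p < n \<and> q < n \<and> {f p, f q} \<in> edges H" .
  qed (use H v min e n_def in auto)
  have fin: "finite (verts H)" using H by (simp add: simple_graph_def)
  obtain f where f: "bij_betw f {..<n} (verts H)" "\<And>x. x \<in> {0} \<Longrightarrow> f x = v"
    by (rule extend_bij_betw[of "{..<n}" "verts H" "{0}" "\<lambda>_. v"]) (use fin v(1) n_pos in \<open>auto simp: n_def\<close>)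
  have lab: "labelling f" using f by (simp add: labelling_def)
  have "in_range n Q \<and> implies Q (contains_base H)" if Q: "Q \<in> set (map fst terms)" for Q
  proof -
    obtain b h where "(Q, b, h) \<in> set terms" using Q by auto
    then have rng: "in_range n Q" and "nth_ok bases b (embeds n Q h)"
      using ok(2) by (auto simp: list_all_iff base_terminal_def)
    then obtain m B where B: "(m, B) \<in> set bases" "embeds n Q h (m, B)" using nth_okD by fastforce
    have "contains_base H" if g: "labelling g" "holds g Q" for g
    proof -
      have "inj_on g {..<n}" using g(1) by (simp add: labelling_def bij_betw_def)
      from embeds_pat_in[OF B(2) rng this] have "pat_in B (\<lambda>i. g (h ! i)) H" using g(2) by (auto simp: holds_def)
      then show ?thesis unfolding contains_base_def using B(1) by blast
    qed
    then show ?thesis using rng unfolding implies_def by blast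
  qed
  then show ?thesis
    using run_sound[OF ok(3), of "contains_base H" "[]" "(0, [])" f] lab by (simp add: holds_def)
qed

text \<open>If the base uses the edge made by the suppression, routing that edge over
  \<open>x\<close> gives a subdivided base in \<open>G\<close>. The suppressed graph has fewer edges
  than \<open>G\<close>, so the base had fewer than 12, and its subdivision again contains a
  base.\<close>

lemma contains_base_suppress:
  assumes G: "simple_graph G" and x: "x \<in> verts G" and ab: "nbrs G x = {a, b}" "a \<noteq> b"
    and e: "card (edges G) \<le> 12" and base: "contains_base (suppress G x a b)"
  shows "contains_base G"
proof -
  let ?H = "suppress G x a b"
  obtain m B f where B: "(m, B) \<in> set bases" and f: "pat_in B f ?H" using base unfolding contains_base_def by blast
  have sH: "simple_graph ?H" by (rule simple_suppress[OF G ab])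
  have spB: "spans m B" using bases_span B by (auto simp: list_all_iff)
  have bp: "base_pat (m, B)" using base_pat_bases B by blast
  have BV: "pat_verts B = {..<m}" "in_range m B" using spans_verts[OF spB] by auto
  have dB: "edge_distinct B" using bases_edge_distinct B by (auto simp: list_all_iff)
  have inj: "inj_on f {..<m}" and fE: "\<And>i j. (i, j) \<in> set B \<Longrightarrow> {f i, f j} \<in> edges ?H"
    using f BV by (auto simp: pat_in_def)
  have fx: "f i \<noteq> x" if "i < m" for i
  proof -
    have "i \<in> pat_verts B" using that BV(1) by simp
    then obtain p q where "(p, q) \<in> set B" "i \<in> {p, q}" by (auto simp: pat_verts_def)
    then have "f i \<in> verts ?H" using fE sH unfolding simple_graph_def by blast
    then show ?thesis by (auto simp: suppress_def)
  qed
  show ?thesis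
  proof (cases "\<forall>(i, j)\<in>set B. {f i, f j} \<in> edges G")
    case True
    then have "pat_in B f G" using f by (auto simp: pat_in_def)
    then show ?thesis using B unfolding contains_base_def by blast
  next
    case False
    then obtain i j where ij: "(i, j) \<in> set B" "{f i, f j} \<notin> edges G" by auto
    then have fij: "{f i, f j} = {a, b}" using fE[OF ij(1)] by (auto simp: suppress_def)
    obtain k where k: "k < length B" "B ! k = (i, j)" using ij(1) by (metis in_set_conv_nth)
    have lt: "i < m" "j < m" using ij(1) BV(2) by (auto simp: in_range_def list_all_iff)
    \<comment> \<open>The new label \<open>m\<close> of the subdivision goes to the suppressed
      vertex.\<close>
    define g where "g = f(m := x)"
    have gE: "{g p, g q} \<in> edges G" if "(p, q) \<in> set (subdivide B k m)" for p q
    proof -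
      have xa: "{x, a} \<in> edges G" "{x, b} \<in> edges G" using ab(1) by (auto simp: nbrs_def)
      have endp: "{g y, g m} \<in> edges G" if "y \<in> {i, j}" for y
      proof -
        have "y < m" "f y \<in> {a, b}" using that lt fij by auto
        then show ?thesis using xa by (auto simp: g_def insert_commute)
      qed
      have old: "{g p, g q} \<in> edges G" if "(p, q) \<in> set B" "{p, q} \<noteq> {i, j}" for p q
      proof -
        have pq: "p < m" "q < m" using that(1) BV(2) by (auto simp: in_range_def list_all_iff)
        have "f ` {p, q} \<noteq> f ` {i, j}" using inj_on_image_eq_iff[OF inj, of "{p, q}" "{i, j}"] that(2) pq lt by auto
        then have "{f p, f q} \<in> edges G" using fE[OF that(1)] fij by (auto simp: suppress_def)
        then show ?thesis using pq by (simp add: g_def)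
      qed
      show ?thesis
      proof (cases "(p, q) = (i, m) \<or> (p, q) = (j, m)")
        case True
        then show ?thesis using endp by auto
      next
        case False
        have "(p, q) \<in> set B" using that False set_subdivide_subset[OF k(1), of m] k(2) by auto
        \<comment> \<open>The subdivided edge does not occur a second time, because the base lists
          each edge once and position \<open>k\<close> has been overwritten.\<close>
        moreover have "{p, q} \<noteq> {i, j}"
        proof
          assume "{p, q} = {i, j}"
          have "(p, q) \<in> set (B[k := (i, m)]) " using that False k(2) by (auto simp: subdivide_def)
          then obtain k' where k': "k' < length B" "B[k := (i, m)] ! k' = (p, q)" by (metis in_set_conv_nth length_list_update)
          have "k' \<noteq> k" using k' k False by auto
          then have "B ! k' = (p, q)" using k' by simp
          then show False using edge_distinct_nth[OF dB k(1) k'(1) k(2)] \<open>{p, q} = {i, j}\<close> \<open>k' \<noteq> k\<close> by simp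
        qed
        ultimately show ?thesis using old by blast
      qed
    qed
    have ginj: "inj_on g {..<Suc m}"
    proof -
      have "x \<notin> f ` {..<m}" using fx by blast
      then show ?thesis using inj by (auto simp: g_def inj_on_def less_Suc_eq)
    qed
    \<comment> \<open>The base sits in the suppressed graph, which has strictly fewer edges than
      \<open>G\<close>.\<close>
    have "length B < 12"
    proof -
      have "inj_on ((`) f) (pat_edges B)"
        by (rule inj_on_subset[OF inj_on_image_Pow[OF inj]]) (use BV(1) in \<open>auto simp: pat_verts_Union\<close>)
      then have "length B = card ((`) f ` pat_edges B)" using card_pat_edges[OF dB] by (simp add: card_image)
      also have "\<dots> \<le> card (edges ?H)"
        using fE finite_edges[OF sH] by (intro card_mono) (auto simp: pat_edges_def)
      also have "\<dots> < card (edges G)" by (rule card_edges_suppress[OF G ab])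
      finally show ?thesis using e by simp
    qed
    from bases_closed_under_subdivision[OF B this k(1)]
    obtain m' B' h where B': "(m', B') \<in> set bases" "embeds (Suc m) (subdivide B k m) h (m', B')" by blast
    have rng: "in_range (Suc m) (subdivide B k m)" using base_pat_subdivide[OF bp k(1)] by (simp add: base_pat_def)
    have "pat_in B' (\<lambda>i. g (h ! i)) G" by (rule embeds_pat_in[OF B'(2) rng ginj gE])
    then show ?thesis using B'(1) unfolding contains_base_def by blast
  qed
qed

section \<open>Petersen minors in patterns\<close>

fun arcs :: "nat \<Rightarrow> nat list list \<Rightarrow> pattern" where
  "arcs i [] = []"
| "arcs i (js # rs) = map (Pair i) js @ arcs (Suc i) rs"

text \<open>Short notation for the certificates: the list at place \<open>i\<close> holds the labels
  paired with \<open>i\<close>.\<close>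

definition adj :: "nat list list \<Rightarrow> pattern" where
  "adj = arcs 0"

text \<open>Frees label 0 for the vertex of maximum degree, whose deletion leaves the base.\<close>

definition shift_pat :: "pattern \<Rightarrow> pattern" where
  "shift_pat P = map (\<lambda>(i, j). (Suc i, Suc j)) P"

definition merge_vertex :: "nat \<Rightarrow> nat \<Rightarrow> nat \<Rightarrow> nat" where
  "merge_vertex u v x = (if x = v then u else x)"

definition contract_pat :: "nat \<Rightarrow> nat \<Rightarrow> pattern \<Rightarrow> pattern" where
  "contract_pat u v Q = map (\<lambda>(i, j). (merge_vertex u v i, merge_vertex u v j))
     (filter (\<lambda>(i, j). \<not> (i = u \<and> j = v \<or> i = v \<and> j = u)) Q)"

definition occurs :: "nat \<Rightarrow> pattern \<Rightarrow> bool" where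
  "occurs x P \<longleftrightarrow> list_ex (\<lambda>(i, j). i = x \<or> j = x) P"

text \<open>The pattern is a member of the family, or becomes one when the edge
  \<open>(u, v)\<close> is contracted. The clause with \<open>occurs\<close> ensures that no vertex
  turns isolated by the contraction; patterns have no isolated vertices, while
  \<open>contract_edge\<close> would keep one.\<close>

fun petersen_terminal :: "nat \<Rightarrow> pattern \<times> (nat \<times> nat) option \<times> nat \<times> nat list \<Rightarrow> bool" where
  "petersen_terminal n (Q, None, r, h) \<longleftrightarrow> in_range n Q \<and> nth_ok reps r (isomorphic n Q h)"
| "petersen_terminal n (Q, Some (u, v), r, h) \<longleftrightarrow> in_range n Q \<and> u < n \<and> v < n \<and> u \<noteq> v \<and> List.member Q (u, v) \<and>
     list_all (\<lambda>(i, j). occurs (merge_vertex u v i) (contract_pat u v Q) \<and> occurs (merge_vertex u v j) (contract_pat u v Q)) Q \<and>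
     nth_ok reps r (isomorphic n (contract_pat u v Q) h)"

definition petersen_minor :: "'a ugraph \<Rightarrow> bool" where
  "petersen_minor G \<longleftrightarrow> (\<exists>H. is_minor H G \<and> is_rep H)"

lemma occurs_iff: "occurs x P \<longleftrightarrow> x \<in> pat_verts P"
  by (auto simp: occurs_def pat_verts_def list_ex_iff)

lemma pat_edges_contract_pat: "pat_edges (contract_pat u v Q) = (`) (merge_vertex u v) ` (pat_edges Q - {{u, v}})"
proof -
  have "filter (\<lambda>(i, j). \<not> (i = u \<and> j = v \<or> i = v \<and> j = u)) Q = filter (\<lambda>(i, j). {i, j} \<notin> {{u, v}}) Q"
    by (intro filter_cong) (auto simp: doubleton_eq_iff)
  then have "pat_edges (contract_pat u v Q) = (`) (merge_vertex u v) ` pat_edges (filter (\<lambda>(i, j). {i, j} \<notin> {{u, v}}) Q)"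
    unfolding contract_pat_def by (simp only:) (simp add: pat_edges_def image_image split_beta)
  then show ?thesis by (simp only: pat_edges_filter)
qed

lemma simple_graph_edge: "simple_graph G \<Longrightarrow> e \<in> edges G \<Longrightarrow> e \<subseteq> verts G \<and> card e = 2"
  by (simp add: simple_graph_def)

lemma pat_image_subgraph:
  assumes G: "simple_graph G" and Q: "\<And>i j. (i, j) \<in> set Q \<Longrightarrow> {f i, f j} \<in> edges G" and inj: "inj_on f (pat_verts Q)"
  defines "K \<equiv> \<lparr>verts = f ` pat_verts Q, edges = (`) f ` pat_edges Q\<rparr>"
  shows "subgraph K G" "pat_iso Q f K"
proof -
  have E: "f ` e \<in> edges G" if "e \<in> pat_edges Q" for e using that Q by (auto simp: pat_edges_def)
  have "finite (f ` pat_verts Q)" by (auto simp: pat_verts_def)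
  moreover have "f ` e \<subseteq> f ` pat_verts Q" if "e \<in> pat_edges Q" for e using that by (auto simp: pat_verts_Union)
  moreover have "f ` e \<subseteq> verts G" "card (f ` e) = 2" if "e \<in> pat_edges Q" for e
    using simple_graph_edge[OF G E[OF that]] by auto
  moreover have "f ` pat_verts Q \<subseteq> verts G" using calculation(3) unfolding pat_verts_Union by blast
  ultimately show "subgraph K G" unfolding subgraph_def simple_graph_def K_def using E by auto
  show "pat_iso Q f K" using inj by (simp add: pat_iso_def K_def)
qed

text \<open>The image of the pattern is a subgraph of \<open>G\<close>, and contracting an edge of
  the pattern commutes with taking the image.\<close>

lemma petersen_terminal_minor:
  assumes G: "simple_graph G" and t: "petersen_terminal n (Q, c, r, h)" and inj: "inj_on f {..<n}"
    and Q: "\<And>i j. (i, j) \<in> set Q \<Longrightarrow> {f i, f j} \<in> edges G"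
  shows "petersen_minor G"
proof -
  have rng: "in_range n Q" using t by (cases c) auto
  have QV: "pat_verts Q \<subseteq> {..<n}" by (rule in_range_verts[OF rng])
  have injQ: "inj_on f (pat_verts Q)" using inj QV by (rule inj_on_subset)
  define K where "K = \<lparr>verts = f ` pat_verts Q, edges = (`) f ` pat_edges Q\<rparr>"
  have K: "subgraph K G" "pat_iso Q f K" using pat_image_subgraph[OF G Q injQ] unfolding K_def by auto
  show ?thesis
  proof (cases c)
    case None
    then obtain m P where "(m, P) \<in> set reps" "isomorphic n Q h (m, P)" using t nth_okD by fastforce
    then have "is_rep K" using pat_iso_isomorphic K(2) by blast
    then show ?thesis using K(1) contracts_refl unfolding petersen_minor_def is_minor_def by blast
  next
    case (Some uv)
    then obtain u v where c: "c = Some (u, v)" by (cases uv) auto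
    let ?Q = "contract_pat u v Q" and ?r = "merge_vertex u v"
    have uv: "u < n" "v < n" "u \<noteq> v" "(u, v) \<in> set Q"
      and oc: "\<And>i j. (i, j) \<in> set Q \<Longrightarrow> ?r i \<in> pat_verts ?Q \<and> ?r j \<in> pat_verts ?Q"
      using t c by (auto simp: list_all_iff occurs_iff)
    obtain m P where P: "(m, P) \<in> set reps" "isomorphic n ?Q h (m, P)" using t c nth_okD by fastforce
    have uvV: "u \<in> pat_verts Q" "v \<in> pat_verts Q" using uv(4) by (force simp: pat_verts_def)+
    have V: "pat_verts ?Q = ?r ` pat_verts Q"
    proof
      show "pat_verts ?Q \<subseteq> ?r ` pat_verts Q" unfolding pat_verts_Union pat_edges_contract_pat by auto
      show "?r ` pat_verts Q \<subseteq> pat_verts ?Q" using oc by (auto simp: pat_verts_def[of Q])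
    qed
    \<comment> \<open>The vertex map of \<open>contract_edge\<close>; on images it agrees with
      \<open>merge_vertex\<close> on labels.\<close>
    define F where "F = (\<lambda>x. if x = f v then f u else x)"
    have Ff: "F (f i) = f (?r i)" if "i \<in> pat_verts Q" for i
      using injQ that uvV by (auto simp: F_def merge_vertex_def dest: inj_onD)
    have e_sub: "e \<subseteq> pat_verts Q" if "e \<in> pat_edges Q" for e using that by (auto simp: pat_verts_Union)
    have Fe: "F ` f ` e = f ` ?r ` e" if "e \<in> pat_edges Q" for e
      unfolding image_image by (rule image_cong) (use Ff e_sub[OF that] in auto)
    have fuv: "f ` e = {f u, f v} \<longleftrightarrow> e = {u, v}" if "e \<in> pat_edges Q" for e
      using inj_on_image_eq_iff[OF injQ e_sub[OF that], of "{u, v}"] uvV by simp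
    have "contract_edge K (f u) (f v) = \<lparr>verts = f ` pat_verts ?Q, edges = (`) f ` pat_edges ?Q\<rparr>"
    proof -
      have "F ` f ` pat_verts Q = f ` pat_verts ?Q"
        unfolding V image_image by (rule image_cong) (use Ff in auto)
      moreover have "(`) F ` ((`) f ` pat_edges Q - {{f u, f v}}) = (`) f ` pat_edges ?Q"
      proof -
        have "(`) f ` pat_edges Q - {{f u, f v}} = (`) f ` (pat_edges Q - {{u, v}})" using fuv by auto
        then show ?thesis
          unfolding pat_edges_contract_pat by (simp only: image_image) (rule image_cong, use Fe in \<open>auto simp: image_image\<close>)
      qed
      ultimately show ?thesis unfolding contract_edge_def Let_def F_def[symmetric] K_def by simp
    qed
    moreover have "inj_on f (pat_verts ?Q)"
    proof -
      have "?r ` pat_verts Q \<subseteq> pat_verts Q" using uvV by (auto simp: merge_vertex_def)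
      then show ?thesis using injQ V by (metis inj_on_subset)
    qed
    ultimately have "pat_iso ?Q f (contract_edge K (f u) (f v))" by (simp add: pat_iso_def)
    then have "is_rep (contract_edge K (f u) (f v))" using pat_iso_isomorphic P by blast
    moreover have "{f u, f v} \<in> edges K"
    proof -
      have "{u, v} \<in> pat_edges Q" using uv(4) by (intro pat_edgesI) auto
      then have "f ` {u, v} \<in> edges K" unfolding K_def ugraph.simps by (rule imageI)
      then show ?thesis by simp
    qed
    moreover have "f u \<noteq> f v" using injQ uvV uv(3) by (auto dest: inj_onD)
    ultimately have "contracts_to K (contract_edge K (f u) (f v))"
      by (intro contracts_step contracts_refl)
    then show ?thesis
      unfolding petersen_minor_def is_minor_def using K(1) \<open>is_rep (contract_edge K (f u) (f v))\<close> by metis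
  qed
qed

text \<open>32 is twice 16. The drawings have \<open>n - 1\<close> points since label
  \<open>n - 1\<close> is the one deleted; the permutation of a \<open>Cover\<close> node decides
  which vertex that is. The roots are all bases that leave room for label 0.\<close>

definition apex_certificate :: "nat \<Rightarrow> (point list \<times> pattern) list \<Rightarrow>
    (pattern \<times> (nat \<times> nat) option \<times> nat \<times> nat list) list \<Rightarrow> proof_node list \<Rightarrow> (nat \<times> nat list) list \<Rightarrow> bool" where
  "apex_certificate n draws terms nodes root_certs \<longleftrightarrow>
     list_all (drawing_ok (n - 1)) draws \<and> list_all (petersen_terminal n) terms \<and>
     (let Bs = filter (\<lambda>(m, B). m < n) bases in length Bs = length root_certs \<and>
       run n 32 (map snd draws) (map fst terms) nodes (map2 (\<lambda>(m, B) c. (shift_pat B, c)) Bs root_certs))"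

text \<open>If the maximum degree is 3, the graph is cubic, so 3 divides twice the number of edges.
  This rules out 16 edges, and at most 15 - 3 remain; otherwise at least 4 edges are lost.\<close>

lemma max_degree_del_vertex:
  assumes G: "simple_graph G" and v: "v \<in> verts G" "\<And>x. x \<in> verts G \<Longrightarrow> card (nbrs G x) \<le> card (nbrs G v)"
    and min: "\<And>x. x \<in> verts G \<Longrightarrow> 3 \<le> card (nbrs G x)" and e: "card (edges G) \<le> 16"
  shows "card (edges (del_vertex G v)) \<le> 12"
proof (cases "card (nbrs G v) = 3")
  case True
  then have "card (nbrs G x) = 3" if "x \<in> verts G" for x using v(2)[OF that] min[OF that] by simp
  then have "3 * card (verts G) = 2 * card (edges G)" using sum_card_nbrs[OF G] by simp
  then have "card (edges G) \<le> 15" using e by presburger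
  then show ?thesis using card_edges_del_vertex[OF G, of v] True by simp
next
  case False
  then show ?thesis using card_edges_del_vertex[OF G, of v] min[OF v(1)] e by simp
qed

lemma petersen_minor_if_certificate:
  assumes G: "simple_graph G" and na: "\<not> line_apex G" and e: "card (edges G) \<le> 16"
    and min: "\<And>x. x \<in> verts G \<Longrightarrow> 3 \<le> card (nbrs G x)"
    and v: "v \<in> verts G" "\<And>x. x \<in> verts G \<Longrightarrow> card (nbrs G x) \<le> card (nbrs G v)"
    and base: "contains_base (del_vertex G v)"
    and cert: "apex_certificate (card (verts G)) draws terms nodes root_certs"
  shows "petersen_minor G"
proof -
  define n where "n = card (verts G)"
  have fin: "finite (verts G)" using G by (simp add: simple_graph_def)
  have n0: "0 < n" using v(1) fin by (auto simp: n_def card_gt_0_iff)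
  define Bs where "Bs = filter (\<lambda>(m, B). m < n) bases"
  have ok: "list_all (drawing_ok (n - 1)) draws" "list_all (petersen_terminal n) terms" "length Bs = length root_certs"
    "run n 32 (map snd draws) (map fst terms) nodes (map2 (\<lambda>(m, B) c. (shift_pat B, c)) Bs root_certs)"
    using cert unfolding apex_certificate_def n_def Bs_def Let_def by auto
  interpret sparse_graph G n 32 v "map snd draws"
  proof
    fix C f assume "C \<in> set (map snd draws)" and f: "bij_betw f {..<n} (verts G)"
    then obtain pts where "(pts, C) \<in> set draws" by auto
    then have dr: "drawing_ok (n - 1) (pts, C)" using ok(1) by (auto simp: list_all_iff)
    \<comment> \<open>The drawings use the labels below \<open>n - 1\<close>, hence cover the graph
      without this vertex. That graph has no straight-line drawing, since \<open>G\<close> is not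
      straight-line apex.\<close>
    let ?w = "f (n - 1)"
    have "{..<n} = insert (n - 1) {..<n - 1}" using n0 by auto
    then have "bij_betw f {..<n - 1} (verts G - {?w})"
      using f bij_betw_DiffI[OF f, of "{n - 1}" "{?w}"] n0 by (auto simp: bij_betw_def)
    then have bij: "bij_betw f {..<n - 1} (verts (del_vertex G ?w))" by (simp add: del_vertex_def)
    have "?w \<in> verts G" using f n0 by (auto simp: bij_betw_def)
    then have "\<not> line_planar (del_vertex G ?w)" using na unfolding line_apex_def by blast
    from drawing_ok_cover[OF dr simple_del_vertex[OF G] bij this]
    obtain i j where "(i, j) \<in> set C" "i < n - 1" "j < n - 1" "{f i, f j} \<in> edges (del_vertex G ?w)" by auto
    then show "\<exists>(p, q)\<in>set C. p < n \<and> q < n \<and> {f p, f q} \<in> edges G"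
      by (intro bexI[of _ "(i, j)"]) (auto simp: del_vertex_def)
  qed (use G v min e n_def in auto)
  obtain m B f where B: "(m, B) \<in> set bases" and f: "pat_in B f (del_vertex G v)"
    using base unfolding contains_base_def by blast
  have BV: "pat_verts B = {..<m}" using bases_span B spans_verts by (fastforce simp: list_all_iff)
  have fE: "\<And>i j. (i, j) \<in> set B \<Longrightarrow> {f i, f j} \<in> edges (del_vertex G v)" and inj: "inj_on f {..<m}"
    using f BV by (auto simp: pat_in_def)
  have fV: "f i \<in> verts G - {v}" if "i < m" for i
  proof -
    have "i \<in> pat_verts B" using that BV by simp
    then obtain p q where "(p, q) \<in> set B" "i \<in> {p, q}" by (auto simp: pat_verts_def)
    then have "f i \<in> verts (del_vertex G v)" using fE simple_del_vertex[OF G, of v] unfolding simple_graph_def by blast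
    then show ?thesis by (simp add: del_vertex_def)
  qed
  have "card (f ` {..<m}) \<le> card (verts G - {v})" using fV fin by (intro card_mono) auto
  then have mn: "m < n" using inj v(1) fin n0 by (simp add: card_image n_def)
  \<comment> \<open>\<open>v\<close> takes label 0 and the base is shifted by one, in accordance
    with \<open>shift_pat\<close>.\<close>
  define F where "F i = (case i of 0 \<Rightarrow> v | Suc i \<Rightarrow> f i)" for i
  have F: "F 0 = v" "F (Suc i) = f i" for i by (simp_all add: F_def)
  have lt: "{..<Suc m} = insert 0 (Suc ` {..<m})" by (auto simp: image_iff less_Suc_eq_0_disj)
  have injF: "inj_on F {..<Suc m}"
  proof -
    have "v \<notin> f ` {..<m}" using fV by auto
    then show ?thesis using inj unfolding lt by (auto simp: F inj_on_def)
  qed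
  obtain g where g: "bij_betw g {..<n} (verts G)" "\<And>x. x \<in> {..<Suc m} \<Longrightarrow> g x = F x"
    by (rule extend_bij_betw[of "{..<n}" "verts G" "{..<Suc m}" F])
      (use fin mn injF fV v(1) in \<open>auto simp: n_def lt F\<close>)
  have lab: "labelling g" using g F(1) by (simp add: labelling_def)
  have hold: "holds g (shift_pat B)"
  proof -
    have "{g (Suc i), g (Suc j)} \<in> edges G" if "(i, j) \<in> set B" for i j
    proof -
      have "i < m" "j < m" using that BV by (force simp: pat_verts_def)+
      then show ?thesis using fE[OF that] g(2) by (simp add: F del_vertex_def)
    qed
    then show ?thesis by (auto simp: holds_def shift_pat_def)
  qed
  have "in_range n Q \<and> implies Q (petersen_minor G)" if Q: "Q \<in> set (map fst terms)" for Q
  proof -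
    obtain c r h where "(Q, c, r, h) \<in> set terms" using Q by auto
    then have t: "petersen_terminal n (Q, c, r, h)" using ok(2) by (auto simp: list_all_iff)
    have "petersen_minor G" if g: "labelling g" "holds g Q" for g
    proof (rule petersen_terminal_minor[OF G t])
      show "inj_on g {..<n}" using g(1) by (simp add: labelling_def bij_betw_def)
      show "{g i, g j} \<in> edges G" if "(i, j) \<in> set Q" for i j using g(2) that by (auto simp: holds_def)
    qed
    moreover have "in_range n Q" using t by (cases c) auto
    ultimately show ?thesis unfolding implies_def by simp
  qed
  moreover obtain c where "(shift_pat B, c) \<in> set (map2 (\<lambda>(m, B) c. (shift_pat B, c)) Bs root_certs)"
  proof -
    have "(m, B) \<in> set Bs" using B mn by (simp add: Bs_def)
    then obtain k where k: "k < length Bs" "Bs ! k = (m, B)" by (metis in_set_conv_nth)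
    let ?L = "map2 (\<lambda>(m, B) c. (shift_pat B, c)) Bs root_certs"
    have L: "?L ! k = (shift_pat B, root_certs ! k)" "k < length ?L" using k ok(3) by simp_all
    show ?thesis using nth_mem[OF L(2)] unfolding L(1) by (rule that)
  qed
  ultimately show ?thesis using run_sound[OF ok(4) _ _ lab hold] by metis
qed

section \<open>The certificates\<close>

text \<open>The drawing is that of the complete graph on four vertices. Its list of missing pairs is
  empty, so the empty pattern closes at once and there is nothing to reach.\<close>

lemma kuratowski_certificate_4: "kuratowski_certificate 4
    [([(1,0),(3,0),(0,2),(1,1)], adj [])]
    []
    [(adj [], Cover 0 [0,1,3,2], [])]"
  by code_simp

lemma kuratowski_certificate_5: "kuratowski_certificate 5
    [([(0,0),(1,1),(2,1),(3,0),(1,3)], adj [[2]])]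
    [(adj [[1,2,3,4],[2,3,4],[3,4],[4]], 1, [0,1,2,3,4])]
    [(adj [[1,2,3,4],[2,3],[3,4],[4]], Cover 0 [4,2,1,3,0], [(0,[])]),
     (adj [[1,2,3,4],[3],[3,4],[4]], Cover 0 [1,4,2,0,3], [(0,[])]),
     (adj [[1,2,3,4],[],[3,4],[4]], Cover 0 [1,0,3,2,4], [(0,[])]),
     (adj [[1,3,4],[],[3,4],[4]], Cover 0 [0,4,2,1,3], [(0,[])]),
     (adj [[1,3,4],[],[3],[4]], Cover 0 [2,1,4,3,0], [(0,[])]),
     (adj [[1,3,4],[],[3]], Cover 0 [4,0,3,2,1], [(0,[])]),
     (adj [[1,3],[],[3]], Cover 0 [0,1,4,2,3], [(0,[])]),
     (adj [[1],[],[3]], Cover 0 [0,1,3,4,2], [(0,[])]),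
     (adj [[],[],[3]], Cover 0 [1,3,0,4,2], [(0,[])]),
     (adj [], Cover 0 [2,4,3,0,1], [(0,[])])]"
  by code_simp

text \<open>The drawn graph is \<open>K5\<close> minus an edge, so each node has a single candidate;
  all ten edges are forced one after the other.\<close>

lemma kuratowski_certificate_6: "kuratowski_certificate 6
    [([(0,0),(5,2),(2,3),(1,3),(1,1),(0,4)], adj [[2,3],[3]]),
     ([(0,0),(4,1),(2,2),(1,4),(1,2),(2,1)], adj [[2],[4],[],[5]])]
    [(adj [[1,2,3,5],[2,3,4],[3,4],[4],[5]], 13, [0,4,1,2,3,5]),
     (adj [[1,2,3,4],[2,3,4],[3,4],[5],[5]], 13, [3,4,0,1,2,5]),
     (adj [[3,4,5],[3,4,5],[3,4,5]], 0, [0,1,2,3,4,5]),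
     (adj [[1,2,3,4],[2,3,4],[3,4],[4]], 1, [0,1,2,3,4])]
    [(adj [[1,2,3,4],[2,3,4,5],[3,4,5]], At 5, [(2,[])]),
     (adj [[1,2,3,4],[2,3,4,5],[3,4],[5]], Cover 0 [5,3,2,4,1,0], []),
     (adj [[1,2,3,4],[2,3,4,5],[3,4]], Cover 0 [3,2,4,5,1,0], [(0,[]),(1,[])]),
     (adj [[1,2,3,4],[2,3,4],[3,4],[5]], Cover 0 [4,2,3,5,0,1], [(4,[]),(0,[0,2,1])]),
     (adj [[1,2,3,4],[2,3,4],[3,4]], Cover 0 [3,1,4,5,2,0], [(7,[]),(0,[]),(1,[])]),
     (adj [[1,2,3],[2,3,4],[3,4],[4,5]], Cover 0 [4,2,0,5,1,3], []),
     (adj [[1,2,3],[2,3,4],[3,4],[4],[5]], Cover 0 [5,4,1,0,2,3], [(6,[])]),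
     (adj [[1,2,3],[2,3,4],[3,4],[4]], Cover 0 [4,3,0,5,2,1], [(2,[]),(0,[]),(1,[])]),
     (adj [[1,2,3,5],[2,3,4],[3,4],[],[5]], Cover 0 [4,5,0,3,2,1], [(3,[]),(0,[]),(10,[0,3,4,1,2])]),
     (adj [[1,2,3],[2,3,4],[3,4],[],[5]], Cover 0 [4,5,3,0,2,1], [(1,[]),(4,[]),(0,[])]),
     (adj [[1,2,3],[2,3,4],[3,4]], At 4, [(5,[]),(2,[]),(0,[])]),
     (adj [[1,2,3],[2,3,4],[3,5]], Cover 0 [3,1,4,5,0,2], [(0,[0,1,3,2]),(0,[0,2,3,1,5,4]),(0,[0,1,2,3,5,4])]),
     (adj [[1,2,3],[2,3,4],[3]], Cover 0 [2,3,5,4,0,1], [(0,[]),(1,[]),(1,[0,1,3,2])]),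
     (adj [[1,2,3],[2,4,5],[3,5],[4,5]], Cover 1 [0,4,5,1,2,3], [(0,[0,1,2,5,4,3]),(15,[0,4,5,3,1,2])]),
     (adj [[1,2,3],[2,4,5],[3,5],[4]], Cover 0 [3,0,1,5,2,4], [(1,[]),(0,[]),(1,[0,1,2,5,4,3])]),
     (adj [[1,2,3],[2,4],[3,5],[4],[5]], At 5, [(17,[0,2,4,3,1]),(0,[]),(0,[0,3,2,1])]),
     (adj [[1,2,3],[2,4],[3,5],[4]], Cover 0 [5,3,4,1,2,0], [(0,[]),(1,[]),(3,[])]),
     (adj [[1,2,3],[2,4],[3],[4,5]], Cover 1 [4,5,0,3,2,1], [(0,[0,2,3,4,1]),(0,[]),(4,[])]),
     (adj [[1,2,3],[2,4],[3],[4]], Cover 0 [3,2,1,5,0,4], [(5,[]),(0,[]),(1,[])]),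
     (adj [[1,2,3],[2,4],[3],[5]], Cover 0 [1,4,5,3,2,0], [(0,[0,1,2,3,5,4]),(6,[]),(0,[])]),
     (adj [[1,2,3],[2,4],[3]], At 3, [(7,[]),(1,[]),(0,[])]),
     (adj [[1,2,3],[2,4,5],[4],[4,5]], Cover 0 [5,3,0,2,1,4], [(0,[0,1,5,3,4,2]),(23,[0,4,5,3,1,2]),(0,[])]),
     (adj [[1,2,3],[2,4,5],[4],[5]], At 3, [(1,[0,2,1]),(1,[]),(0,[])]),
     (adj [[1,2,3],[2,4,5],[4]], Cover 0 [5,4,3,0,2,1], [(0,[]),(2,[0,2,1,5,4,3]),(2,[0,1,2,4,5,3])]),
     (adj [[1,2,3],[2,4],[4]], Cover 0 [1,2,5,3,0,4], [(0,[]),(3,[0,2,1]),(3,[])]),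
     (adj [[1,2,3],[2,4],[5]], Cover 0 [0,2,5,4,1,3], [(4,[0,1,2,5,4,3]),(4,[0,2,1,4,5,3]),(0,[])]),
     (adj [[1,2,3],[2,4]], At 2, [(5,[]),(1,[]),(0,[])]),
     (adj [[1,2,3],[4,5],[4,5],[4]], At 3, [(0,[0,1,3,2]),(0,[0,2,3,1]),(29,[0,4,5,3,1,2])]),
     (adj [[1,2,3],[4,5],[4,5]], Cover 0 [4,1,0,3,5,2], [(1,[0,4,2,3,1]),(0,[]),(1,[0,1,3,2])]),
     (adj [[1,2,3],[4,5],[4]], At 2, [(2,[]),(2,[0,2,3,1]),(0,[])]),
     (adj [[1,2,3],[4,5]], Cover 1 [2,0,4,1,5,3], [(0,[]),(3,[0,1,5,3,4,2]),(3,[0,1,3,2])]),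
     (adj [[1,2,3],[4]], At 1, [(4,[]),(4,[0,1,3,2]),(0,[])]),
     (adj [[1,2,3]], Cover 0 [1,3,5,4,2,0], [(0,[0,1,2,3,5,4]),(0,[]),(0,[0,3,2,1])]),
     (adj [[1,2]], At 0, [(0,[]),(0,[0,1,2,4,3]),(0,[0,1,2,5,4,3])]),
     (adj [[1]], At 0, [(0,[]),(0,[0,1,3,2]),(0,[0,1,4,3,2]),(0,[0,1,5,3,4,2])]),
     (adj [], At 0, [(0,[]),(0,[0,2,1]),(0,[0,3,2,1]),(0,[0,4,2,3,1]),(0,[0,5,2,3,4,1])])]"
  by code_simp

lemma kuratowski_certificate_7: "kuratowski_certificate 7
    [([(1,2),(1,1),(7,1),(3,4),(1,5),(2,2),(0,7)], adj [[2,3,4],[3,4],[4]]),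
     ([(3,4),(1,0),(6,0),(5,1),(5,2),(4,7),(4,1)], adj [[2,3,4],[3,4],[],[5]]),
     ([(1,1),(0,0),(5,0),(2,2),(0,5),(1,2),(2,1)], adj [[2,3,4],[3],[5],[],[6]])]
    [(adj [[1,3,6],[2,4],[3,6],[4],[6]], 0, [0,2,4,1,3,6]),
     (adj [[1,3,5],[2,4],[3,6],[4],[6],[6]], 2, [0,2,4,6,1,3,5]),
     (adj [[1,3,6],[2,5],[3,6],[4],[5],[6]], 2, [3,1,6,5,0,2,4])]
    [(adj [[1,2,3],[2,3,5],[3,6]], Cover 1 [3,2,6,4,5,1,0], []),
     (adj [[1,2,3],[2,3,5],[3],[5]], Cover 1 [2,3,5,4,6,1,0], []),
     (adj [[1,2,3],[2,3,5],[3]], Cover 1 [6,4,2,3,1,5,0], [(1,[]),(1,[0,1,3,2]),(1,[0,1,3,2,6,5,4]),(0,[])]),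
     (adj [[1,2,3,4,5],[2,4,5],[3],[4]], Cover 1 [4,3,2,6,5,1,0], []),
     (adj [[1,2,3,4,6],[2,4,5],[3],[4]], Cover 1 [5,6,0,3,4,1,2], []),
     (adj [[1,2,3,4],[2,4,5],[3,6],[4]], Cover 1 [5,6,4,3,0,1,2], []),
     (adj [[1,2,3,4],[2,4,5],[3],[4]], Cover 2 [6,4,0,2,1,5,3], [(1,[]),(0,[]),(2,[])]),
     (adj [[1,2,3],[2,4,5],[3,4],[4]], Cover 1 [6,5,1,4,2,0,3], []),
     (adj [[1,2,3,5],[2,4,5],[3,6],[4],[5]], At 6, []),
     (adj [[1,2,3,5],[2,4,5],[3],[4],[5]], Cover 2 [2,1,4,6,5,0,3], [(0,[])]),
     (adj [[1,2,3],[2,4,5],[3],[4],[5,6]], Cover 0 [3,2,1,5,6,0,4], []),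
     (adj [[1,2,3],[2,4,5],[3,6],[4],[5],[6]], At 6, [(13,[])]),
     (adj [[1,2,3],[2,4,5],[3],[4],[5],[6]], Cover 2 [2,1,5,6,4,3,0], [(0,[]),(5,[])]),
     (adj [[1,2,3],[2,4,5],[3],[4],[5]], Cover 2 [6,0,4,5,1,2,3], [(2,[]),(0,[]),(3,[])]),
     (adj [[1,2,3,5],[2,4,5],[3,6],[4],[6]], At 6, [(15,[])]),
     (adj [[1,2,3,5],[2,4,5],[3],[4],[6]], Cover 2 [2,3,6,5,4,1,0], [(0,[]),(12,[0,1,2,5,3,4]),(8,[0,1,2,3,5,4])]),
     (adj [[1,2,3,6],[2,4,5],[3],[4],[6],[6]], Cover 0 [3,2,1,5,6,0,4], [(17,[0,1,4,6,5,2,3]),(18,[0,1,4,3,2])]),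
     (adj [[1,2,3,6],[2,4,5],[3],[4],[6]], At 6, [(17,[]),(3,[0,3,2,1,4,6,5]),(0,[])]),
     (adj [[1,2,3],[2,4,5],[3,6],[4],[6]], Cover 0 [0,3,4,6,5,1,2], [(18,[]),(2,[])]),
     (adj [[1,2,3],[2,4,5],[3],[4],[6]], Cover 2 [6,5,1,0,2,3,4], [(1,[]),(0,[]),(3,[])]),
     (adj [[1,2,3],[2,4,5],[3],[4]], At 4, [(13,[]),(12,[]),(6,[]),(0,[])]),
     (adj [[1,2,3,5,6],[2,5,6],[3],[4],[6]], At 4, [(23,[0,5,1,2,3,4])]),
     (adj [[1,2,3,5,6],[2,5,6],[3],[4]], Cover 0 [6,1,2,3,4,0,5], [(0,[])]),
     (adj [[1,2,3,6],[2,5,6],[3],[4]], Cover 2 [3,0,6,5,1,2,4], [(2,[0,1,2,3,6,5,4]),(2,[0,3,2,1,5,4]),(0,[]),(20,[0,1,2,6,4,5,3])]),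
     (adj [[1,2,3],[2,5,6],[3,5],[4],[5]], Cover 2 [3,4,5,1,6,0,2], []),
     (adj [[1,2,3],[2,5,6],[3],[4],[5]], Cover 2 [3,0,1,6,5,4,2], [(4,[0,1,2,3,6,5,4]),(4,[0,3,2,1,5,4]),(1,[]),(0,[])]),
     (adj [[1,2,3],[2,5,6],[3],[4]], Cover 1 [6,1,0,4,3,5,2], [(2,[]),(0,[0,1,2,3,4,6,5]),(5,[0,1,2,3,6,5,4]),(0,[])]),
     (adj [[1,2,3,6],[2,5],[3],[4],[5,6]], Cover 2 [1,5,4,3,6,0,2], [(6,[]),(24,[]),(0,[]),(6,[0,3,2,1,5,4]),(0,[0,4,3,2,1]),(29,[0,3,2,1,5,4])]),
     (adj [[1,2,3],[2,5],[3],[4],[5,6]], Cover 0 [6,4,3,0,1,5,2], [(1,[0,3,2,1,5,4]),(0,[]),(1,[]),(1,[0,4,3,2,1]),(7,[]),(25,[])]),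
     (adj [[1,2,3],[2,5],[3],[4],[5]], Cover 0 [6,3,4,5,1,2,0], [(0,[]),(0,[0,3,2,1,5,4]),(2,[]),(8,[0,3,2,1,5,4]),(26,[]),(8,[])]),
     (adj [[1,2,3],[2,5],[3],[4]], Cover 0 [1,5,6,4,3,0,2], [(3,[]),(9,[]),(27,[]),(0,[]),(9,[0,3,2,1,5,4]),(3,[0,3,2,1,5,4])]),
     (adj [[1,2,3],[2,5],[3,4],[5],[5,6]], Cover 1 [3,0,1,6,4,2,5], [(0,[0,1,2,3,6,5,4]),(32,[0,1,2,3,5,6,4]),(31,[0,1,2,3,5,6,4])]),
     (adj [[1,2,3],[2,5],[3,4],[5],[5]], Cover 2 [6,5,3,2,4,1,0], [(1,[0,1,2,3,6,5,4]),(0,[]),(32,[0,1,2,3,5,6,4])]),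
     (adj [[1,2,3],[2,5],[3,4],[5],[6],[6]], At 6, [(35,[0,1,5,6,4,2,3]),(2,[0,1,2,3,5,6,4]),(2,[0,1,2,3,6,5,4])]),
     (adj [[1,2,3],[2,5],[3,4],[5],[],[6]], Cover 1 [5,6,0,4,2,3,1], [(3,[0,2,1,5,3,4]),(1,[]),(0,[]),(3,[])]),
     (adj [[1,2,3],[2,5],[3,4],[5]], At 5, [(4,[0,2,1,5,3,4]),(2,[]),(0,[])]),
     (adj [[1,2,3],[2,5],[3],[5]], Cover 0 [4,6,3,2,1,0,5], [(5,[]),(0,[]),(5,[0,3,2,1]),(0,[0,1,2,3,6,5,4]),(5,[0,1,2,3,5,6,4]),(33,[])]),
     (adj [[1,2,3],[2,5],[3]], At 3, [(34,[]),(6,[]),(0,[]),(6,[0,1,2,3,6,5,4])]),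
     (adj [[1,2,3,6],[2,5],[4,5],[4,5],[6]], Cover 1 [1,5,3,6,4,2,0], [(40,[0,2,4,3,5,1]),(40,[0,3,4,2,1])]),
     (adj [[1,2,3],[2,5],[4,5],[4,5],[6]], Cover 1 [1,2,4,6,3,0,5], [(41,[0,2,5,1,6,4,3]),(0,[])]),
     (adj [[1,2,3],[2,5],[4,5],[4,5]], Cover 2 [4,5,1,0,6,3,2], [(40,[0,1,4,3,5,6,2]),(2,[0,1,2,4,3]),(0,[]),(2,[0,1,5,3,4,2])]),
     (adj [[1,2,3],[2,5,6],[4],[4,5,6],[5]], Cover 1 [6,0,2,4,5,1,3], []),
     (adj [[1,2,3],[2,5,6],[4],[4,5],[5]], Cover 2 [3,5,1,2,6,4,0], [(0,[]),(4,[0,2,1,6,3,4,5])]),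
     (adj [[1,2,3],[2,5],[4],[4,5],[5,6],[6]], At 6, [(45,[0,3,4,2,1])]),
     (adj [[1,2,3],[2,5],[4],[4,5],[5],[6]], Cover 2 [2,1,5,3,6,0,4], [(1,[0,2,1,3,5,4]),(0,[])]),
     (adj [[1,2,3],[2,5],[4],[4,5],[5]], Cover 1 [1,2,4,6,3,5,0], [(4,[0,2,1,3,5,4]),(2,[]),(7,[0,3,1,2]),(2,[0,2,1,3,5,4]),(7,[]),(0,[])]),
     (adj [[1,2,3],[2,5],[4],[4,5],[6],[6]], Cover 2 [5,1,2,4,0,3,6], [(5,[]),(0,[]),(8,[0,1,5,3,4,2]),(5,[0,2,1,3,5,4]),(8,[]),(48,[0,3,4,2,1])]),
     (adj [[1,2,3],[2,5],[4],[4,5],[],[6]], At 4, [(9,[0,1,2,4,3]),(6,[0,2,1,3,5,4]),(1,[]),(0,[])]),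
     (adj [[1,2,3],[2,5],[4],[4,5]], At 5, [(10,[0,1,5,3,4,2]),(7,[]),(2,[]),(0,[])]),
     (adj [[1,2,3],[2,5],[4,5],[4,6],[],[6]], Cover 1 [1,2,4,3,6,5,0], [(51,[0,1,4,3,6,5,2]),(0,[0,1,2,3,4,6,5])]),
     (adj [[1,2,3],[2,5],[4],[4,6],[5],[6]], Cover 2 [5,4,3,0,2,1,6], [(1,[]),(12,[0,2,1,5,3,4]),(0,[]),(12,[0,1,2,4,3]),(12,[0,2,1,3,5,4]),(51,[0,2,4,3,6,1,5])]),
     (adj [[1,2,3],[2,5],[4],[4,6],[],[6]], At 5, [(13,[0,2,1,5,3,4]),(1,[]),(2,[]),(0,[])]),
     (adj [[1,2,3],[2,5],[4],[4,6]], Cover 1 [5,1,0,3,6,2,4], [(14,[0,2,1,5,3,4]),(3,[]),(0,[]),(14,[0,2,1,3,5,4]),(3,[0,1,2,3,4,6,5]),(14,[])]),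
     (adj [[1,2,3],[2,5],[4],[4]], At 3, [(15,[0,2,1,3,5,4]),(15,[]),(4,[]),(0,[])]),
     (adj [[1,2,3],[2,5],[4],[6]], At 3, [(16,[0,2,1,3,5,4]),(16,[]),(0,[]),(0,[0,2,1,3,5,4])]),
     (adj [[1,2,3],[2,5],[4]], At 3, [(17,[0,2,1,3,5,4]),(17,[]),(1,[]),(1,[0,2,1,3,5,4]),(0,[])]),
     (adj [[1,2,3,4],[2,5],[5],[],[5],[6]], Cover 2 [3,4,5,1,2,0,6], [(18,[0,2,1]),(18,[]),(18,[0,2,1,4,3]),(0,[0,1,2,3,6,5,4])]),
     (adj [[1,2,3,4],[2,5],[5],[],[],[6]], Cover 1 [4,3,5,2,1,6,0], [(0,[]),(19,[0,1,2,4,3]),(19,[0,2,1,4,3]),(19,[]),(19,[0,2,1]),(1,[0,1,2,3,6,5,4])]),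
     (adj [[1,2,3,4],[2,5],[5]], Cover 1 [2,1,4,6,3,5,0], [(20,[0,1,2,4,3]),(2,[0,1,2,3,6,5,4]),(20,[]),(2,[0,1,2,3,5,6,4]),(20,[0,2,1]),(0,[])]),
     (adj [[1,2,3],[2,5],[5]], Cover 1 [6,4,2,1,0,3,5], [(3,[0,1,2,3,6,5,4]),(3,[0,1,2,3,5,6,4]),(0,[0,1,2,3,6,5,4]),(3,[0,2,1]),(0,[]),(21,[0,2,1])]),
     (adj [[1,2,3],[2,5]], At 2, [(22,[]),(4,[]),(0,[]),(4,[0,1,2,3,6,5,4])]),
     (adj [[1,2,3],[4,5,6],[4,5],[4,6],[5]], Cover 0 [3,6,1,5,2,4,0], []),
     (adj [[1,2,3],[4,5],[4,5],[4,6],[5]], Cover 0 [1,5,2,6,3,0,4], [(0,[]),(64,[0,1,4,3,6,5,2])]),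
     (adj [[1,2,3],[4,5],[4,5],[4,6]], At 5, [(2,[0,1,5,3,2,4]),(63,[0,1,4,3,5,6,2]),(0,[]),(65,[0,1,4,3,6,5,2])]),
     (adj [[1,2,3],[4,5],[4,5],[4]], At 3, [(3,[0,1,3,2]),(3,[0,2,3,1]),(64,[0,1,4,3,5,6,2]),(0,[])]),
     (adj [[1,2,3],[4,5],[4,5],[6]], At 3, [(4,[0,1,3,2]),(4,[0,2,3,1]),(0,[]),(0,[0,1,2,3,5,4])]),
     (adj [[1,2,3],[4,5],[4,5]], At 3, [(5,[0,1,3,2]),(5,[0,2,3,1]),(1,[]),(1,[0,1,2,3,5,4]),(0,[])]),
     (adj [[1,2,3],[4,5],[5,6],[5]], At 3, [(6,[0,1,3,2]),(6,[0,2,3,1]),(0,[0,1,3,2]),(0,[0,2,3,1,5,6,4])]),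
     (adj [[1,2,3],[4,5],[5,6]], Cover 2 [1,4,6,2,3,0,5], [(1,[0,1,2,3,5,6,4]),(7,[]),(7,[0,1,3,2]),(1,[]),(7,[0,2,6,3,4,5,1]),(0,[])]),
     (adj [[1,2,3],[4,5],[5]], At 2, [(8,[]),(8,[0,2,3,1]),(2,[]),(0,[])]),
     (adj [[1,2,3],[4,5]], Cover 1 [5,4,2,3,0,1,6], [(0,[]),(0,[0,1,3,2]),(9,[0,1,5,3,2,4]),(0,[0,1,3,2,5,4]),(9,[0,1,4,3,2]),(9,[0,1,3,2])]),
     (adj [[1,2,3],[5]], At 1, [(10,[]),(10,[0,1,3,2]),(0,[]),(0,[0,1,2,3,5,6,4])]),
     (adj [[1,2,3]], Cover 1 [2,3,4,5,6,1,0], [(0,[0,2,1,3,5,4]),(0,[0,2,1]),(0,[0,2,1,3,4,6,5]),(0,[0,3,2,1]),(0,[0,3,2,1,4,6,5]),(0,[])]),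
     (adj [[1,2]], At 0, [(0,[]),(0,[0,1,2,4,3]),(0,[0,1,2,5,4,3]),(0,[0,1,2,6,4,5,3])]),
     (adj [[1]], At 0, [(0,[]),(0,[0,1,3,2]),(0,[0,1,4,3,2]),(0,[0,1,5,3,4,2]),(0,[0,1,6,3,4,5,2])]),
     (adj [], At 0, [(0,[]),(0,[0,2,1]),(0,[0,3,2,1]),(0,[0,4,2,3,1]),(0,[0,5,2,3,4,1]),(0,[0,6,2,3,4,5,1])])]"
  by code_simp

text \<open>Eight vertices of degree at least 3 with degree sum at most 24 make the graph cubic, so
  every pair that would create a vertex of degree four is pruned.\<close>

lemma kuratowski_certificate_8: "kuratowski_certificate 8
    [([(2,4),(1,4),(0,0),(7,1),(4,2),(5,3),(0,9),(3,2)], adj [[2,3,4,5],[3,4,5],[4,5],[],[6]]),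
     ([(2,3),(1,0),(10,0),(6,2),(4,4),(4,5),(2,10),(3,3)], adj [[2,3,4,5],[3,4,5],[4],[6],[6]]),
     ([(1,1),(0,0),(6,0),(3,2),(2,3),(2,5),(1,2),(3,1)], adj [[2,3,4,5],[3,4],[4,6],[6],[],[7]]),
     ([(2,3),(2,2),(0,0),(7,0),(4,3),(5,3),(3,7),(3,2)], adj [[3,4,5],[3,4,5,6],[4,5],[],[],[7]])]
    [(adj [[1,4,5],[2,3],[4,5],[6,7],[6],[7]], 7, [3,0,2,4,5,1,6,7]),
     (adj [[1,4,5],[2,3],[4,7],[5,6],[6],[7]], 11, [2,3,0,5,4,1,7,6]),
     (adj [[1,4,5],[2,3],[4,6],[4,6],[],[7],[7]], 3, [0,2,3,6,1,4,7,5]),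
     (adj [[1,4,5],[2,3],[4,6],[4,7],[],[6],[7]], 7, [6,1,4,0,3,2,5,7]),
     (adj [[1,4,5],[2,3],[4,6],[4,6],[],[6]], 2, [0,2,3,6,1,4,5]),
     (adj [[1,4,5],[2,3],[4,5],[4,6],[],[7],[7]], 3, [3,0,2,5,1,4,7,6]),
     (adj [[1,4,5],[2,3],[4,5],[4,6],[],[6]], 2, [3,0,2,5,1,4,6]),
     (adj [[1,4,5],[2,3],[4,5],[4,5]], 0, [0,2,3,1,4,5]),
     (adj [[1,2,4],[3],[5],[6,7],[6,7],[6,7]], 7, [0,6,7,3,5,4,1,2])]
    [(adj [[1,2,3],[2,3],[4],[7]], Cover 3 [5,6,7,2,1,0,3,4], []),
     (adj [[1,2,3],[2,3],[4]], Cover 3 [6,7,4,2,1,0,3,5], [(0,[])]),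
     (adj [[1,2,3],[2,3]], Cover 3 [2,0,1,7,4,5,6,3], [(0,[0,1,2,3,7,5,6,4]),(0,[]),(0,[0,1,2,3,5,4]),(0,[0,1,3,2,5,4])]),
     (adj [[1,2,4],[2,3],[3],[5]], Cover 1 [0,1,3,7,6,5,2,4], []),
     (adj [[1,2,4],[2,3],[3]], Cover 3 [7,5,4,0,2,1,3,6], [(0,[])]),
     (adj [[1,2,4],[2,3],[5],[6,7],[7],[6,7]], At 6, [(13,[])]),
     (adj [[1,2,4],[2,3],[5],[6],[7],[6,7]], Cover 0 [7,6,3,1,2,0,4,5], [(0,[])]),
     (adj [[1,2,4],[2,3],[5],[],[7],[6,7]], Cover 0 [0,1,3,7,5,6,4,2], [(0,[])]),
     (adj [[1,2,4],[2,3],[5],[],[7],[6]], Cover 0 [7,6,5,2,1,0,4,3], [(0,[])]),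
     (adj [[1,2,4],[2,3],[5],[],[],[6]], Cover 1 [2,0,4,6,7,3,1,5], [(0,[])]),
     (adj [[1,2,4],[2,3],[5]], Cover 3 [1,2,5,4,7,6,3,0], [(0,[0,1,2,3,4,5,7,6]),(0,[])]),
     (adj [[1,2,4],[2,3]], At 2, [(6,[]),(8,[0,2,1,4,3]),(0,[]),(0,[0,1,2,3,4,6,5]),(0,[0,1,2,3,4,7,6,5])]),
     (adj [[1,2],[2,3]], At 0, [(9,[]),(0,[]),(0,[0,1,2,3,5,4]),(0,[0,1,2,3,6,5,4]),(0,[0,1,2,3,7,5,6,4])]),
     (adj [[1,4,5],[2,3],[4,5],[4,6],[],[7]], At 7, [(18,[])]),
     (adj [[1,4,5],[2,3],[4,5],[4,6]], At 5, [(20,[]),(0,[])]),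
     (adj [[1,4,5],[2,3],[4,5],[4]], At 3, [(22,[]),(0,[]),(0,[0,1,2,3,4,5,7,6])]),
     (adj [[1,4,5],[2,3],[4,6],[4],[],[6],[7]], At 3, [(0,[0,1,3,2]),(19,[])]),
     (adj [[1,4,5],[2,3],[4,6],[4],[],[6]], At 6, [(21,[]),(0,[])]),
     (adj [[1,4,5],[2,3],[4,6],[4,6],[],[],[7]], At 5, [(20,[])]),
     (adj [[1,4,5],[2,3],[4,6],[4],[],[],[7]], At 6, [(0,[]),(1,[])]),
     (adj [[1,4,5],[2,3],[4,6],[4]], Cover 3 [6,2,4,0,7,5,3,1], [(0,[]),(2,[])]),
     (adj [[1,4,5],[2,3],[4],[4]], Cover 1 [7,6,0,4,2,1,5,3], [(0,[0,1,2,3,4,5,7,6]),(0,[]),(5,[])]),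
     (adj [[1,4,5],[2,3],[4],[5,6],[6],[7]], Cover 0 [4,2,1,3,5,7,6,0], [(23,[])]),
     (adj [[1,4,5],[2,3],[4],[5,6],[6]], Cover 0 [3,5,0,4,7,2,1,6], [(0,[]),(1,[0,1,2,3,5,4])]),
     (adj [[1,4,5],[2,3],[4],[6,7],[6],[7]], At 5, [(24,[]),(0,[0,4,2,6,1,5,3])]),
     (adj [[1,4,5],[2,3],[4],[6,7],[6]], Cover 1 [5,0,1,3,7,6,4,2], [(0,[]),(1,[0,4,2,6,1,5,3])]),
     (adj [[1,4,5],[2,3],[4],[6],[6]], Cover 0 [5,7,4,6,3,1,0,2], [(2,[0,4,2,6,1,5,3]),(2,[]),(0,[0,4,2,6,1,5,3]),(0,[])]),
     (adj [[1,4,5],[2,3],[3,4],[7],[6]], Cover 1 [7,5,0,1,2,4,6,3], []),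
     (adj [[1,4,5],[2,3],[4],[5,7],[6]], Cover 2 [3,5,0,4,2,6,7,1], [(6,[0,1,2,3,5,4])]),
     (adj [[1,4,5],[2,3],[4],[7],[6]], At 3, [(1,[]),(0,[]),(2,[])]),
     (adj [[1,4,5],[2,3],[4],[],[6]], Cover 0 [7,6,4,0,1,3,5,2], [(0,[]),(3,[])]),
     (adj [[1,4,5],[2,3],[4]], At 4, [(9,[]),(18,[0,4,5,2,1,3]),(0,[]),(0,[0,1,2,3,4,5,7,6])]),
     (adj [[1,4,5],[2,3],[],[],[6,7]], At 5, [(0,[0,1,2,3,5,4]),(0,[0,1,3,2,5,4]),(0,[0,4,6,7,5,1,2,3]),(0,[0,4,7,6,5,1,2,3])]),
     (adj [[1,4,5],[2,3],[],[],[6]], At 4, [(1,[]),(1,[0,1,3,2]),(20,[0,4,5,6,1,2,3]),(0,[])]),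
     (adj [[1,4,5],[2,3]], Cover 0 [6,2,1,0,4,5,3,7], [(0,[]),(0,[0,1,2,3,5,4]),(2,[]),(2,[0,1,2,3,5,4]),(2,[0,1,3,2])]),
     (adj [[1,4],[2,3]], At 0, [(22,[]),(22,[0,1,3,2]),(0,[]),(0,[0,1,2,3,4,6,5]),(0,[0,1,2,3,4,7,6,5])]),
     (adj [[1],[2,3]], At 0, [(23,[]),(23,[0,1,3,2]),(0,[]),(0,[0,1,2,3,5,4]),(0,[0,1,2,3,6,5,4]),(0,[0,1,2,3,7,5,6,4])]),
     (adj [[1],[2]], At 1, [(0,[]),(0,[0,1,2,4,3]),(0,[0,1,2,5,4,3]),(0,[0,1,2,6,4,5,3]),(0,[0,1,2,7,4,5,6,3])]),
     (adj [[1]], At 1, [(0,[]),(0,[0,1,3,2]),(0,[0,1,4,3,2]),(0,[0,1,5,3,4,2]),(0,[0,1,6,3,4,5,2]),(0,[0,1,7,3,4,5,6,2])]),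
     (adj [], At 0, [(0,[]),(0,[0,2,1]),(0,[0,3,2,1]),(0,[0,4,2,3,1]),(0,[0,5,2,3,4,1]),(0,[0,6,2,3,4,5,1]),(0,[0,7,2,3,4,5,6,1])])]"
  by code_simp

section \<open>From a subdivision of \<open>K33\<close> or \<open>K5\<close> to a Petersen
  minor\<close>

text \<open>The only root is \<open>K5\<close> on the labels 1 to 5. Deleting one of them must leave
  a complete graph on the others, so each node forces one more edge at label 0, up to
  \<open>K6\<close>.\<close>

lemma apex_certificate_6: "apex_certificate 6
    [([(0,0),(1,1),(2,1),(3,0),(1,3)], adj [[2]])]
    [(adj [[1,2,3,4,5],[2,3,4,5],[3,4,5],[4,5],[5]], None, 5, [0,1,2,3,4,5])]
    [(adj [[1,2,3,4],[2,3,4,5],[3,4,5],[4,5],[5]], Cover 0 [0,2,5,4,3,1], [(0,[])]),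
     (adj [[1,2,4],[2,3,4,5],[3,4,5],[4,5],[5]], Cover 0 [3,2,0,5,4,1], [(0,[])]),
     (adj [[1,4],[2,3,4,5],[3,4,5],[4,5],[5]], Cover 0 [0,3,2,5,4,1], [(0,[])]),
     (adj [[1],[2,3,4,5],[3,4,5],[4,5],[5]], Cover 0 [4,5,0,2,3,1], [(0,[])]),
     (adj [[],[2,3,4,5],[3,4,5],[4,5],[5]], Cover 0 [1,3,0,5,4,2], [(0,[])])]
    [(0,[])]"
  by code_simp

text \<open>Every branch ends beyond the degree bound or with \<open>K331\<close> or
  \<open>P7\<close> as a subgraph.\<close>

lemma apex_certificate_7: "apex_certificate 7
    [([(0,0),(5,2),(2,3),(1,3),(1,1),(0,4)], adj [[2,3],[3]]),
     ([(0,0),(4,1),(2,2),(1,4),(1,2),(2,1)], adj [[2],[4],[],[5]])]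
    [(adj [[1,2,3],[4,5,6],[4,5,6],[4,5,6],[5,6],[6]], None, 4, [4,5,1,6,2,3,0]),
     (adj [[1,2,3,5],[4,5,6],[4,5,6],[4,5,6],[5],[6]], None, 3, [5,0,1,4,2,3,6]),
     (adj [[1,2,3,4,5],[4,5,6],[4,5,6],[4,5,6],[5]], None, 4, [0,4,1,5,2,3,6]),
     (adj [[1,2,3,4,5,6],[4,5,6],[4,5,6],[4,5,6]], None, 3, [0,1,4,2,5,6,3]),
     (adj [[3,4,5,6],[3,4,5,6],[3,4,5,6],[4,5],[5]], None, 4, [3,4,0,5,1,2,6])]
    [(adj [[4,5,6],[3,4,5,6],[3,4,5,6],[4,5,6],[5]], Cover 0 [2,3,1,0,5,6,4], []),
     (adj [[4,5,6],[3,4,5,6],[3,4,5,6],[4,5],[5]], Cover 0 [3,5,0,6,2,4,1], [(5,[]),(0,[])]),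
     (adj [[4,6],[3,4,5,6],[3,4,5,6],[4,5,6],[5]], Cover 0 [6,0,4,5,3,2,1], [(0,[])]),
     (adj [[4,6],[3,4,5,6],[3,4,5,6],[4,5],[5]], Cover 0 [5,3,0,6,2,4,1], [(1,[]),(0,[0,1,2,5,4,3]),(0,[])]),
     (adj [[6],[3,4,5,6],[3,4,5,6],[4,5,6],[5,6]], Cover 0 [5,4,6,0,3,2,1], []),
     (adj [[6],[3,4,5,6],[3,4,5,6],[4,5,6],[5]], Cover 0 [0,6,5,4,3,2,1], [(1,[0,1,2,3,5,4]),(1,[]),(0,[])]),
     (adj [[6],[3,4,5,6],[3,4,5,6],[4,5],[5]], Cover 0 [6,0,3,4,5,2,1], [(0,[]),(0,[0,1,2,4,3]),(2,[])]),
     (adj [[3,5],[3,4,5,6],[3,4,5,6],[4,5,6],[5]], Cover 0 [2,6,1,0,4,5,3], []),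
     (adj [[3],[3,4,5,6],[3,4,5,6],[4,5,6],[5]], Cover 0 [5,4,0,6,3,2,1], [(0,[])]),
     (adj [[],[3,4,5,6],[3,4,5,6],[4,5,6],[5,6]], Cover 0 [1,4,2,0,6,5,3], [(2,[0,5,6,3,4,2,1])]),
     (adj [[],[3,4,5,6],[3,4,5,6],[4,5,6],[5]], Cover 0 [0,4,3,6,2,5,1], [(1,[]),(3,[]),(0,[])]),
     (adj [[],[3,4,5,6],[3,4,5,6],[4,5],[5]], At 6, [(4,[]),(0,[]),(0,[0,1,2,4,3]),(0,[0,1,2,5,4,3])]),
     (adj [[1,2,3,4],[2,3,4,5],[3,4,5],[4,5],[5]], Cover 0 [6,0,1,5,4,3,2], []),
     (adj [[1,2,4,6],[2,3,4,5],[3,4,5],[4,5],[5],[6]], Cover 0 [3,4,0,6,2,5,1], []),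
     (adj [[1,2,4,6],[2,3,4,5],[3,4,5],[4,5],[5]], Cover 0 [6,0,2,5,3,4,1], [(0,[]),(1,[0,1,2,4,5,3])]),
     (adj [[1,2,4],[2,3,4,5],[3,4,5],[4,5],[5]], Cover 0 [0,4,3,6,2,5,1], [(2,[]),(0,[])]),
     (adj [[1,2],[2,3,4,5],[3,4,5],[4,5],[5,6]], Cover 0 [0,6,4,5,3,2,1], [(0,[0,1,2,3,5,4]),(4,[0,4,5,3,1,2])]),
     (adj [[1,2],[2,3,4,5],[3,4,5],[4,5],[5]], Cover 0 [0,6,5,4,2,3,1], [(1,[0,1,2,3,5,4]),(1,[]),(0,[])]),
     (adj [[2],[2,3,4,5,6],[3,4,5],[4,5],[5]], Cover 0 [5,1,6,0,3,4,2], [(6,[0,1,5,3,4,2]),(0,[0,2,5,3,4,1]),(0,[])]),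
     (adj [[2],[2,3,4,5],[3,4,5],[4,5],[5]], Cover 0 [1,5,6,0,4,3,2], [(0,[]),(1,[]),(1,[0,2,5,3,4,1])]),
     (adj [[],[2,3,4,5,6],[3,4,5],[4,5],[5]], Cover 0 [6,0,5,4,3,2,1], [(8,[0,1,5,3,4,2]),(8,[0,1,4,3,2]),(0,[0,1,4,3,2])]),
     (adj [[],[2,3,4,5],[3,4,5],[4,5],[5]], Cover 0 [6,0,1,2,4,5,3], [(0,[]),(0,[0,2,1]),(1,[])]),
     (adj [[1,2,3,4,5],[4,5,6],[4,5,6],[4,5,6],[6],[6]], Cover 1 [6,1,0,4,3,5,2], []),
     (adj [[1,2,3,4,5],[4,5,6],[4,5,6],[4,5,6],[6]], Cover 0 [5,0,4,6,3,2,1], [(0,[]),(26,[])]),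
     (adj [[1,2,3,4,5],[4,5,6],[4,5,6],[4,5,6]], Cover 0 [4,0,5,6,3,2,1], [(26,[]),(0,[]),(27,[])]),
     (adj [[1,2,4,5],[3,4,5,6],[3,4,5,6],[4,5,6]], Cover 1 [1,3,2,5,0,6,4], []),
     (adj [[1,2,4,5],[4,5,6],[3,4,5,6],[4,5,6]], Cover 0 [3,6,1,0,5,4,2], [(0,[]),(1,[]),(1,[0,4,5,6,1,2,3])]),
     (adj [[1,2,4,5],[4,5,6],[4,5,6],[4,5,6]], Cover 0 [0,2,6,3,5,4,1], [(2,[0,4,5,6,1,2,3]),(2,[]),(0,[])]),
     (adj [[1,2,5],[4,5,6],[4,5,6],[4,5,6],[5],[6]], Cover 0 [3,1,0,2,6,5,4], [(29,[])]),
     (adj [[1,2,5],[4,5,6],[4,5,6],[4,5,6],[5]], Cover 0 [6,4,5,0,2,3,1], [(0,[]),(1,[0,1,2,3,5,6,4]),(1,[])]),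
     (adj [[1,2,5],[4,5,6],[4,5,6],[4,5,6]], Cover 0 [4,6,5,0,3,2,1], [(0,[]),(2,[]),(2,[0,1,2,3,5,6,4])]),
     (adj [[1,5],[4,5,6],[4,5,6],[4,5,6]], At 0, [(0,[]),(0,[0,1,3,2]),(0,[0,4,5,6,2,1,3]),(0,[0,5,6,4,2,1,3])]),
     (adj [[1,2],[4,5,6],[4,5,6],[4,5,6],[5,6],[6]], Cover 0 [0,2,5,3,4,6,1], [(32,[])]),
     (adj [[1],[4,5,6],[4,5,6],[4,5,6],[5,6],[6]], Cover 0 [2,5,3,0,4,6,1], [(21,[0,4,5,3,2,6,1]),(0,[]),(1,[])]),
     (adj [[1],[4,5,6],[4,5,6],[4,5,6],[5,6]], Cover 0 [0,5,4,6,2,3,1], [(2,[0,1,2,3,5,4]),(2,[0,1,2,3,4,6,5]),(0,[])]),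
     (adj [[1],[4,5,6],[4,5,6],[4,5,6],[5]], Cover 0 [0,6,5,4,2,3,1], [(3,[]),(3,[0,1,2,3,5,4]),(0,[])]),
     (adj [[1],[4,5,6],[4,5,6],[4,5,6]], Cover 0 [4,0,6,5,2,3,1], [(0,[0,1,2,3,4,6,5]),(0,[]),(4,[])]),
     (adj [[],[2,4,5,6],[4,5,6],[4,5,6],[],[6]], Cover 0 [0,3,6,1,5,4,2], [(0,[0,6,4,5,1,2,3]),(0,[]),(25,[0,2,3,1,5,6,4])]),
     (adj [[],[2,4,5,6],[4,5,6],[4,5,6]], Cover 0 [0,5,2,6,3,4,1], [(1,[0,2,1]),(1,[0,6,4,5,1,2,3]),(0,[])]),
     (adj [[],[4,5,6],[4,5,6],[4,5,6]], Cover 0 [2,0,3,1,6,5,4], [(0,[0,2,3,1]),(0,[]),(2,[])])]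
    [(0,[]), (18,[]), (28,[])]"
  by code_simp

text \<open>\<open>K44\<close> minus an edge is terminal in two forms, with label 0 at the missing
  edge or away from it, because relabellings fix label 0. Three terminals reach \<open>K331\<close>
  or \<open>P7\<close> by a contraction.\<close>

lemma apex_certificate_8: "apex_certificate 8
    [([(3,4),(1,0),(6,0),(5,1),(5,2),(4,7),(4,1)], adj [[2,3,4],[3,4],[],[5]]),
     ([(2,2),(1,3),(0,0),(6,1),(2,1),(3,3),(0,6)], adj [[2,3],[3,5],[5],[],[6]])]
    [(adj [[4,5,7],[4,5,6,7],[4,5,6,7],[4,5,6,7]], None, 6, [1,2,4,3,5,7,0,6]),
     (adj [[4,5,6,7],[4,5,6,7],[4,5,6,7],[4,5,6]], None, 6, [0,1,4,2,5,6,3,7]),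
     (adj [[2,3,7],[5,6,7],[4,5,6],[4,5,6],[5,6,7]], None, 2, [4,2,5,3,7,6,0,1]),
     (adj [[2,3,5,7],[4,5,6,7],[4,5,6],[4,5,6],[7],[],[7]], Some (0,7), 3, [0,1,4,2,5,6,3]),
     (adj [[1,2,3,7],[5,6,7],[4,5,6],[4,5,6],[5,7],[],[7]], Some (1,5), 3, [1,0,2,4,3,7,6]),
     (adj [[1,2,3,5,7],[5,6,7],[4,5,6],[4,5,6],[7],[7]], Some (1,6), 4, [0,1,2,5,3,7,4]),
     (adj [[2,5,6,7],[2,5,6,7],[4,5,6],[4,5,6],[7]], None, 2, [2,0,5,1,4,6,7,3]),
     (adj [[2,3,5,6,7],[5,6,7],[4,5,6],[4,5,6],[7]], None, 2, [0,2,5,3,7,6,4,1]),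
     (adj [[5,6,7],[3,4,5,6],[3,4,5,6],[5,7],[5,7]], None, 2, [5,1,3,2,0,4,6,7])]
    [(adj [[1,6,7],[3,4,5,7],[3,4,5,6],[4,5],[5],[],[7]], Cover 0 [5,3,0,6,7,4,2,1], []),
     (adj [[3,6,7],[3,4,5,7],[3,4,5,6],[4,5],[5],[],[7]], Cover 0 [5,4,0,7,6,2,3,1], []),
     (adj [[6,7],[3,4,5,7],[3,4,5,6],[4,5],[5],[],[7]], At 0, [(1,[]),(1,[0,2,1,3,4,5,7,6]),(0,[]),(0,[0,1,2,4,3]),(0,[0,1,2,5,4,3])]),
     (adj [[7],[3,4,5,6,7],[3,4,5,6],[4,5],[5],[],[7]], At 0, []),
     (adj [[7],[3,4,5,7],[3,4,5,6],[4,5,6],[5],[],[7]], At 0, []),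
     (adj [[7],[3,4,5,7],[3,4,5,6],[4,5],[5],[],[7]], At 6, [(2,[]),(1,[]),(0,[]),(0,[0,1,2,4,3]),(0,[0,1,2,5,4,3])]),
     (adj [[],[3,4,5,7],[3,4,5,6,7],[4,5],[5],[],[7]], Cover 0 [0,7,4,3,5,6,2,1], []),
     (adj [[],[3,4,5,7],[3,4,5,6],[4,5,7],[5],[],[7]], Cover 0 [5,4,7,0,6,3,2,1], []),
     (adj [[],[3,4,5,7],[3,4,5,6],[4,5],[5],[],[7]], At 7, [(2,[]),(1,[]),(0,[]),(0,[0,1,2,4,3]),(0,[0,1,2,5,4,3])]),
     (adj [[2],[4,5,6,7],[3,4,5,6],[4,5,7],[5]], Cover 0 [0,7,3,4,5,6,2,1], []),
     (adj [[4],[4,5,6,7],[3,4,5,6],[4,5,7],[5]], Cover 0 [5,4,0,6,7,3,2,1], []),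
     (adj [[],[4,5,6,7],[3,4,5,6,7],[4,5,7],[5]], Cover 0 [0,6,3,5,4,7,2,1], []),
     (adj [[],[4,5,6,7],[3,4,5,6],[4,5,7],[5]], Cover 0 [0,1,4,2,3,7,6,5], [(1,[]),(2,[]),(2,[0,1,3,2,4,5,7,6]),(0,[])]),
     (adj [[1],[3,4,5,6],[3,4,5,6],[5,7],[5,7]], Cover 0 [5,3,7,0,6,2,4,1], []),
     (adj [[5,7],[3,4,5,6],[3,4,5,6],[5,7],[5,7]], At 6, [(22,[])]),
     (adj [[5],[3,4,5,6],[3,4,5,6],[5,7],[5,7]], Cover 0 [7,2,5,0,1,4,6,3], [(0,[])]),
     (adj [[6],[3,4,5,6],[3,4,5,6],[5,7],[5,7]], Cover 0 [0,6,1,4,5,3,7,2], [(2,[]),(2,[0,4,3,1,2,5,7,6]),(0,[])]),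
     (adj [[],[3,4,5,6],[3,4,5,6],[5,7],[5,7]], At 0, [(3,[]),(3,[0,2,1]),(3,[0,3,4,1,2,5,7,6]),(3,[0,4,3,1,2,5,7,6]),(1,[]),(0,[]),(0,[0,3,4,1,2,5,7,6])]),
     (adj [[4,6],[3,4,5,6],[3,4,5,6],[4,5],[5]], Cover 0 [3,5,0,7,6,4,2,1], []),
     (adj [[6],[3,4,5,6],[3,4,5,6],[4,5],[5],[7]], Cover 0 [0,6,1,3,5,7,4,2], []),
     (adj [[6],[3,4,5,6],[3,4,5,6],[4,5],[5]], Cover 0 [5,4,7,6,0,3,2,1], [(0,[]),(1,[0,1,2,3,5,4]),(1,[])]),
     (adj [[],[3,4,5,6],[3,4,5,6],[4,5,6],[5]], Cover 0 [2,5,1,0,7,3,6,4], []),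
     (adj [[4],[3,4,5,6],[3,4,5,6],[4,5],[5],[],[7]], Cover 0 [1,3,2,0,7,5,6,4], []),
     (adj [[],[3,4,5,6],[3,4,5,6],[4,5],[5],[7],[7]], Cover 0 [7,0,4,3,2,6,5,1], []),
     (adj [[],[3,4,5,6],[3,4,5,6],[4,5],[5],[],[7]], Cover 0 [5,4,7,6,0,3,2,1], [(0,[]),(1,[0,1,2,3,5,4]),(1,[])]),
     (adj [[],[3,4,5,6],[3,4,5,6],[4,5],[5]], At 6, [(4,[]),(3,[]),(3,[0,1,2,4,3]),(3,[0,1,2,5,4,3]),(0,[])]),
     (adj [[1,2,5,6,7],[3,5,6,7],[4,5,6],[4,5,6],[7]], Cover 1 [3,1,0,2,6,4,5,7], []),
     (adj [[1,2,5,6,7],[5,6,7],[4,5,6,7],[4,5,6],[7]], Cover 0 [4,3,5,1,0,2,7,6], []),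
     (adj [[1,2,5,6,7],[5,6,7],[4,5,6],[4,5,6,7],[7]], Cover 1 [0,2,4,3,6,1,5,7], []),
     (adj [[1,2,5,6,7],[5,6,7],[4,5,6],[4,5,6],[7],[7]], Cover 1 [1,3,4,2,6,0,7,5], []),
     (adj [[1,2,5,6,7],[5,6,7],[4,5,6],[4,5,6],[7]], Cover 0 [3,2,0,7,1,5,6,4], [(37,[]),(1,[]),(3,[]),(2,[]),(36,[]),(0,[])]),
     (adj [[1,2,5,7],[5,6,7],[4,5,6,7],[4,5,6],[7]], Cover 1 [7,4,3,5,0,1,6,2], [(0,[])]),
     (adj [[1,2,5,7],[5,6,7],[4,5,6],[4,5,6],[5,7]], Cover 1 [2,6,1,7,0,4,3,5], [(38,[0,4,5,6,1,2,3])]),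
     (adj [[1,2,5,7],[5,6,7],[4,5,6],[4,5,6],[6,7]], Cover 1 [1,7,4,2,0,5,6,3], [(2,[])]),
     (adj [[1,2,5,7],[5,6,7],[4,5,6],[4,5,6],[7],[7]], Cover 0 [7,1,6,3,2,0,5,4], [(39,[])]),
     (adj [[1,2,5,7],[5,6,7],[4,5,6],[4,5,6],[7],[],[7]], Cover 1 [7,1,5,2,0,4,6,3], [(4,[])]),
     (adj [[1,2,5,7],[5,6,7],[4,5,6],[4,5,6],[7]], Cover 0 [6,5,0,7,4,2,3,1], [(5,[]),(0,[]),(2,[]),(1,[]),(3,[]),(4,[])]),
     (adj [[1,2,3,7],[5,6,7],[4,5,6],[4,5,6,7],[7]], Cover 1 [2,5,1,7,0,4,6,3], [(0,[0,1,2,3,4,6,5])]),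
     (adj [[1,2,7],[5,6,7],[4,5,6],[4,5,6,7],[5,7]], Cover 0 [0,1,5,3,4,2,7,6], []),
     (adj [[1,2,7],[5,6,7],[4,5,6],[4,5,6,7],[7],[7]], Cover 1 [2,4,3,1,7,0,6,5], []),
     (adj [[1,2,7],[5,6,7],[4,5,6],[4,5,6,7],[7]], Cover 0 [5,6,4,0,7,3,2,1], [(1,[]),(3,[]),(0,[]),(3,[0,1,2,3,4,6,5]),(0,[0,1,2,3,4,6,5]),(2,[])]),
     (adj [[1,2,3,7],[5,6,7],[4,5,6],[4,5,6],[5,7]], Cover 1 [4,7,1,6,5,2,0,3], [(45,[]),(47,[0,4,5,6,1,2,3])]),
     (adj [[1,2,7],[3,5,6,7],[4,5,6],[4,5,6],[5,7]], Cover 1 [0,7,5,3,4,6,1,2], []),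
     (adj [[1,2,7],[5,6,7],[4,5,6],[4,5,6],[5,7],[7]], Cover 0 [7,0,2,3,6,1,5,4], []),
     (adj [[1,2,7],[5,6,7],[4,5,6],[4,5,6],[5,7]], Cover 0 [0,7,6,3,5,1,4,2], [(7,[0,1,2,3,4,6,5]),(2,[]),(7,[]),(3,[]),(0,[]),(1,[])]),
     (adj [[1,2,7],[4,5,6,7],[4,5,6],[4,5,6],[7],[7]], Cover 0 [6,4,7,0,5,3,2,1], []),
     (adj [[1,2,7],[5,6,7],[4,5,6],[4,5,6],[7],[7]], Cover 1 [1,6,3,4,0,7,5,2], [(5,[0,7,2,3,6,5,4,1]),(0,[]),(1,[0,1,2,3,4,6,5]),(0,[0,7,2,3,5,6,4,1]),(5,[]),(9,[])]),
     (adj [[1,2,7],[5,6,7],[4,5,6],[4,5,6],[7]], Cover 0 [5,6,0,7,4,3,2,1], [(10,[]),(0,[]),(2,[]),(0,[0,1,2,3,4,6,5]),(2,[0,1,2,3,4,6,5]),(6,[])]),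
     (adj [[1,4,7],[5,6,7],[4,5,6],[4,5,6,7],[6,7]], Cover 0 [7,0,5,2,6,1,4,3], []),
     (adj [[1,4,7],[5,6,7],[4,5,6],[4,5,6,7],[7],[7]], Cover 1 [7,0,6,2,1,5,4,3], []),
     (adj [[1,4,7],[5,6,7],[4,5,6],[4,5,6,7],[7]], Cover 0 [6,5,4,0,7,3,2,1], [(1,[]),(2,[0,4,6,5,1,2,3]),(0,[0,1,2,3,4,6,5]),(2,[0,4,5,6,1,2,3]),(0,[]),(2,[0,1,3,2])]),
     (adj [[1,4,7],[5,6,7],[4,5,6],[4,5,6],[5,7]], Cover 0 [6,2,4,0,7,5,3,1], [(3,[0,4,6,5,1,2,3]),(0,[0,4,5,6,1,2,3]),(3,[]),(0,[0,1,3,2]),(3,[0,4,5,6,1,2,3])]),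
     (adj [[1,4,7],[5,6,7],[4,5,6],[4,5,6],[7]], Cover 0 [5,3,4,0,7,2,6,1], [(0,[]),(4,[0,4,5,6,1,2,3]),(1,[0,4,6,5,1,2,3]),(4,[0,1,3,2]),(1,[]),(4,[])]),
     (adj [[1,5,7],[2,5,6,7],[4,5,6],[4,5,6],[5,7]], Cover 1 [7,4,2,6,3,0,1,5], []),
     (adj [[1,5,7],[2,5,6,7],[4,5,6],[4,5,6],[7]], Cover 0 [4,3,5,0,1,2,7,6], [(0,[]),(6,[0,4,5,6,1,2,3]),(6,[0,1,3,2]),(6,[])]),
     (adj [[1,5,7],[5,6,7],[4,5,6,7],[4,5,6,7],[7]], Cover 0 [3,4,2,0,1,6,7,5], []),
     (adj [[1,5,7],[5,6,7],[4,5,6,7],[4,5,6],[7]], Cover 0 [3,2,7,0,1,4,6,5], [(0,[]),(8,[0,1,3,2]),(1,[0,1,3,2]),(8,[]),(1,[]),(8,[0,4,5,6,1,2,3])]),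
     (adj [[1,5,7],[5,6,7],[4,5,6],[4,5,6],[7]], Cover 0 [7,1,6,3,2,0,5,4], [(4,[0,5,4,6,7,2,3,1]),(0,[0,1,3,2]),(0,[]),(2,[0,1,3,2]),(2,[]),(9,[0,1,3,2])]),
     (adj [[1,7],[5,6,7],[4,5,6],[4,5,6],[7]], At 0, [(10,[]),(10,[0,1,3,2]),(5,[]),(0,[]),(0,[0,1,2,3,4,6,5])]),
     (adj [[2,3,5,7],[5,6,7],[4,5,6],[4,5,6],[7],[6]], Cover 1 [4,2,5,1,6,7,0,3], [(66,[])]),
     (adj [[2,3,5,7],[5,6,7],[4,5,6],[4,5,6],[7],[],[7]], Cover 1 [1,5,3,4,6,7,0,2], [(63,[]),(67,[])]),
     (adj [[2,3,5,7],[5,6,7],[4,5,6],[4,5,6],[7]], Cover 0 [6,4,7,0,5,1,3,2], [(0,[]),(68,[]),(1,[]),(2,[0,4,5,6,1,2,3]),(67,[0,4,5,6,1,2,3]),(2,[])]),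
     (adj [[2,3,7],[5,6,7],[4,5,6],[4,5,6],[6,7],[6]], Cover 1 [0,7,1,6,4,3,5,2], []),
     (adj [[2,3,7],[5,6,7],[4,5,6],[4,5,6],[6,7],[],[7]], Cover 1 [1,7,4,2,6,5,0,3], []),
     (adj [[2,3,7],[5,6,7],[4,5,6],[4,5,6],[6,7]], Cover 0 [6,4,7,0,5,1,3,2], [(0,[]),(2,[0,1,2,3,4,6,5]),(1,[]),(5,[0,4,5,6,1,2,3]),(66,[]),(5,[])]),
     (adj [[2,3,7],[5,6,7],[4,5,6],[4,5,6],[7],[7],[7]], Cover 1 [6,1,5,4,2,0,3,7], []),
     (adj [[2,3,7],[5,6,7],[4,5,6],[4,5,6],[7],[7]], Cover 0 [6,5,7,0,4,1,3,2], [(0,[]),(4,[0,1,2,3,4,6,5]),(1,[]),(4,[]),(1,[0,1,2,3,4,6,5]),(7,[])]),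
     (adj [[2,3,7],[5,6,7],[4,5,6],[4,5,6],[7]], Cover 0 [0,7,1,6,5,4,3,2], [(8,[]),(5,[0,1,2,3,4,6,5]),(5,[]),(0,[0,1,2,3,4,6,5]),(0,[]),(2,[])]),
     (adj [[2,5,7],[4,5,6,7],[4,5,6],[4,5,6,7],[7]], Cover 1 [7,0,5,6,3,4,2,1], [(0,[0,4,5,6,1,2,3])]),
     (adj [[2,5,7],[5,6,7],[4,5,6],[4,5,6,7],[7],[],[7]], Cover 0 [0,4,3,6,1,5,7,2], []),
     (adj [[2,5,7],[5,6,7],[4,5,6],[4,5,6,7],[7]], Cover 0 [4,0,5,6,1,7,3,2], [(2,[0,6,5,7,4,1,3,2]),(11,[0,5,6,7,4,1,3,2]),(1,[]),(2,[0,4,5,6,1,2,3]),(11,[]),(0,[])]),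
     (adj [[2,5,7],[3,5,6,7],[4,5,6],[4,5,6],[7],[6]], Cover 1 [0,7,4,3,2,5,1,6], []),
     (adj [[2,5,7],[5,6,7],[4,5,6],[4,5,6],[7],[6]], Cover 1 [0,7,4,6,1,5,3,2], [(13,[0,4,5,6,1,2,3]),(4,[0,4,5,6,1,2,3]),(1,[0,4,5,6,1,2,3]),(0,[])]),
     (adj [[2,5,7],[5,6,7],[4,5,6],[4,5,6],[7]], Cover 0 [6,3,5,0,7,1,4,2], [(0,[]),(5,[0,4,5,6,1,2,3]),(2,[0,4,5,6,1,2,3]),(5,[]),(2,[]),(14,[])]),
     (adj [[2,7],[5,6,7],[4,5,6],[4,5,6],[7]], At 0, [(15,[]),(6,[]),(15,[0,4,5,6,1,2,3]),(0,[]),(0,[0,1,2,3,4,6,5])]),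
     (adj [[7],[5,6,7],[4,5,6],[4,5,6],[7]], At 0, [(16,[]),(0,[]),(0,[0,1,3,2]),(16,[0,4,5,6,1,2,3]),(0,[0,4,5,6,1,2,3]),(0,[0,4,6,5,1,2,3])]),
     (adj [[1,2,3,6],[5,6,7],[4,5,6,7],[4,5,6],[7]], Cover 1 [4,7,6,0,3,5,2,1], [(0,[0,3,2,1,7,5,6,4]),(0,[])]),
     (adj [[1,2,3],[5,6,7],[4,5,6,7],[4,5,6],[7]], Cover 1 [4,6,5,0,2,7,1,3], [(1,[0,4,2,1,6,5,7,3]),(1,[0,3,2,1,7,5,6,4]),(0,[]),(1,[0,5,4,6,7,2,3,1]),(1,[0,6,4,5,7,2,3,1])]),
     (adj [[1,3],[5,6,7],[4,5,6,7],[4,5,6],[7]], Cover 0 [4,7,5,0,6,2,3,1], [(2,[0,4,2,1,6,5,7,3]),(2,[0,3,2,1,7,5,6,4]),(2,[0,4,2,1,5,6,7,3]),(2,[]),(2,[0,5,4,6,7,2,3,1]),(0,[])]),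
     (adj [[1],[5,6,7],[4,5,6,7],[4,5,6],[5,6,7]], At 0, []),
     (adj [[1],[5,6,7],[4,5,6,7],[4,5,6],[6,7]], Cover 0 [7,4,6,0,5,3,2,1], [(4,[0,5,4,6,7,2,3,1]),(4,[]),(4,[0,6,4,5,7,2,3,1]),(4,[0,3,2,1,7,5,6,4]),(0,[]),(4,[0,4,2,1,5,6,7,3])]),
     (adj [[1],[5,6,7],[4,5,6,7],[4,5,6],[7]], Cover 0 [0,6,3,7,4,5,2,1], [(2,[]),(5,[]),(5,[0,3,2,1,7,5,6,4]),(5,[0,5,4,6,7,2,3,1]),(0,[]),(5,[0,6,4,5,7,2,3,1])]),
     (adj [[],[3,5,6,7],[4,5,6,7],[4,5,6],[6,7]], Cover 1 [3,6,0,7,1,5,4,2], [(6,[0,4,2,1,5,6,7,3]),(6,[0,2,1,4,3,6,7,5])]),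
     (adj [[],[5,6,7],[4,5,6,7],[4,5,6],[6,7]], Cover 0 [3,5,1,0,7,4,6,2], [(0,[]),(7,[0,4,2,1,5,6,7,3]),(65,[0,2,3,6,7,4,5,1]),(1,[0,5,6,7,4,1,2,3]),(0,[0,5,6,7,4,1,2,3]),(7,[0,3,2,1,7,5,6,4])]),
     (adj [[],[5,6,7],[4,5,6,7],[4,5,6],[7]], Cover 0 [7,4,5,0,6,1,3,2], [(0,[0,3,2,1,7,6,5,4]),(8,[]),(0,[0,3,2,1,7,5,6,4]),(8,[0,3,2,1,7,5,6,4]),(0,[]),(2,[])]),
     (adj [[],[5,6,7],[4,5,6],[4,5,6],[7]], At 7, [(9,[]),(0,[]),(0,[0,1,3,2]),(0,[0,4,5,6,1,2,3]),(0,[0,4,6,5,1,2,3])]),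
     (adj [[4],[2,3,4,5],[3,4,5],[4,5],[5]], Cover 0 [0,6,3,1,5,7,4,2], []),
     (adj [[],[2,3,4,5],[3,4,5],[4,5,7],[5]], Cover 0 [5,4,0,6,7,2,3,1], []),
     (adj [[],[2,3,4,5],[3,4,5],[4,5],[5]], Cover 0 [7,0,3,4,5,6,2,1], [(0,[]),(0,[0,1,2,4,3]),(0,[0,1,2,5,4,3]),(1,[]),(1,[0,1,2,3,5,4]),(0,[0,1,2,4,3,5,7,6])]),
     (adj [[1,2,4,5,7],[4,5,6,7],[4,5,6,7],[4,5,6]], Cover 0 [3,6,2,7,0,4,5,1], []),
     (adj [[1,2,5,7],[4,5,6,7],[4,5,6,7],[4,5,6]], Cover 0 [4,5,0,7,6,3,2,1], [(0,[])]),
     (adj [[1,2,7],[4,5,6,7],[4,5,6,7],[4,5,6],[5]], Cover 0 [7,0,4,3,5,1,6,2], []),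
     (adj [[1,2,7],[4,5,6,7],[4,5,6,7],[4,5,6]], Cover 1 [4,6,5,7,2,0,3,1], [(0,[]),(6,[]),(6,[0,1,2,3,6,5,4]),(1,[0,1,2,3,4,6,5]),(1,[])]),
     (adj [[1,3,4,6,7],[4,5,6,7],[4,5,6,7],[4,5,6]], Cover 0 [5,4,0,7,6,3,2,1], []),
     (adj [[1,3,4,7],[4,5,6,7],[4,5,6,7],[4,5,6]], Cover 0 [6,5,0,7,4,3,2,1], [(0,[])]),
     (adj [[1,3,7],[4,5,6,7],[4,5,6,7],[4,5,6],[5]], Cover 0 [7,0,3,5,4,6,2,1], []),
     (adj [[1,3,7],[4,5,6,7],[4,5,6,7],[4,5,6]], Cover 1 [5,0,7,4,1,6,2,3], [(10,[0,1,2,3,5,4]),(0,[]),(1,[]),(1,[0,1,2,3,6,5,4]),(10,[0,1,2,3,6,5,4])]),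
     (adj [[1,4,5,7],[4,5,6,7],[4,5,6,7],[4,5,6]], Cover 0 [7,5,3,6,4,0,2,1], [(98,[])]),
     (adj [[1,4,7],[4,5,6,7],[4,5,6,7],[4,5,6,7]], Cover 0 [0,4,3,6,5,7,2,1], []),
     (adj [[1,4,7],[4,5,6,7],[4,5,6,7],[4,5,6]], Cover 0 [3,2,7,0,1,5,6,4], [(0,[]),(2,[]),(6,[]),(1,[])]),
     (adj [[1,7],[4,5,6,7],[4,5,6,7],[4,5,6]], At 0, [(7,[]),(3,[]),(0,[]),(0,[0,1,2,3,5,4]),(0,[0,1,2,3,6,5,4])]),
     (adj [[3,4,5,7],[4,5,6,7],[4,5,6,7],[4,5,6]], Cover 0 [7,4,3,6,5,0,2,1], [(15,[0,1,2,3,6,5,4]),(102,[])]),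
     (adj [[3,4,7],[4,5,6,7],[4,5,6,7],[4,5,6],[5]], Cover 0 [6,5,4,0,7,1,3,2], []),
     (adj [[3,4,7],[4,5,6,7],[4,5,6,7],[4,5,6]], Cover 0 [0,7,1,5,6,4,3,2], [(2,[]),(1,[]),(1,[0,1,2,3,4,6,5]),(17,[0,1,2,3,5,4]),(17,[0,1,2,3,6,5,4]),(0,[])]),
     (adj [[3,7],[4,5,6,7],[4,5,6,7],[4,5,6]], At 0, [(3,[]),(3,[0,2,1]),(0,[]),(0,[0,1,2,3,5,4]),(0,[0,1,2,3,6,5,4])]),
     (adj [[4,5,7],[3,4,5,6,7],[4,5,6,7],[4,5,6]], Cover 0 [7,5,3,6,4,0,2,1], []),
     (adj [[4,5,7],[4,5,6,7],[4,5,6,7],[4,5,6]], Cover 0 [7,0,5,3,6,1,4,2], [(20,[0,1,2,3,5,4]),(106,[]),(20,[0,1,2,3,6,5,4]),(1,[]),(107,[]),(0,[])]),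
     (adj [[4,7],[4,5,6,7],[4,5,6,7],[4,5,6]], At 0, [(6,[]),(6,[0,2,1]),(2,[]),(0,[]),(0,[0,1,2,3,4,6,5])]),
     (adj [[7],[4,5,6,7],[4,5,6,7],[4,5,6]], At 0, [(7,[]),(7,[0,2,1]),(3,[]),(0,[]),(0,[0,1,2,3,5,4]),(0,[0,1,2,3,6,5,4])]),
     (adj [[7],[4,5,6,7],[4,5,6],[4,5,6]], At 7, [(0,[]),(0,[0,1,3,2]),(23,[]),(23,[0,1,2,3,5,4]),(23,[0,1,2,3,6,5,4])]),
     (adj [[7],[4,5,6],[4,5,6],[4,5,6]], At 7, [(0,[]),(0,[0,2,1]),(0,[0,3,2,1]),(0,[0,4,5,6,1,2,3]),(0,[0,5,4,6,1,2,3]),(0,[0,6,4,5,1,2,3])]),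
     (adj [[],[4,5,6,7],[3,4,5,6,7],[4,5,6,7]], Cover 0 [6,7,5,0,4,3,2,1], [(0,[0,1,2,3,4,5,7,6]),(0,[])]),
     (adj [[],[4,5,6,7],[4,5,6,7],[4,5,6,7]], Cover 1 [5,4,0,7,3,6,2,1], [(1,[0,1,2,3,4,6,7,5]),(26,[0,1,2,3,5,4]),(26,[]),(26,[0,1,2,3,4,5,7,6]),(1,[0,1,2,3,4,5,7,6]),(0,[])]),
     (adj [[],[4,5,6,7],[4,5,6,7],[4,5,6]], At 7, [(2,[]),(0,[]),(27,[]),(27,[0,1,2,3,5,4]),(27,[0,1,2,3,6,5,4])]),
     (adj [[],[4,5,6,7],[4,5,6],[4,5,6]], At 7, [(3,[]),(0,[]),(0,[0,1,3,2]),(28,[]),(28,[0,1,2,3,5,4]),(28,[0,1,2,3,6,5,4])]),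
     (adj [[],[4,5,6],[4,5,6],[4,5,6]], At 7, [(4,[]),(0,[]),(0,[0,2,1]),(0,[0,3,2,1]),(0,[0,4,5,6,1,2,3]),(0,[0,5,4,6,1,2,3]),(0,[0,6,4,5,1,2,3])])]
    [(0,[]), (27,[]), (30,[]), (90,[]), (107,[]), (103,[]), (98,[])]"
  by code_simp

text \<open>Terminals are \<open>P9\<close> itself, or patterns that contract to \<open>P8\<close>
  or to \<open>K44\<close> minus an edge.\<close>

lemma apex_certificate_9: "apex_certificate 9
    [([(1,4),(0,0),(8,2),(5,3),(5,4),(2,5),(0,8),(2,3)], adj [[2,3,4,5],[3,4,5],[5],[5,6]]),
     ([(2,3),(1,0),(10,0),(6,2),(4,4),(4,5),(2,10),(3,3)], adj [[2,3,4,5],[3,4,5],[4],[6],[6]]),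
     ([(2,3),(0,1),(8,0),(4,2),(3,4),(5,3),(4,7),(2,2)], adj [[2,3,4,5],[3,4,5],[4],[6],[],[7]]),
     ([(1,1),(0,0),(6,0),(3,2),(2,3),(2,5),(1,2),(3,1)], adj [[2,3,4,5],[3,4],[4,6],[6],[],[7]]),
     ([(4,4),(4,3),(2,4),(1,3),(0,0),(2,2),(7,2),(0,7)], adj [[2,3,4,5],[4],[4,5,6],[6],[],[7]]),
     ([(2,3),(2,2),(0,0),(7,0),(4,3),(5,3),(3,7),(3,2)], adj [[3,4,5],[3,4,5,6],[4,5],[],[],[7]]),
     ([(2,4),(1,3),(0,1),(7,1),(5,3),(3,8),(4,5),(3,2)], adj [[2,3,4],[3,4,6],[4,6],[6],[],[7]]),
     ([(5,4),(4,1),(3,1),(2,2),(0,0),(7,0),(4,7),(3,2)], adj [[2,3,4],[3,4,6],[6],[5],[7],[7]])]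
    [(adj [[2,3,7,8],[5,6,7],[4,5,6],[4,5,6],[7],[8],[8]], Some (0,8), 2, [0,2,5,3,7,6,4,1]),
     (adj [[2,3,7,8],[5,6,7],[4,5,6],[4,5,6],[7,8],[8]], Some (1,7), 6, [0,4,1,5,2,3,6,8]),
     (adj [[1,3,7,8],[5,6,7],[4,6,8],[4,5,6],[7],[7,8]], Some (1,6), 2, [1,0,3,5,2,7,8,4]),
     (adj [[3,7,8],[5,6,7],[4,6,8],[4,5,6],[5,7],[8]], None, 1, [3,0,7,4,5,6,8,1,2]),
     (adj [[3,6,7,8],[5,6,7],[4,6,8],[4,5,6],[7],[8]], None, 1, [0,7,4,3,6,8,1,2,5]),
     (adj [[2,3,4,8],[6,7,8],[4,5,6],[4,5,6],[7],[7,8]], Some (0,8), 2, [0,2,4,3,1,5,6,7]),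
     (adj [[2,3,7,8],[6,7,8],[4,5,6],[4,5,6],[7,8],[8]], Some (1,6), 6, [0,1,2,4,3,8,5,7]),
     (adj [[2,3,7,8],[6,7,8],[4,5,6],[4,5,6],[5,7],[8]], Some (4,7), 2, [4,0,2,5,1,3,8,6]),
     (adj [[2,3,6,7,8],[6,7,8],[4,5,6],[4,5,6],[7],[8]], Some (4,7), 2, [0,2,4,3,8,6,5,1])]
    [(adj [[1,2,3,7,8],[5,6,8],[4,5,6],[4,5,6],[7],[],[],[8]], Cover 4 [5,1,6,4,7,8,0,3,2], []),
     (adj [[1,2,7,8],[5,6,8],[4,5,6],[4,5,6,7],[7],[],[],[8]], Cover 4 [6,3,4,7,8,5,1,0,2], []),
     (adj [[1,2,7,8],[5,6,8],[4,5,6],[4,5,6],[7],[],[7],[8]], Cover 4 [1,5,3,4,7,2,0,8,6], []),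
     (adj [[1,2,7,8],[5,6,8],[4,5,6],[4,5,6],[7],[],[8],[8]], Cover 4 [4,2,5,6,8,0,7,3,1], []),
     (adj [[1,2,7,8],[5,6,8],[4,5,6],[4,5,6],[7],[],[],[8]], Cover 4 [2,4,7,8,1,3,6,0,5], [(2,[]),(1,[]),(0,[]),(3,[])]),
     (adj [[1,2,7],[5,6,8],[4,5,6,8],[4,5,6],[7],[],[],[8]], Cover 4 [4,3,5,1,8,0,7,6,2], []),
     (adj [[1,2,7],[5,6,8],[4,5,6],[4,5,6,8],[7],[],[],[8]], Cover 4 [3,5,2,0,7,1,8,4,6], [(1,[])]),
     (adj [[1,2,5,7],[5,6,8],[4,5,6],[4,5,6],[7,8],[],[],[8]], Cover 4 [7,0,1,6,3,2,4,8,5], []),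
     (adj [[1,2,7],[5,6,8],[4,5,6],[4,5,6],[7,8],[],[],[8]], Cover 4 [5,2,6,0,7,8,4,3,1], [(0,[])]),
     (adj [[1,2,7],[5,6,8],[4,5,6],[4,5,6],[7],[8],[],[8]], Cover 3 [6,2,4,7,8,5,1,0,3], []),
     (adj [[1,2,7],[5,6,8],[4,5,6],[4,5,6],[7],[],[],[8]], At 8, [(5,[]),(4,[]),(3,[]),(1,[]),(0,[]),(0,[0,1,2,3,4,6,5])]),
     (adj [[1,4,7],[5,6,8],[4,5,6,7],[4,5,6],[7],[],[],[8]], Cover 2 [8,7,4,6,5,3,0,2,1], []),
     (adj [[1,4,7],[5,6,8],[4,5,6,8],[4,5,6],[7],[],[],[8]], Cover 3 [3,5,1,8,7,2,4,0,6], []),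
     (adj [[1,4,7],[5,6,8],[4,5,6],[4,5,6],[7,8],[],[],[8]], Cover 2 [8,7,3,5,2,6,4,0,1], []),
     (adj [[1,4,7],[5,6,8],[4,5,6],[4,5,6],[7],[],[],[8]], Cover 2 [1,8,7,3,2,4,0,5,6], [(1,[0,1,3,2]),(1,[]),(0,[]),(2,[]),(3,[0,1,3,2])]),
     (adj [[1,5,7],[5,6,8],[4,5,6],[4,5,6,7],[7],[],[],[8]], Cover 3 [4,2,6,1,0,5,7,8,3], []),
     (adj [[1,5,7],[5,6,8],[4,5,6],[4,5,6,8],[7],[],[],[8]], Cover 4 [7,0,1,6,3,2,4,8,5], []),
     (adj [[1,5,7],[5,6,8],[4,5,6],[4,5,6],[7,8],[],[],[8]], Cover 2 [7,8,5,3,6,2,1,0,4], [(6,[])]),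
     (adj [[1,5,7],[5,6,8],[4,5,6],[4,5,6],[7],[],[],[8]], Cover 3 [1,5,3,4,7,2,8,0,6], [(2,[]),(1,[]),(0,[]),(7,[])]),
     (adj [[1,7,8],[5,6,8],[4,5,6,8],[4,5,6],[7],[],[],[8]], Cover 3 [3,5,1,8,7,2,4,0,6], []),
     (adj [[1,7,8],[5,6,8],[4,5,6],[4,5,6],[5,7],[],[],[8]], Cover 2 [8,7,2,5,3,6,0,4,1], []),
     (adj [[1,7,8],[5,6,8],[4,5,6],[4,5,6],[7],[7],[],[8]], Cover 3 [6,1,8,7,4,5,3,0,2], []),
     (adj [[1,7,8],[5,6,8],[4,5,6],[4,5,6],[7],[8],[],[8]], Cover 2 [4,7,8,5,6,1,0,2,3], []),
     (adj [[1,7,8],[5,6,8],[4,5,6],[4,5,6],[7],[],[],[8]], Cover 5 [0,8,7,2,6,5,3,4,1], [(12,[]),(4,[0,1,2,3,4,6,5]),(4,[]),(3,[]),(0,[0,1,2,3,4,6,5]),(0,[]),(3,[0,1,3,2]),(1,[0,1,2,3,4,6,5]),(1,[]),(2,[])]),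
     (adj [[1,7],[5,6,8],[4,5,6],[4,5,6],[7],[],[],[8]], At 0, [(13,[]),(13,[0,1,3,2]),(9,[]),(5,[]),(5,[0,1,2,3,4,6,5]),(0,[])]),
     (adj [[1,2],[5,6,7,8],[4,5,6],[4,5,6],[7],[],[],[8]], Cover 3 [8,7,3,6,2,4,0,1,5], []),
     (adj [[1,5],[5,6,7,8],[4,5,6],[4,5,6],[7],[],[],[8]], Cover 3 [8,0,2,6,3,4,7,5,1], []),
     (adj [[1],[5,6,7,8],[4,5,6],[4,5,6],[7],[],[8],[8]], At 0, []),
     (adj [[1],[5,6,7,8],[4,5,6],[4,5,6],[7],[],[],[8]], Cover 2 [7,0,3,6,2,5,8,4,1], [(1,[0,1,2,3,4,6,5]),(2,[]),(1,[]),(0,[])]),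
     (adj [[1,3,8],[5,6,8],[4,5,6,7],[4,5,6],[7],[],[],[8]], Cover 4 [2,6,3,0,8,1,7,4,5], [(4,[])]),
     (adj [[1,3],[5,6,8],[4,5,6,7],[4,5,6],[7],[],[],[8]], Cover 6 [2,3,0,1,8,4,7,5,6], [(0,[]),(5,[])]),
     (adj [[1,4],[5,6,8],[4,5,6,7],[4,5,6,8],[7],[],[],[8]], At 0, []),
     (adj [[1,4],[5,6,8],[4,5,6,7],[4,5,6],[7],[],[],[8]], Cover 4 [1,6,3,4,7,2,8,0,5], [(0,[])]),
     (adj [[1],[5,6,8],[4,5,6,7],[4,5,6],[5,7],[],[],[8]], Cover 4 [3,5,0,8,7,2,4,1,6], []),
     (adj [[1],[5,6,8],[4,5,6,7],[4,5,6],[7],[],[7],[8]], Cover 3 [0,8,7,2,3,4,1,5,6], []),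
     (adj [[1],[5,6,8],[4,5,6,7],[4,5,6],[7],[],[],[8]], Cover 5 [7,4,3,6,0,1,5,2,8], [(0,[]),(10,[]),(1,[0,1,2,3,4,6,5]),(2,[]),(1,[]),(4,[])]),
     (adj [[1,3],[5,6,8],[4,5,6],[4,5,6],[7],[7],[8],[8]], At 0, []),
     (adj [[1,3],[5,6,8],[4,5,6],[4,5,6],[7],[7],[],[8]], Cover 3 [7,8,1,6,3,0,4,5,2], [(12,[]),(0,[])]),
     (adj [[1],[5,6,8],[4,5,6,8],[4,5,6],[7],[7],[],[8]], Cover 6 [8,0,6,3,5,1,7,2,4], [(13,[0,1,2,7,4,5,8,3,6]),(13,[])]),
     (adj [[1],[5,6,8],[4,5,6],[4,5,6],[7,8],[7],[],[8]], Cover 3 [3,1,8,7,2,0,6,5,4], [(1,[])]),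
     (adj [[1],[5,6,8],[4,5,6],[4,5,6],[7],[7],[],[8]], Cover 2 [1,8,7,3,2,4,0,5,6], [(1,[0,1,3,2]),(1,[]),(0,[]),(4,[]),(2,[])]),
     (adj [[1],[5,6,8],[4,5,6],[4,5,6],[7],[],[],[8]], At 7, [(16,[]),(12,[]),(5,[]),(5,[0,1,3,2]),(0,[]),(0,[0,1,2,3,4,6,5])]),
     (adj [[2,3,5,7,8],[5,6,8],[4,5,6],[4,5,6],[7],[],[],[8]], Cover 5 [4,7,0,5,1,6,3,8,2], []),
     (adj [[2,3,7,8],[5,6,8],[4,5,6],[4,5,6],[6,7],[],[],[8]], Cover 3 [4,7,8,1,5,0,2,6,3], []),
     (adj [[2,3,7,8],[5,6,8],[4,5,6],[4,5,6],[7],[8],[],[8]], Cover 6 [8,7,4,2,6,5,1,0,3], []),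
     (adj [[2,3,7,8],[5,6,8],[4,5,6],[4,5,6],[7],[],[],[8]], Cover 2 [8,7,2,5,3,6,0,4,1], [(0,[]),(0,[0,1,2,3,4,6,5]),(3,[0,7,2,3,6,5,4,1]),(3,[0,7,2,3,5,4,6,1]),(2,[]),(1,[])]),
     (adj [[2,3,6,8],[5,6,7,8],[4,5,6],[4,5,6],[7],[],[],[8]], Cover 3 [4,7,8,0,6,1,5,3,2], []),
     (adj [[2,3,8],[5,6,7,8],[4,5,6],[4,5,6],[7],[],[],[8]], Cover 2 [8,7,4,2,5,6,3,0,1], [(0,[])]),
     (adj [[2,3,8],[5,6,8],[4,5,6,7],[4,5,6],[7],[],[],[8]], Cover 2 [4,7,6,5,0,1,8,2,3], []),
     (adj [[2,3,8],[5,6,8],[4,5,6],[4,5,6],[7],[7],[],[8]], Cover 4 [6,0,8,7,5,4,2,1,3], []),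
     (adj [[2,3,8],[5,6,8],[4,5,6],[4,5,6],[7],[],[],[8]], At 7, [(4,[]),(2,[]),(1,[]),(1,[0,1,3,2]),(0,[]),(0,[0,1,2,3,4,6,5])]),
     (adj [[2,5,8],[5,6,8],[4,5,6,7],[4,5,6],[7],[],[],[8]], Cover 2 [4,3,5,1,8,0,2,7,6], []),
     (adj [[2,5,8],[5,6,8],[4,5,6],[4,5,6,7],[7],[],[],[8]], Cover 4 [2,0,1,8,3,7,4,6,5], []),
     (adj [[2,5,8],[5,6,8],[4,5,6],[4,5,6],[7],[],[8],[8]], Cover 3 [7,8,1,3,2,6,0,5,4], []),
     (adj [[2,5,8],[5,6,8],[4,5,6],[4,5,6],[7],[],[],[8]], Cover 2 [8,7,5,3,6,2,0,1,4], [(12,[0,2,1,3,8,5,6,7,4]),(0,[]),(1,[]),(12,[0,5,4,6,7,2,3,8,1]),(2,[]),(3,[])]),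
     (adj [[2,7,8],[5,6,8],[4,5,6],[4,5,6],[5,7],[],[],[8]], Cover 3 [7,4,2,6,1,5,8,0,3], []),
     (adj [[2,7,8],[5,6,8],[4,5,6],[4,5,6],[7],[8],[],[8]], Cover 3 [6,1,8,7,4,5,3,0,2], []),
     (adj [[2,7,8],[5,6,8],[4,5,6],[4,5,6],[7],[],[],[8]], Cover 5 [5,6,3,4,0,8,7,2,1], [(1,[]),(2,[]),(0,[]),(1,[0,1,2,3,4,6,5]),(2,[0,1,2,3,4,6,5]),(0,[0,1,2,3,4,6,5]),(15,[0,7,2,3,5,4,6,1]),(6,[]),(15,[0,2,1,3,8,5,6,7,4]),(15,[0,8,5,6,3,1,2,4,7])]),
     (adj [[2,8],[5,6,8],[4,5,6],[4,5,6],[7],[],[],[8]], At 0, [(16,[]),(7,[]),(16,[0,4,5,6,1,2,3,8,7]),(3,[]),(3,[0,1,2,3,4,6,5]),(0,[])]),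
     (adj [[2,6],[5,6,8],[4,5,6,8],[4,5,6],[7],[],[],[8]], Cover 3 [4,0,6,1,5,8,7,3,2], []),
     (adj [[2],[5,6,8],[4,5,6,8],[4,5,6],[7],[],[],[8]], Cover 2 [1,8,2,4,3,0,5,6,7], [(18,[]),(18,[0,8,5,6,3,1,2,4,7]),(0,[])]),
     (adj [[2,7],[5,6,8],[4,5,6],[4,5,6],[7,8],[],[],[8]], Cover 3 [1,5,4,7,0,2,6,8,3], [(2,[0,1,2,3,4,5,6,8,7]),(19,[]),(19,[0,7,2,3,6,5,4,1]),(2,[0,4,5,6,1,2,3,8,7]),(19,[0,4,5,6,1,2,3,8,7]),(19,[0,7,2,3,5,4,6,1])]),
     (adj [[2],[5,6,7,8],[4,5,6],[4,5,6],[7,8],[],[],[8]], Cover 2 [8,7,5,3,6,0,2,4,1], [(3,[]),(3,[0,1,2,3,4,5,6,8,7])]),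
     (adj [[2],[5,6,8],[4,5,6],[4,5,6],[7,8],[],[7],[8]], Cover 2 [0,5,4,7,6,8,1,2,3], [(21,[0,7,2,3,5,4,6,1]),(4,[])]),
     (adj [[2],[5,6,8],[4,5,6],[4,5,6],[7,8],[],[],[8]], Cover 4 [0,5,1,8,4,7,2,6,3], [(22,[]),(5,[]),(22,[0,4,5,6,1,2,3,8,7]),(2,[]),(1,[]),(0,[])]),
     (adj [[2,3],[5,6,8],[4,5,6],[4,5,6],[7],[8],[],[8]], Cover 3 [8,1,6,2,4,0,7,5,3], [(6,[]),(0,[0,7,2,3,5,4,6,1])]),
     (adj [[2],[5,6,8],[4,5,6],[4,5,6,7],[7],[8],[],[8]], Cover 2 [4,7,8,5,6,1,0,3,2], []),
     (adj [[2],[5,6,8],[4,5,6],[4,5,6],[7],[8],[],[8]], Cover 4 [0,5,8,1,4,3,2,7,6], [(8,[]),(25,[]),(25,[0,4,5,6,1,2,3,8,7]),(1,[]),(2,[]),(25,[0,2,1,3,8,5,6,7,4]),(0,[])]),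
     (adj [[2],[5,6,8],[4,5,6],[4,5,6],[7],[],[],[8]], At 8, [(9,[]),(7,[]),(26,[0,2,1,3,8,5,6,7,4]),(3,[]),(0,[]),(0,[0,1,2,3,4,6,5])]),
     (adj [[7,8],[5,6,8],[4,5,6],[4,5,6],[7],[],[],[8]], At 0, [(27,[]),(0,[]),(0,[0,1,3,2]),(27,[0,4,5,6,1,2,3,8,7]),(0,[0,4,5,6,1,2,3,8,7]),(0,[0,4,6,5,1,2,3,8,7])]),
     (adj [[7],[5,6,8],[4,5,6],[4,5,6],[7],[],[],[8]], At 0, [(28,[]),(1,[]),(1,[0,1,3,2]),(28,[0,4,5,6,1,2,3,8,7]),(1,[0,4,5,6,1,2,3,8,7]),(1,[0,4,6,5,1,2,3,8,7]),(0,[])]),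
     (adj [[],[5,6,8],[4,5,6],[4,5,6],[7],[],[],[8]], At 0, [(29,[]),(2,[]),(2,[0,1,3,2]),(29,[0,4,5,6,1,2,3,8,7]),(2,[0,4,5,6,1,2,3,8,7]),(2,[0,4,6,5,1,2,3,8,7]),(0,[]),(0,[0,4,5,6,1,2,3,8,7])]),
     (adj [[1,2,3,7,8],[6,7,8],[4,5,6],[4,5,6],[7],[8]], Cover 6 [0,7,4,6,5,2,8,3,1], []),
     (adj [[1,2,4,7,8],[6,7,8],[4,5,6],[4,5,6],[7],[8]], Cover 5 [3,6,2,0,7,8,5,4,1], []),
     (adj [[1,2,7,8],[6,7,8],[4,5,6],[4,5,6],[7,8],[8]], Cover 2 [7,0,8,3,6,5,1,4,2], []),
     (adj [[1,2,7,8],[6,7,8],[4,5,6],[4,5,6],[7],[8]], Cover 3 [1,8,3,4,2,5,0,7,6], [(0,[]),(2,[]),(1,[]),(0,[0,1,2,3,5,4,6,8,7])]),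
     (adj [[1,7,8],[2,6,7,8],[4,5,6],[4,5,6],[7],[8]], Cover 2 [8,7,4,3,6,2,1,0,5], []),
     (adj [[1,7,8],[6,7,8],[4,5,6,7],[4,5,6],[7],[8]], Cover 2 [8,1,6,3,4,2,7,0,5], []),
     (adj [[1,7,8],[6,7,8],[4,5,6],[4,5,6],[7],[7,8]], Cover 4 [7,1,8,6,3,2,4,0,5], [(2,[])]),
     (adj [[1,7,8],[6,7,8],[4,5,6],[4,5,6],[7],[8]], Cover 5 [8,7,0,6,3,2,5,1,4], [(7,[0,4,5,6,8,2,3,1,7]),(1,[0,1,3,2,5,4,6,8,7]),(1,[0,1,2,3,5,4,6,8,7]),(7,[0,5,4,6,7,2,3,1]),(1,[0,1,3,2]),(1,[]),(0,[]),(3,[0,1,3,2]),(3,[]),(2,[])]),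
     (adj [[2,3,7,8],[6,7,8],[4,5,6],[4,5,6],[7],[8]], Cover 7 [6,2,0,8,7,4,1,5,3], [(88,[]),(8,[0,4,5,6,8,2,3,1,7]),(8,[0,5,4,6,7,2,3,1]),(0,[]),(86,[]),(86,[0,1,2,3,5,4,6,8,7]),(87,[])]),
     (adj [[2,6,7,8],[6,7,8],[4,5,6],[4,5,6,7],[7],[8]], Cover 2 [4,3,6,0,8,1,5,2,7], []),
     (adj [[2,6,7,8],[6,7,8],[4,5,6],[4,5,6],[7,8],[8]], Cover 4 [7,0,8,5,3,2,6,1,4], []),
     (adj [[2,6,7,8],[6,7,8],[4,5,6],[4,5,6],[7],[8]], Cover 2 [8,7,4,3,6,2,0,1,5], [(0,[]),(1,[0,1,2,3,5,4,6,8,7]),(1,[]),(2,[])]),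
     (adj [[2,7,8],[4,6,7,8],[4,5,6],[4,5,6],[7],[8]], Cover 2 [5,0,7,1,6,4,2,8,3], [(0,[])]),
     (adj [[2,7,8],[6,7,8],[4,5,6],[4,5,6],[6,7],[8]], Cover 7 [8,5,2,7,4,6,1,0,3], []),
     (adj [[2,7,8],[6,7,8],[4,5,6],[4,5,6],[7,8],[8]], Cover 5 [1,7,8,5,2,3,6,0,4], [(5,[])]),
     (adj [[2,7,8],[6,7,8],[4,5,6],[4,5,6],[7],[8]], Cover 2 [6,1,7,0,5,4,3,8,2], [(15,[0,5,4,6,7,2,3,1]),(3,[]),(1,[0,1,2,3,5,4,6,8,7]),(1,[]),(7,[]),(2,[0,1,2,3,5,4,6,8,7]),(2,[]),(0,[0,1,2,3,5,4,6,8,7]),(6,[]),(0,[])]),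
     (adj [[4,6,7,8],[3,6,7,8],[4,5,6],[4,5,6],[7],[8]], Cover 4 [5,3,1,7,0,4,2,8,6], []),
     (adj [[4,6,7,8],[6,7,8],[4,5,6,8],[4,5,6],[7],[8]], Cover 5 [3,5,2,1,0,7,4,6,8], []),
     (adj [[4,6,7,8],[6,7,8],[4,5,6],[4,5,6,7],[7],[8]], Cover 4 [3,7,1,8,2,0,4,5,6], []),
     (adj [[4,6,7,8],[6,7,8],[4,5,6],[4,5,6],[7],[8]], Cover 3 [8,1,6,3,4,2,7,0,5], [(1,[0,1,3,2]),(1,[]),(2,[]),(0,[]),(3,[])]),
     (adj [[4,7,8],[6,7,8],[4,5,6,7],[4,5,6],[7],[8]], Cover 3 [8,1,7,4,3,2,5,0,6], []),
     (adj [[4,7,8],[6,7,8],[4,5,6,8],[4,5,6],[7],[8]], Cover 6 [5,8,1,7,4,0,3,2,6], []),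
     (adj [[4,7,8],[6,7,8],[4,5,6],[4,5,6],[7],[6,8]], Cover 3 [7,0,8,5,6,2,4,3,1], []),
     (adj [[4,7,8],[6,7,8],[4,5,6],[4,5,6],[7],[8]], Cover 5 [7,0,8,3,2,6,1,5,4], [(2,[0,1,3,2]),(2,[]),(23,[0,5,4,6,7,2,3,1]),(7,[0,1,3,2]),(7,[]),(3,[]),(15,[]),(1,[]),(23,[0,4,5,6,8,2,3,1,7]),(0,[])]),
     (adj [[6,7,8],[3,6,7,8],[4,5,6],[4,5,6],[7],[8]], Cover 4 [2,5,8,1,7,3,4,0,6], []),
     (adj [[6,7,8],[6,7,8],[4,5,6,7],[4,5,6],[7],[8]], Cover 4 [3,6,8,1,7,2,4,0,5], []),
     (adj [[6,7,8],[6,7,8],[4,5,6],[4,5,6],[7],[7,8]], Cover 3 [3,2,8,1,7,0,4,5,6], [(10,[0,1,3,2])]),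
     (adj [[6,7,8],[6,7,8],[4,5,6],[4,5,6],[7],[8]], Cover 5 [2,3,6,0,8,7,1,5,4], [(11,[]),(1,[0,1,2,3,5,4,6,8,7]),(1,[]),(11,[0,1,3,2]),(1,[0,1,3,2,5,4,6,8,7]),(1,[0,1,3,2]),(2,[]),(27,[0,4,5,6,8,2,3,1,7]),(27,[0,5,4,6,7,2,3,1]),(0,[])]),
     (adj [[7,8],[6,7,8],[4,5,6],[4,5,6],[7],[8]], At 0, [(20,[]),(12,[]),(12,[0,1,3,2]),(4,[]),(4,[0,1,2,3,5,4,6,8,7]),(0,[])]),
     (adj [[1,2,8],[6,7,8],[4,5,6,7],[4,5,6],[7],[8]], Cover 4 [7,2,0,5,3,6,4,8,1], []),
     (adj [[1,8],[6,7,8],[4,5,6,7],[4,5,6,7],[7],[8]], At 0, []),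
     (adj [[1,8],[6,7,8],[4,5,6,7],[4,5,6,8],[7],[8]], At 0, []),
     (adj [[1,8],[6,7,8],[4,5,6,7],[4,5,6],[7],[8]], Cover 4 [2,4,3,0,1,8,7,6,5], [(2,[]),(0,[]),(1,[]),(3,[]),(32,[0,4,5,6,8,2,3,1,7])]),
     (adj [[2,4,8],[6,7,8],[4,5,6,7],[4,5,6],[7],[8]], Cover 6 [0,4,7,6,5,3,8,1,2], []),
     (adj [[2,8],[6,7,8],[4,5,6,7],[4,5,6],[7],[8]], Cover 3 [4,5,8,1,6,0,3,7,2], [(0,[]),(5,[])]),
     (adj [[3,8],[6,7,8],[4,5,6,7],[4,5,6],[7],[8],[],[8]], At 0, []),
     (adj [[3,8],[6,7,8],[4,5,6,7],[4,5,6],[7],[8]], Cover 3 [8,1,7,2,3,6,0,4,5], [(0,[]),(36,[0,4,5,6,8,2,3,1,7]),(7,[]),(1,[]),(7,[0,5,6,7,4,1,2,3])]),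
     (adj [[4,5,8],[6,7,8],[4,5,6,7],[4,5,6],[7],[8]], Cover 3 [8,5,3,4,7,2,1,0,6], []),
     (adj [[4,6,8],[6,7,8],[4,5,6,7],[4,5,6],[7],[8]], Cover 3 [8,1,6,3,4,2,7,0,5], []),
     (adj [[4,8],[6,7,8],[4,5,6,7],[4,5,6],[7],[8]], At 0, [(6,[]),(4,[]),(2,[]),(1,[]),(0,[]),(10,[])]),
     (adj [[5,8],[6,7,8],[4,5,6,7],[4,5,6],[7,8],[8]], At 0, []),
     (adj [[5,8],[6,7,8],[4,5,6,7],[4,5,6],[7],[8]], Cover 7 [1,4,2,0,5,7,8,6,3], [(8,[]),(1,[]),(0,[]),(12,[]),(41,[0,5,4,6,7,2,3,1])]),
     (adj [[6,8],[6,7,8],[4,5,6,7],[4,5,6],[7],[8]], At 0, [(9,[]),(7,[]),(5,[]),(2,[]),(0,[]),(13,[])]),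
     (adj [[8],[6,7,8],[4,5,6,7],[4,5,6],[7],[8]], At 0, [(10,[]),(8,[]),(6,[]),(3,[]),(1,[]),(0,[]),(14,[])]),
     (adj [[2,4,8],[6,7,8],[4,5,6],[4,5,6],[7],[7,8]], Cover 4 [8,1,7,4,2,3,6,0,5], [(121,[])]),
     (adj [[2,8],[6,7,8],[4,5,6],[4,5,6],[7,8],[7,8]], At 0, []),
     (adj [[2,8],[6,7,8],[4,5,6],[4,5,6],[7],[7,8]], Cover 7 [7,8,0,2,6,1,4,5,3], [(17,[]),(46,[0,5,4,6,7,2,3,1]),(46,[0,6,4,5,7,2,3,1]),(0,[]),(1,[])]),
     (adj [[8],[2,6,7,8],[4,5,6],[4,5,6],[7],[7,8]], Cover 2 [7,8,0,3,2,6,1,5,4], [(18,[])]),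
     (adj [[8],[6,7,8],[4,5,6,8],[4,5,6],[7],[7,8]], Cover 3 [3,4,2,8,1,0,7,5,6], [(1,[0,1,3,2])]),
     (adj [[8],[6,7,8],[4,5,6],[4,5,6],[7],[7,8]], Cover 1 [7,8,0,3,2,6,1,5,4], [(20,[]),(5,[0,1,3,2]),(5,[]),(49,[0,5,4,6,7,2,3,1]),(0,[0,1,3,2]),(0,[]),(49,[0,6,4,5,7,2,3,1]),(2,[]),(1,[0,1,3,2]),(1,[])]),
     (adj [[2,3,6,8],[6,7,8],[4,5,6],[4,5,6],[7],[8],[],[8]], Cover 2 [5,0,6,7,4,1,2,3,8], []),
     (adj [[2,3,8],[6,7,8],[4,5,6],[4,5,6],[7],[8],[],[8]], Cover 3 [4,0,5,6,1,8,7,2,3], [(0,[]),(22,[0,7,2,3,6,5,4,1])]),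
     (adj [[2,8],[6,7,8],[4,5,6],[4,5,6],[7],[8],[],[8]], Cover 4 [3,5,2,0,7,8,1,6,4], [(0,[]),(8,[0,1,3,2]),(52,[0,7,2,3,6,5,4,1]),(23,[0,7,2,3,6,5,4,1])]),
     (adj [[8],[6,7,8],[4,5,6,8],[4,5,6],[7],[8],[],[8]], At 0, []),
     (adj [[8],[6,7,8],[4,5,6],[4,5,6],[7],[8],[],[8]], Cover 3 [2,4,0,8,1,7,3,6,5], [(1,[]),(0,[]),(10,[0,7,2,3,6,5,4,1]),(10,[]),(54,[0,6,4,5,8,2,3,7,1]),(54,[0,5,4,6,1,2,3]),(25,[0,7,2,3,6,5,4,1]),(1,[0,1,3,2]),(0,[0,1,3,2]),(54,[0,5,4,6,7,2,3,1])]),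
     (adj [[8],[6,7,8],[4,5,6],[4,5,6],[7],[8]], At 7, [(26,[]),(11,[]),(11,[0,1,3,2]),(5,[]),(55,[0,5,4,6,7,2,3,1]),(0,[])]),
     (adj [[],[6,7,8],[4,5,6,7,8],[4,5,6],[7],[8]], Cover 3 [4,3,5,8,1,0,6,2,7], [(0,[0,3,2,1,8,7,6,5,4])]),
     (adj [[2],[6,7,8],[4,5,6,8],[4,5,6,7],[7],[8]], At 0, []),
     (adj [[4,5],[6,7,8],[4,5,6,8],[4,5,6,7],[7],[8]], At 0, []),
     (adj [[4],[6,7,8],[4,5,6,8],[4,5,6,7],[7],[8]], Cover 2 [5,2,4,7,1,0,6,3,8], [(0,[])]),
     (adj [[],[6,7,8],[4,5,6,8],[4,5,6,7],[5,7],[8]], At 0, []),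
     (adj [[],[6,7,8],[4,5,6,8],[4,5,6,7],[7],[8]], Cover 3 [0,6,2,8,7,4,3,5,1], [(3,[]),(5,[]),(5,[0,1,2,3,5,4,6,8,7]),(1,[]),(61,[0,4,5,6,8,2,3,1,7]),(61,[0,5,4,6,7,2,3,1]),(0,[])]),
     (adj [[1],[6,7,8],[4,5,6,8],[4,5,6],[7],[7,8]], Cover 3 [7,1,8,2,3,6,0,4,5], [(6,[])]),
     (adj [[],[6,7,8],[4,5,6,8],[4,5,6,8],[7],[7,8]], At 0, []),
     (adj [[],[6,7,8],[4,5,6,8],[4,5,6],[7],[7,8]], Cover 2 [7,8,2,0,3,6,1,5,4], [(8,[0,1,2,3,5,4,6,8,7]),(2,[]),(64,[0,2,3,7,6,5,4,1]),(8,[]),(0,[]),(64,[0,6,4,5,7,2,3,1]),(1,[])]),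
     (adj [[],[6,7,8],[4,5,6,8],[4,5,6],[7],[8],[],[8]], Cover 2 [3,0,2,1,7,8,5,6,4], [(3,[0,7,2,3,6,5,4,1]),(3,[]),(9,[0,7,2,3,5,6,4,8,1]),(9,[0,1,2,3,5,4,6,8,7]),(9,[]),(65,[])]),
     (adj [[],[6,7,8],[4,5,6,8],[4,5,6],[7],[8]], At 7, [(10,[0,1,2,3,5,4,6,8,7]),(9,[]),(4,[]),(1,[]),(66,[0,5,4,6,7,2,3,1]),(0,[])]),
     (adj [[],[6,7,8],[4,5,6],[4,5,6],[7,8],[7,8]], Cover 3 [8,7,2,3,0,6,1,5,4], [(0,[]),(0,[0,1,3,2]),(11,[]),(67,[0,6,4,5,7,2,3,1]),(0,[0,1,3,2,4,5,6,8,7]),(11,[0,1,2,3,4,5,6,8,7]),(11,[0,6,7,8,4,5,1,3,2]),(67,[0,1,4,5,3,7,8,6,2]),(67,[0,1,4,5,2,7,8,6,3])]),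
     (adj [[],[6,7,8],[4,5,6],[4,5,6],[7,8],[8]], At 7, [(12,[0,1,2,3,5,4,6,8,7]),(1,[0,1,2,3,5,4,6,8,7]),(1,[0,1,3,2,5,4,6,8,7]),(0,[]),(68,[0,5,4,6,7,2,3,1]),(68,[0,6,4,5,8,2,3,7,1])]),
     (adj [[2,5],[6,7,8],[4,5,6],[4,5,6],[7],[8],[],[8]], Cover 2 [1,7,4,2,5,0,3,8,6], [(69,[0,5,4,6,1,2,3]),(13,[0,7,2,3,5,6,4,8,1]),(13,[0,1,2,3,5,4,6,8,7]),(13,[])]),
     (adj [[2],[6,7,8],[4,5,6],[4,5,6],[7],[8],[],[8]], Cover 5 [3,0,4,7,1,8,5,2,6], [(3,[0,1,3,2,5,4,6,8,7]),(3,[0,7,3,2,5,6,4,8,1]),(3,[0,1,3,2]),(14,[0,1,2,3,5,4,6,8,7]),(14,[0,7,2,3,5,6,4,8,1]),(14,[]),(0,[]),(70,[0,5,4,6,1,2,3]),(70,[0,6,4,5,8,2,3,7,1]),(3,[])]),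
     (adj [[],[6,7,8],[4,5,6],[4,5,6],[7],[8],[],[8]], Cover 1 [7,8,0,3,2,6,1,5,4], [(15,[0,1,2,3,5,4,6,8,7]),(4,[0,1,3,2,5,4,6,8,7]),(4,[0,1,2,3,5,4,6,8,7]),(71,[0,5,4,6,7,2,3,1]),(4,[0,1,3,2]),(4,[]),(71,[0,4,5,6,8,2,3,1,7]),(0,[]),(4,[0,7,3,2,5,6,4,8,1]),(4,[0,7,2,3,5,6,4,8,1])]),
     (adj [[],[6,7,8],[4,5,6],[4,5,6],[7],[8]], At 8, [(16,[]),(5,[]),(5,[0,1,3,2]),(3,[]),(72,[0,4,5,6,8,2,3,1,7]),(0,[])]),
     (adj [[1,2,3,7,8],[5,6,7],[4,6,8],[4,5,6],[7],[8]], Cover 3 [5,6,4,7,0,2,8,1,3], []),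
     (adj [[1,3,7,8],[5,6,7],[4,5,6,8],[4,5,6],[7],[8]], Cover 3 [8,5,6,4,7,3,0,1,2], []),
     (adj [[1,3,7,8],[5,6,7],[4,6,8],[4,5,6],[7],[8]], Cover 7 [7,2,6,3,5,1,0,4,8], [(2,[0,5,4,6,7,2,3,1]),(149,[]),(0,[]),(1,[]),(151,[]),(150,[])]),
     (adj [[1,4,7,8],[5,6,7],[4,6,7,8],[4,5,6],[7],[8]], Cover 3 [8,0,7,6,3,1,5,4,2], []),
     (adj [[1,4,7,8],[5,6,7],[4,6,8],[4,5,6],[7],[8],[],[8]], Cover 6 [0,2,6,3,5,1,7,8,4], []),
     (adj [[1,4,7,8],[5,6,7],[4,6,8],[4,5,6],[7],[8]], Cover 3 [8,2,4,7,1,3,6,0,5], [(0,[]),(5,[0,1,2,3,4,8,6,7,5]),(1,[]),(5,[0,5,4,6,7,2,3,1]),(2,[])]),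
     (adj [[1,6,7,8],[5,6,7],[4,5,6,8],[4,5,6],[7],[8]], Cover 4 [2,6,3,1,7,0,8,5,4], []),
     (adj [[1,6,7,8],[5,6,7],[4,6,8],[4,5,6],[7],[8]], Cover 3 [1,6,3,4,8,2,0,5,7], [(7,[0,1,2,3,4,8,6,7,5]),(156,[]),(4,[0,4,5,6,1,2,3]),(0,[])]),
     (adj [[1,7,8],[3,5,6,7],[4,6,8],[4,5,6],[7],[8]], Cover 1 [0,7,4,3,6,5,8,2,1], []),
     (adj [[1,7,8],[5,6,7,8],[4,6,8],[4,5,6],[7],[8]], Cover 5 [7,0,8,5,6,3,4,2,1], []),
     (adj [[1,7,8],[5,6,7],[4,6,8],[4,5,6],[7,8],[8]], Cover 4 [3,6,1,0,8,2,4,7,5], [(7,[])]),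
     (adj [[1,7,8],[5,6,7],[4,6,8],[4,5,6],[7],[8]], Cover 1 [3,6,1,0,8,7,4,5,2], [(2,[]),(8,[]),(11,[0,1,2,3,4,8,6,7,5]),(11,[0,2,1,3,7,5,6,4]),(3,[]),(11,[0,4,5,6,1,8,3,7,2]),(11,[0,5,4,6,7,2,3,1]),(1,[]),(5,[]),(0,[])]),
     (adj [[3,7,8],[5,6,7],[3,4,6,8],[4,5,6],[7],[8]], Cover 4 [6,1,4,7,8,0,5,2,3], []),
     (adj [[3,7,8],[5,6,7],[4,6,8],[4,5,6],[7,8],[8]], Cover 3 [4,2,6,5,0,1,7,3,8], [(1,[0,2,1,3,5,4,6,8,7]),(162,[])]),
     (adj [[3,7,8],[5,6,7],[4,6,8],[4,5,6],[7],[8]], Cover 7 [6,3,0,7,8,5,2,4,1], [(163,[]),(14,[0,5,4,6,7,2,3,1]),(14,[0,4,5,6,1,8,3,7,2]),(14,[0,2,1,3,7,5,6,4]),(14,[0,1,2,3,4,8,6,7,5]),(1,[]),(2,[0,2,1,3,5,4,6,8,7]),(0,[0,2,1,3,5,4,6,8,7]),(0,[]),(162,[])]),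
     (adj [[7,8],[5,6,7],[4,6,8],[4,5,6],[7],[8]], At 0, [(3,[]),(3,[0,2,1,3,5,4,6,8,7]),(0,[]),(3,[0,4,5,6,1,2,3]),(3,[0,5,4,6,2,1,3,8,7]),(0,[0,4,5,6,1,2,3])]),
     (adj [[2,8],[5,6,7],[4,6,7,8],[4,5,6],[7],[8]], Cover 7 [5,8,2,6,7,4,1,0,3], [(0,[]),(0,[0,3,2,1,7,5,6,4])]),
     (adj [[8],[5,6,7],[4,6,7,8],[4,5,6],[7,8],[8]], Cover 5 [2,7,4,3,0,5,8,6,1], [(1,[])]),
     (adj [[8],[5,6,7],[4,6,7,8],[4,5,6],[7],[6,8]], Cover 7 [6,5,0,4,7,1,2,8,3], []),
     (adj [[8],[5,6,7],[4,6,7,8],[4,5,6],[7],[8]], Cover 2 [4,7,1,6,8,0,5,2,3], [(19,[0,2,1]),(19,[0,5,6,7,4,2,1,3]),(1,[]),(3,[0,3,2,1,7,5,6,4]),(19,[0,5,4,6,7,2,3,1]),(1,[0,3,2,1,7,5,6,4]),(3,[]),(19,[0,3,2,1,7,8,6,4,5]),(0,[]),(2,[])]),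
     (adj [[1,3,4,8],[5,6,7],[4,6,8],[4,5,6],[7],[8],[],[8]], Cover 7 [0,5,6,2,7,1,4,3,8], []),
     (adj [[1,3,8],[5,6,7],[4,6,8],[4,5,6],[7],[8],[],[8]], Cover 4 [6,2,4,7,5,8,0,1,3], [(0,[]),(5,[])]),
     (adj [[1,8],[5,6,7],[4,6,8],[4,5,6],[7],[8],[],[8]], Cover 3 [3,2,0,1,7,8,4,6,5], [(0,[]),(22,[0,2,1,3,7,5,6,4]),(2,[]),(6,[]),(0,[0,8,3,1,6,7,5,2,4])]),
     (adj [[8],[5,6,7],[4,6,8],[4,5,6],[7],[8],[],[8]], Cover 3 [7,1,5,0,2,3,4,8,6], [(3,[0,4,5,6,1,2,3]),(7,[]),(3,[]),(23,[0,2,1,3,7,5,6,4]),(0,[]),(23,[0,3,2,7,1,8,4,6,5]),(23,[0,7,2,3,6,5,4,1]),(23,[0,6,4,8,5,7,2,3,1]),(0,[0,4,5,6,1,2,3]),(23,[0,1,2,3,4,8,6,7,5])]),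
     (adj [[8],[5,6,7],[4,6,8],[4,5,6],[7],[8]], At 7, [(8,[]),(4,[]),(24,[0,2,1,3,7,5,6,4]),(4,[0,4,5,6,1,2,3]),(24,[0,5,4,6,7,2,3,1]),(0,[])]),
     (adj [[],[5,6,7,8],[4,6,8],[4,5,6],[7],[7,8]], Cover 1 [0,5,8,2,4,6,1,7,3], [(0,[]),(0,[0,1,4,5,3,8,7,6,2]),(0,[0,5,2,1,6,7,8,3,4]),(0,[0,4,1,5,8,3,7,2,6]),(25,[0,6,4,5,7,8,3,1,2])]),
     (adj [[],[5,6,7,8],[4,6,8],[4,5,6],[7],[8]], At 7, [(1,[0,2,1,3,5,4,6,8,7]),(26,[0,3,2,1,7,8,6,4,5]),(26,[0,2,1,3,7,5,6,4]),(0,[]),(26,[0,1,4,6,3,2,7,5]),(0,[0,1,3,2,4,8,6,7,5])]),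
     (adj [[],[5,6,7],[4,6,8],[4,5,6],[7],[8],[],[8]], At 0, [(2,[0,3,7,2,8,6,4,5,1]),(2,[0,3,8,1,7,6,5,4,2]),(2,[0,1,4,8,2,5,7,6,3]),(2,[0,6,7,5,8,3,1,2,4]),(2,[0,6,8,4,7,3,2,1,5]),(2,[0,4,1,8,5,2,7,3,6]),(2,[0,2,1,3,5,4,6,8,7]),(2,[])]),
     (adj [[],[5,6,7],[4,6,8],[4,5,6],[7],[8]], At 8, [(3,[]),(1,[]),(28,[0,1,2,3,4,8,6,7,5]),(1,[0,4,5,6,1,2,3]),(28,[0,4,5,6,1,8,3,7,2]),(0,[])]),
     (adj [[1,2,3,7],[5,6,7],[4,5,6],[4,5,6],[7],[8]], At 8, []),
     (adj [[1,2,3,7],[5,6,7],[4,5,6],[4,5,6],[7]], Cover 7 [5,6,4,8,7,3,0,2,1], [(0,[]),(0,[0,1,2,3,4,6,5])]),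
     (adj [[1,2,6,7,8],[5,6,7],[4,5,6],[4,5,6],[7]], At 8, []),
     (adj [[1,2,7,8],[5,6,7],[4,5,6],[4,5,6,8],[7]], Cover 3 [7,0,2,5,3,6,8,4,1], [(3,[0,1,3,2])]),
     (adj [[1,2,7,8],[5,6,7],[4,5,6],[4,5,6],[6,7]], At 8, []),
     (adj [[1,2,7,8],[5,6,7],[4,5,6],[4,5,6],[7,8],[],[8]], Cover 3 [3,4,8,0,1,2,5,7,6], []),
     (adj [[1,2,7,8],[5,6,7],[4,5,6],[4,5,6],[7,8]], Cover 0 [0,7,4,6,3,5,8,2,1], [(0,[])]),
     (adj [[1,2,7,8],[5,6,7],[4,5,6],[4,5,6],[7],[],[],[8]], Cover 7 [5,3,8,7,0,6,1,4,2], [(36,[0,7,2,3,6,5,4,1])]),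
     (adj [[1,2,7,8],[5,6,7],[4,5,6],[4,5,6],[7]], Cover 7 [3,4,0,8,1,7,6,2,5], [(6,[]),(4,[]),(1,[]),(3,[]),(5,[]),(0,[])]),
     (adj [[1,2,7],[5,6,7,8],[4,5,6],[4,5,6],[7]], Cover 3 [8,7,4,3,6,2,0,1,5], []),
     (adj [[1,2,7],[5,6,7],[4,5,6],[4,5,6,8],[7]], Cover 3 [1,0,2,3,8,4,7,6,5], [(1,[])]),
     (adj [[1,2,7],[5,6,7],[4,5,6],[4,5,6],[7],[],[],[8]], Cover 0 [3,8,7,1,0,2,4,6,5], [(9,[]),(2,[])]),
     (adj [[1,2,7],[5,6,7],[4,5,6],[4,5,6],[7]], Cover 0 [8,2,0,1,7,3,4,6,5], [(3,[]),(2,[]),(0,[]),(1,[]),(10,[])]),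
     (adj [[1,4,7],[5,6,7],[4,5,6,7],[4,5,6],[7]], Cover 1 [0,8,5,3,6,2,7,4,1], []),
     (adj [[1,4,7],[5,6,7],[4,5,6],[4,5,6,8],[7]], Cover 0 [8,5,1,6,7,4,0,3,2], [(14,[0,1,3,2,4,6,5]),(43,[0,7,5,6,2,3,1,4]),(1,[0,4,6,5,1,2,3])]),
     (adj [[1,4,7],[5,6,7],[4,5,6],[4,5,6],[7]], Cover 5 [3,6,5,8,0,7,4,2,1], [(0,[]),(2,[0,1,3,2]),(1,[0,1,3,2]),(0,[0,4,5,6,1,2,3]),(2,[0,4,6,5,1,2,3]),(1,[0,4,6,5,1,2,3]),(2,[0,4,5,6,1,2,3]),(1,[0,4,5,6,1,2,3]),(1,[])]),
     (adj [[1,5,7,8],[5,6,7],[4,5,6,8],[4,5,6],[7]], Cover 3 [6,3,4,7,0,8,5,1,2], [(16,[0,1,2,3,4,6,5])]),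
     (adj [[1,5,7,8],[5,6,7],[4,5,6],[4,5,6],[7,8]], Cover 7 [1,5,2,8,4,3,7,0,6], [(46,[0,4,5,6,1,3,2])]),
     (adj [[1,5,7,8],[5,6,7],[4,5,6],[4,5,6],[7],[8]], At 8, []),
     (adj [[1,5,7,8],[5,6,7],[4,5,6],[4,5,6],[7]], Cover 1 [8,1,5,3,4,2,0,7,6], [(0,[]),(2,[0,1,3,2]),(1,[]),(2,[]),(6,[0,1,3,2]),(6,[0,4,5,6,1,2,3])]),
     (adj [[1,5,7],[5,6,7],[4,5,6],[4,5,6,8],[7]], Cover 5 [3,8,2,0,1,7,5,6,4], [(0,[]),(49,[0,7,5,6,2,3,1,4])]),
     (adj [[1,5,7],[5,6,7],[4,5,6],[4,5,6],[7,8]], Cover 3 [1,5,3,4,8,2,0,7,6], [(50,[0,4,5,6,1,3,2]),(8,[0,1,3,2])]),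
     (adj [[1,5,7],[5,6,7],[4,5,6],[4,5,6],[7]], Cover 3 [4,3,0,1,8,5,2,6,7], [(9,[0,4,5,6,1,2,3]),(0,[]),(1,[]),(2,[]),(9,[])]),
     (adj [[1,7,8],[5,6,7],[4,5,6],[4,5,6],[5,7]], Cover 3 [0,7,4,2,6,5,1,8,3], [(10,[]),(0,[0,1,2,3,4,6,5])]),
     (adj [[1,7,8],[5,6,7],[4,5,6,7],[4,5,6],[7,8]], At 8, []),
     (adj [[1,7,8],[5,6,7],[4,5,6],[4,5,6],[7,8]], Cover 5 [1,0,7,4,3,2,6,8,5], [(9,[]),(12,[0,1,3,2]),(12,[]),(2,[0,1,2,3,4,6,5]),(0,[0,1,3,2]),(0,[]),(54,[0,4,5,6,1,2,3])]),
     (adj [[1,7,8],[5,6,7],[4,5,6],[4,5,6],[7],[7]], Cover 0 [8,6,1,5,7,4,0,3,2], [(0,[])]),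
     (adj [[1,7,8],[5,6,7],[4,5,6],[4,5,6],[7],[8]], Cover 3 [4,3,5,8,0,1,7,2,6], [(1,[]),(11,[]),(27,[0,1,3,2]),(14,[0,1,3,2]),(4,[]),(56,[0,7,2,3,6,5,4,1])]),
     (adj [[1,7,8],[5,6,7],[4,5,6],[4,5,6],[7]], Cover 0 [5,6,8,0,7,4,2,3,1], [(0,[]),(5,[]),(1,[]),(4,[]),(5,[0,1,2,3,4,6,5]),(1,[0,1,2,3,4,6,5]),(4,[0,1,2,3,4,6,5]),(2,[]),(12,[]),(15,[])]),
     (adj [[1,7],[5,6,7],[4,5,6],[4,5,6],[7]], At 0, [(16,[]),(16,[0,1,3,2]),(13,[]),(6,[]),(6,[0,1,2,3,4,6,5]),(0,[])]),
     (adj [[2,3,6,7],[5,6,7],[4,5,6],[4,5,6],[7],[8]], At 8, []),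
     (adj [[2,3,6,7],[5,6,7],[4,5,6],[4,5,6],[7]], Cover 7 [5,6,0,7,8,3,4,2,1], [(0,[])]),
     (adj [[2,3,7],[5,6,7],[4,5,6,8],[4,5,6],[7]], Cover 2 [5,6,4,7,0,8,3,1,2], []),
     (adj [[2,3,7],[5,6,7],[4,5,6],[4,5,6],[5,7]], Cover 4 [5,1,6,8,0,7,4,3,2], []),
     (adj [[2,3,7],[5,6,7],[4,5,6],[4,5,6],[7],[7]], Cover 0 [6,8,0,4,7,5,1,3,2], []),
     (adj [[2,3,7,8],[5,6,7],[4,5,6],[4,5,6],[7],[8]], Cover 2 [6,5,8,7,4,0,2,1,3], [(209,[]),(210,[])]),
     (adj [[2,3,7],[5,6,7],[4,5,6],[4,5,6],[7],[8],[8]], At 8, [(0,[])]),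
     (adj [[2,3,7],[5,6,7],[4,5,6],[4,5,6],[7],[8]], Cover 7 [4,7,1,6,5,8,2,0,3], [(0,[]),(1,[])]),
     (adj [[2,3,7],[5,6,7],[4,5,6],[4,5,6],[7]], Cover 2 [6,5,0,8,4,7,2,3,1], [(6,[]),(0,[0,1,2,3,4,6,5]),(4,[0,1,2,3,4,6,5]),(3,[0,1,2,3,4,6,5]),(0,[]),(4,[]),(3,[]),(8,[0,4,5,6,1,2,3]),(5,[])]),
     (adj [[2,5,7],[5,6,7],[4,5,6],[4,5,6,8],[7]], Cover 3 [6,4,7,0,5,8,3,2,1], [(0,[0,4,5,6,1,2,3]),(39,[0,1,3,2,4,6,5]),(9,[0,4,5,6,1,2,3])]),
     (adj [[2,5,7],[5,6,7],[4,5,6],[4,5,6],[7],[8]], Cover 3 [8,7,3,6,2,4,0,1,5], []),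
     (adj [[2,5,7],[5,6,7],[4,5,6],[4,5,6],[7],[],[7]], Cover 0 [4,3,6,1,8,0,2,7,5], []),
     (adj [[2,5,7],[5,6,7],[4,5,6],[4,5,6],[7]], Cover 7 [6,5,0,7,8,2,4,3,1], [(3,[0,4,5,6,1,2,3]),(0,[]),(2,[0,4,5,6,1,2,3]),(1,[]),(12,[0,4,5,6,1,2,3]),(2,[])]),
     (adj [[2,7,8],[5,6,7],[4,5,6],[4,5,6,7],[7,8]], At 8, []),
     (adj [[2,7,8],[5,6,7],[4,5,6],[4,5,6,7],[7]], Cover 2 [8,1,7,3,2,4,0,5,6], [(0,[])]),
     (adj [[2,7,8],[5,6,7],[4,5,6],[4,5,6],[5,7]], Cover 2 [5,4,7,8,6,0,2,3,1], [(6,[])]),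
     (adj [[2,7,8],[5,6,7],[4,5,6],[4,5,6],[7],[7]], Cover 7 [7,0,8,3,6,1,5,4,2], [(7,[]),(3,[0,1,2,3,4,6,5])]),
     (adj [[2,7,8],[5,6,7],[4,5,6],[4,5,6],[7,8],[8]], Cover 3 [3,6,2,8,7,0,1,4,5], [(8,[])]),
     (adj [[2,7,8],[5,6,7],[4,5,6],[4,5,6],[7],[8]], Cover 3 [7,0,8,5,3,2,4,1,6], [(77,[0,7,2,3,6,5,4,1]),(3,[]),(5,[]),(9,[]),(48,[0,1,3,2]),(0,[])]),
     (adj [[2,7,8],[5,6,7],[4,5,6],[4,5,6],[7]], Cover 1 [0,7,4,6,5,3,8,2,1], [(19,[0,4,5,6,1,2,3]),(6,[0,1,2,3,4,6,5]),(6,[]),(10,[]),(2,[0,1,2,3,4,6,5]),(2,[]),(4,[]),(3,[]),(0,[0,1,2,3,4,6,5]),(0,[])]),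
     (adj [[2,7],[5,6,7],[4,5,6],[4,5,6],[7]], At 0, [(20,[]),(11,[]),(20,[0,4,5,6,1,2,3]),(7,[]),(7,[0,1,2,3,4,6,5]),(0,[])]),
     (adj [[7,8],[5,6,7],[4,5,6],[4,5,6],[7]], At 0, [(21,[]),(0,[]),(0,[0,1,3,2]),(21,[0,4,5,6,1,2,3]),(0,[0,4,5,6,1,2,3]),(0,[0,4,6,5,1,2,3])]),
     (adj [[7],[5,6,7],[4,5,6],[4,5,6],[7]], At 0, [(22,[]),(1,[]),(1,[0,1,3,2]),(22,[0,4,5,6,1,2,3]),(1,[0,4,5,6,1,2,3]),(1,[0,4,6,5,1,2,3]),(0,[])]),
     (adj [[1,2],[5,6,7],[4,5,6,7],[4,5,6],[7]], Cover 0 [6,4,7,8,0,5,2,3,1], []),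
     (adj [[1,3],[5,6,7],[4,5,6,7],[4,5,6],[7],[8]], Cover 5 [4,2,6,1,0,8,3,7,5], []),
     (adj [[1,3],[5,6,7],[4,5,6,7],[4,5,6],[7]], Cover 4 [8,0,3,5,2,1,7,4,6], [(0,[])]),
     (adj [[1,5],[5,6,7],[4,5,6,7],[4,5,6],[7]], Cover 7 [2,7,8,0,3,4,5,1,6], [(3,[]),(3,[0,3,2,1,7,5,6,4])]),
     (adj [[1,8],[5,6,7],[4,5,6,7],[4,5,6],[7]], At 0, [(3,[]),(1,[]),(4,[0,3,2,1,7,5,6,4]),(0,[]),(0,[0,1,2,3,4,6,5]),(4,[])]),
     (adj [[1],[5,6,7],[4,5,6,7],[4,5,6],[7]], At 0, [(4,[]),(2,[]),(5,[0,3,2,1,7,5,6,4]),(1,[]),(1,[0,1,2,3,4,6,5]),(5,[]),(0,[])]),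
     (adj [[2,8],[5,6,7],[4,5,6,7],[4,5,6],[7,8]], At 8, []),
     (adj [[2,8],[5,6,7],[4,5,6,7],[4,5,6],[7]], Cover 7 [7,4,6,8,0,2,5,3,1], [(0,[0,3,2,1,7,5,6,4]),(7,[]),(0,[]),(7,[0,3,2,1,7,5,6,4]),(1,[0,3,2,1,7,5,6,4])]),
     (adj [[2],[5,6,7],[4,5,6,7],[4,5,6],[7]], Cover 7 [7,1,6,3,0,2,4,8,5], [(8,[]),(2,[]),(0,[])]),
     (adj [[5,6],[5,6,7,8],[4,5,6,7],[4,5,6],[7]], Cover 3 [8,1,7,4,3,5,0,6,2], []),
     (adj [[5,6],[5,6,7],[4,5,6,7],[4,5,6],[7]], Cover 3 [8,4,3,6,1,2,7,0,5], [(0,[0,3,2,1,7,5,6,4]),(0,[])]),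
     (adj [[5,8],[5,6,7],[4,5,6,7],[4,5,6],[7]], At 0, [(5,[]),(2,[]),(5,[0,3,2,1,7,5,6,4]),(11,[0,3,2,1,7,5,6,4]),(0,[]),(11,[])]),
     (adj [[5],[5,6,7],[4,5,6,7],[4,5,6],[7]], At 0, [(6,[]),(3,[]),(6,[0,3,2,1,7,5,6,4]),(12,[0,3,2,1,7,5,6,4]),(1,[]),(12,[]),(0,[])]),
     (adj [[8],[5,6,7],[4,5,6,7],[4,5,6],[7]], At 0, [(7,[]),(4,[]),(7,[0,3,2,1,7,5,6,4]),(13,[0,3,2,1,7,5,6,4]),(0,[]),(0,[0,1,2,3,4,6,5]),(13,[])]),
     (adj [[],[5,6,7],[4,5,6,7],[4,5,6],[7]], At 0, [(8,[]),(5,[]),(8,[0,3,2,1,7,5,6,4]),(14,[0,3,2,1,7,5,6,4]),(1,[]),(1,[0,1,2,3,4,6,5]),(14,[]),(0,[])]),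
     (adj [[8],[5,6,7],[4,5,6],[4,5,6],[7],[],[],[8]], At 8, [(170,[]),(97,[0,7,5,6,3,2,1,4]),(97,[0,7,5,6,2,3,1,4]),(170,[0,4,5,6,1,2,3]),(97,[0,7,2,3,6,5,4,1]),(97,[0,7,2,3,5,6,4,1])]),
     (adj [[],[5,6,7],[4,5,6],[4,5,6],[7],[],[],[8]], At 8, [(0,[]),(171,[]),(98,[0,7,5,6,3,2,1,4]),(98,[0,7,5,6,2,3,1,4]),(171,[0,4,5,6,1,2,3]),(98,[0,7,2,3,6,5,4,1]),(98,[0,7,2,3,5,6,4,1])]),
     (adj [[],[5,6,7],[4,5,6],[4,5,6],[7]], At 7, [(17,[]),(2,[]),(2,[0,1,3,2]),(2,[0,4,5,6,1,2,3]),(2,[0,4,6,5,1,2,3]),(0,[])]),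
     (adj [[1,2,3,6],[4,5,6],[4,5,6],[4,5,6]], Cover 3 [8,7,4,6,0,1,5,2,3], []),
     (adj [[1,2,3],[4,5,6],[4,5,6],[4,5,6],[],[7]], Cover 4 [6,1,4,0,7,8,5,2,3], []),
     (adj [[1,2,3],[4,5,6],[4,5,6],[4,5,6]], Cover 2 [8,7,3,5,1,6,4,0,2], [(0,[0,1,2,3,4,5,6,8,7]),(0,[0,1,2,3,4,6,5,8,7]),(0,[]),(0,[0,1,2,3,4,6,5]),(1,[])]),
     (adj [[1,2,4,6],[4,5,6],[4,5,6],[4,5,6]], Cover 3 [7,0,1,5,3,4,8,6,2], []),
     (adj [[1,2,4,7],[4,5,6],[4,5,6],[4,5,6],[],[],[7]], Cover 5 [0,8,7,6,5,3,4,1,2], []),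
     (adj [[1,2,4,7],[4,5,6],[4,5,6],[4,5,6],[],[],[8]], Cover 4 [8,5,3,4,0,1,7,2,6], []),
     (adj [[1,2,4,7],[4,5,6],[4,5,6],[4,5,6]], Cover 5 [4,6,2,5,7,8,0,1,3], [(1,[]),(0,[])]),
     (adj [[1,2,4],[4,5,6],[4,5,6],[4,5,6]], Cover 5 [4,0,2,6,7,8,3,1,5], [(3,[]),(0,[]),(0,[0,1,2,3,4,5,6,8,7]),(4,[])]),
     (adj [[1,2,7],[4,5,6,7],[4,5,6],[4,5,6]], Cover 2 [8,7,6,3,5,4,1,0,2], []),
     (adj [[1,2,7],[4,5,6],[4,5,6],[4,5,6,7],[],[],[],[8]], Cover 0 [7,8,4,6,1,5,0,3,2], [(182,[0,6,4,5,3,1,2]),(182,[0,5,4,6,3,1,2]),(1,[0,1,2,3,6,5,4])]),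
     (adj [[1,2,7],[4,5,6],[4,5,6],[4,5,6,7]], At 7, [(10,[0,3,2,1]),(10,[0,3,2,1,5,4]),(10,[0,3,2,1,6,5,4]),(0,[])]),
     (adj [[1,2,7],[4,5,6],[4,5,6],[4,5,6],[7],[7]], Cover 5 [7,8,2,6,1,3,4,0,5], []),
     (adj [[1,2,7],[4,5,6],[4,5,6],[4,5,6],[7],[8],[],[8]], Cover 5 [7,8,0,2,3,6,1,4,5], []),
     (adj [[1,2,7],[4,5,6],[4,5,6],[4,5,6],[7],[],[],[8]], Cover 3 [8,0,6,5,4,2,7,1,3], [(0,[0,1,2,3,4,6,5]),(0,[]),(5,[0,1,2,3,5,4])]),
     (adj [[1,2,7],[4,5,6],[4,5,6],[4,5,6],[7]], At 7, [(14,[0,3,2,1]),(2,[]),(2,[0,1,2,3,4,6,5]),(0,[])]),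
     (adj [[1,2,7],[4,5,6],[4,5,6],[4,5,6],[],[],[],[8]], At 7, [(6,[]),(6,[0,2,1]),(4,[]),(0,[]),(0,[0,1,2,3,5,4]),(0,[0,1,2,3,6,5,4])]),
     (adj [[1,2,7],[4,5,6],[4,5,6],[4,5,6]], At 7, [(7,[]),(7,[0,2,1]),(5,[]),(1,[]),(1,[0,1,2,3,5,4]),(1,[0,1,2,3,6,5,4]),(0,[])]),
     (adj [[1,2],[4,5,6],[4,5,6],[4,5,6]], At 0, [(14,[]),(9,[]),(9,[0,1,2,3,5,4]),(9,[0,1,2,3,6,5,4]),(0,[]),(0,[0,1,2,3,4,5,6,8,7])]),
     (adj [[1,4,7],[4,5,6],[4,5,6,7],[4,5,6],[],[],[8]], Cover 2 [5,4,0,8,6,7,1,3,2], []),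
     (adj [[1,4,7],[4,5,6],[4,5,6,7],[4,5,6]], Cover 0 [7,8,5,6,1,4,0,3,2], [(19,[0,2,1,3,5,4]),(19,[0,2,1,3,6,5,4]),(0,[]),(1,[0,4,6,5,1,2,3])]),
     (adj [[1,4,7],[4,5,6],[4,5,6,8],[4,5,6]], Cover 4 [6,2,5,7,0,8,4,1,3], [(0,[0,4,6,5,1,2,3]),(2,[0,4,6,5,1,2,3]),(20,[0,2,1,3,6,5,4,8,7]),(2,[0,4,5,6,1,2,3]),(20,[0,2,1,3,5,4,6,8,7])]),
     (adj [[1,4,7],[4,5,6],[4,5,6],[4,5,6]], Cover 5 [7,8,4,2,6,5,3,0,1], [(1,[]),(1,[0,4,6,5,1,2,3]),(1,[0,4,5,6,1,2,3]),(0,[]),(0,[0,4,6,5,1,2,3]),(0,[0,4,5,6,1,2,3]),(0,[0,1,3,2]),(3,[0,4,5,6,1,2,3])]),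
     (adj [[1,4],[4,5,6],[4,5,6],[4,5,6]], At 0, [(4,[]),(4,[0,1,3,2]),(4,[0,4,5,6,1,2,3]),(4,[0,4,6,5,1,2,3]),(0,[]),(0,[0,1,2,3,4,5,6,8,7])]),
     (adj [[1,7,8],[4,5,6],[4,5,6,7],[4,5,6],[5]], Cover 1 [6,5,4,8,0,7,3,2,1], []),
     (adj [[1,7,8],[4,5,6],[4,5,6,7],[4,5,6],[8],[8]], At 7, []),
     (adj [[1,7,8],[4,5,6],[4,5,6,7],[4,5,6],[8]], At 8, [(25,[0,3,2,1,4,5,6,8,7]),(0,[]),(0,[0,1,2,3,4,6,5]),(198,[0,4,5,6,2,1,3])]),
     (adj [[1,7,8],[4,5,6],[4,5,6,7],[4,5,6]], Cover 3 [0,7,4,6,5,2,8,3,1], [(3,[]),(3,[0,1,2,3,6,5,4]),(3,[0,1,2,3,5,4]),(8,[]),(26,[0,2,1,3,6,5,4]),(26,[0,2,1,3,5,4]),(2,[]),(0,[]),(0,[0,1,2,3,6,5,4])]),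
     (adj [[1,7,8],[4,5,6],[4,5,6],[4,5,6],[5]], Cover 5 [7,8,0,1,4,5,3,6,2], [(0,[0,1,3,2,4,5,6,8,7])]),
     (adj [[1,7,8],[4,5,6],[4,5,6],[4,5,6],[7],[8]], Cover 7 [8,7,4,1,2,3,5,0,6], [(28,[0,2,1,3,5,4,6,8,7]),(28,[0,2,1]),(10,[]),(10,[0,1,3,2])]),
     (adj [[1,7,8],[4,5,6],[4,5,6],[4,5,6],[7]], Cover 5 [8,0,1,5,2,3,4,7,6], [(0,[]),(2,[0,1,2,3,4,5,6,8,7]),(2,[0,1,3,2,4,5,6,8,7]),(6,[0,1,2,3,5,4]),(11,[]),(11,[0,1,3,2]),(6,[]),(29,[0,3,2,1])]),
     (adj [[1,7,8],[4,5,6],[4,5,6],[4,5,6]], Cover 1 [4,3,5,7,8,0,2,6,1], [(2,[]),(0,[]),(0,[0,1,2,3,4,5,6,8,7]),(7,[]),(3,[0,1,3,2]),(3,[0,1,3,2,4,5,6,8,7]),(12,[0,1,3,2]),(0,[0,1,2,3,5,4,6,8,7]),(3,[]),(3,[0,1,2,3,4,5,6,8,7])]),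
     (adj [[1,7],[4,5,6],[4,5,6],[4,5,6]], At 0, [(13,[]),(13,[0,1,3,2]),(8,[]),(8,[0,1,2,3,5,4]),(8,[0,1,2,3,6,5,4]),(0,[])]),
     (adj [[1],[4,5,6],[4,5,6],[4,5,6]], At 0, [(14,[]),(14,[0,1,3,2]),(9,[]),(9,[0,1,2,3,5,4]),(9,[0,1,2,3,6,5,4]),(0,[]),(0,[0,1,2,3,4,5,6,8,7])]),
     (adj [[7,8],[4,5,6],[4,5,6],[4,5,6]], At 0, [(0,[]),(0,[0,2,1]),(0,[0,3,2,1]),(0,[0,4,5,6,1,2,3]),(0,[0,5,4,6,1,2,3]),(0,[0,6,4,5,1,2,3])]),
     (adj [[7],[4,5,6],[4,5,6],[4,5,6]], At 0, [(1,[]),(1,[0,2,1]),(1,[0,3,2,1]),(1,[0,4,5,6,1,2,3]),(1,[0,5,4,6,1,2,3]),(1,[0,6,4,5,1,2,3]),(0,[])]),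
     (adj [[],[4,5,6],[4,5,6],[4,5,6]], At 0, [(2,[]),(2,[0,2,1]),(2,[0,3,2,1]),(2,[0,4,5,6,1,2,3]),(2,[0,5,4,6,1,2,3]),(2,[0,6,4,5,1,2,3]),(0,[]),(0,[0,1,2,3,4,5,6,8,7])])]
    [(0,[]), (0,[]), (36,[]), (209,[]), (136,[]), (107,[]), (0,[]), (0,[]), (0,[]), (0,[])]"
  by code_simp

text \<open>The degree sum exceeds that of a cubic graph on ten vertices by at most 2. All 17 bases
  are roots; the terminals are the Petersen graph and one pattern that contracts to
  \<open>P9\<close>.\<close>

lemma apex_certificate_10: "apex_certificate 10
    [([(3,4),(2,3),(0,0),(4,1),(5,1),(7,0),(5,3),(3,7),(4,2)], adj [[2,3,4,5,6],[3,4,5,6],[4,6],[6,7],[6,7]]),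
     ([(3,4),(0,0),(3,1),(4,1),(10,0),(7,4),(7,5),(5,10),(5,3)], adj [[2,3,4,5,6],[5,6],[4,5,6,7],[5,6,7],[],[],[8]]),
     ([(1,1),(0,0),(9,1),(4,5),(3,5),(2,6),(0,10),(2,3),(4,3)], adj [[2,3,4,5,6],[3,4,5],[4,5,7],[5,7],[7],[],[8]]),
     ([(3,5),(4,5),(5,2),(4,1),(2,2),(1,0),(7,1),(3,7),(2,3)], adj [[2,3,4,5,6],[3,4,5],[4,5,7],[7],[6,7],[],[8]]),
     ([(1,4),(0,0),(12,0),(5,5),(4,5),(4,3),(2,3),(2,6),(0,11)], adj [[2,3,4,5,6],[3,4],[6,7],[5,6,7],[6,7],[],[8]]),
     ([(1,4),(0,1),(5,1),(5,2),(3,4),(4,4),(10,0),(0,8),(2,2)], adj [[2,3,4,5,6],[3,4,5],[4,5,7],[5,7],[],[8],[8]]),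
     ([(1,2),(0,0),(8,0),(3,4),(2,3),(2,5),(0,8),(1,3),(3,2)], adj [[2,3,4,5,6],[3,4,5],[4,5,7],[7],[6],[8],[8]]),
     ([(1,2),(0,0),(9,1),(6,2),(4,3),(3,5),(2,9),(1,4),(4,1)], adj [[2,3,4,5,6],[3,4,5],[5,7],[5,6,7],[],[8],[8]]),
     ([(3,2),(2,2),(2,1),(0,0),(7,0),(5,3),(3,7),(4,3),(3,1)], adj [[2,3,4,5,6],[4,5],[4,5,6,7],[5,7],[],[8],[8]]),
     ([(0,0),(3,3),(4,1),(11,2),(4,5),(4,7),(6,6),(2,13),(3,5)], adj [[4,5,6],[3,4,5,6,7],[4,5,6,7],[5],[],[8],[8]])]
    [(adj [[7,8,9],[5,6,7],[4,6,8],[4,5,9],[7],[8],[9]], None, 0, [0,7,1,5,8,9,4,6,3,2]),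
     (adj [[3,7,8,9],[6,7,8],[4,5,9],[4,5,6],[7],[8],[9]], Some (4,7), 1, [0,8,5,3,4,9,1,2,6])]
    [(adj [[1,8],[5,6,9],[4,5,6],[4,5,6],[7],[],[],[8],[9]], Cover 4 [4,5,9,8,0,1,6,2,7,3], []),
     (adj [[2,8],[5,6,9],[4,5,6],[4,5,6],[7],[],[],[8],[9]], Cover 3 [1,5,4,7,0,8,3,6,2,9], []),
     (adj [[7,8],[5,6,9],[4,5,6],[4,5,6],[7],[],[],[8],[9]], Cover 0 [5,1,6,0,8,7,4,3,9,2], [(0,[0,4,5,6,1,2,3,9,8,7]),(1,[]),(1,[0,4,5,6,1,2,3,9,8,7]),(0,[0,1,3,2])]),
     (adj [[8],[5,6,9],[4,5,6],[4,5,6],[7],[],[],[8],[9]], At 0, [(2,[]),(1,[]),(1,[0,1,3,2]),(2,[0,4,5,6,1,2,3,9,8,7]),(1,[0,4,5,6,1,2,3,9,8,7]),(1,[0,4,6,5,1,2,3,9,8,7]),(0,[]),(0,[0,4,5,6,1,2,3,9,8,7])]),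
     (adj [[],[5,6,8,9],[4,5,6],[4,5,6],[7],[],[],[8],[9]], Cover 4 [8,9,2,6,5,4,0,7,3,1], []),
     (adj [[],[5,6,9],[4,5,6,8],[4,5,6],[7],[],[],[8],[9]], Cover 2 [1,9,8,2,4,3,7,0,5,6], []),
     (adj [[],[5,6,9],[4,5,6],[4,5,6],[7],[],[],[8],[9]], At 8, [(2,[]),(1,[]),(0,[]),(0,[0,1,3,2]),(1,[0,4,5,6,1,2,3,9,8,7]),(0,[0,4,5,6,1,2,3,9,8,7]),(0,[0,4,6,5,1,2,3,9,8,7])]),
     (adj [[1,7,9],[6,8,9],[4,5,6],[4,5,6],[7],[9],[],[8]], Cover 4 [6,3,8,7,0,9,5,2,1,4], []),
     (adj [[6,7,9],[6,8,9],[4,5,6],[4,5,6],[7],[9],[],[8]], Cover 4 [3,4,1,8,0,9,2,5,7,6], []),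
     (adj [[7,9],[6,8,9],[4,5,6],[4,5,6,8],[7],[9],[],[8]], At 0, []),
     (adj [[7,9],[6,8,9],[4,5,6],[4,5,6],[7],[8,9],[],[8]], At 0, []),
     (adj [[7,9],[6,8,9],[4,5,6],[4,5,6],[7],[9],[],[8]], Cover 7 [5,3,4,7,8,1,6,9,0,2], [(0,[]),(1,[]),(3,[]),(2,[])]),
     (adj [[7],[6,8,9],[4,5,6,9],[4,5,6],[7],[9],[],[8]], Cover 3 [0,8,1,2,5,3,6,7,4,9], []),
     (adj [[7],[6,8,9],[4,5,6],[4,5,6],[7,9],[9],[],[8]], Cover 3 [0,8,9,5,6,2,4,7,1,3], []),
     (adj [[7],[6,8,9],[4,5,6],[4,5,6],[7],[9],[],[8,9]], Cover 3 [0,7,9,1,6,3,5,4,8,2], []),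
     (adj [[5,7],[6,8,9],[4,5,6],[4,5,6],[7],[9],[],[8],[9]], At 0, []),
     (adj [[7],[6,8,9],[4,5,6],[4,5,6],[7],[9],[],[8],[9]], Cover 2 [4,0,6,1,9,5,8,7,3,2], [(4,[0,9,2,3,4,6,5,7,8,1]),(4,[]),(0,[])]),
     (adj [[7],[6,8,9],[4,5,6],[4,5,6],[7],[9],[],[8]], At 9, [(5,[]),(4,[]),(4,[0,1,3,2]),(3,[]),(10,[0,4,5,6,9,2,3,1,8,7]),(2,[]),(0,[])]),
     (adj [[],[6,7,8,9],[4,5,6],[4,5,6],[7],[9],[],[8]], Cover 1 [7,4,6,3,5,9,0,8,2,1], []),
     (adj [[],[6,8,9],[4,5,6,7],[4,5,6],[7],[9],[],[8]], Cover 6 [7,4,5,6,0,1,3,8,2,9], []),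
     (adj [[],[6,8,9],[4,5,6],[4,5,6],[7],[7,9],[],[8]], Cover 2 [0,8,7,5,2,6,4,1,9,3], []),
     (adj [[2],[6,8,9],[4,5,6],[4,5,6],[7],[9],[],[8,9]], Cover 6 [2,4,3,9,1,8,7,0,6,5], []),
     (adj [[5],[6,8,9],[4,5,6],[4,5,6],[7],[9],[],[8,9]], Cover 4 [9,7,4,2,3,0,8,1,6,5], []),
     (adj [[9],[6,8,9],[4,5,6],[4,5,6],[7],[9],[],[8,9]], Cover 1 [6,1,8,0,9,4,5,3,7,2], []),
     (adj [[],[6,8,9],[4,5,6,8],[4,5,6],[7],[9],[],[8,9]], At 0, []),
     (adj [[],[6,8,9],[4,5,6],[4,5,6],[7],[9],[],[8,9]], Cover 3 [0,6,1,9,7,5,2,3,8,4], [(7,[0,7,2,3,6,5,4,1]),(1,[]),(7,[]),(2,[]),(3,[]),(0,[])]),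
     (adj [[],[6,8,9],[4,5,6],[4,5,6],[7],[9],[],[8]], At 7, [(8,[]),(7,[]),(6,[]),(6,[0,1,3,2]),(5,[]),(19,[0,5,4,6,7,2,3,8,1]),(0,[])]),
     (adj [[1,9],[5,6,8],[4,6,9],[4,5,6],[7],[9],[],[8]], Cover 6 [4,9,5,1,6,8,0,7,2,3], []),
     (adj [[2,9],[5,6,8],[4,6,9],[4,5,6],[7],[9],[],[8]], Cover 6 [8,7,2,9,5,3,6,1,0,4], []),
     (adj [[3,9],[5,6,8],[4,6,9],[4,5,6],[7],[9],[],[8]], Cover 6 [5,6,4,7,0,8,2,9,3,1], []),
     (adj [[7,9],[5,6,8],[4,6,9],[4,5,6],[7],[9],[],[8]], Cover 6 [0,7,4,3,1,6,2,9,5,8], [(2,[0,4,5,6,1,2,3,8,7]),(0,[]),(2,[]),(0,[0,4,5,6,1,2,3,8,7]),(1,[])]),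
     (adj [[9],[5,6,8],[4,6,9],[4,5,6],[7],[9],[],[8]], At 0, [(3,[]),(2,[]),(1,[]),(3,[0,4,5,6,1,2,3,8,7]),(2,[0,4,5,6,1,2,3,8,7]),(1,[0,4,5,6,1,2,3,8,7]),(0,[]),(0,[0,4,5,6,1,2,3,8,7])]),
     (adj [[],[5,6,8,9],[4,6,9],[4,5,6],[7],[9],[],[8]], Cover 4 [2,9,0,7,8,1,5,6,4,3], []),
     (adj [[2],[5,6,8],[4,6,9],[4,5,6],[7],[9],[],[8,9]], Cover 1 [9,5,3,6,1,0,8,7,2,4], []),
     (adj [[6],[5,6,8],[4,6,9],[4,5,6],[7],[9],[],[8,9]], Cover 3 [4,2,9,0,8,1,5,3,6,7], []),
     (adj [[7],[5,6,8],[4,6,9],[4,5,6],[7],[9],[],[8,9]], Cover 6 [1,6,4,7,0,9,2,5,8,3], []),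
     (adj [[],[5,6,8],[4,6,9],[4,5,6],[7],[9],[],[8,9]], Cover 3 [0,1,6,2,7,9,3,5,8,4], [(1,[]),(2,[]),(0,[]),(4,[]),(2,[0,7,3,2,6,9,4,1,8,5]),(9,[0,2,1,3,8,5,6,7,4])]),
     (adj [[],[5,6,8],[4,6,9],[4,5,6],[7],[9],[],[8]], At 9, [(5,[]),(4,[]),(10,[0,1,2,3,4,9,6,7,8,5]),(4,[0,4,5,6,1,2,3,8,7]),(10,[0,4,5,6,1,9,3,8,7,2]),(0,[]),(0,[0,4,5,6,1,2,3,8,7])]),
     (adj [[2,7,8],[7,8,9],[4,5,6],[4,5,6],[7],[8],[9]], Cover 6 [7,8,5,2,9,6,3,1,0,4], []),
     (adj [[5,7,8],[7,8,9],[4,5,6],[4,5,6],[7],[8],[9]], Cover 4 [8,1,3,4,2,6,9,0,5,7], []),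
     (adj [[6,7,8],[7,8,9],[4,5,6],[4,5,6],[7],[8],[9]], Cover 6 [8,1,9,6,2,4,3,7,0,5], []),
     (adj [[7,8],[7,8,9],[4,5,6],[4,5,6],[7],[8],[9]], Cover 6 [6,3,5,1,7,0,8,4,2,9], [(0,[]),(2,[0,1,3,2]),(1,[]),(2,[])]),
     (adj [[8],[7,8,9],[4,5,6,7],[4,5,6],[7],[8],[9]], Cover 2 [7,4,3,6,0,8,5,1,9,2], []),
     (adj [[8],[7,8,9],[4,5,6],[4,5,6],[7],[7,8],[9]], Cover 2 [3,6,9,0,8,7,1,4,2,5], []),
     (adj [[8],[7,8,9],[4,5,6],[4,5,6],[7],[8],[7,9]], Cover 6 [3,7,9,0,2,8,1,4,6,5], []),
     (adj [[8],[7,8,9],[4,5,6],[4,5,6],[7],[8],[9]], At 7, [(3,[]),(2,[]),(2,[0,1,3,2]),(1,[]),(0,[]),(18,[0,7,2,3,6,5,4,9,1,8]),(18,[0,7,2,3,5,6,4,8,1])]),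
     (adj [[],[7,8,9],[4,5,6,8],[4,5,6],[7],[8],[9]], Cover 6 [5,2,4,7,1,9,0,8,3,6], []),
     (adj [[],[7,8,9],[4,5,6],[4,5,6],[7,8],[8],[9]], Cover 6 [0,7,1,6,3,2,8,5,9,4], []),
     (adj [[],[7,8,9],[4,5,6],[4,5,6],[7],[8],[9]], At 8, [(2,[]),(1,[]),(1,[0,1,3,2]),(0,[]),(0,[0,1,2,3,6,5,4,9,8,7]),(21,[0,7,2,3,6,5,4,9,1,8]),(21,[0,8,2,3,4,6,5,7,1])]),
     (adj [[1,7],[6,7,8],[5,6,9],[4,5,6],[7,9],[8]], Cover 8 [5,2,6,1,0,4,7,9,8,3], []),
     (adj [[2,7],[6,7,8],[5,6,9],[4,5,6],[7,9],[8]], Cover 5 [1,7,3,5,2,9,4,0,6,8], []),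
     (adj [[3,7],[6,7,8],[5,6,9],[4,5,6],[7,9],[8]], Cover 5 [4,7,0,8,5,2,1,6,3,9], []),
     (adj [[7],[6,7,8],[5,6,9],[4,5,6],[7,9],[8],[9]], Cover 3 [7,0,3,6,9,2,5,8,1,4], []),
     (adj [[7],[6,7,8],[5,6,9],[4,5,6],[7,9],[8]], Cover 6 [0,4,5,2,1,6,3,7,9,8], [(2,[0,4,5,6,1,2,3,7,9,8]),(2,[]),(3,[]),(1,[0,4,5,6,1,2,3,7,9,8]),(1,[]),(0,[]),(26,[0,1,2,3,9,5,6,4,7,8])]),
     (adj [[],[6,7,8],[5,6,7,9],[4,5,6],[7,9],[8]], Cover 3 [3,5,0,9,7,1,8,6,4,2], []),
     (adj [[1],[6,7,8],[5,6,9],[4,5,6],[7,9],[8],[],[8]], Cover 5 [1,7,3,5,2,9,4,0,8,6], []),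
     (adj [[4],[6,7,8],[5,6,9],[4,5,6],[7,9],[8],[],[8]], Cover 5 [0,4,7,8,6,2,5,9,1,3], []),
     (adj [[],[6,7,8],[5,6,9],[4,5,6],[7,9],[8],[],[8]], Cover 9 [6,2,0,3,8,7,4,1,5,9], [(1,[0,8,2,3,4,6,5,7,1]),(3,[]),(0,[]),(1,[])]),
     (adj [[],[6,7,8],[5,6,9],[4,5,6],[7,9],[8]], At 7, [(4,[]),(3,[]),(20,[0,2,1,3,7,5,6,4,9,8]),(3,[0,4,5,6,1,2,3,7,9,8]),(20,[0,5,4,6,7,2,3,1]),(0,[]),(0,[0,4,5,6,1,2,3,7,9,8])]),
     (adj [[3,7,9],[6,7,8],[4,5,9],[4,5,6],[7],[8],[9]], At 8, [(60,[])]),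
     (adj [[5,7,9],[6,7,8],[4,5,9],[4,5,6],[7],[8],[9]], Cover 6 [8,1,7,4,2,3,6,5,0,9], []),
     (adj [[7,9],[6,7,8],[4,5,9],[4,5,6],[7],[8],[9]], Cover 5 [7,1,6,9,2,5,3,4,0,8], [(0,[]),(1,[])]),
     (adj [[9],[6,7,8],[4,5,7,9],[4,5,6],[7],[8],[9]], Cover 6 [5,3,6,1,0,7,4,2,9,8], []),
     (adj [[9],[6,7,8],[4,5,9],[4,5,6,7],[7],[8],[9]], Cover 4 [1,6,9,0,2,4,3,7,8,5], []),
     (adj [[9],[6,7,8],[4,5,9],[4,5,6],[7],[7,8],[9]], Cover 6 [1,7,5,2,0,9,4,6,8,3], []),
     (adj [[9],[6,7,8],[4,5,9],[4,5,6],[7],[8],[9]], At 7, [(3,[]),(2,[]),(1,[]),(0,[]),(27,[0,5,6,4,7,2,3,1]),(6,[0,7,2,3,6,5,4,1]),(27,[0,1,4,9,2,6,7,5,8,3])]),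
     (adj [[],[6,7,8,9],[4,5,9],[4,5,6],[7],[8],[9]], Cover 9 [2,9,6,3,8,7,0,4,5,1], []),
     (adj [[],[6,7,8],[4,5,9],[4,5,6],[7],[8],[9]], At 9, [(1,[]),(0,[]),(18,[0,1,2,3,4,5,9,7,8,6]),(8,[0,1,9,3,5,4,6,8,7,2]),(8,[0,1,9,3,4,5,6,7,8,2]),(29,[0,1,4,9,2,6,7,5,8,3]),(29,[0,1,5,9,2,6,8,4,7,3])]),
     (adj [[7,8],[5,6,7],[4,6,8],[4,5,9],[7],[8],[9]], At 9, [(68,[]),(0,[0,2,1,3,5,9,4,8,6,7]),(0,[0,1,2,3,4,9,5,7,6,8]),(0,[0,5,4,6,2,9,1,8,3,7]),(0,[0,4,5,6,1,9,2,7,3,8]),(9,[0,2,7,3,5,9,4,8,6,1]),(9,[0,1,8,3,4,9,5,7,6,2])]),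
     (adj [[8],[5,6,7],[4,6,8],[4,5,9],[7],[8],[9]], At 7, [(0,[]),(1,[0,3,2,1,6,7,5,9,4,8]),(1,[0,2,3,1,7,5,6,4]),(1,[0,6,5,4,3,7,2,9,1,8]),(1,[0,5,6,4,7,2,3,1]),(10,[0,3,7,2,6,8,4,9,5,1]),(10,[0,2,7,3,5,9,4,8,6,1])]),
     (adj [[],[5,6,7],[4,6,8],[4,5,9],[7],[8],[9]], At 8, [(0,[]),(2,[0,3,1,2,6,8,4,9,5,7]),(2,[0,1,3,2,4,8,6,7,5]),(2,[0,6,4,5,3,8,1,9,2,7]),(2,[0,4,6,5,1,8,3,7,2]),(11,[0,3,7,2,6,8,4,9,5,1]),(11,[0,1,8,3,4,9,5,7,6,2])]),
     (adj [[1,9],[5,6,8],[4,5,6],[4,5,6],[7],[],[],[8]], Cover 9 [3,6,2,4,0,9,7,8,5,1], []),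
     (adj [[2,9],[5,6,8],[4,5,6],[4,5,6],[7],[],[],[8]], Cover 9 [9,0,8,1,6,3,5,4,7,2], []),
     (adj [[7,8,9],[5,6,8],[4,5,6,9],[4,5,6],[7],[],[],[8]], At 9, []),
     (adj [[7,8,9],[5,6,8],[4,5,6],[4,5,6],[7],[],[],[8]], Cover 4 [6,2,7,8,9,4,5,3,0,1], [(0,[0,4,6,5,1,2,3,8,7]),(0,[]),(0,[0,4,5,6,1,2,3,8,7]),(0,[0,1,3,2]),(1,[0,4,5,6,1,2,3,8,7])]),
     (adj [[7,9],[5,6,8],[4,5,6],[4,5,6],[7],[],[],[8]], At 0, [(3,[]),(2,[]),(2,[0,1,3,2]),(3,[0,4,5,6,1,2,3,8,7]),(2,[0,4,5,6,1,2,3,8,7]),(2,[0,4,6,5,1,2,3,8,7]),(0,[])]),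
     (adj [[9],[5,6,8],[4,5,6],[4,5,6],[7],[],[],[8]], At 0, [(4,[]),(3,[]),(3,[0,1,3,2]),(4,[0,4,5,6,1,2,3,8,7]),(3,[0,4,5,6,1,2,3,8,7]),(3,[0,4,6,5,1,2,3,8,7]),(0,[]),(0,[0,4,5,6,1,2,3,8,7])]),
     (adj [[],[5,6,8,9],[4,5,6],[4,5,6],[7],[],[],[8]], Cover 6 [9,8,0,2,6,3,5,1,7,4], [(0,[])]),
     (adj [[],[5,6,8],[4,5,6,9],[4,5,6],[7],[],[],[8]], Cover 1 [4,3,6,1,5,9,0,7,2,8], []),
     (adj [[],[5,6,8],[4,5,6],[4,5,6],[7],[],[],[8,9]], At 9, [(2,[]),(1,[]),(30,[0,7,5,6,3,1,2,4]),(30,[0,7,5,6,2,1,3,4]),(72,[0,4,5,6,1,2,3,8,7]),(52,[0,7,2,3,6,5,4,1]),(52,[0,7,2,3,5,6,4,1]),(72,[0,1,2,3,4,5,6,7,9,8])]),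
     (adj [[],[5,6,8],[4,5,6],[4,5,6],[7],[],[],[8]], At 9, [(3,[]),(2,[]),(1,[]),(1,[0,1,3,2]),(2,[0,4,5,6,1,2,3,8,7]),(1,[0,4,5,6,1,2,3,8,7]),(1,[0,4,6,5,1,2,3,8,7]),(0,[]),(0,[0,4,5,6,1,2,3,8,7])]),
     (adj [[3,7,8],[6,7,8],[4,5,6],[4,5,6],[7],[8]], Cover 8 [5,8,9,0,7,6,1,2,4,3], []),
     (adj [[6,7,8],[6,7,8],[4,5,6],[4,5,6],[7],[8]], Cover 6 [9,7,4,3,8,5,2,0,1,6], []),
     (adj [[7,8],[6,7,8],[4,5,6,9],[4,5,6],[7],[8]], Cover 6 [3,6,1,7,0,9,2,5,8,4], []),
     (adj [[7,8],[6,7,8],[4,5,6],[4,5,6],[7],[8],[9]], Cover 8 [9,4,3,2,1,8,7,0,6,5], []),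
     (adj [[7,8],[6,7,8],[4,5,6],[4,5,6],[7],[8],[],[],[9]], Cover 5 [5,2,4,0,9,1,7,6,3,8], []),
     (adj [[7,8],[6,7,8],[4,5,6],[4,5,6],[7],[8]], Cover 5 [8,2,6,3,9,7,4,0,5,1], [(0,[]),(2,[]),(1,[]),(3,[]),(4,[])]),
     (adj [[8],[6,7,8],[4,5,6,7],[4,5,6],[7],[8]], Cover 3 [5,3,4,9,0,1,7,6,8,2], []),
     (adj [[8],[6,7,8],[4,5,6],[4,5,6],[7],[7,8]], Cover 6 [9,0,2,6,3,1,8,7,4,5], []),
     (adj [[8],[6,7,8],[4,5,6],[4,5,6],[7],[8],[],[8]], Cover 9 [8,0,9,1,2,3,6,5,7,4], []),
     (adj [[3,8,9],[6,7,8],[4,5,6],[4,5,6],[7],[8],[],[9]], At 9, []),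
     (adj [[8,9],[6,7,8],[4,5,6],[4,5,6],[7],[8],[],[9]], Cover 6 [2,6,3,7,9,8,1,0,4,5], [(23,[0,7,5,6,2,3,1,9,4,8]),(64,[0,7,2,3,5,6,4,8,1]),(23,[0,7,5,6,2,3,1,4,9,8]),(0,[]),(4,[]),(64,[0,1,2,3,4,5,6,7,9,8])]),
     (adj [[8],[6,7,8],[4,5,6],[4,5,6],[7],[8,9],[],[9]], Cover 8 [1,0,9,5,3,4,2,6,8,7], []),
     (adj [[8],[6,7,8],[4,5,6],[4,5,6],[7],[8],[],[9]], At 9, [(1,[]),(66,[0,1,2,3,4,5,6,7,9,8]),(25,[0,7,5,6,2,3,1,9,4,8]),(25,[0,7,5,6,2,3,1,4,9,8]),(66,[0,1,2,3,4,5,6,9,7,8]),(0,[]),(66,[0,7,2,3,5,6,4,8,1]),(66,[0,7,2,3,5,6,4,8,9,1])]),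
     (adj [[8],[6,7,8],[4,5,6],[4,5,6],[7],[8]], At 7, [(7,[]),(6,[]),(6,[0,1,3,2]),(5,[]),(13,[0,5,4,6,7,2,3,1]),(4,[]),(0,[])]),
     (adj [[],[6,7,8],[4,5,6,8],[4,5,6],[7],[8]], Cover 2 [0,3,4,2,8,1,5,9,6,7], []),
     (adj [[],[6,7,8],[4,5,6],[4,5,6],[7,8],[8]], Cover 8 [8,6,2,3,7,0,9,1,4,5], []),
     (adj [[2],[6,7,8],[4,5,6],[4,5,6],[7],[8],[],[8]], Cover 4 [9,7,4,3,6,1,8,0,2,5], []),
     (adj [[4],[6,7,8],[4,5,6],[4,5,6],[7],[8],[],[8]], Cover 6 [9,0,7,8,3,6,1,2,5,4], []),
     (adj [[9],[6,7,8],[4,5,6],[4,5,6],[7],[8],[],[8]], At 0, [(4,[0,7,2,3,5,6,4,8,1]),(1,[]),(1,[0,1,3,2]),(0,[]),(0,[0,1,2,3,5,4,6,8,7]),(0,[0,7,2,3,6,5,4,1]),(4,[0,1,2,3,5,4,6,8,7]),(4,[])]),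
     (adj [[],[6,7,8],[4,5,6],[4,5,6],[7],[8],[],[8]], At 0, [(5,[0,7,2,3,5,6,4,8,1]),(2,[]),(2,[0,1,3,2]),(1,[]),(1,[0,1,2,3,5,4,6,8,7]),(1,[0,7,2,3,6,5,4,1]),(5,[0,1,2,3,5,4,6,8,7]),(5,[]),(0,[])]),
     (adj [[],[6,7,8],[4,5,6],[4,5,6],[7],[8],[],[],[9]], At 7, [(6,[0,1,2,3,5,4,6,8,7]),(5,[0,1,2,3,5,4,6,8,7]),(5,[0,1,3,2,5,4,6,8,7]),(4,[0,1,2,3,5,4,6,8,7]),(20,[0,5,4,6,7,2,3,1]),(0,[]),(74,[0,7,2,3,5,6,4,8,9,1])]),
     (adj [[],[6,7,8],[4,5,6],[4,5,6],[7],[8]], At 8, [(7,[]),(6,[]),(6,[0,1,3,2]),(5,[]),(21,[0,4,5,6,8,2,3,1,7]),(1,[]),(0,[])]),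
     (adj [[1,7,8],[5,6,7],[4,6,8],[4,5,6],[7],[8]], Cover 8 [9,4,7,5,8,6,3,2,0,1], []),
     (adj [[3,7,8],[5,6,7],[4,6,8],[4,5,6],[7],[8]], Cover 3 [6,4,9,0,8,5,7,1,2,3], []),
     (adj [[7,8,9],[5,6,7],[4,6,8,9],[4,5,6],[7],[8]], At 9, []),
     (adj [[7,8,9],[5,6,7],[4,6,8],[4,5,6,9],[7],[8]], At 9, []),
     (adj [[7,8,9],[5,6,7],[4,6,8],[4,5,6],[7],[8]], Cover 6 [3,1,7,0,2,8,9,5,6,4], [(2,[]),(0,[]),(3,[]),(3,[0,5,4,6,2,1,3,8,7]),(1,[]),(0,[0,4,5,6,1,2,3])]),
     (adj [[7,8],[5,6,7],[4,6,8],[4,5,6],[7],[8]], At 0, [(4,[]),(4,[0,2,1,3,5,4,6,8,7]),(3,[]),(4,[0,4,5,6,1,2,3]),(4,[0,5,4,6,2,1,3,8,7]),(3,[0,4,5,6,1,2,3]),(0,[])]),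
     (adj [[8],[5,6,7],[4,6,7,8],[4,5,6],[7],[8]], Cover 2 [4,7,1,5,0,9,8,2,6,3], []),
     (adj [[8],[5,6,7],[4,6,8],[4,5,6],[7],[8],[],[8]], Cover 2 [7,4,5,9,0,6,3,2,1,8], []),
     (adj [[8,9],[5,6,7],[4,6,8],[4,5,6],[7],[8],[],[9]], At 9, [(73,[0,1,2,3,4,5,6,7,9,8]),(52,[0,2,3,1,7,5,6,9,8,4]),(52,[0,2,3,1,7,5,6,4]),(73,[0,1,2,3,4,5,6,9,7,8]),(52,[0,5,6,4,7,2,3,9,8,1]),(52,[0,5,6,4,7,2,3,1]),(52,[0,7,3,2,8,6,4,9,1,5])]),
     (adj [[8],[5,6,7],[4,6,8],[4,5,6],[7],[8],[],[9]], At 9, [(0,[]),(74,[0,1,2,3,4,5,6,7,9,8]),(53,[0,2,3,1,7,5,6,9,8,4]),(53,[0,2,3,1,7,5,6,4]),(74,[0,1,2,3,4,5,6,9,7,8]),(53,[0,5,6,4,7,2,3,9,8,1]),(53,[0,5,6,4,7,2,3,1]),(53,[0,7,3,2,8,6,4,9,1,5])]),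
     (adj [[8],[5,6,7],[4,6,8],[4,5,6],[7],[8]], At 7, [(4,[]),(3,[]),(10,[0,2,1,3,7,5,6,4]),(3,[0,4,5,6,1,2,3]),(10,[0,5,4,6,7,2,3,1]),(2,[]),(0,[])]),
     (adj [[],[5,6,7,8],[4,6,8],[4,5,6],[7],[8]], Cover 8 [8,6,3,4,7,0,9,1,2,5], []),
     (adj [[],[5,6,7],[4,6,8],[4,5,6,9],[7],[8],[],[8]], Cover 1 [4,6,0,9,1,5,8,2,3,7], []),
     (adj [[],[5,6,7],[4,6,8],[4,5,6],[7],[8],[],[8]], Cover 6 [0,9,8,7,3,4,2,6,5,1], [(2,[]),(2,[0,2,1,3,5,4,6,8,7]),(2,[0,1,4,8,2,5,7,6,3]),(2,[0,6,7,5,8,3,1,2,4]),(2,[0,3,8,1,7,6,5,4,2]),(0,[0,2,5,7,1,4,8,6,3]),(0,[]),(0,[0,6,8,4,7,3,2,1,5])]),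
     (adj [[],[5,6,7],[4,6,8],[4,5,6],[7],[8],[],[],[9]], At 7, [(3,[0,2,1,3,5,4,6,8,7]),(2,[0,2,1,3,5,4,6,8,7]),(14,[0,2,1,3,7,5,6,4]),(2,[0,5,4,6,2,1,3,8,7]),(14,[0,5,4,6,7,2,3,1]),(0,[]),(58,[0,7,3,2,8,6,4,9,1,5])]),
     (adj [[],[5,6,7],[4,6,8],[4,5,6],[7],[8]], At 8, [(4,[]),(3,[]),(15,[0,1,2,3,4,8,6,7,5]),(3,[0,4,5,6,1,2,3]),(15,[0,4,5,6,1,8,3,7,2]),(1,[]),(0,[])]),
     (adj [[1,7],[5,6,7],[4,5,6],[4,5,6],[7]], Cover 6 [3,5,1,0,8,9,7,2,6,4], []),
     (adj [[2,7],[5,6,7],[4,5,6],[4,5,6],[7]], Cover 6 [6,5,8,0,4,7,9,3,2,1], []),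
     (adj [[7,8,9],[5,6,7],[4,5,6,9],[4,5,6],[7]], Cover 5 [8,0,7,1,5,3,6,2,9,4], []),
     (adj [[7,8,9],[5,6,7],[4,5,6],[4,5,6],[7,8]], Cover 1 [1,6,2,3,8,9,0,7,4,5], []),
     (adj [[7,8,9],[5,6,7],[4,5,6],[4,5,6],[7]], Cover 8 [5,2,6,4,7,9,0,8,3,1], [(1,[0,4,5,6,1,2,3]),(2,[0,4,5,6,1,2,3]),(1,[]),(1,[0,4,6,5,1,2,3]),(2,[0,4,6,5,1,2,3]),(1,[0,4,6,5,1,2,3,7,9,8]),(0,[0,1,2,3,4,5,6,7,9,8]),(0,[]),(1,[0,1,3,2]),(2,[0,1,3,2])]),
     (adj [[7,8],[5,6,7],[4,5,6],[4,5,6],[7]], At 0, [(4,[]),(3,[]),(3,[0,1,3,2]),(4,[0,4,5,6,1,2,3]),(3,[0,4,5,6,1,2,3]),(3,[0,4,6,5,1,2,3]),(0,[])]),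
     (adj [[7],[5,6,7],[4,5,6],[4,5,6],[7]], At 0, [(5,[]),(4,[]),(4,[0,1,3,2]),(5,[0,4,5,6,1,2,3]),(4,[0,4,5,6,1,2,3]),(4,[0,4,6,5,1,2,3]),(0,[]),(0,[0,1,2,3,4,5,6,7,9,8])]),
     (adj [[],[5,6,7],[4,5,6,7],[4,5,6],[7]], Cover 6 [4,3,5,8,9,0,1,7,2,6], []),
     (adj [[3,8],[5,6,7],[4,5,6],[4,5,6],[7],[],[],[8],[9]], Cover 4 [4,5,9,8,0,1,6,2,7,3], []),
     (adj [[8],[5,6,7],[4,5,6],[4,5,6],[7],[],[],[8],[9]], Cover 9 [9,8,7,4,2,5,3,6,0,1], [(101,[0,7,5,6,2,3,1,9,8,4]),(101,[0,7,2,3,5,6,4,9,8,1]),(101,[0,7,5,6,3,2,1,9,8,4]),(0,[0,4,6,5,1,2,3]),(0,[])]),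
     (adj [[8],[5,6,7],[4,5,6],[4,5,6],[7],[],[],[8]], At 8, [(48,[]),(26,[0,7,5,6,3,2,1,4]),(26,[0,7,5,6,2,3,1,4]),(48,[0,4,5,6,1,2,3]),(26,[0,7,2,3,6,5,4,1]),(26,[0,7,2,3,5,6,4,1]),(0,[])]),
     (adj [[],[5,6,7],[4,5,6],[4,5,6],[7],[],[],[8],[9]], At 8, [(0,[]),(49,[]),(27,[0,7,5,6,3,2,1,4]),(27,[0,7,5,6,2,3,1,4]),(49,[0,4,5,6,1,2,3]),(27,[0,7,2,3,6,5,4,1]),(27,[0,7,2,3,5,6,4,1])]),
     (adj [[],[5,6,7],[4,5,6],[4,5,6],[7],[],[],[8]], At 8, [(1,[]),(50,[]),(28,[0,7,5,6,3,2,1,4]),(28,[0,7,5,6,2,3,1,4]),(50,[0,4,5,6,1,2,3]),(28,[0,7,2,3,6,5,4,1]),(28,[0,7,2,3,5,6,4,1]),(0,[])]),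
     (adj [[],[5,6,7],[4,5,6],[4,5,6],[7]], At 7, [(6,[]),(5,[]),(5,[0,1,3,2]),(5,[0,4,5,6,1,2,3]),(5,[0,4,6,5,1,2,3]),(0,[]),(0,[0,1,2,3,4,5,6,7,9,8])]),
     (adj [[1],[4,5,6],[4,5,6],[4,5,6]], Cover 9 [7,8,9,5,1,6,4,2,0,3], []),
     (adj [[7,8,9],[4,5,6],[4,5,6,8],[4,5,6]], Cover 9 [2,4,1,5,7,0,9,8,3,6], []),
     (adj [[7,8,9],[4,5,6],[4,5,6],[4,5,6]], Cover 4 [6,2,7,9,8,5,4,3,0,1], [(0,[0,4,6,5,1,2,3,8,7]),(0,[0,4,6,5,1,2,3,7,9,8]),(0,[0,4,6,5,1,2,3]),(0,[0,1,2,3,4,5,6,7,9,8]),(0,[]),(0,[0,5,4,6,1,2,3,8,7]),(0,[0,1,3,2,4,5,6,8,7]),(0,[0,4,5,6,1,2,3,7,9,8]),(0,[0,5,4,6,1,2,3,7,9,8]),(0,[0,1,3,2,4,5,6,7,9,8]),(0,[0,5,4,6,1,2,3]),(0,[0,1,3,2]),(1,[0,4,5,6,1,2,3])]),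
     (adj [[7,8],[4,5,6],[4,5,6],[4,5,6]], At 0, [(2,[]),(2,[0,2,1]),(2,[0,3,2,1]),(2,[0,4,5,6,1,2,3]),(2,[0,5,4,6,1,2,3]),(2,[0,6,4,5,1,2,3]),(0,[])]),
     (adj [[7],[4,5,6],[4,5,6],[4,5,6]], At 0, [(3,[]),(3,[0,2,1]),(3,[0,3,2,1]),(3,[0,4,5,6,1,2,3]),(3,[0,5,4,6,1,2,3]),(3,[0,6,4,5,1,2,3]),(0,[]),(0,[0,1,2,3,4,5,6,7,9,8])]),
     (adj [[],[4,5,6],[4,5,6],[4,5,6]], At 0, [(4,[]),(4,[0,2,1]),(4,[0,3,2,1]),(4,[0,4,5,6,1,2,3]),(4,[0,5,4,6,1,2,3]),(4,[0,6,4,5,1,2,3]),(0,[]),(0,[0,1,2,3,4,5,6,8,7]),(0,[0,1,2,3,4,5,6,9,8,7])])]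
    [(0,[]), (0,[]), (6,[]), (58,[]), (132,[]), (112,[]), (101,[]), (36,[]), (90,[]), (80,[]), (71,[]), (20,[]), (68,[]), (0,[]), (0,[]), (0,[]), (0,[])]"
  by code_simp

section \<open>Proof of the classification\<close>

lemma low_degree_cases:
  assumes G: "simple_graph G" and x: "card (nbrs G x) < 3"
  obtains a where "nbrs G x \<subseteq> {a}" | a b where "nbrs G x = {a, b}" "a \<noteq> b"
proof -
  have fin: "finite (nbrs G x)"
    using nbrs_subset[OF G, of x] G by (meson finite_Diff finite_subset simple_graph_def)
  consider "card (nbrs G x) = 0" | "card (nbrs G x) = 1" | "card (nbrs G x) = 2" using x by linarith
  then show ?thesis
  proof cases
    case 1
    then show ?thesis using that(1) fin by auto
  next
    case 2
    then show ?thesis using that(1) by (auto simp: card_1_singleton_iff)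
  next
    case 3
    then show ?thesis using that(2) by (auto simp: card_2_iff)
  qed
qed

lemma line_planar_no_verts:
  assumes "simple_graph G" "verts G = {}"
  shows "line_planar G"
proof -
  have "edges G = {}" using assms by (metis empty_iff ex_in_conv simple_graph_edgeE)
  then have "line_drawing G (\<lambda>_. 0)" using assms(2) by (simp add: line_drawing_def)
  then show ?thesis unfolding line_planar_def by blast
qed

lemma contains_base_del_vertex: "contains_base (del_vertex G x) \<Longrightarrow> contains_base G"
  unfolding contains_base_def pat_in_def by (fastforce simp: del_vertex_def)

text \<open>The form of Kuratowski's theorem used here. Vertices of degree at most two are removed
  by induction; with minimum degree 3 and at most 12 edges there are between 4 and 8 vertices, and a
  certificate exists for each number.\<close>

theorem nonplanar_contains_base:
  assumes "simple_graph H" "\<not> line_planar H" "card (edges H) \<le> 12"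
  shows "contains_base H"
  using assms
proof (induction "card (verts H)" arbitrary: H rule: less_induct)
  case less
  note H = less(2) and np = less(3) and e = less(4)
  have fin: "finite (verts H)" using H by (simp add: simple_graph_def)
  show ?case
  proof (cases "\<exists>x\<in>verts H. card (nbrs H x) < 3")
    case True
    then obtain x where x: "x \<in> verts H" "card (nbrs H x) < 3" by blast
    show ?thesis
    proof (cases rule: low_degree_cases[OF H x(2)])
      case (1 a)
      let ?H = "del_vertex H x"
      have "\<not> line_planar ?H" using line_planar_del_low_degree[OF H x(1) 1] np by blast
      moreover have "card (verts ?H) < card (verts H)" using card_Diff1_less[OF fin x(1)] by (simp only: del_vertex_def ugraph.simps)
      moreover have "card (edges ?H) \<le> 12" using card_edges_del_vertex[OF H, of x] e by simp
      ultimately have "contains_base ?H" using less(1) simple_del_vertex[OF H] by simp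
      then show ?thesis by (rule contains_base_del_vertex)
    next
      case (2 a b)
      let ?H = "suppress H x a b"
      have "\<not> line_planar ?H" using line_planar_suppress[OF H x(1) 2] np by blast
      moreover have "card (verts ?H) < card (verts H)" using card_Diff1_less[OF fin x(1)] by (simp only: suppress_def ugraph.simps)
      moreover have "card (edges ?H) \<le> 12" using card_edges_suppress[OF H 2] e by simp
      ultimately have "contains_base ?H" using less(1) simple_suppress[OF H 2] by simp
      then show ?thesis by (rule contains_base_suppress[OF H x(1) 2 e])
    qed
  next
    case False
    then have min: "3 \<le> card (nbrs H x)" if "x \<in> verts H" for x using that by (auto simp: not_less)
    have ne: "verts H \<noteq> {}"
      using line_planar_no_verts[OF H] np by blast
    then obtain x where x: "x \<in> verts H" by blast
    note cert = contains_base_if_certificate[OF H np e min ne]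
    have "card (verts H) \<le> 8" "4 \<le> card (verts H)"
      using min_degree_card_verts(1)[OF H min] min_degree_card_verts(2)[OF H min x] e by linarith+
    then consider "card (verts H) = 4" | "card (verts H) = 5" | "card (verts H) = 6" | "card (verts H) = 7" | "card (verts H) = 8"
      by linarith
    then show ?thesis
      by cases (use cert kuratowski_certificate_4 kuratowski_certificate_5 kuratowski_certificate_6
          kuratowski_certificate_7 kuratowski_certificate_8 in metis)+
  qed
qed

lemma contains_base_card_verts:
  assumes G: "simple_graph G" and v: "v \<in> verts G" and base: "contains_base (del_vertex G v)"
  shows "6 \<le> card (verts G)"
proof -
  obtain m B f where B: "(m, B) \<in> set bases" and f: "pat_in B f (del_vertex G v)"
    using base unfolding contains_base_def by blast
  have m: "pat_verts B = {..<m}" "5 \<le> m" using bases_span B spans_verts by (fastforce simp: list_all_iff)+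
  have sub: "f ` pat_verts B \<subseteq> verts G - {v}"
  proof
    fix y assume "y \<in> f ` pat_verts B"
    then obtain p q where "(p, q) \<in> set B" "y \<in> {f p, f q}" by (auto simp: pat_verts_def)
    then have "y \<in> verts (del_vertex G v)"
      using f simple_del_vertex[OF G, of v] unfolding pat_in_def simple_graph_def by blast
    then show "y \<in> verts G - {v}" by (simp add: del_vertex_def)
  qed
  have fin: "finite (verts G)" using G by (simp add: simple_graph_def)
  have "m = card (f ` pat_verts B)" using f m(1) by (simp add: pat_in_def card_image)
  also have "\<dots> \<le> card (verts G - {v})" using sub fin by (intro card_mono) auto
  finally show ?thesis using m(2) v fin by simp
qed

text \<open>After the removal of vertices of degree at most two, the base in \<open>G\<close> minus
  \<open>v\<close> gives at least 6 vertices and the degree sum 32 at most 10.\<close>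

theorem not_line_apex_petersen_minor:
  assumes "simple_graph G" "\<not> line_apex G" "card (edges G) \<le> 16"
  shows "petersen_minor G"
  using assms
proof (induction "card (verts G)" arbitrary: G rule: less_induct)
  case less
  note G = less(2) and na = less(3) and e = less(4)
  have fin: "finite (verts G)" using G by (simp add: simple_graph_def)
  show ?case
  proof (cases "\<exists>x\<in>verts G. card (nbrs G x) < 3")
    case True
    then obtain x where x: "x \<in> verts G" "card (nbrs G x) < 3" by blast
    show ?thesis
    proof (cases rule: low_degree_cases[OF G x(2)])
      case (1 a)
      let ?H = "del_vertex G x"
      have "\<not> line_apex ?H" using line_apex_del_low_degree[OF G x(1) 1] na by blast
      moreover have "card (verts ?H) < card (verts G)" using card_Diff1_less[OF fin x(1)] by (simp only: del_vertex_def ugraph.simps)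
      moreover have "card (edges ?H) \<le> 16" using card_edges_del_vertex[OF G, of x] e by simp
      ultimately have "petersen_minor ?H" using less(1) simple_del_vertex[OF G] by simp
      then show ?thesis unfolding petersen_minor_def by (auto dest: is_minor_del_vertex)
    next
      case (2 a b)
      let ?H = "suppress G x a b"
      have "\<not> line_apex ?H" using line_apex_suppress[OF G x(1) 2] na by blast
      moreover have "card (verts ?H) < card (verts G)" using card_Diff1_less[OF fin x(1)] by (simp only: suppress_def ugraph.simps)
      moreover have "card (edges ?H) \<le> 16" using card_edges_suppress[OF G 2] e by simp
      ultimately have "petersen_minor ?H" using less(1) simple_suppress[OF G 2] by simp
      then show ?thesis unfolding petersen_minor_def by (auto dest: is_minor_suppress[OF G x(1) 2])
    qed
  next
    case False
    then have min: "3 \<le> card (nbrs G x)" if "x \<in> verts G" for x using that by (auto simp: not_less)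
    have ne: "verts G \<noteq> {}"
      using line_planar_no_verts[OF G] na unfolding line_apex_def by blast
    obtain v where v: "v \<in> verts G" "\<And>x. x \<in> verts G \<Longrightarrow> card (nbrs G x) \<le> card (nbrs G v)"
      using exists_max_degree[OF G ne] by metis
    have np: "\<not> line_planar (del_vertex G v)" using na v(1) unfolding line_apex_def by blast
    have base: "contains_base (del_vertex G v)"
      by (rule nonplanar_contains_base[OF simple_del_vertex[OF G] np max_degree_del_vertex[OF G v min e]])
    note cert = petersen_minor_if_certificate[OF G na e min v base]
    have "card (verts G) \<le> 10" using min_degree_card_verts(1)[OF G min] e by linarith
    moreover have "6 \<le> card (verts G)" by (rule contains_base_card_verts[OF G v(1) base])
    ultimately consider "card (verts G) = 6" | "card (verts G) = 7" | "card (verts G) = 8" | "card (verts G) = 9" | "card (verts G) = 10"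
      by linarith
    then show ?thesis
      by cases (use cert apex_certificate_6 apex_certificate_7 apex_certificate_8 apex_certificate_9 apex_certificate_10 in metis)+
  qed
qed

section \<open>Edge counts of proper minors\<close>

lemma simple_contract_edge:
  assumes "simple_graph H" "{u, v} \<in> edges H" "u \<noteq> v"
  shows "simple_graph (contract_edge H u v)" "card (edges (contract_edge H u v)) < card (edges H)"
proof -
  define f where "f = (\<lambda>x. if x = v then u else x)"
  have c: "contract_edge H u v = \<lparr>verts = f ` verts H, edges = (`) f ` (edges H - {{u, v}})\<rparr>"
    by (simp add: contract_edge_def f_def Let_def)
  have "f ` e \<subseteq> f ` verts H \<and> card (f ` e) = 2" if e: "e \<in> edges H - {{u, v}}" for e
  proof -
    obtain a b where ab: "e = {a, b}" "a \<noteq> b" "a \<in> verts H" "b \<in> verts H" using simple_graph_edgeE[OF assms(1)] e by (metis DiffD1)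
    \<comment> \<open>Only the contracted edge itself collapses to a point.\<close>
    then have "f a \<noteq> f b" using e by (auto simp: f_def)
    then show ?thesis using ab by auto
  qed
  then show "simple_graph (contract_edge H u v)" using assms(1) by (auto simp: c simple_graph_def)
  have fin: "finite (edges H)" by (rule finite_edges[OF assms(1)])
  have "card (edges (contract_edge H u v)) \<le> card (edges H - {{u, v}})" unfolding c using fin by (simp add: card_image_le)
  also have "\<dots> < card (edges H)" using fin assms(2) by (rule card_Diff1_less)
  finally show "card (edges (contract_edge H u v)) < card (edges H)" .
qed

lemma contracts_to_simple:
  assumes "contracts_to K H" "simple_graph K"
  shows "simple_graph H \<and> (H = K \<or> card (edges H) < card (edges K))"
  using assms
proof (induction rule: contracts_to.induct)
  case (contracts_step H u v)
  then have "simple_graph H" "card (edges H) \<le> card (edges K)" by auto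
  then show ?case using simple_contract_edge[OF _ contracts_step(2,3)] by fastforce
qed auto

lemma reps_edge_distinct: "list_all (\<lambda>(k, R). edge_distinct R) reps"
  by code_simp

lemma is_rep_edges:
  assumes "is_rep G"
  shows "card (edges G) = 15" "verts G \<subseteq> \<Union> (edges G)"
proof -
  obtain k R f where R: "(k, R) \<in> set reps" and f: "pat_iso R f G" using assms unfolding is_rep_def by blast
  have "edge_distinct R" "length R = 15" using reps_edge_distinct repsD[OF R] R by (auto simp: list_all_iff)
  then have "card (pat_edges R) = 15" using card_pat_edges by simp
  moreover have "inj_on ((`) f) (pat_edges R)"
    by (rule inj_on_subset[OF inj_on_image_Pow[of f "pat_verts R"]]) (use f in \<open>auto simp: pat_iso_def pat_verts_Union\<close>)
  ultimately show "card (edges G) = 15" using f by (simp add: pat_iso_def card_image)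
  show "verts G \<subseteq> \<Union> (edges G)" using f by (auto simp: pat_iso_def pat_verts_Union)
qed

text \<open>Every contraction loses an edge. Without one the minor is a subgraph, and if it had all
  15 edges it would also have all vertices, none of them being isolated.\<close>

lemma proper_minor_of_rep:
  assumes G: "simple_graph G" "is_rep G" and H: "proper_minor H G"
  shows "simple_graph H" "card (edges H) \<le> 14"
proof -
  obtain K where K: "subgraph K G" "contracts_to K H" and ne: "H \<noteq> G"
    using H unfolding proper_minor_def is_minor_def by blast
  have sK: "simple_graph K" and KV: "verts K \<subseteq> verts G" and KE: "edges K \<subseteq> edges G" using K(1) by (auto simp: subgraph_def)
  note c = contracts_to_simple[OF K(2) sK]
  show "simple_graph H" using c by blast
  note r = is_rep_edges[OF G(2)]
  have finG: "finite (edges G)" by (rule finite_edges[OF G(1)])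
  have le: "card (edges K) \<le> 15" using card_mono[OF finG KE] r(1) by simp
  show "card (edges H) \<le> 14"
  proof (cases "card (edges H) < card (edges K)")
    case True
    then show ?thesis using le by simp
  next
    case False
    then have HK: "H = K" using c by blast
    have "edges K \<noteq> edges G"
    proof
      assume eq: "edges K = edges G"
      have "\<Union> (edges K) \<subseteq> verts K" using sK by (auto simp: simple_graph_def)
      then have "verts K = verts G" using eq r(2) KV by auto
      then show False using ne HK eq by simp
    qed
    then have "card (edges K) < card (edges G)" using KE finG by (simp add: psubset_card_mono psubsetI)
    then show ?thesis using HK r(1) by simp
  qed
qed

lemma is_rep_not_apex: "is_rep G \<Longrightarrow> \<not> apex G"
  using reps_not_apex unfolding is_rep_def by blast

text \<open>Otherwise the graph would have a minor in the Petersen family, but a minor has at most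
  as many edges as the graph and those members have 15.\<close>

lemma few_edges_apex:
  assumes "simple_graph H" "card (edges H) \<le> 14"
  shows "apex H"
proof (rule ccontr)
  assume "\<not> apex H"
  then have "\<not> line_apex H" using line_apex_imp_apex[OF assms(1)] by blast
  then obtain J where J: "is_minor J H" "is_rep J"
    using not_line_apex_petersen_minor[OF assms(1)] assms(2) unfolding petersen_minor_def by auto
  obtain K where K: "subgraph K H" "contracts_to K J" using J(1) unfolding is_minor_def by blast
  have "card (edges J) \<le> card (edges K)" using contracts_to_simple[OF K(2)] K(1) by (auto simp: subgraph_def)
  also have "\<dots> \<le> card (edges H)" using K(1) finite_edges[OF assms(1)] by (auto simp: subgraph_def card_mono)
  finally show False using is_rep_edges(1)[OF J(2)] assms(2) by simp
qed

theorem theorem1p4: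
  fixes G :: "'a ugraph"
  assumes "simple_graph G" and "card (edges G) \<le> 16"
  shows "MMNA G \<longleftrightarrow> (\<exists>P\<in>petersen_family. graph_iso G P)"
proof -
  have "MMNA G \<longleftrightarrow> is_rep G"
  proof
    assume M: "MMNA G"
    then have "\<not> line_apex G" using line_apex_imp_apex[OF assms(1)] by (auto simp: MMNA_def)
    then obtain H where H: "is_minor H G" "is_rep H"
      using not_line_apex_petersen_minor[OF assms(1) _ assms(2)] unfolding petersen_minor_def by auto
    \<comment> \<open>Minimality: the minor \<open>H\<close> is itself not apex, so it cannot be
      proper.\<close>
    have "H = G"
    proof (rule ccontr)
      assume "H \<noteq> G"
      then have "apex H" using M H(1) by (auto simp: MMNA_def proper_minor_def)
      then show False using is_rep_not_apex[OF H(2)] by blast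
    qed
    then show "is_rep G" using H by simp
  next
    assume r: "is_rep G"
    show "MMNA G"
      unfolding MMNA_def
    proof (intro conjI allI impI)
      show "\<not> apex G" by (rule is_rep_not_apex[OF r])
      show "apex H" if "proper_minor H G" for H
        by (rule few_edges_apex[OF proper_minor_of_rep[OF assms(1) r that]])
    qed
  qed
  then show ?thesis using is_rep_iff_petersen_family[OF assms(1)] by simp
qed

end
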